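(* Let $\nu>-1$ and $\delta>0$, and let $$p_0(\delta)=\begin{cases}1,& \text{if } \delta>\nu+1/2 \text{ or } -1<\nu\le -1/2,\\ \frac{4(\nu+1)}{2\nu+3+2\delta},& \text{if } \delta\le \nu+1/2 \text{ and } \nu>-1/2.\end{cases}$$ Then there is $C$ independent of $f$ such that $$\|\mathcal{B}^\delta f\|_{L^{p_0(\delta),\infty}((0,1),d\mu_\nu)}\le C\|f\|_{L^{p_0(\delta)}((0,1),d\mu_\nu)}.$$
   Context: Let $J_\nu$ be the Bessel function of order $\nu>-1$, $0<s_1<s_2<\dots$ its successive positive zeros, $d\mu_\nu(x)=x^{2\nu+1}dx$ on $(0,1)$, $\psi_j(x)=\frac{\sqrt2}{|J_{\nu+1}(s_j)|}x^{-\nu}J_\nu(s_jx)$, $a_j(f)=\int_0^1 f\psi_j\,d\mu_\nu$. For $\delta>0$, $R>0$, $\mathcal{B}_R^\delta(f,x)=\sum_{j\ge1}(1-s_j^2/R^2)_+^\delta a_j(f)\psi_j(x)$ with $(1-s^2)_+=\max\{1-s^2,0\}$, and $\mathcal{B}^\delta f(x)=\sup_{R>0}|\mathcal{B}_R^\delta(f,x)|$. For $1\le q<\infty$, $L^{q,\infty}((0,1),d\mu_\nu)$ is the weak $L^q$ space with quasinorm $\|g\|_{L^{q,\infty}}=\sup_{\lambda>0}\lambda\,\mu_\nu(\{x\in(0,1):|g(x)|>\lambda\})^{1/q}$. *)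

theory Defs
  imports "HOL-Analysis.Analysis"
begin

text \<open>Bessel function of the first kind of order nu, for x > 0 (power series).\<close>
definition besselJ :: "real \<Rightarrow> real \<Rightarrow> real" where
  "besselJ \<nu> x = (\<Sum>k. (-1) ^ k / (fact k * Gamma (real k + \<nu> + 1)) * (x / 2) powr (2 * real k + \<nu>))"

text \<open>Successive positive zeros: bessel_zero nu 0 = s_1 < bessel_zero nu 1 = s_2 < ...\<close>
definition bessel_zero :: "real \<Rightarrow> nat \<Rightarrow> real" where
  "bessel_zero \<nu> = (THE s. strict_mono s \<and> range s = {x. 0 < x \<and> besselJ \<nu> x = 0})"

definition mu_nu :: "real \<Rightarrow> real measure" where
  "mu_nu \<nu> = density lborel (\<lambda>x. ennreal (indicator {0<..<1} x * x powr (2 * \<nu> + 1)))"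

definition psi :: "real \<Rightarrow> nat \<Rightarrow> real \<Rightarrow> real" where
  "psi \<nu> j x = sqrt 2 / \<bar>besselJ (\<nu> + 1) (bessel_zero \<nu> j)\<bar> * x powr (- \<nu>) * besselJ \<nu> (bessel_zero \<nu> j * x)"

definition fourier_bessel_coeff :: "real \<Rightarrow> (real \<Rightarrow> real) \<Rightarrow> nat \<Rightarrow> real" where
  "fourier_bessel_coeff \<nu> f j = (\<integral>x. f x * psi \<nu> j x \<partial>mu_nu \<nu>)"

definition bochner_riesz :: "real \<Rightarrow> real \<Rightarrow> real \<Rightarrow> (real \<Rightarrow> real) \<Rightarrow> real \<Rightarrow> real" where
  "bochner_riesz \<nu> \<delta> R f x =
     (\<Sum>j. (max (1 - (bessel_zero \<nu> j)\<^sup>2 / R\<^sup>2) 0) powr \<delta> * fourier_bessel_coeff \<nu> f j * psi \<nu> j x)"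

definition bochner_riesz_max :: "real \<Rightarrow> real \<Rightarrow> (real \<Rightarrow> real) \<Rightarrow> real \<Rightarrow> ennreal" where
  "bochner_riesz_max \<nu> \<delta> f x = (SUP R\<in>{0<..}. ennreal \<bar>bochner_riesz \<nu> \<delta> R f x\<bar>)"

definition Lp_norm :: "real \<Rightarrow> real \<Rightarrow> (real \<Rightarrow> real) \<Rightarrow> real" where
  "Lp_norm \<nu> p f = (\<integral>x. \<bar>f x\<bar> powr p \<partial>mu_nu \<nu>) powr (1 / p)"

text \<open>Weak L^q quasinorm over (0,1) w.r.t. mu_nu (mu_nu is a finite measure).\<close>
definition weak_Lq_norm :: "real \<Rightarrow> real \<Rightarrow> (real \<Rightarrow> ennreal) \<Rightarrow> ennreal" where
  "weak_Lq_norm \<nu> q g = (SUP t\<in>{0<..}. ennreal (t *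
      (enn2real (emeasure (mu_nu \<nu>) {x \<in> {0<..<1}. g x > ennreal t})) powr (1 / q)))"

definition p0 :: "real \<Rightarrow> real \<Rightarrow> real" where
  "p0 \<nu> \<delta> = (if \<delta> > \<nu> + 1/2 \<or> \<nu> \<le> -1/2 then 1 else 4 * (\<nu> + 1) / (2 * \<nu> + 3 + 2 * \<delta>))"

end

theory Submission
  imports Defs "HOL-Complex_Analysis.Complex_Analysis"
begin

text \<open>The means are sums over the zeros below \<open>R\<close> of residues of a meromorphic function built from
  the entire function \<open>w powr (- \<nu>) * J w\<close> and a second solution of Bessel's equation that
  vanishes at the right end point. Shifting the contour to a vertical line through a point within
  \<open>O(1)\<close> of \<open>R\<close>, where the denominator is as large as it can be, gives off-diagonal decay of the
  kernel; the boundedly many zeros left over, and the kernel near the diagonal, are estimated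
  directly from the spacing of the zeros. The part of the kernel away from the diagonal is dominated,
  uniformly in \<open>R\<close>, by \<open>x powr (- 2 * (\<nu> + 1) / p0) * norm f\<close> with Hoelder's inequality; that
  power of \<open>x\<close> lies exactly in weak \<open>L\<close>-\<open>p0\<close>. The part near the diagonal is dominated by the
  one-dimensional uncentred maximal function with respect to \<open>\<mu>\<close>.\<close>

text \<open>The maximal operator takes a supremum over all \<open>R\<close>, so kernel bounds must
  be uniform in \<open>R\<close>. Estimating the sum over zeros termwise loses the cancellation away
  from the diagonal; the second solution recovers it. At a zero it is a multiple of the
  eigenfunction in y, so the residues are the right ones, but off the real axis it grows only like
  exp(|Im z| (1 - y)). Against the factor exp(|Im z| x) above and exp(|Im z|) below, this leaves
  exp(- |Im z| (y - x)) for x < y. The contour cannot reach \<open>R\<close>, where the complex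
  power has its branch point; hence the boundedly many zeros left outside it. For \<delta> < \<nu> +
  1/2 the supremum over \<open>R\<close> cannot always be taken under the integral: for y \<le> x /
  2 it would leave a weight in y that just misses the dual Lebesgue space. There Hoelder's
  inequality is applied at fixed \<open>R\<close>, and the powers of \<open>R\<close> cancel
  afterwards. For -1 < \<nu> < -1/2 the product of sqrt t and J t is unbounded at 0;
  \<open>\<Phi>\<close> treats both signs of \<nu> + 1/2 together.\<close>

locale bessel_order =
  fixes \<nu> :: real
  assumes nu: "\<nu> > -1"
begin

section \<open>Power series, Bessel's equation and its normal form\<close>

definition \<sigma> :: real where "\<sigma> = \<nu> + 1/2"
text \<open>\<open>\<sigma>\<close> is the power that removes the first-order term from the equation
  of \<open>g\<close>; \<open>\<kappa>\<close>, which equals \<sigma> (\<sigma> - 1), is the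
  coefficient of the inverse-square potential that this produces.\<close>

definition \<kappa> :: real where "\<kappa> = \<nu>\<^sup>2 - 1/4"

text \<open>\<open>besselJ \<nu> x = x powr \<nu> * g x\<close>, where \<open>g\<close> is even and entire.\<close>
definition coef :: "nat \<Rightarrow> real" where
  "coef k = (-1) ^ k / (fact k * Gamma (real k + \<nu> + 1)) * 2 powr (- (2 * real k + \<nu>))"

text \<open>Series in the square of the variable keep everything single-valued: the branch of
  \<open>powr\<close> enters only through \<open>u\<close>. \<open>P1\<close> and \<open>P2\<close>
  are the first two derivatives of \<open>P0\<close>, written with \<open>diffs\<close> so that
  termwise differentiation applies directly.\<close>

definition P0 :: "complex \<Rightarrow> complex" where "P0 z = (\<Sum>k. of_real (coef k) * z ^ k)"
definition P1 :: "complex \<Rightarrow> complex" where "P1 z = (\<Sum>k. diffs (\<lambda>k. of_real (coef k)) k * z ^ k)"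
definition P2 :: "complex \<Rightarrow> complex" where
  "P2 z = (\<Sum>k. diffs (diffs (\<lambda>k. of_real (coef k))) k * z ^ k)"

definition g :: "complex \<Rightarrow> complex" where "g w = P0 (w\<^sup>2)"
definition g' :: "complex \<Rightarrow> complex" where "g' w = 2 * w * P1 (w\<^sup>2)"
definition g'' :: "complex \<Rightarrow> complex" where "g'' w = 2 * P1 (w\<^sup>2) + 4 * w\<^sup>2 * P2 (w\<^sup>2)"

text \<open>The functional equation of Gamma supplies k + \<nu> + 1, the factorial k + 1, the power
  of 2 the 4. This single recursion gives both the convergence of the series and the differential
  equation.\<close>

lemma coef_Suc: "4 * (real k + 1) * (real k + \<nu> + 1) * coef (Suc k) = - coef k"
proof -
  have p: "real k + \<nu> + 1 > 0" using nu by simp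
  have "Gamma (real (Suc k) + \<nu> + 1) = (real k + \<nu> + 1) * Gamma (real k + \<nu> + 1)"
    using Gamma_plus1[of "real k + \<nu> + 1"] p by (auto simp: add_ac nonpos_Ints_def)
  moreover have "2 powr (- (2 * real (Suc k) + \<nu>)) = 2 powr (- (2 * real k + \<nu>)) / (4::real)"
  proof -
    have "- (2 * real (Suc k) + \<nu>) = - (2 * real k + \<nu>) - 2" by simp
    then show ?thesis by (simp only: powr_diff) simp
  qed
  moreover have "Gamma (real k + \<nu> + 1) \<noteq> 0" using Gamma_real_pos[OF p] by simp
  ultimately show ?thesis using p unfolding coef_def
    by (simp add: divide_simps) (simp add: algebra_simps)
qed

lemma coef_0_pos: "coef 0 > 0"
  unfolding coef_def using Gamma_real_pos[of "\<nu> + 1"] nu by simp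

lemma summable_coef: "summable (\<lambda>k. (of_real (coef k) :: complex) * z ^ k)"
proof (rule summable_ratio_test[where c = "1/2" and N = "nat \<lceil>norm z\<rceil>"])
  fix k assume k: "nat \<lceil>norm z\<rceil> \<le> k"
  then have kz: "norm z \<le> real k" by linarith
  have p: "real k + \<nu> + 1 > 0" using nu by simp
  show "norm (of_real (coef (Suc k)) * z ^ Suc k) \<le> 1/2 * norm (of_real (coef k) * z ^ k)"
  \<comment> \<open>At k = 0 the factor k + \<nu> + 1 may be arbitrarily small, but the threshold of
    the ratio test then forces z = 0.\<close>
  proof (cases "k = 0")
    case True
    then show ?thesis using kz by simp
  next
    case False
    have e: "coef (Suc k) = - coef k / (4 * (real k + 1) * (real k + \<nu> + 1))"
      proof -
      have "4 * (real k + 1) * (real k + \<nu> + 1) \<noteq> 0" using p by simp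
      then show ?thesis using coef_Suc[of k] by (metis nonzero_mult_div_cancel_left)
    qed
    have kk: "real k \<le> real k + \<nu> + 1" using nu by simp
    have k1: "real k \<ge> 1" using False by simp
    have "2 * real k \<le> 4 * (real k + 1) * 1 " by simp
    have "norm z * 2 \<le> 4 * (real k + 1) * (real k + \<nu> + 1)"
    proof -
      have "norm z * 2 \<le> 4 * (1 * real k)" using kz k1 by linarith
      also have "\<dots> \<le> 4 * ((real k + 1) * (real k + \<nu> + 1))"
        by (intro mult_left_mono mult_mono) (use kk k1 in auto)
      finally show ?thesis by (simp only: mult.assoc)
    qed
    then have "norm z / (4 * (real k + 1) * (real k + \<nu> + 1)) \<le> 1/2"
      using p pos_divide_le_eq[of "4 * (real k + 1) * (real k + \<nu> + 1)" "norm z" "1/2"] by simp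
    then have "(norm z / (4 * (real k + 1) * (real k + \<nu> + 1))) * (\<bar>coef k\<bar> * norm z ^ k) \<le> 1/2 * (\<bar>coef k\<bar> * norm z ^ k)"
      by (intro mult_right_mono) auto
    moreover have "\<bar>coef (Suc k)\<bar> = \<bar>coef k\<bar> / (4 * (real k + 1) * (real k + \<nu> + 1))"
      unfolding e using p by (simp add: abs_mult)
    ultimately show ?thesis by (simp only: norm_mult norm_power norm_of_real) (simp add: mult_ac)
  qed
qed simp

lemma P0_deriv: "(P0 has_field_derivative P1 z) (at z)"
  unfolding P0_def[abs_def] P1_def by (rule termdiffs_strong_converges_everywhere[OF summable_coef])

lemma summable_diffs_coef: "summable (\<lambda>k. diffs (\<lambda>k. of_real (coef k) :: complex) k * z ^ k)"
  by (rule termdiff_converges_all[OF summable_coef])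

lemma P1_deriv: "(P1 has_field_derivative P2 z) (at z)"
  unfolding P1_def[abs_def] P2_def
  by (rule termdiffs_strong_converges_everywhere[OF summable_diffs_coef])

text \<open>Comparison of coefficients: z times the second derivative contributes k times the k-th
  coefficient of \<open>P1\<close>, and \<open>coef_Suc\<close> makes the total coefficient of each
  power vanish.\<close>

lemma P_ode: "4 * z * P2 z + 4 * (of_real \<nu> + 1) * P1 z + P0 z = 0"
proof -
  define c :: "nat \<Rightarrow> complex" where "c = (\<lambda>k. of_real (coef k))"
  have s0: "(\<lambda>k. c k * z ^ k) sums P0 z" 
    unfolding P0_def c_def by (rule summable_sums[OF summable_coef])
  have s1: "(\<lambda>k. diffs c k * z ^ k) sums P1 z"
    unfolding P1_def c_def by (rule summable_sums[OF summable_diffs_coef])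
  have s2: "(\<lambda>k. of_nat k * diffs c k * z ^ (k - Suc 0)) sums P2 z"
    unfolding P2_def c_def
    using diffs_equiv[OF termdiff_converges_all[OF summable_diffs_coef]] by simp
  have s2': "(\<lambda>k. of_nat k * diffs c k * z ^ k) sums (z * P2 z)"
  proof -
    have "(\<lambda>k. z * (of_nat k * diffs c k * z ^ (k - Suc 0))) sums (z * P2 z)"
      by (rule sums_mult[OF s2])
    moreover have "z * (of_nat k * diffs c k * z ^ (k - Suc 0)) = of_nat k * diffs c k * z ^ k" for k
      by (cases k) auto
    ultimately show ?thesis by simp
  qed
  have "(\<lambda>k. 4 * (of_nat k * diffs c k * z ^ k) + 4 * (of_real \<nu> + 1) * (diffs c k * z ^ k) + c k * z ^ k)
    sums (4 * (z * P2 z) + 4 * (of_real \<nu> + 1) * P1 z + P0 z)"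
    by (intro sums_add sums_mult s0 s1 s2')
  moreover have "4 * (of_nat k * diffs c k * z ^ k) + 4 * (of_real \<nu> + 1) * (diffs c k * z ^ k) + c k * z ^ k = 0" for k
  proof -
    have "4 * of_nat k * diffs c k + 4 * (of_real \<nu> + 1) * diffs c k + c k
      = of_real (4 * (real k + 1) * (real k + \<nu> + 1) * coef (Suc k) + coef k)"
      unfolding diffs_def c_def by (simp add: algebra_simps)
    also have "\<dots> = 0" using coef_Suc[of k] by simp
    finally have "(4 * of_nat k * diffs c k + 4 * (of_real \<nu> + 1) * diffs c k + c k) * z ^ k = 0" by simp
    then show ?thesis by (simp add: algebra_simps)
  qed
  ultimately have "(\<lambda>k::nat. 0::complex) sums (4 * (z * P2 z) + 4 * (of_real \<nu> + 1) * P1 z + P0 z)" by simp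
  then show ?thesis using sums_unique2[OF _ sums_zero] by (metis mult.assoc)
qed

lemma g_deriv: "(g has_field_derivative g' w) (at w)"
  unfolding g_def[abs_def] g'_def
  by (rule DERIV_chain2[OF P0_deriv, THEN DERIV_cong]) (auto intro!: derivative_eq_intros)

lemma g'_deriv: "(g' has_field_derivative g'' w) (at w)"
proof -
  have "((\<lambda>w. P1 (w\<^sup>2)) has_field_derivative P2 (w\<^sup>2) * (2 * w)) (at w)"
    by (rule DERIV_chain2[OF P1_deriv, THEN DERIV_cong]) (auto intro!: derivative_eq_intros)
  then show ?thesis unfolding g'_def[abs_def] g''_def
    by (auto intro!: derivative_eq_intros simp: power2_eq_square)
qed

lemma g_ode: "w * g'' w + 2 * of_real \<sigma> * g' w + w * g w = 0"
proof -
  have "w * g'' w + 2 * of_real \<sigma> * g' w + w * g w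
     = w * (4 * w\<^sup>2 * P2 (w\<^sup>2) + 4 * (of_real \<nu> + 1) * P1 (w\<^sup>2) + P0 (w\<^sup>2))"
    unfolding g_def g'_def g''_def \<sigma>_def by (simp add: algebra_simps)
  then show ?thesis using P_ode[of "w\<^sup>2"] by simp
qed

lemma g_minus [simp]: "g (- w) = g w" by (simp add: g_def)

lemma g_0_pos: "g 0 = of_real (coef 0)"
  unfolding g_def P0_def using powser_zero[of "\<lambda>k. of_real (coef k) :: complex"] by simp

lemma P0_cnj: "P0 (cnj z) = cnj (P0 z)"
  unfolding P0_def using bounded_linear.suminf[OF bounded_linear_cnj summable_coef] by simp

lemma P1_cnj: "P1 (cnj z) = cnj (P1 z)"
proof -
  have "diffs (\<lambda>k. complex_of_real (coef k)) n = of_real (diffs coef n)" for n by (simp add: diffs_def)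
  then show ?thesis
  unfolding P1_def using bounded_linear.suminf[OF bounded_linear_cnj summable_diffs_coef] by simp
qed

lemma g_cnj: "g (cnj w) = cnj (g w)" using P0_cnj[of "w\<^sup>2"] by (simp add: g_def)
lemma g'_cnj: "g' (cnj w) = cnj (g' w)" using P1_cnj[of "w\<^sup>2"] by (simp add: g'_def)

lemma g_real: "g (of_real x) = of_real (Re (g (of_real x)))"
  using g_cnj[of "of_real x"] by (simp add: complex_eq_iff)

lemma g'_real: "g' (of_real x) = of_real (Re (g' (of_real x)))"
  using g'_cnj[of "of_real x"] by (simp add: complex_eq_iff)

text \<open>The signs of the coefficients cancel those of the even powers of an imaginary number, so
  all terms are nonnegative and the constant one is positive. It keeps the zeros off the side of the
  contour that lies on the imaginary axis.\<close>

lemma g_imag_axis: "Re (g (\<i> * of_real t)) > 0"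
proof -
  have e: "of_real (coef k) * ((\<i> * of_real t)\<^sup>2) ^ k = complex_of_real (\<bar>coef k\<bar> * (t\<^sup>2) ^ k)" for k
  proof -
    have "\<bar>coef k\<bar> = (-1)^k * coef k"
    proof -
      have "Gamma (real k + \<nu> + 1) > 0" using nu by (intro Gamma_real_pos) simp
      then show ?thesis unfolding coef_def by (cases "even k") (auto simp: abs_mult)
    qed
    moreover have "(\<i> * complex_of_real t)\<^sup>2 = of_real (- (t\<^sup>2))"
      by (simp add: power_mult_distrib)
    then have "((\<i> * complex_of_real t)\<^sup>2) ^ k = of_real ((- (t\<^sup>2)) ^ k)" by (simp only: of_real_power)
    moreover have "(- (t\<^sup>2)) ^ k = (-1)^k * (t\<^sup>2) ^ k" by (rule power_minus)
    ultimately show ?thesis by simp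
  qed
  have "summable (\<lambda>k. complex_of_real (\<bar>coef k\<bar> * (t\<^sup>2) ^ k))"
    using summable_coef[of "(\<i> * of_real t)\<^sup>2"] unfolding e .
  then have sm: "summable (\<lambda>k. \<bar>coef k\<bar> * (t\<^sup>2) ^ k)" by (simp only: summable_of_real_iff)
  have "g (\<i> * of_real t) = of_real (\<Sum>k. \<bar>coef k\<bar> * (t\<^sup>2) ^ k)"
    unfolding g_def P0_def e using suminf_of_real[OF sm, where 'a=complex] by simp
  moreover have "(\<Sum>k. \<bar>coef k\<bar> * (t\<^sup>2) ^ k) > 0"
    by (rule suminf_pos2[OF sm, of 0]) (use coef_0_pos in auto)
  ultimately show ?thesis by simp
qed

lemma besselJ_eq: 
  assumes "x > 0"
  shows "besselJ \<nu> x = x powr \<nu> * Re (g (of_real x))"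
proof -
  have sm: "summable (\<lambda>k. coef k * (x\<^sup>2) ^ k)"
    using summable_coef[of "of_real (x\<^sup>2)"]
    by (simp only: of_real_power[symmetric] of_real_mult[symmetric] summable_of_real_iff)
  have "g (of_real x) = of_real (\<Sum>k. coef k * (x\<^sup>2) ^ k)"
    unfolding g_def P0_def using suminf_of_real[OF sm, where 'a=complex] by simp
  then have "x powr \<nu> * Re (g (of_real x)) = (\<Sum>k. x powr \<nu> * (coef k * (x\<^sup>2) ^ k))"
    using suminf_mult[OF sm] by simp
  also have "(\<lambda>k. x powr \<nu> * (coef k * (x\<^sup>2) ^ k)) = 
     (\<lambda>k. (-1) ^ k / (fact k * Gamma (real k + \<nu> + 1)) * (x / 2) powr (2 * real k + \<nu>))"
  proof
    fix k
    have "(x / 2) powr (2 * real k + \<nu>) = x powr (2 * real k + \<nu>) * 2 powr (- (2 * real k + \<nu>))"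
      using assms powr_minus_divide[of 2 "2 * real k + \<nu>"] powr_divide[of x 2] by simp
    moreover have "x powr (2 * real k + \<nu>) = x powr \<nu> * (x\<^sup>2) ^ k"
      using assms powr_realpow[OF assms, of "2 * k"] by (simp add: powr_add power_mult)
    ultimately show "x powr \<nu> * (coef k * (x\<^sup>2) ^ k) =
      (-1) ^ k / (fact k * Gamma (real k + \<nu> + 1)) * (x / 2) powr (2 * real k + \<nu>)"
      unfolding coef_def by simp
  qed
  finally show ?thesis unfolding besselJ_def by simp
qed

text \<open>The classical rule that x powr (- \<nu>) times J of order \<nu> has derivative minus x
  powr (- \<nu>) times J of order \<nu> + 1, checked term by term. It turns the normalising constant
  of \<open>psi\<close> into a value of \<open>g'\<close>.\<close>

lemma besselJ_Suc_eq: 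
  assumes "x > 0"
  shows "besselJ (\<nu> + 1) x = - (x powr \<nu> * Re (g' (of_real x)))"
proof -
  have d: "diffs (\<lambda>k. complex_of_real (coef k)) n = of_real (diffs coef n)" for n by (simp add: diffs_def)
  have sm: "summable (\<lambda>k. diffs coef k * (x\<^sup>2) ^ k)"
    using summable_diffs_coef[of "of_real (x\<^sup>2)"]
    by (simp only: d of_real_power[symmetric] of_real_mult[symmetric] summable_of_real_iff)
  have "g' (of_real x) = of_real (2 * x * (\<Sum>k. diffs coef k * (x\<^sup>2) ^ k))"
    unfolding g'_def P1_def d using suminf_of_real[OF sm, where 'a=complex] by simp
  then have "- (x powr \<nu> * Re (g' (of_real x))) = (- (2 * x) * x powr \<nu>) * (\<Sum>k. diffs coef k * (x\<^sup>2) ^ k)"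
    by simp
  also have "\<dots> = (\<Sum>k. (- (2 * x) * x powr \<nu>) * (diffs coef k * (x\<^sup>2) ^ k))"
    by (rule suminf_mult[OF sm, symmetric])
  also have "(\<lambda>k. (- (2 * x) * x powr \<nu>) * (diffs coef k * (x\<^sup>2) ^ k)) = 
     (\<lambda>k. (-1) ^ k / (fact k * Gamma (real k + (\<nu> + 1) + 1)) * (x / 2) powr (2 * real k + (\<nu> + 1)))"
  proof
    fix k
    have "(x / 2) powr (2 * real k + (\<nu> + 1)) = x powr (2 * real k + (\<nu> + 1)) * 2 powr (- (2 * real k + (\<nu> + 1)))"
      using assms powr_minus_divide[of 2 "2 * real k + (\<nu> + 1)"] powr_divide[of x 2] by simp
    moreover have "x powr (2 * real k + (\<nu> + 1)) = x powr \<nu> * x * (x\<^sup>2) ^ k"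
      using assms powr_realpow[OF assms, of "2 * k"] by (simp add: powr_add power_mult)
    moreover have "2 powr (- (2 * real k + (\<nu> + 1))) = 2 * 2 powr (- (2 * real (Suc k) + \<nu>))"
    proof -
      have "- (2 * real k + (\<nu> + 1)) = - (2 * real (Suc k) + \<nu>) + 1" by simp
      then show ?thesis by (simp only: powr_add) simp
    qed
    ultimately show "(- (2 * x) * x powr \<nu>) * (diffs coef k * (x\<^sup>2) ^ k) =
      (-1) ^ k / (fact k * Gamma (real k + (\<nu> + 1) + 1)) * (x / 2) powr (2 * real k + (\<nu> + 1))"
      unfolding coef_def diffs_def by (simp add: add_ac divide_simps)
  qed
  finally show ?thesis unfolding besselJ_def by simp
qed

text \<open>The normal form of Bessel's equation: \<open>u'' = (\<kappa> / w\<^sup>2 - 1) * u\<close>.\<close>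
definition u :: "complex \<Rightarrow> complex" where "u w = w powr of_real \<sigma> * g w"
definition u' :: "complex \<Rightarrow> complex" where
  "u' w = of_real \<sigma> * w powr (of_real \<sigma> - 1) * g w + w powr of_real \<sigma> * g' w"

lemma u_deriv: "w \<notin> \<real>\<^sub>\<le>\<^sub>0 \<Longrightarrow> (u has_field_derivative u' w) (at w)"
  unfolding u_def[abs_def] u'_def
  by (auto intro!: derivative_eq_intros g_deriv)

lemma u'_deriv: 
  assumes "w \<notin> \<real>\<^sub>\<le>\<^sub>0" 
  shows "(u' has_field_derivative - (1 - of_real \<kappa> / w\<^sup>2) * u w) (at w)"
proof -
  have w0: "w \<noteq> 0" using assms by auto
  define s where "s = complex_of_real \<sigma>"
  define p where "p = w powr s"
  have p1: "w powr (s - 1) = p / w" unfolding p_def using w0 by (simp add: powr_diff)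
  have p2: "w powr (s - 1 - 1) = p / w\<^sup>2"
    using w0 by (simp add: powr_diff p_def power2_eq_square)
  have gg: "g'' w = - 2 * s * g' w / w - g w"
    proof -
    have "w * (g'' w - (- 2 * s * g' w / w - g w)) = 0"
      using g_ode[of w] w0 unfolding s_def by (simp add: algebra_simps)
    then show ?thesis using w0 by simp
  qed
  have k: "s * (s - 1) = of_real \<kappa>"
  proof -
    have "\<sigma> * (\<sigma> - 1) = \<kappa>" unfolding \<sigma>_def \<kappa>_def by (simp add: algebra_simps power2_eq_square)
    then show ?thesis unfolding s_def by (metis of_real_1 of_real_diff of_real_mult)
  qed
  have "(u' has_field_derivative (s * ((s - 1) * w powr (s - 1 - 1)) * g w + s * w powr (s - 1) * g' w)
      + (s * w powr (s - 1) * g' w + w powr s * g'' w)) (at w)"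
    unfolding u'_def[abs_def] s_def[symmetric]
    by (auto intro!: derivative_eq_intros g_deriv g'_deriv simp: assms algebra_simps)
  moreover have "(s * ((s - 1) * w powr (s - 1 - 1)) * g w + s * w powr (s - 1) * g' w)
      + (s * w powr (s - 1) * g' w + w powr s * g'' w) = - (1 - of_real \<kappa> / w\<^sup>2) * u w"
    unfolding p1 p2 gg k[symmetric] u_def s_def[symmetric] p_def[symmetric]
    using w0 by (simp add: field_simps power2_eq_square)
  ultimately show ?thesis by simp
qed

lemma norm_u: "w \<noteq> 0 \<Longrightarrow> norm (u w) = norm w powr \<sigma> * norm (g w)"
  unfolding u_def by (simp add: norm_mult norm_powr_real_powr')

lemma u_of_real:
  assumes "x > 0"
  shows "u (of_real x) = of_real (x powr \<sigma> * Re (g (of_real x)))"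
        "u' (of_real x) = of_real (\<sigma> * x powr (\<sigma> - 1) * Re (g (of_real x)) + x powr \<sigma> * Re (g' (of_real x)))"
proof -
  have "complex_of_real x powr of_real a = of_real (x powr a)" for a
    using assms by (simp add: powr_of_real)
  from this[of \<sigma>] this[of "\<sigma> - 1"]
  show "u (of_real x) = of_real (x powr \<sigma> * Re (g (of_real x)))"
        "u' (of_real x) = of_real (\<sigma> * x powr (\<sigma> - 1) * Re (g (of_real x)) + x powr \<sigma> * Re (g' (of_real x)))"
    unfolding u_def u'_def
    by (simp_all add: g_real[symmetric] g'_real[symmetric])
qed

end

section \<open>Asymptotics in the quarter plane\<close>

text \<open>The weight exp(- m) makes the energy |A|^2 + |B|^2 nonincreasing. The hypothesis
  controls only inner products with the derivative, so a rotating or decaying part of the derivative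
  costs nothing.\<close>

lemma gronwall_pair:
  fixes A B :: "real \<Rightarrow> complex"
  assumes ab: "a \<le> b"
    and A: "\<And>t. a \<le> t \<Longrightarrow> t \<le> b \<Longrightarrow> (A has_vector_derivative A' t) (at t)"
    and B: "\<And>t. a \<le> t \<Longrightarrow> t \<le> b \<Longrightarrow> (B has_vector_derivative B' t) (at t)"
    and m: "\<And>t. a \<le> t \<Longrightarrow> t \<le> b \<Longrightarrow> (m has_real_derivative 2 * k t) (at t)"
    and le: "\<And>t. a \<le> t \<Longrightarrow> t \<le> b \<Longrightarrow>
       A t \<bullet> A' t + B t \<bullet> B' t \<le> k t * ((norm (A t))\<^sup>2 + (norm (B t))\<^sup>2)"
  shows "(norm (A b))\<^sup>2 + (norm (B b))\<^sup>2 \<le> exp (m b - m a) * ((norm (A a))\<^sup>2 + (norm (B a))\<^sup>2)"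
proof -
  define S where "S = (\<lambda>t. A t \<bullet> A t + B t \<bullet> B t)"
  have S': "((\<lambda>t. exp (- m t) * S t) has_real_derivative
      exp (- m t) * (2 * (A t \<bullet> A' t + B t \<bullet> B' t) - 2 * k t * S t)) (at t)"
    if "a \<le> t" "t \<le> b" for t
  proof -
    have "(S has_real_derivative 2 * (A t \<bullet> A' t + B t \<bullet> B' t)) (at t)"
    proof -
      have "((\<lambda>t. A t \<bullet> A t) has_real_derivative 2 * (A t \<bullet> A' t)) (at t)"
        if h: "(A has_vector_derivative A' t) (at t)" for A A' :: "real \<Rightarrow> complex"
        using bounded_bilinear.has_vector_derivative[OF bounded_bilinear_inner h h]
        by (simp add: has_real_derivative_iff_has_vector_derivative inner_commute)
      from DERIV_add[OF this[of A A'] this[of B B']] A[OF that] B[OF that]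
      show ?thesis unfolding S_def by (simp add: algebra_simps)
    qed
    then show ?thesis
      by (auto intro!: derivative_eq_intros m[OF that] simp: algebra_simps)
  qed
  have "exp (- m b) * S b \<le> exp (- m a) * S a"
  proof (rule DERIV_nonpos_imp_nonincreasing[OF ab])
    fix t assume t: "a \<le> t" "t \<le> b"
    have "2 * (A t \<bullet> A' t + B t \<bullet> B' t) - 2 * k t * S t \<le> 0"
      using le[OF t] unfolding S_def by (simp add: power2_norm_eq_inner)
    then show "\<exists>y. ((\<lambda>t. exp (- m t) * S t) has_real_derivative y) (at t) \<and> y \<le> 0"
      using S'[OF t] by (auto intro!: exI mult_nonneg_nonpos)
  qed
  then have "exp (m b) * (exp (- m b) * S b) \<le> exp (m b) * (exp (- m a) * S a)" by simp
  then have "S b \<le> exp (m b - m a) * S a"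
    by (simp add: exp_diff exp_minus divide_inverse mult.assoc[symmetric])
  then show ?thesis unfolding S_def by (simp add: power2_norm_eq_inner)
qed

lemma sum_norms_sq: "(norm a + norm b)\<^sup>2 \<le> 2 * ((norm a)\<^sup>2 + (norm b)\<^sup>2)"
  for a b :: "'a::real_normed_vector"
  using sum_squares_bound[of "norm a" "norm b"] by (simp add: power2_sum)

context bessel_order
begin

text \<open>The amplitudes of the two exponentials in \<open>u\<close>, both scaled by \<open>exp (\<i> * w)\<close> so that they stay
  bounded in the upper half plane.\<close>
definition A :: "complex \<Rightarrow> complex" where "A w = (u w - \<i> * u' w) / 2 * exp (\<i> * w)"
definition B :: "complex \<Rightarrow> complex" where "B w = (u w + \<i> * u' w) / 2 * exp (\<i> * w)"

lemma A_plus_B: "A w + B w = u w * exp (\<i> * w)"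
  unfolding A_def B_def by (simp add: field_simps)

text \<open>Variation of constants: apart from the rotation factor 2 \<i> in \<open>A\<close>, both
  amplitudes change only through a term of order 1 / w^2, which is integrable at infinity.\<close>

lemma A_deriv:
  assumes "w \<notin> \<real>\<^sub>\<le>\<^sub>0"
  shows "(A has_field_derivative 2 * \<i> * A w - \<i> * of_real \<kappa> / (2 * w\<^sup>2) * (A w + B w)) (at w)"
proof -
  have "w \<noteq> 0" using assms by auto
  then show ?thesis
    unfolding A_def[abs_def] B_def
    by (auto intro!: derivative_eq_intros u_deriv u'_deriv assms simp: divide_simps)
       (simp add: algebra_simps power2_eq_square)
qed

lemma B_deriv:
  assumes "w \<notin> \<real>\<^sub>\<le>\<^sub>0"
  shows "(B has_field_derivative \<i> * of_real \<kappa> / (2 * w\<^sup>2) * (A w + B w)) (at w)"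
proof -
  have "w \<noteq> 0" using assms by auto
  then show ?thesis
    unfolding B_def[abs_def] A_def
    by (auto intro!: derivative_eq_intros u_deriv u'_deriv assms simp: divide_simps)
       (simp add: algebra_simps power2_eq_square)
qed

text \<open>\<open>u\<close> and \<open>u'\<close> are real on the positive axis, so there the two
  amplitudes are conjugate up to a phase and it is enough to follow \<open>B\<close>.\<close>

lemma A_real:
  assumes "x > 0"
  shows "A (of_real x) = cnj (B (of_real x)) * exp (2 * \<i> * of_real x)"
proof -
  have "cnj (B (of_real x)) = (u x - \<i> * u' x) / 2 * exp (- (\<i> * x))"
    unfolding B_def by (simp add: u_of_real[OF assms] exp_cnj)
  moreover have "exp (2 * \<i> * complex_of_real x) = exp (\<i> * x) * exp (\<i> * x)"
    by (simp add: mult_exp_exp mult.assoc)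
  moreover have "exp (- (\<i> * complex_of_real x)) * exp (\<i> * x) = 1" by (simp add: exp_add[symmetric])
  ultimately have "cnj (B (of_real x)) * exp (2 * \<i> * of_real x) = (u x - \<i> * u' x) / 2 * 1 * exp (\<i> * x)"
    by (metis mult.assoc)
  then show ?thesis unfolding A_def by simp
qed

lemma norm_A_real: "x > 0 \<Longrightarrow> norm (A (of_real x)) = norm (B (of_real x))"
  by (subst A_real) (simp_all add: norm_mult)

text \<open>Identifies |B|^2 with the oscillator energy, which is conserved up to the inverse-square
  potential. Bounds on \<open>B\<close> from below thus say that \<open>u\<close> and
  \<open>u'\<close> are never small together.\<close>

lemma norm_B_real:
  assumes "x > 0"
  shows "4 * (norm (B (of_real x)))\<^sup>2 = (Re (u x))\<^sup>2 + (Re (u' x))\<^sup>2"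
  proof -
  define p q where "p = Re (u x)" and "q = Re (u' x)"
  have "u x = of_real p" "u' x = of_real q"
    unfolding p_def q_def by (simp_all add: u_of_real[OF assms])
  then have "norm (B (of_real x)) = norm (of_real p + \<i> * of_real q) / 2"
    unfolding B_def by (simp add: norm_mult norm_divide)
  also have "norm (of_real p + \<i> * of_real q) = sqrt (p\<^sup>2 + q\<^sup>2)" by (simp add: cmod_def)
  finally have "norm (B (of_real x)) * 2 = sqrt (p\<^sup>2 + q\<^sup>2)" by simp
  then have "(norm (B (of_real x)) * 2)\<^sup>2 = p\<^sup>2 + q\<^sup>2" by simp
  then show ?thesis unfolding p_def[symmetric] q_def[symmetric] by (simp add: power_mult_distrib)
qed

lemma deriv_term_bound:
  "2 * (norm (\<i> * of_real \<kappa> / (2 * w\<^sup>2) * (a + b)) * (norm a + norm b))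
     \<le> 2 * (\<bar>\<kappa>\<bar> / (norm w)\<^sup>2) * ((norm a)\<^sup>2 + (norm b)\<^sup>2)"
proof -
  have "2 * (norm (\<i> * of_real \<kappa> / (2 * w\<^sup>2) * (a + b)) * (norm a + norm b))
     = (\<bar>\<kappa>\<bar> / (norm w)\<^sup>2) * (norm (a + b) * (norm a + norm b))"
    by (simp add: norm_mult norm_divide norm_power)
  also have "\<dots> \<le> (\<bar>\<kappa>\<bar> / (norm w)\<^sup>2) * ((norm a + norm b) * (norm a + norm b))"
    by (intro mult_left_mono mult_right_mono norm_triangle_ineq) auto
  also have "\<dots> \<le> (\<bar>\<kappa>\<bar> / (norm w)\<^sup>2) * (2 * ((norm a)\<^sup>2 + (norm b)\<^sup>2))"
    using sum_norms_sq[of a b] by (intro mult_left_mono) (auto simp: power2_eq_square)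
  finally show ?thesis by (simp only: mult_ac)
qed

lemma inner_le_norms:
  fixes a b x y :: complex
  assumes "norm x \<le> e" "norm y \<le> e"
  shows "a \<bullet> x + b \<bullet> y \<le> e * (norm a + norm b)"
proof -
  have "a \<bullet> x \<le> norm a * norm x" "b \<bullet> y \<le> norm b * norm y" by (rule norm_cauchy_schwarz)+
  moreover have "norm a * norm x \<le> norm a * e" "norm b * norm y \<le> norm b * e"
    using assms by (auto intro: mult_left_mono)
  ultimately show ?thesis by (simp add: algebra_simps)
qed

lemma not_nonpos_real: "x > 0 \<Longrightarrow> complex_of_real x \<notin> \<real>\<^sub>\<le>\<^sub>0"
  by (simp add: complex_nonpos_Reals_iff)

text \<open>The exponent is the integral of 2 |\<kappa>| / t^2 from a to b. Both directions are
  needed: growth gives upper bounds at infinity, its reversal gives the lower bounds.\<close>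

lemma B_real_growth:
  assumes "0 < a" "a \<le> b"
  shows "(norm (B (of_real b)))\<^sup>2 \<le> exp (2 * \<bar>\<kappa>\<bar> * (1 / a - 1 / b)) * (norm (B (of_real a)))\<^sup>2"
    and "(norm (B (of_real a)))\<^sup>2 \<le> exp (2 * \<bar>\<kappa>\<bar> * (1 / a - 1 / b)) * (norm (B (of_real b)))\<^sup>2"
proof -
  define A' where "A' = (\<lambda>w. 2 * \<i> * A w - \<i> * of_real \<kappa> / (2 * w\<^sup>2) * (A w + B w))"
  define B' where "B' = (\<lambda>w. \<i> * of_real \<kappa> / (2 * w\<^sup>2) * (A w + B w))"
  have dA: "((\<lambda>t. A (of_real t)) has_vector_derivative A' (of_real t)) (at t)"
    and dB: "((\<lambda>t. B (of_real t)) has_vector_derivative B' (of_real t)) (at t)" if "t > 0" for t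
    using has_vector_derivative_real_field[OF A_deriv[OF not_nonpos_real[OF that]]]
      has_vector_derivative_real_field[OF B_deriv[OF not_nonpos_real[OF that]]]
    unfolding A'_def B'_def by auto
  have inn: "\<bar>A t \<bullet> A' t + B t \<bullet> B' t\<bar> \<le> (\<bar>\<kappa>\<bar> / (norm t)\<^sup>2) * ((norm (A t))\<^sup>2 + (norm (B t))\<^sup>2)" for t :: complex
  proof -
    define e where "e = \<i> * of_real \<kappa> / (2 * t\<^sup>2) * (A t + B t)"
    \<comment> \<open>Multiplication by 2 \<i> is a rotation by a right angle, so the oscillating
      part of the derivative is invisible to the energy.\<close>
    have z: "A t \<bullet> (2 * \<i> * A t) = 0" by (simp add: inner_complex_def algebra_simps)
    have "A t \<bullet> A' t = A t \<bullet> (- e)" unfolding A'_def e_def[symmetric] inner_diff_right z by simp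
    moreover have "B' t = e" unfolding B'_def e_def ..
    ultimately have eq: "A t \<bullet> A' t + B t \<bullet> B' t = A t \<bullet> (- e) + B t \<bullet> e" "- (A t \<bullet> A' t + B t \<bullet> B' t) = A t \<bullet> e + B t \<bullet> (- e)"
      by simp_all
    have "A t \<bullet> (- e) + B t \<bullet> e \<le> norm e * (norm (A t) + norm (B t))"
      "A t \<bullet> e + B t \<bullet> (- e) \<le> norm e * (norm (A t) + norm (B t))" by (intro inner_le_norms; simp)+
    moreover have "norm e * (norm (A t) + norm (B t)) \<le> (\<bar>\<kappa>\<bar> / (norm t)\<^sup>2) * ((norm (A t))\<^sup>2 + (norm (B t))\<^sup>2)"
      using deriv_term_bound[of t "A t" "B t"] unfolding e_def by simp
    ultimately show ?thesis using eq by linarith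
  qed
  have dinv: "((\<lambda>t. 2 * \<bar>\<kappa>\<bar> * (- 1 / t)) has_real_derivative 2 * (\<bar>\<kappa>\<bar> / t\<^sup>2)) (at t)" if "t \<noteq> 0" for t :: real
    using that by (auto intro!: derivative_eq_intros simp: power2_eq_square)
  have "(norm (A (of_real b)))\<^sup>2 + (norm (B (of_real b)))\<^sup>2 \<le> exp (2 * \<bar>\<kappa>\<bar> * (- 1 / b) - 2 * \<bar>\<kappa>\<bar> * (- 1 / a)) *
     ((norm (A (of_real a)))\<^sup>2 + (norm (B (of_real a)))\<^sup>2)"
  proof (rule gronwall_pair[OF assms(2), where A = "\<lambda>t. A (of_real t)" and B = "\<lambda>t. B (of_real t)"
        and k = "\<lambda>t. \<bar>\<kappa>\<bar> / t\<^sup>2" and m = "\<lambda>t. 2 * \<bar>\<kappa>\<bar> * (- 1 / t)"])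
    fix t assume t: "a \<le> t" "t \<le> b"
    show "((\<lambda>t. A (of_real t)) has_vector_derivative A' (of_real t)) (at t)"
      "((\<lambda>t. B (of_real t)) has_vector_derivative B' (of_real t)) (at t)" using dA dB t assms by auto
    show "((\<lambda>t. 2 * \<bar>\<kappa>\<bar> * (- 1 / t)) has_real_derivative 2 * (\<bar>\<kappa>\<bar> / t\<^sup>2)) (at t)"
      using dinv[of t] t assms by auto
    show "A t \<bullet> A' t + B t \<bullet> B' t \<le> \<bar>\<kappa>\<bar> / t\<^sup>2 * ((norm (A t))\<^sup>2 + (norm (B t))\<^sup>2)"
      using inn[of t] by simp
  qed
  then show "(norm (B (of_real b)))\<^sup>2 \<le> exp (2 * \<bar>\<kappa>\<bar> * (1 / a - 1 / b)) * (norm (B (of_real a)))\<^sup>2"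
    using assms by (simp add: norm_A_real algebra_simps)
  \<comment> \<open>The same estimate run backwards, after the substitution of - t for t.\<close>
  have "(norm (A (of_real (- (- a)))))\<^sup>2 + (norm (B (of_real (- (- a)))))\<^sup>2 \<le> 
     exp (2 * \<bar>\<kappa>\<bar> * (- 1 / (- a)) - 2 * \<bar>\<kappa>\<bar> * (- 1 / (- b))) *
     ((norm (A (of_real (- (- b)))))\<^sup>2 + (norm (B (of_real (- (- b)))))\<^sup>2)"
  proof (rule gronwall_pair[where a = "- b" and b = "- a" and A = "\<lambda>t. A (of_real (- t))" and B = "\<lambda>t. B (of_real (- t))"
        and k = "\<lambda>t. \<bar>\<kappa>\<bar> / t\<^sup>2" and m = "\<lambda>t. 2 * \<bar>\<kappa>\<bar> * (- 1 / t)"])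
    fix t assume t: "- b \<le> t" "t \<le> - a"
    have "((\<lambda>t. A (of_real t)) \<circ> uminus has_vector_derivative (- 1) *\<^sub>R A' (of_real (- t))) (at t)"
      "((\<lambda>t. B (of_real t)) \<circ> uminus has_vector_derivative (- 1) *\<^sub>R B' (of_real (- t))) (at t)"
      by (rule vector_diff_chain_at; use dA[of "- t"] dB[of "- t"] t assms in \<open>auto intro!: derivative_eq_intros\<close>)+
    then show "((\<lambda>t. A (of_real (- t))) has_vector_derivative - A' (of_real (- t))) (at t)"
      "((\<lambda>t. B (of_real (- t))) has_vector_derivative - B' (of_real (- t))) (at t)"
      by (simp_all add: o_def)
    show "((\<lambda>t. 2 * \<bar>\<kappa>\<bar> * (- 1 / t)) has_real_derivative 2 * (\<bar>\<kappa>\<bar> / t\<^sup>2)) (at t)"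
      using dinv[of t] t assms by auto
    show "A (of_real (- t)) \<bullet> - A' (of_real (- t)) + B (of_real (- t)) \<bullet> - B' (of_real (- t)) \<le> 
       \<bar>\<kappa>\<bar> / t\<^sup>2 * ((norm (A (of_real (- t))))\<^sup>2 + (norm (B (of_real (- t))))\<^sup>2)"
      using inn[of "of_real (- t)"] by simp
  qed (use assms in auto)
  then show "(norm (B (of_real a)))\<^sup>2 \<le> exp (2 * \<bar>\<kappa>\<bar> * (1 / a - 1 / b)) * (norm (B (of_real b)))\<^sup>2"
    using assms by (simp add: norm_A_real algebra_simps)
qed

text \<open>The energy is positive at a point a < 1 where \<open>g\<close> does not vanish;
  \<open>B_real_growth\<close> carries it to all x \<ge> 1 with the fixed factor exp(2 |\<kappa>| /
  a), because 1 / t^2 is integrable at infinity.\<close>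

lemma B_real_bounds:
  obtains c C where "0 < c" "\<And>x. x \<ge> 1 \<Longrightarrow> c \<le> norm (B (of_real x))"
     "\<And>x. x \<ge> 1 \<Longrightarrow> norm (B (of_real x)) \<le> C"
proof -
  obtain a where a: "0 < a" "a < 1" "g (of_real a) \<noteq> 0"
  proof -
    have "isCont g 0" using g_deriv by (rule DERIV_isCont)
    then have "\<forall>\<^sub>F w in at 0. g w \<noteq> 0"
      unfolding isCont_def using g_0_pos coef_0_pos by (intro tendsto_imp_eventually_ne) auto
    then obtain d where d: "d > 0" "\<And>w. w \<noteq> 0 \<Longrightarrow> dist w 0 < d \<Longrightarrow> g w \<noteq> 0"
      unfolding eventually_at by auto
    show ?thesis
      by (rule that[of "min (d/2) (1/2)"]) (use d in \<open>auto intro!: d(2)\<close>)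
  qed
  have ba: "norm (B (of_real a)) > 0"
  proof -
    have "Re (g (of_real a)) \<noteq> 0" using a(3) g_real[of a] by (metis of_real_0)
    then have "Re (u a) \<noteq> 0" using a by (simp add: u_of_real)
    then have "(Re (u a))\<^sup>2 > 0" by simp
    then have "4 * (norm (B (of_real a)))\<^sup>2 > 0"
      using norm_B_real[OF a(1)] zero_le_power2[of "Re (u' a)"] by linarith
    then show ?thesis by simp
  qed
  define E where "E = exp (2 * \<bar>\<kappa>\<bar> / a)"
  have Epos: "E > 0" unfolding E_def by simp
  have E: "exp (2 * \<bar>\<kappa>\<bar> * (1 / a - 1 / x)) \<le> E" if "x \<ge> 1" for x
    unfolding E_def using that a by (simp add: right_diff_distrib)
  show ?thesis
  proof (rule that[of "sqrt ((norm (B (of_real a)))\<^sup>2 / E)" "sqrt (E * (norm (B (of_real a)))\<^sup>2)"])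
    show "0 < sqrt ((norm (B (of_real a)))\<^sup>2 / E)" using ba Epos by simp
  next
    fix x :: real assume x: "1 \<le> x"
    have ax: "a \<le> x" using a x by simp
    have "(norm (B (of_real a)))\<^sup>2 \<le> E * (norm (B (of_real x)))\<^sup>2"
      by (rule order_trans[OF B_real_growth(2)[OF a(1) ax]]) (intro mult_right_mono E x, simp)
    then show "sqrt ((norm (B (of_real a)))\<^sup>2 / E) \<le> norm (B (of_real x))"
      using Epos by (intro real_le_lsqrt) (auto simp: field_simps)
    have "(norm (B (of_real x)))\<^sup>2 \<le> E * (norm (B (of_real a)))\<^sup>2"
      by (rule order_trans[OF B_real_growth(1)[OF a(1) ax]]) (intro mult_right_mono E x, simp)
    then show "norm (B (of_real x)) \<le> sqrt (E * (norm (B (of_real a)))\<^sup>2)"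
      by (rule real_le_rsqrt)
  qed
qed

text \<open>The derivative of \<open>B\<close> is O(1 / t^2), so \<open>B\<close> converges with
  tail K / x. The lower bound on the energy survives in the limit and keeps \<beta> away from
  0.\<close>

lemma B_limit:
  obtains \<beta> K where "\<beta> \<noteq> 0" "0 < K" "\<And>x. x \<ge> 1 \<Longrightarrow> norm (B (of_real x) - \<beta>) \<le> K / x"
proof -
  obtain c C where c: "0 < c" and lo: "\<And>x. x \<ge> 1 \<Longrightarrow> c \<le> norm (B (of_real x))"
    and hi: "\<And>x. x \<ge> 1 \<Longrightarrow> norm (B (of_real x)) \<le> C" using B_real_bounds by metis
  have C: "C > 0" using c lo[of 1] hi[of 1] by simp
  define K where "K = \<bar>\<kappa>\<bar> * C + 1"
  have K: "K > 0" unfolding K_def using C by (intro add_nonneg_pos) auto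
  have diff: "norm (B (of_real y) - B (of_real x)) \<le> K / x - K / y" if "1 \<le> x" "x < y" for x y
  proof -
    have dB: "((\<lambda>t. B (of_real t)) has_vector_derivative \<i> * of_real \<kappa> / (2 * (of_real t)\<^sup>2) * (A t + B t)) (at t)"
      if "t > 0" for t
      using has_vector_derivative_real_field[OF B_deriv[OF not_nonpos_real[OF that]]] .
    have dK: "((\<lambda>t. - K / t) has_vector_derivative K / t\<^sup>2) (at t)" if "t > 0" for t :: real
      using that unfolding has_real_derivative_iff_has_vector_derivative[symmetric]
      by (auto intro!: derivative_eq_intros simp: power2_eq_square)
    have "norm (B (of_real y) - B (of_real x)) \<le> - K / y - (- K / x)"
    proof (rule differentiable_bound_general[OF that(2), where f = "\<lambda>t. B (of_real t)" and \<phi> = "\<lambda>t. - K / t"])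
      show "continuous_on {x..y} (\<lambda>t. B (of_real t))"
        using that by (intro continuous_at_imp_continuous_on ballI has_vector_derivative_continuous[OF dB]) auto
      show "continuous_on {x..y} (\<lambda>t. - K / t)"
        using that by (intro continuous_intros) auto
      fix t assume t: "x < t" "t < y"
      show "((\<lambda>t. B (of_real t)) has_vector_derivative \<i> * of_real \<kappa> / (2 * (of_real t)\<^sup>2) * (A t + B t)) (at t)"
        "((\<lambda>t. - K / t) has_vector_derivative K / t\<^sup>2) (at t)"
        using dB[of t] dK[of t] t that by auto
      have "norm (A (of_real t) + B (of_real t)) \<le> 2 * C"
        using norm_triangle_ineq[of "A (of_real t)" "B (of_real t)"] hi[of t] norm_A_real[of t] t that by simp
      note h = this
      have "norm (\<i> * of_real \<kappa> / (2 * (of_real t)\<^sup>2) * (A t + B t)) \<le> \<bar>\<kappa>\<bar> / (2 * t\<^sup>2) * (2 * C)"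
      proof -
        have "norm (\<i> * of_real \<kappa> / (2 * (of_real t)\<^sup>2) * (A t + B t)) = \<bar>\<kappa>\<bar> / (2 * t\<^sup>2) * norm (A t + B t)"
          by (simp add: norm_mult norm_divide norm_power)
        also have "\<dots> \<le> \<bar>\<kappa>\<bar> / (2 * t\<^sup>2) * (2 * C)" using h by (intro mult_left_mono) auto
        finally show ?thesis .
      qed
      also have "\<dots> \<le> K / t\<^sup>2" unfolding K_def by (simp add: divide_right_mono)
      finally show "norm (\<i> * of_real \<kappa> / (2 * (of_real t)\<^sup>2) * (A t + B t)) \<le> K / t\<^sup>2" .
    qed
    then show ?thesis by simp
  qed
  have diff': "norm (B (of_real y) - B (of_real x)) \<le> K / x" if "1 \<le> x" "x \<le> y" for x y
  proof (cases "x = y")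
    case False
    then have "norm (B (of_real y) - B (of_real x)) \<le> K / x - K / y" using diff that by simp
    moreover have "K / y \<ge> 0" using K that by simp
    ultimately show ?thesis by linarith
  qed (use K that in auto)
  have "Cauchy (\<lambda>n. B (of_real (real (Suc n))))"
  proof (rule CauchyI')
    fix e :: real assume e: "e > 0"
    obtain M :: nat where M: "K / e < M" using reals_Archimedean2 by blast
    have "norm (B (of_real (real (Suc m))) - B (of_real (real (Suc n)))) < e" if "M \<le> m" "m < n" for m n
    proof -
      have "norm (B (of_real (real (Suc n))) - B (of_real (real (Suc m)))) \<le> K / real (Suc m)"
        using that by (intro diff') auto
      also have "\<dots> < e"
      proof -
        have "K / e < real (Suc m)" using M that by simp
        then show ?thesis using e by (simp add: field_simps)
      qed
      finally show ?thesis by (simp add: norm_minus_commute)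
    qed
    then show "\<exists>M. \<forall>m\<ge>M. \<forall>n>m. dist (B (of_real (real (Suc m)))) (B (of_real (real (Suc n)))) < e"
      by (auto simp: dist_norm)
  qed
  then obtain \<beta> where \<beta>: "(\<lambda>n. B (of_real (real (Suc n)))) \<longlonglongrightarrow> \<beta>"
    using Cauchy_convergent_iff convergent_def by blast
  have lim: "norm (B (of_real x) - \<beta>) \<le> K / x" if "x \<ge> 1" for x
  proof -
    have "(\<lambda>n. norm (B (of_real x) - B (of_real (real (Suc n))))) \<longlonglongrightarrow> norm (B (of_real x) - \<beta>)"
      by (intro tendsto_intros \<beta>)
    moreover have "\<forall>\<^sub>F n in sequentially. norm (B (of_real x) - B (of_real (real (Suc n)))) \<le> K / x"
      using eventually_ge_at_top[of "nat \<lceil>x\<rceil>"]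
    proof eventually_elim
      case (elim n)
      then have "x \<le> real (Suc n)" by linarith
      from diff'[OF that this] show ?case by (simp add: norm_minus_commute)
    qed
    ultimately show ?thesis by (intro tendsto_upperbound) auto
  qed
  have "c \<le> norm (B (of_real (real (Suc n))))" for n by (rule lo) simp
  then have "norm \<beta> \<ge> c"
    by (intro tendsto_lowerbound[OF tendsto_norm[OF \<beta>]] always_eventually allI) simp_all
  then have "\<beta> \<noteq> 0" using c by auto
  with K lim show ?thesis using that by blast
qed

section \<open>Propagation along circular arcs from the real axis\<close>

definition arc :: "real \<Rightarrow> real \<Rightarrow> complex" where "arc r t = of_real r * exp (\<i> * of_real t)"

lemma norm_arc: "r \<ge> 0 \<Longrightarrow> norm (arc r t) = r" unfolding arc_def by (simp add: norm_mult)

lemma Re_arc: "Re (arc r t) = r * cos t" and Im_arc: "Im (arc r t) = r * sin t"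
  unfolding arc_def by (simp_all add: Re_exp Im_exp)

lemma arc_deriv: "(arc r has_vector_derivative \<i> * arc r t) (at t)"
  unfolding arc_def[abs_def]
  by (rule has_vector_derivative_real_field) (auto intro!: derivative_eq_intros)

lemma arc_not_nonpos:
  assumes "r > 0" "0 \<le> t" "t \<le> pi / 2"
  shows "arc r t \<notin> \<real>\<^sub>\<le>\<^sub>0"
proof
  assume "arc r t \<in> \<real>\<^sub>\<le>\<^sub>0"
  then have "r * cos t \<le> 0" "r * sin t = 0"
    by (auto simp: complex_nonpos_Reals_iff Re_arc Im_arc)
  then have "cos t \<le> 0" "sin t = 0" using assms by (auto simp: mult_le_0_iff)
  moreover have "t = 0"
  proof (rule ccontr)
    assume "t \<noteq> 0" then have "sin t > 0" using assms by (intro sin_gt_zero) auto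
    with \<open>sin t = 0\<close> show False by simp
  qed
  ultimately show False by simp
qed

lemma arc_has_deriv:
  assumes "(f has_field_derivative D) (at (arc r t))"
  shows "((\<lambda>t. f (arc r t)) has_vector_derivative \<i> * arc r t * D) (at t)"
  using field_vector_diff_chain_at[OF arc_deriv assms] by (simp add: o_def)

text \<open>Propagating from the positive real axis along circular arcs, on which the imaginary
  part grows, keeps the recessive component under control.\<close>
lemma arc_asymptotics:
  obtains M where "0 < M"
    "\<And>r t. 1 \<le> r \<Longrightarrow> 0 \<le> t \<Longrightarrow> t \<le> pi / 2 \<Longrightarrow> norm (A (arc r t) + B (arc r t)) \<le> M"
    "\<And>r t. 1 \<le> r \<Longrightarrow> 0 \<le> t \<Longrightarrow> t \<le> pi / 2 \<Longrightarrow> norm (B (arc r t) - B (of_real r)) \<le> M / r"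
    "\<And>r t. 1 \<le> r \<Longrightarrow> 0 \<le> t \<Longrightarrow> t \<le> pi / 2 \<Longrightarrow> 
        norm (A (arc r t) - exp (2 * \<i> * (arc r t - of_real r)) * A (of_real r)) \<le> M / r"
proof -
  obtain C where hi: "\<And>x. x \<ge> 1 \<Longrightarrow> norm (B (of_real x)) \<le> C" using B_real_bounds by metis
  have C: "C \<ge> 0" using norm_ge_zero[of "B (of_real 1)"] hi[of 1] by linarith
  define A' where "A' = (\<lambda>w. 2 * \<i> * A w - \<i> * of_real \<kappa> / (2 * w\<^sup>2) * (A w + B w))"
  define B' where "B' = (\<lambda>w. \<i> * of_real \<kappa> / (2 * w\<^sup>2) * (A w + B w))"
  \<comment> \<open>The energy grows along an arc at rate 2 |\<kappa>| / r over an angle of at most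
    pi / 2, hence exp(pi |\<kappa>|); 2 C^2 bounds the energy at the real end, and the outer 2 comes
    from \<open>sum_norms_sq\<close>.\<close>
  define M1 where "M1 = sqrt (2 * (exp (pi * \<bar>\<kappa>\<bar>) * (2 * C\<^sup>2)))"
  define M where "M = M1 * (1 + pi * \<bar>\<kappa>\<bar>) + 1"
  have M1: "M1 \<ge> 0" unfolding M1_def by simp
  have M: "M > 0" "M1 \<le> M" proof -
    have "0 \<le> M1 * (pi * \<bar>\<kappa>\<bar>)" using M1 by simp
    then show "M > 0" "M1 \<le> M" unfolding M_def distrib_left using M1 by linarith+
  qed
  have dA: "((\<lambda>t. A (arc r t)) has_vector_derivative \<i> * arc r t * A' (arc r t)) (at t)"
    and dB: "((\<lambda>t. B (arc r t)) has_vector_derivative \<i> * arc r t * B' (arc r t)) (at t)"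
    if "1 \<le> r" "0 \<le> t" "t \<le> pi / 2" for r t
    using arc_has_deriv[OF A_deriv[OF arc_not_nonpos[of r t]]] arc_has_deriv[OF B_deriv[OF arc_not_nonpos[of r t]]] that
    unfolding A'_def B'_def by auto
  have arc0: "arc r 0 = of_real r" for r unfolding arc_def by simp
  have bd1: "norm (A (arc r t) + B (arc r t)) \<le> M1" if r: "1 \<le> r" and t: "0 \<le> t" "t \<le> pi / 2" for r t
  proof -
    have "(norm (A (arc r t)))\<^sup>2 + (norm (B (arc r t)))\<^sup>2 \<le> exp (2 * (\<bar>\<kappa>\<bar> / r) * t - 2 * (\<bar>\<kappa>\<bar> / r) * 0) *
       ((norm (A (arc r 0)))\<^sup>2 + (norm (B (arc r 0)))\<^sup>2)"
    proof (rule gronwall_pair[OF t(1), where A = "\<lambda>t. A (arc r t)" and B = "\<lambda>t. B (arc r t)"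
        and k = "\<lambda>t. \<bar>\<kappa>\<bar> / r" and m = "\<lambda>t. 2 * (\<bar>\<kappa>\<bar> / r) * t"])
      fix s assume s: "0 \<le> s" "s \<le> t"
      show "((\<lambda>t. A (arc r t)) has_vector_derivative \<i> * arc r s * A' (arc r s)) (at s)"
        "((\<lambda>t. B (arc r t)) has_vector_derivative \<i> * arc r s * B' (arc r s)) (at s)"
        using dA dB r s t by auto
      show "((\<lambda>t. 2 * (\<bar>\<kappa>\<bar> / r) * t) has_real_derivative 2 * (\<bar>\<kappa>\<bar> / r)) (at s)"
        by (rule derivative_eq_intros refl | simp)+
      define w where "w = arc r s"
      have w: "norm w = r" "Re w \<ge> 0" "w \<noteq> 0"
        unfolding w_def using r s t arc_not_nonpos[of r s] cos_ge_zero[of s] by (auto simp: norm_arc Re_arc)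
      define e where "e = \<i> * of_real \<kappa> / (2 * w\<^sup>2) * (A w + B w)"
      \<comment> \<open>Along the arc the oscillating term contributes - 2 Re w |A|^2, which has the
        good sign exactly because the arc stays in the right half plane.\<close>
      have z: "A w \<bullet> (\<i> * w * (2 * \<i> * A w)) \<le> 0"
      proof -
        have "A w \<bullet> (\<i> * w * (2 * \<i> * A w)) = - 2 * (Re w * (norm (A w))\<^sup>2)"
          unfolding cmod_power2 by (simp add: inner_complex_def algebra_simps power2_eq_square)
        then show ?thesis using w by simp
      qed
      have "A w \<bullet> (\<i> * w * A' w) + B w \<bullet> (\<i> * w * B' w) = 
        A w \<bullet> (\<i> * w * (2 * \<i> * A w)) + (A w \<bullet> (- (\<i> * w * e)) + B w \<bullet> (\<i> * w * e))"
        unfolding A'_def B'_def e_def[symmetric] by (simp add: inner_diff_right right_diff_distrib)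
      also have "\<dots> \<le> A w \<bullet> (- (\<i> * w * e)) + B w \<bullet> (\<i> * w * e)" using z by simp
      also have "\<dots> \<le> (r * norm e) * (norm (A w) + norm (B w))"
        by (rule inner_le_norms) (simp_all add: norm_mult w)
      also have "\<dots> = r * (norm e * (norm (A w) + norm (B w)))" by simp
      also have "\<dots> \<le> r * ((\<bar>\<kappa>\<bar> / r\<^sup>2) * ((norm (A w))\<^sup>2 + (norm (B w))\<^sup>2))"
        using deriv_term_bound[of w "A w" "B w"] r unfolding e_def w by (intro mult_left_mono) simp_all
      also have "\<dots> = (\<bar>\<kappa>\<bar> / r) * ((norm (A w))\<^sup>2 + (norm (B w))\<^sup>2)"
        using r by (simp add: power2_eq_square)
      finally show "A (arc r s) \<bullet> (\<i> * arc r s * A' (arc r s)) + B (arc r s) \<bullet> (\<i> * arc r s * B' (arc r s)) \<le>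
         \<bar>\<kappa>\<bar> / r * ((norm (A (arc r s)))\<^sup>2 + (norm (B (arc r s)))\<^sup>2)" unfolding w_def .
    qed
    also have "\<dots> \<le> exp (pi * \<bar>\<kappa>\<bar>) * (2 * C\<^sup>2)"
    proof (rule mult_mono)
      have "2 * (\<bar>\<kappa>\<bar> / r) * t \<le> 2 * (\<bar>\<kappa>\<bar> / 1) * (pi / 2)"
        using r t by (intro mult_mono divide_left_mono) auto
      then show "exp (2 * (\<bar>\<kappa>\<bar> / r) * t - 2 * (\<bar>\<kappa>\<bar> / r) * 0) \<le> exp (pi * \<bar>\<kappa>\<bar>)" by (simp add: mult.commute)
      have "(norm (B (of_real r)))\<^sup>2 \<le> C\<^sup>2" using hi[OF r] by (intro power_mono) auto
      then show "(norm (A (arc r 0)))\<^sup>2 + (norm (B (arc r 0)))\<^sup>2 \<le> 2 * C\<^sup>2"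
        using r norm_A_real[of r] by (simp add: arc0)
    qed auto
    finally have "2 * ((norm (A (arc r t)))\<^sup>2 + (norm (B (arc r t)))\<^sup>2) \<le> 2 * (exp (pi * \<bar>\<kappa>\<bar>) * (2 * C\<^sup>2))" by simp
    then have "(norm (A (arc r t)) + norm (B (arc r t)))\<^sup>2 \<le> 2 * (exp (pi * \<bar>\<kappa>\<bar>) * (2 * C\<^sup>2))"
      using sum_norms_sq[of "A (arc r t)" "B (arc r t)"] by linarith
    then have "norm (A (arc r t)) + norm (B (arc r t)) \<le> M1" unfolding M1_def by (rule real_le_rsqrt)
    then show ?thesis using norm_triangle_ineq[of "A (arc r t)" "B (arc r t)"] by linarith
  qed
  have B'bd: "norm (\<i> * arc r t * B' (arc r t)) \<le> M1 * \<bar>\<kappa>\<bar> / r" if r: "1 \<le> r" and t: "0 \<le> t" "t \<le> pi / 2" for r t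
  proof -
    have "norm (\<i> * arc r t * B' (arc r t)) = \<bar>\<kappa>\<bar> / (2 * r) * norm (A (arc r t) + B (arc r t))"
      unfolding B'_def using r norm_arc[of r t]
      by (cases "arc r t = 0") (simp_all add: norm_mult norm_divide norm_power power2_eq_square)
    also have "\<dots> \<le> \<bar>\<kappa>\<bar> / (2 * r) * M1" using bd1[OF that] r by (intro mult_left_mono) auto
    also have "\<dots> \<le> M1 * \<bar>\<kappa>\<bar> / r" using r M1 by (simp add: divide_simps mult_left_mono)
    finally show ?thesis .
  qed
  have Mb: "M1 * \<bar>\<kappa>\<bar> / r * t \<le> M / r" if r: "1 \<le> r" and t: "0 \<le> t" "t \<le> pi / 2" for r t
  proof -
    have "M1 * \<bar>\<kappa>\<bar> / r * t \<le> M1 * \<bar>\<kappa>\<bar> / r * pi" using that M1 pi_gt_zero by (intro mult_left_mono) auto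
    also have "\<dots> \<le> M / r" unfolding M_def using r M1 by (simp add: field_simps)
    finally show ?thesis .
  qed
  show ?thesis
  proof (rule that[OF M(1)])
    fix r t :: real assume r: "1 \<le> r" and t: "0 \<le> t" "t \<le> pi / 2"
    show "norm (A (arc r t) + B (arc r t)) \<le> M" using bd1[OF r t] M by linarith
    define w where "w = arc r t"
    show "norm (B (arc r t) - B (of_real r)) \<le> M / r"
    proof (cases "t = 0")
      case False
      then have "norm (B (arc r t) - B (arc r 0)) \<le> M1 * \<bar>\<kappa>\<bar> / r * t - M1 * \<bar>\<kappa>\<bar> / r * 0"
      proof (intro differentiable_bound_general[where f = "\<lambda>t. B (arc r t)" and \<phi> = "\<lambda>t. M1 * \<bar>\<kappa>\<bar> / r * t"])
        show "continuous_on {0..t} (\<lambda>t. B (arc r t))"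
          using r t by (intro continuous_at_imp_continuous_on ballI has_vector_derivative_continuous[OF dB]) auto
        fix s assume s: "0 < s" "s < t"
        show "((\<lambda>t. B (arc r t)) has_vector_derivative \<i> * arc r s * B' (arc r s)) (at s)"
          using dB r s t by auto
        show "((\<lambda>t. M1 * \<bar>\<kappa>\<bar> / r * t) has_vector_derivative M1 * \<bar>\<kappa>\<bar> / r) (at s)"
          unfolding has_real_derivative_iff_has_vector_derivative[symmetric]
          by (rule derivative_eq_intros refl | simp)+
        show "norm (\<i> * arc r s * B' (arc r s)) \<le> M1 * \<bar>\<kappa>\<bar> / r" using B'bd r s t by auto
      qed (use t r in \<open>auto intro!: continuous_intros\<close>)
      then show ?thesis using Mb[OF r t] by (simp add: arc0)
    qed (use M r in \<open>simp add: arc0\<close>)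
    show "norm (A (arc r t) - exp (2 * \<i> * (arc r t - of_real r)) * A (of_real r)) \<le> M / r"
    proof (cases "t = 0")
      case False
      \<comment> \<open>The integrating factor for \<open>A\<close>, normalised at the end point of
        the arc. Its modulus is at most 1, since the imaginary part increases along the arc.\<close>
      define D where "D = (\<lambda>s. exp (2 * \<i> * (w - arc r s)) * A (arc r s))"
      define D' where "D' = (\<lambda>s. exp (2 * \<i> * (w - arc r s)) * (- (\<i> * arc r s * B' (arc r s))))"
      have dD: "(D has_vector_derivative D' s) (at s)" if "0 \<le> s" "s \<le> t" for s
      proof -
        have "((\<lambda>z. exp (2 * \<i> * (w - z)) * A z) has_field_derivative 
          exp (2 * \<i> * (w - arc r s)) * (- (B' (arc r s)))) (at (arc r s))"
          using arc_not_nonpos[of r s] that r t unfolding B'_def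
          by (auto intro!: derivative_eq_intros A_deriv simp: algebra_simps)
        from arc_has_deriv[OF this] show ?thesis unfolding D_def D'_def by (simp add: mult_ac)
      qed
      have "norm (D t - D 0) \<le> M1 * \<bar>\<kappa>\<bar> / r * t - M1 * \<bar>\<kappa>\<bar> / r * 0"
      proof (intro differentiable_bound_general[where f = D and \<phi> = "\<lambda>t. M1 * \<bar>\<kappa>\<bar> / r * t"])
        show "continuous_on {0..t} D"
          using r t by (intro continuous_at_imp_continuous_on ballI has_vector_derivative_continuous[OF dD]) auto
        fix s assume s: "0 < s" "s < t"
        show "(D has_vector_derivative D' s) (at s)"
          using dD s by auto
        show "((\<lambda>t. M1 * \<bar>\<kappa>\<bar> / r * t) has_vector_derivative M1 * \<bar>\<kappa>\<bar> / r) (at s)"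
          unfolding has_real_derivative_iff_has_vector_derivative[symmetric]
          by (rule derivative_eq_intros refl | simp)+
        have "sin s \<le> sin t" using s t by (intro sin_monotone_2pi_le) auto
        then have "Im (w - arc r s) \<ge> 0" unfolding w_def using r by (simp add: Im_arc)
        then have "norm (exp (2 * \<i> * (w - arc r s))) \<le> 1" by (simp add: norm_exp_eq_Re)
        then have "norm (D' s) \<le> 1 * norm (\<i> * arc r s * B' (arc r s))"
          unfolding D'_def norm_mult norm_minus_cancel by (intro mult_right_mono) auto
        then show "norm (D' s) \<le> M1 * \<bar>\<kappa>\<bar> / r" using B'bd[of r s] r s t by auto
      qed (use t False r in \<open>auto intro!: continuous_intros\<close>)
      then show ?thesis using Mb[OF r t] unfolding D_def w_def by (simp add: arc0)
    qed (use M r in \<open>simp add: arc0\<close>)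
  qed
qed

lemma complex_eq_arc:
  assumes "Re w \<ge> 0" "Im w \<ge> 0"
  obtains t where "0 \<le> t" "t \<le> pi / 2" "w = arc (norm w) t"
proof (cases "w = 0")
  case True then show ?thesis using that[of 0] by (simp add: arc_def)
next
  case False
  have "0 \<le> Arg w" using assms Arg_less_0 by (meson not_less)
  moreover have "Arg w \<le> pi / 2" using assms Arg_Re_nonneg[of w] by simp
  ultimately show ?thesis using that[of "Arg w"] Arg_eq[OF False] by (simp add: arc_def)
qed

text \<open>\<beta> records amplitude and phase: on the positive axis \<open>u\<close> is twice the
  real part of cnj \<beta> * exp(\<i> x), up to O(1 / x). The factor exp(\<i> w) makes the statement
  uniform in the closed first quadrant, where \<open>u\<close> itself may grow
  exponentially.\<close>

lemma u_asymptotics: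
  obtains \<beta> K where "\<beta> \<noteq> 0" "0 < K"
    "\<And>w. 1 \<le> norm w \<Longrightarrow> 0 \<le> Re w \<Longrightarrow> 0 \<le> Im w \<Longrightarrow> 
       norm (u w * exp (\<i> * w) - (cnj \<beta> * exp (2 * \<i> * w) + \<beta>)) \<le> K / norm w"
    "\<And>w. 1 \<le> norm w \<Longrightarrow> 0 \<le> Re w \<Longrightarrow> 0 \<le> Im w \<Longrightarrow> norm (u w * exp (\<i> * w)) \<le> K"
proof -
  obtain \<beta> K where \<beta>: "\<beta> \<noteq> 0" and K: "0 < K" and lim: "\<And>x. x \<ge> 1 \<Longrightarrow> norm (B (of_real x) - \<beta>) \<le> K / x"
    using B_limit by blast
  obtain M where M: "0 < M"
    "\<And>r t. 1 \<le> r \<Longrightarrow> 0 \<le> t \<Longrightarrow> t \<le> pi / 2 \<Longrightarrow> norm (A (arc r t) + B (arc r t)) \<le> M"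
    "\<And>r t. 1 \<le> r \<Longrightarrow> 0 \<le> t \<Longrightarrow> t \<le> pi / 2 \<Longrightarrow> norm (B (arc r t) - B (of_real r)) \<le> M / r"
    "\<And>r t. 1 \<le> r \<Longrightarrow> 0 \<le> t \<Longrightarrow> t \<le> pi / 2 \<Longrightarrow> 
        norm (A (arc r t) - exp (2 * \<i> * (arc r t - of_real r)) * A (of_real r)) \<le> M / r"
    using arc_asymptotics by blast
  show ?thesis
  proof (rule that[OF \<beta>, of "2 * M + 2 * K"])
    fix w assume w: "1 \<le> norm w" "0 \<le> Re w" "0 \<le> Im w"
    then obtain t where t: "0 \<le> t" "t \<le> pi / 2" "w = arc (norm w) t" using complex_eq_arc by blast
    define r where "r = norm w"
    have r: "r \<ge> 1" "r > 0" and wr: "w = arc r t" using w t unfolding r_def by auto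
    have uw: "u w * exp (\<i> * w) = A w + B w" by (simp add: A_plus_B)
    show "norm (u w * exp (\<i> * w)) \<le> 2 * M + 2 * K" unfolding uw using M(2)[OF r(1) t(1,2)] K M(1) by (simp add: wr)
    have e2: "exp (2 * \<i> * (w - of_real r)) * exp (2 * \<i> * of_real r) = exp (2 * \<i> * w)"
      unfolding exp_add[symmetric] by (simp add: algebra_simps)
    have eA: "exp (2 * \<i> * (w - of_real r)) * A (of_real r) = cnj (B (of_real r)) * exp (2 * \<i> * w)"
      unfolding A_real[OF r(2)] e2[symmetric] by (simp only: mult_ac)
    have ne: "norm (exp (2 * \<i> * w)) \<le> 1" using w by (simp add: norm_exp_eq_Re)
    have "A w + B w - (cnj \<beta> * exp (2 * \<i> * w) + \<beta>) = 
       (A w - cnj (B (of_real r)) * exp (2 * \<i> * w)) + (B w - B (of_real r)) 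
       + (cnj (B (of_real r) - \<beta>) * exp (2 * \<i> * w) + (B (of_real r) - \<beta>))"
      by (simp add: algebra_simps)
    also have "norm \<dots> \<le> (M / r + M / r) + (K / r + K / r)"
    proof (intro norm_triangle_mono)
      show "norm (A w - cnj (B (of_real r)) * exp (2 * \<i> * w)) \<le> M / r"
        using M(4)[OF r(1) t(1,2)] unfolding wr[symmetric] eA .
      show "norm (B w - B (of_real r)) \<le> M / r" using M(3)[OF r(1) t(1,2)] unfolding wr[symmetric] .
      show "norm (B (of_real r) - \<beta>) \<le> K / r" using lim[OF r(1)] .
      have "norm (cnj (B (of_real r) - \<beta>) * exp (2 * \<i> * w)) \<le> norm (cnj (B (of_real r) - \<beta>)) * 1"
        unfolding norm_mult using ne by (intro mult_left_mono) auto
      then show "norm (cnj (B (of_real r) - \<beta>) * exp (2 * \<i> * w)) \<le> K / r"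
        using lim[OF r(1)] unfolding complex_mod_cnj by linarith
    qed
    finally show "norm (u w * exp (\<i> * w) - (cnj \<beta> * exp (2 * \<i> * w) + \<beta>)) \<le> (2 * M + 2 * K) / norm w"
      unfolding uw r_def[symmetric] by (simp add: add_divide_distrib)
  qed (use M K in auto)
qed

text \<open>The size of t powr \<sigma> * g t for real t away from the zeros: the power near 0, a
  constant beyond 1. Thus t powr (- \<sigma>) * \<Phi> t is the natural envelope of
  \<open>g\<close>.\<close>

definition \<Phi> :: "real \<Rightarrow> real" where "\<Phi> t = (min 1 t) powr \<sigma>"

lemma exp_i_norm: "norm (exp (\<i> * w)) = exp (- Im w)"
  by (simp add: norm_exp_eq_Re)

text \<open>Compactness handles the unit disc, \<open>u_asymptotics\<close> the rest of the first
  quadrant, and conjugation the fourth quadrant.\<close>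

lemma g_upper:
  obtains C where "0 < C" "\<And>w. 0 \<le> Re w \<Longrightarrow> w \<noteq> 0 \<Longrightarrow> norm (g w) \<le> C * (norm w powr (- \<sigma>) * \<Phi> (norm w)) * exp \<bar>Im w\<bar>"
proof -
  obtain K where K: "0 < K" "\<And>w. 1 \<le> norm w \<Longrightarrow> 0 \<le> Re w \<Longrightarrow> 0 \<le> Im w \<Longrightarrow> norm (u w * exp (\<i> * w)) \<le> K"
    using u_asymptotics by metis
  have "continuous_on (cball 0 1) g"
    using g_deriv by (intro continuous_at_imp_continuous_on ballI DERIV_isCont)
  then have "bounded (g ` cball 0 1)" by (intro compact_imp_bounded compact_continuous_image) auto
  then obtain C0 where C0': "\<forall>x\<in>g ` cball 0 1. norm x \<le> C0" unfolding bounded_iff by blast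
  have C0: "norm (g w) \<le> C0" if "norm w \<le> 1" for w using C0' that by simp
  have up: "norm (g w) \<le> K * norm w powr (- \<sigma>) * exp (Im w)" if "1 \<le> norm w" "0 \<le> Re w" "0 \<le> Im w" for w
  proof -
    have "norm (u w) * exp (- Im w) \<le> K" using K(2)[OF that] by (simp add: norm_mult norm_exp_eq_Re)
    then have "norm (u w) \<le> K * exp (Im w)" by (simp add: exp_minus field_simps)
    moreover have "norm (u w) = norm w powr \<sigma> * norm (g w)" using that by (intro norm_u) auto
    moreover have "norm w > 0" using that by linarith
    ultimately show ?thesis by (simp add: powr_minus field_simps)
  qed
  show ?thesis
  proof (rule that[of "max K C0"])
    show "0 < max K C0" using K by auto
    fix w assume w: "0 \<le> Re w" "w \<noteq> 0"
    have n0: "norm w > 0" using w by simp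
    show "norm (g w) \<le> max K C0 * (norm w powr (- \<sigma>) * \<Phi> (norm w)) * exp \<bar>Im w\<bar>"
    proof (cases "norm w \<ge> 1")
      case True
      have "norm (g w) \<le> K * norm w powr (- \<sigma>) * exp \<bar>Im w\<bar>"
      proof (cases "Im w \<ge> 0")
        case True
        then show ?thesis using up[of w] w \<open>1 \<le> norm w\<close> by simp
      next
        case False
        then show ?thesis using up[of "cnj w"] w \<open>1 \<le> norm w\<close> by (simp add: g_cnj)
      qed
      also have "\<dots> \<le> max K C0 * norm w powr (- \<sigma>) * exp \<bar>Im w\<bar>" by (intro mult_right_mono) auto
      finally show ?thesis using True by (simp add: \<Phi>_def)
    next
      case False
      have "norm w powr (- \<sigma>) * \<Phi> (norm w) = 1" using False n0 by (simp add: \<Phi>_def powr_minus)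
      moreover have "norm (g w) \<le> max K C0 * 1" using C0[of w] False by simp
      moreover have "max K C0 * 1 \<le> max K C0 * exp \<bar>Im w\<bar>" using K by (intro mult_left_mono) auto
      ultimately show ?thesis by (simp only: mult_1_right)
    qed
  qed
qed

text \<open>On the lines \<open>Re z = \<theta> + n * pi\<close> the two exponentials in the expansion of \<open>u\<close> add up in phase.\<close>
lemma g_lower:
  obtains c r0 \<theta> where "0 < c" "1 \<le> r0" "\<bar>\<theta>\<bar> \<le> pi"
    "\<And>z n. 0 \<le> Re z \<Longrightarrow> r0 \<le> norm z \<Longrightarrow> Re z = \<theta> + of_nat n * pi \<Longrightarrow> c * norm z powr (- \<sigma>) * exp \<bar>Im z\<bar> \<le> norm (g z)"
    "\<And>z. 0 \<le> Re z \<Longrightarrow> r0 \<le> \<bar>Im z\<bar> \<Longrightarrow> c * norm z powr (- \<sigma>) * exp \<bar>Im z\<bar> \<le> norm (g z)"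
    "\<And>n. r0 \<le> \<theta> + of_nat n * pi \<Longrightarrow> 0 < (-1) ^ n * Re (g (of_real (\<theta> + of_nat n * pi)))"
proof -
  obtain \<beta> K where \<beta>: "\<beta> \<noteq> 0" and K: "0 < K"
    and as: "\<And>w. 1 \<le> norm w \<Longrightarrow> 0 \<le> Re w \<Longrightarrow> 0 \<le> Im w \<Longrightarrow> 
       norm (u w * exp (\<i> * w) - (cnj \<beta> * exp (2 * \<i> * w) + \<beta>)) \<le> K / norm w"
    using u_asymptotics by metis
  define \<theta> where "\<theta> = Arg \<beta>"
  define b where "b = norm \<beta>"
  have b: "b > 0" unfolding b_def using \<beta> by simp
  have \<beta>e: "\<beta> = of_real b * exp (\<i> * of_real \<theta>)" unfolding b_def \<theta>_def using Arg_eq[OF \<beta>] .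
  \<comment> \<open>Beyond this radius the error K / |z| of the expansion is at most a quarter of
    |\<beta>|.\<close>
  define r0 where "r0 = max 1 (4 * K / b)"
  have Kb: "K / norm z \<le> b / 4" if "r0 \<le> norm z" for z :: complex
  proof -
    have "4 * K / b \<le> norm z" "norm z > 0" using that unfolding r0_def by (auto simp: max_def split: if_splits)
    then show ?thesis using b by (simp add: field_simps)
  qed
  \<comment> \<open>\<theta> is the argument of \<beta>, so cnj \<beta> * exp(2 \<i> \<theta>) =
    \<beta>; adding n * pi to \<theta> changes nothing, and the imaginary part only contributes a
    positive factor. The two terms therefore cannot cancel.\<close>
  have phase: "cnj \<beta> * exp (2 * \<i> * (of_real (\<theta> + of_nat n * pi) + \<i> * of_real t)) = \<beta> * of_real (exp (- 2 * t))" for n t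
  proof -
    have "exp (2 * \<i> * (of_real (\<theta> + of_nat n * pi) + \<i> * of_real t)) 
      = exp (2 * (\<i> * of_real \<theta>)) * exp (of_nat n * (2 * of_real pi * \<i>)) * exp (of_real (- 2 * t))"
      unfolding exp_add[symmetric] by (simp add: algebra_simps)
    also have "exp (of_nat n * (2 * complex_of_real pi * \<i>)) = 1"
      unfolding exp_of_nat_mult by simp
    finally have e: "exp (2 * \<i> * (of_real (\<theta> + of_nat n * pi) + \<i> * of_real t)) = exp (2 * (\<i> * of_real \<theta>)) * of_real (exp (- 2 * t))"
      by (simp only: exp_of_real mult_1_right)
    have "cnj \<beta> = of_real b * exp (- (\<i> * of_real \<theta>))" unfolding \<beta>e by (simp add: exp_cnj)
    moreover have "exp (- (\<i> * of_real \<theta>)) * exp (2 * (\<i> * of_real \<theta>)) = exp (\<i> * complex_of_real \<theta>)"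
      unfolding exp_add[symmetric] by simp
    ultimately have "cnj \<beta> * exp (2 * (\<i> * of_real \<theta>)) = of_real b * exp (\<i> * of_real \<theta>)"
      by (metis mult.assoc)
    then have "cnj \<beta> * exp (2 * (\<i> * of_real \<theta>)) = \<beta>" using \<beta>e by simp
    then show ?thesis unfolding e by (simp only: mult.assoc[symmetric])
  qed
  have low1: "b / 4 * exp (Im z) \<le> norm (u z)"
    if z: "0 \<le> Re z" "0 \<le> Im z" "r0 \<le> norm z" and bb: "b / 2 \<le> norm (cnj \<beta> * exp (2 * \<i> * z) + \<beta>)" for z
  proof -
    have "1 \<le> norm z" using z unfolding r0_def by simp
    from as[OF this z(1,2)] have "norm (cnj \<beta> * exp (2 * \<i> * z) + \<beta>) - norm (u z * exp (\<i> * z)) \<le> K / norm z"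
      using norm_triangle_ineq2[of "cnj \<beta> * exp (2 * \<i> * z) + \<beta>" "u z * exp (\<i> * z)"]
      by (subst (asm) norm_minus_commute) linarith
    then have "b / 4 \<le> norm (u z) * exp (- Im z)" using Kb[OF z(3)] bb unfolding norm_mult exp_i_norm by linarith
    then show ?thesis by (simp add: exp_minus field_simps)
  qed
  have conv: "b / 4 * norm z powr (- \<sigma>) * exp (Im z) \<le> norm (g z)" if "b / 4 * exp (Im z) \<le> norm (u z)" "z \<noteq> 0" for z
    using that norm_u[of z] by (simp add: powr_minus field_simps)
  have pos1: "r0 \<ge> 1" unfolding r0_def by simp
  have line: "b / 4 * norm z powr (- \<sigma>) * exp (Im z) \<le> norm (g z)"
    if z: "0 \<le> Re z" "0 \<le> Im z" "r0 \<le> norm z" "Re z = \<theta> + of_nat n * pi" for z n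
  proof (intro conv low1 z)
    have "z = of_real (\<theta> + of_nat n * pi) + \<i> * of_real (Im z)" using z(4) by (simp add: complex_eq_iff)
    then have "cnj \<beta> * exp (2 * \<i> * z) + \<beta> = \<beta> * of_real (exp (- 2 * Im z) + 1)"
      using phase[of n "Im z"] by (simp add: algebra_simps)
    then have "norm (cnj \<beta> * exp (2 * \<i> * z) + \<beta>) = b * \<bar>exp (- 2 * Im z) + 1\<bar>"
      unfolding b_def by (simp only: norm_mult norm_of_real)
    also have "\<dots> \<ge> b * (1 / 2)" using b exp_gt_zero[of "- 2 * Im z"] by (intro mult_left_mono) linarith+
    finally show "b / 2 \<le> norm (cnj \<beta> * exp (2 * \<i> * z) + \<beta>)" by simp
  qed (use z pos1 in auto)
  \<comment> \<open>Far from the real axis no phase is required: one of the two exponentials is at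
    most half the other.\<close>
  have high: "b / 4 * norm z powr (- \<sigma>) * exp (Im z) \<le> norm (g z)"
    if z: "0 \<le> Re z" "r0 \<le> Im z" for z
  proof (intro conv low1 z)
    show "r0 \<le> norm z" using z abs_Im_le_cmod[of z] by linarith
    have "exp (2 * Im z) \<ge> 2" using exp_ge_add_one_self[of "2 * Im z"] z pos1 by linarith
    then have "exp (- (2 * Im z)) \<le> 1 / 2" by (simp add: exp_minus field_simps)
    then have "norm (cnj \<beta> * exp (2 * \<i> * z)) \<le> b * (1 / 2)"
      unfolding norm_mult b_def by (intro mult_mono) (auto simp: norm_exp_eq_Re)
    then show "b / 2 \<le> norm (cnj \<beta> * exp (2 * \<i> * z) + \<beta>)"
      using norm_diff_ineq[of \<beta> "cnj \<beta> * exp (2 * \<i> * z)"] unfolding b_def by (simp add: add.commute)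
  qed (use z pos1 in auto)
  show ?thesis
  proof (rule that[of "b / 4" r0 \<theta>])
    show "\<bar>\<theta>\<bar> \<le> pi" unfolding \<theta>_def using Arg_bounded[of \<beta>] by (auto simp: abs_if)
    show "b / 4 * norm z powr (- \<sigma>) * exp \<bar>Im z\<bar> \<le> norm (g z)"
      if "0 \<le> Re z" "r0 \<le> norm z" "Re z = \<theta> + of_nat n * pi" for z n
      using line[of z n] line[of "cnj z" n] that by (cases "Im z \<ge> 0") (auto simp: g_cnj)
    show "b / 4 * norm z powr (- \<sigma>) * exp \<bar>Im z\<bar> \<le> norm (g z)" if "0 \<le> Re z" "r0 \<le> \<bar>Im z\<bar>" for z
      using high[of z] high[of "cnj z"] that by (cases "Im z \<ge> 0") (auto simp: g_cnj)
    fix n assume n: "r0 \<le> \<theta> + of_nat n * pi"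
    define t where "t = \<theta> + of_nat n * pi"
    have t: "t \<ge> r0" "t \<ge> 1" "t > 0" using n pos1 unfolding t_def by auto
    define U where "U = t powr \<sigma> * Re (g (of_real t))"
    have uU: "u (of_real t) = of_real U" unfolding U_def using u_of_real[OF t(3)] by simp
    have ei: "exp (\<i> * of_real t) = (-1) ^ n * exp (\<i> * complex_of_real \<theta>)"
    proof -
      have "exp (\<i> * of_real t) = exp (of_nat n * (\<i> * of_real pi)) * exp (\<i> * complex_of_real \<theta>)"
        unfolding t_def exp_add[symmetric] by (simp add: algebra_simps)
      then show ?thesis unfolding exp_of_nat_mult by simp
    qed
    have "norm (u (of_real t) * exp (\<i> * of_real t) - (cnj \<beta> * exp (2 * \<i> * of_real t) + \<beta>)) \<le> K / norm (complex_of_real t)"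
      by (rule as) (use t in auto)
    also have "\<dots> \<le> b / 4" using t by (intro Kb) auto
    also have "cnj \<beta> * exp (2 * \<i> * of_real t) + \<beta> = of_real (2 * b) * exp (\<i> * of_real \<theta>)"
      using phase[of n 0] unfolding t_def[symmetric] by (simp add: \<beta>e[symmetric])
    also have "u (of_real t) * exp (\<i> * of_real t) - of_real (2 * b) * exp (\<i> * of_real \<theta>)
       = of_real ((-1) ^ n * U - 2 * b) * exp (\<i> * of_real \<theta>)" unfolding uU ei by (simp add: algebra_simps)
    finally have "\<bar>(-1) ^ n * U - 2 * b\<bar> \<le> b / 4" unfolding norm_mult norm_of_real by (simp add: norm_exp_eq_Re)
    then have "(-1) ^ n * U > 0" using b by linarith
    then have "t powr \<sigma> * ((-1) ^ n * Re (g (of_real t))) > 0" unfolding U_def by (simp add: mult_ac)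
    then show "0 < (-1) ^ n * Re (g (of_real (\<theta> + of_nat n * pi)))"
      unfolding t_def[symmetric] using t by (simp add: zero_less_mult_iff)
  qed (use b pos1 in auto)
qed

lemma g_real_deriv: "((\<lambda>x. Re (g (of_real x))) has_real_derivative Re (g' (of_real x))) (at x)"
  using has_vector_derivative_real_field[OF g_deriv]
  unfolding has_real_derivative_iff_has_vector_derivative
  by (rule bounded_linear.has_vector_derivative[OF bounded_linear_Re])

lemma g_real_cont: "continuous_on S (\<lambda>x. Re (g (of_real x)))"
  by (intro continuous_at_imp_continuous_on ballI DERIV_isCont[OF g_real_deriv])

section \<open>Zeros\<close>

definition Z :: "real set" where "Z = {x. 0 < x \<and> Re (g (of_real x)) = 0}"

lemma Z_eq: "Z = {x. 0 < x \<and> besselJ \<nu> x = 0}"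
  unfolding Z_def by (auto simp: besselJ_eq)

lemma Z_g: "s \<in> Z \<longleftrightarrow> 0 < s \<and> g (of_real s) = 0"
proof -
  have "g (of_real s) = 0 \<longleftrightarrow> Re (g (of_real s)) = 0" by (subst g_real) (simp only: of_real_eq_0_iff)
  then show ?thesis unfolding Z_def by simp
qed

text \<open>\<open>g\<close> has sign (-1)^n at \<theta> + n * pi, so every two consecutive such
  points enclose a zero.\<close>

lemma Z_unbounded: "\<exists>s\<in>Z. r < s"
proof -
  obtain r0 \<theta> where r0: "1 \<le> r0"
    and sgn: "\<And>n. r0 \<le> \<theta> + of_nat n * pi \<Longrightarrow> 0 < (-1) ^ n * Re (g (of_real (\<theta> + of_nat n * pi)))"
    by (rule g_lower) blast
  obtain n :: nat where n: "max r0 r - \<theta> < n" using reals_Archimedean2 by blast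
  have "real n * 1 \<le> real n * pi" using pi_gt3 by (intro mult_left_mono) auto
  then have n': "r0 \<le> \<theta> + of_nat n * pi" "r < \<theta> + of_nat n * pi" using n by auto
  define a where "a = \<theta> + of_nat n * pi"
  have a: "r0 \<le> a" "r < a" using n' unfolding a_def by auto
  define f where "f = (\<lambda>x. (-1) ^ n * Re (g (of_real x)))"
  have "0 < f a" using sgn[of n] n' unfolding f_def a_def by simp
  moreover have "f (a + pi) < 0"
  proof -
    have "a + pi = \<theta> + of_nat (Suc n) * pi" unfolding a_def by (simp add: algebra_simps)
    then have "0 < (-1) ^ Suc n * Re (g (of_real (a + pi)))" using sgn[of "Suc n"] a pi_gt_zero by simp
    then show ?thesis unfolding f_def by simp
  qed
  moreover have "continuous_on {a..a + pi} f" unfolding f_def by (intro continuous_intros g_real_cont)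
  ultimately obtain x where "a \<le> x" "f x = 0" using IVT2'[of f "a + pi" 0 a] pi_gt_zero by auto
  then have "x \<in> Z" "r < x" using a r0 unfolding f_def Z_def by auto
  then show ?thesis by blast
qed

lemma g_pos_near_0:
  obtains a where "0 < a" "a < 1" "\<And>x. \<bar>x\<bar> \<le> a \<Longrightarrow> Re (g (of_real x)) > 0"
proof -
  have "isCont (\<lambda>x. Re (g (of_real x))) 0" using g_real_deriv by (rule DERIV_isCont)
  moreover have "0 < Re (g (of_real 0))" using g_0_pos coef_0_pos by simp
  ultimately have "\<forall>\<^sub>F x in at 0. 0 < Re (g (of_real x))"
    unfolding isCont_def by (intro order_tendstoD(1)) 
  then obtain d where d: "d > 0" "\<And>x. x \<noteq> 0 \<Longrightarrow> dist x 0 < d \<Longrightarrow> Re (g (of_real x)) > 0"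
    unfolding eventually_at by auto
  have "Re (g (of_real x)) > 0" if "dist x 0 < d" for x
    using d(2)[of x] that g_0_pos coef_0_pos by (cases "x = 0") auto
  with d(1) show ?thesis by (intro that[of "min (d/2) (1/2)"]) auto
qed

text \<open>Moves the starting point of the energy bounds from 1 to any a > 0. In
  \<open>Z_spacing\<close> a lies below every zero, so that the bounds hold at all of them.\<close>

lemma B_real_bounds':
  assumes "a > 0"
  obtains c C where "0 < c" "\<And>x. x \<ge> a \<Longrightarrow> c \<le> norm (B (of_real x))"
     "\<And>x. x \<ge> a \<Longrightarrow> norm (B (of_real x)) \<le> C"
proof -
  obtain c C where c: "0 < c" and lo: "\<And>x. x \<ge> 1 \<Longrightarrow> c \<le> norm (B (of_real x))"
    and hi: "\<And>x. x \<ge> 1 \<Longrightarrow> norm (B (of_real x)) \<le> C" using B_real_bounds by metis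
  define E where "E = exp (\<bar>\<kappa>\<bar> / a)"
  have E: "E \<ge> 1" unfolding E_def using assms by simp
  have C: "C > 0" using c lo[of 1] hi[of 1] by simp
  have ex: "exp (2 * \<bar>\<kappa>\<bar> * (1 / x - 1 / 1)) \<le> E\<^sup>2" if "x \<ge> a" for x
  proof -
    have "1 / x \<le> 1 / a" using that assms by (simp add: frac_le)
    then have "2 * \<bar>\<kappa>\<bar> * (1 / x - 1 / 1) \<le> 2 * \<bar>\<kappa>\<bar> * (1 / a)" by (intro mult_left_mono) auto
    then show ?thesis unfolding E_def exp_double[symmetric] by simp
  qed
  show ?thesis
  proof (rule that[of "c / E" "E * C"])
    show "0 < c / E" using c E by simp
    fix x assume x: "a \<le> x"
    have "c / E \<le> norm (B (of_real x)) \<and> norm (B (of_real x)) \<le> E * C"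
    proof (cases "x \<ge> 1")
      case True
      have "c / E \<le> c" using c E by (simp add: field_simps)
      moreover have "1 * C \<le> E * C" using C E by (intro mult_right_mono) auto
      ultimately show ?thesis using lo[OF True] hi[OF True] by auto
    next
      case False
      have x0: "0 < x" "x \<le> 1" using x assms False by auto
      have "(norm (B (of_real 1)))\<^sup>2 \<le> E\<^sup>2 * (norm (B (of_real x)))\<^sup>2"
        by (rule order_trans[OF B_real_growth(1)[OF x0]]) (intro mult_right_mono ex x, simp)
      then have 1: "norm (B (of_real 1)) \<le> E * norm (B (of_real x))"
        unfolding power_mult_distrib[symmetric] by (rule power2_le_imp_le) (use E in auto)
      have "(norm (B (of_real x)))\<^sup>2 \<le> E\<^sup>2 * (norm (B (of_real 1)))\<^sup>2"
        by (rule order_trans[OF B_real_growth(2)[OF x0]]) (intro mult_right_mono ex x, simp)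
      then have 2: "norm (B (of_real x)) \<le> E * norm (B (of_real 1))"
        unfolding power_mult_distrib[symmetric] by (rule power2_le_imp_le) (use E in auto)
      have "E * norm (B (of_real 1)) \<le> E * C" using hi[of 1] E by (intro mult_left_mono) auto
      then have "norm (B (of_real x)) \<le> E * C" "c \<le> E * norm (B (of_real x))" using 1 2 lo[of 1] by linarith+
      then show ?thesis using E by (simp add: divide_le_eq mult.commute)
    qed
    then show "c / E \<le> norm (B (of_real x))" "norm (B (of_real x)) \<le> E * C" by auto
  qed
qed

text \<open>At a zero \<open>s\<close> of \<open>u\<close> the conserved quantity forces \<open>\<bar>u' s\<bar>\<close> to be bounded below,
  whereas \<open>u''\<close> is bounded; so the next zero cannot be close.\<close>
lemma Z_spacing:
  obtains \<eta> c where "0 < \<eta>" "0 < c" "\<And>x. x \<in> Z \<Longrightarrow> \<eta> \<le> x" "\<And>x y. x \<in> Z \<Longrightarrow> y \<in> Z \<Longrightarrow> x < y \<Longrightarrow> x + \<eta> \<le> y"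
    "\<And>x. x \<in> Z \<Longrightarrow> c * x powr (- \<sigma>) \<le> \<bar>Re (g' (of_real x))\<bar>"
proof -
  obtain a where a: "0 < a" "\<And>x. \<bar>x\<bar> \<le> a \<Longrightarrow> Re (g (of_real x)) > 0" using g_pos_near_0 by metis
  obtain c C where c: "0 < c" and lo: "\<And>x. x \<ge> a \<Longrightarrow> c \<le> norm (B (of_real x))"
    and hi: "\<And>x. x \<ge> a \<Longrightarrow> norm (B (of_real x)) \<le> C" using B_real_bounds'[OF a(1)] by metis
  have C: "C > 0" using c lo[of a] hi[of a] by simp
  have Za: "a \<le> x" if "x \<in> Z" for x
  proof (rule ccontr)
    assume "\<not> a \<le> x"
    then have "\<bar>x\<bar> \<le> a" using that unfolding Z_def by auto
    then show False using a(2)[of x] that unfolding Z_def by auto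
  qed
  define U where "U = (\<lambda>x::real. Re (u (of_real x)))"
  define U' where "U' = (\<lambda>x::real. Re (u' (of_real x)))"
  have sq: "(U x)\<^sup>2 + (U' x)\<^sup>2 = 4 * (norm (B (of_real x)))\<^sup>2" if "x > 0" for x
    unfolding U_def U'_def using norm_B_real[OF that] by simp
  have dU: "(U has_real_derivative U' x) (at x)" if "x > 0" for x
    unfolding U_def U'_def has_real_derivative_iff_has_vector_derivative
    by (rule bounded_linear.has_vector_derivative[OF bounded_linear_Re has_vector_derivative_real_field[OF u_deriv[OF not_nonpos_real[OF that]]]])
  have dU': "(U' has_real_derivative - (1 - \<kappa> / x\<^sup>2) * U x) (at x)" if "x > 0" for x
  proof -
    have "(U' has_real_derivative Re (- (1 - of_real \<kappa> / (of_real x)\<^sup>2) * u (of_real x))) (at x)"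
      unfolding U'_def has_real_derivative_iff_has_vector_derivative
      by (rule bounded_linear.has_vector_derivative[OF bounded_linear_Re has_vector_derivative_real_field[OF u'_deriv[OF not_nonpos_real[OF that]]]])
    moreover have "- (1 - complex_of_real \<kappa> / (of_real x)\<^sup>2) * u (of_real x) = of_real (- (1 - \<kappa> / x\<^sup>2) * U x)"
      unfolding U_def u_of_real(1)[OF that] by simp
    ultimately show ?thesis by (simp only: Re_complex_of_real)
  qed
  define L where "L = (1 + \<bar>\<kappa>\<bar> / a\<^sup>2) * (2 * C)"
  have L: "L > 0" unfolding L_def using C by (intro mult_pos_pos add_pos_nonneg) auto
  have UZ: "U x = 0" "2 * c \<le> \<bar>U' x\<bar>" if "x \<in> Z" for x
  proof -
    have x: "x > 0" "x \<ge> a" using that Za unfolding Z_def by auto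
    show U0: "U x = 0" using that u_of_real(1)[OF x(1)] unfolding U_def Z_def by simp
    have "(2 * c)\<^sup>2 \<le> \<bar>U' x\<bar>\<^sup>2"
      using sq[OF x(1)] power_mono[OF lo[OF x(2)], of 2] c unfolding U0 by (simp add: power_mult_distrib)
    then show "2 * c \<le> \<bar>U' x\<bar>" by (rule power2_le_imp_le) simp
  qed
  have U''bd: "\<bar>- (1 - \<kappa> / x\<^sup>2) * U x\<bar> \<le> L" if "x \<ge> a" for x
  proof -
    have x: "x > 0" using that a by simp
    have "(U x)\<^sup>2 \<le> (2 * C)\<^sup>2"
      proof -
      have "4 * (norm (B (of_real x)))\<^sup>2 \<le> 4 * C\<^sup>2" using power_mono[OF hi[OF that], of 2] by simp
      moreover have "(2 * C)\<^sup>2 = 4 * C\<^sup>2" by (simp add: power_mult_distrib)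
      ultimately show ?thesis using sq[OF x] zero_le_power2[of "U' x"] by linarith
    qed
    then have "\<bar>U x\<bar>\<^sup>2 \<le> (2 * C)\<^sup>2" by (simp only: power2_abs)
    then have 1: "\<bar>U x\<bar> \<le> 2 * C" by (rule power2_le_imp_le) (use C in simp)
    have "a\<^sup>2 \<le> x\<^sup>2" using that a by (intro power_mono) auto
    then have "\<bar>\<kappa>\<bar> / x\<^sup>2 \<le> \<bar>\<kappa>\<bar> / a\<^sup>2" using a x by (intro divide_left_mono mult_pos_pos) auto
    moreover have "\<bar>1 - \<kappa> / x\<^sup>2\<bar> \<le> 1 + \<bar>\<kappa>\<bar> / x\<^sup>2" using abs_triangle_ineq4[of 1 "\<kappa> / x\<^sup>2"] by simp
    ultimately have "\<bar>1 - \<kappa> / x\<^sup>2\<bar> \<le> 1 + \<bar>\<kappa>\<bar> / a\<^sup>2" by linarith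
    then show ?thesis unfolding L_def abs_mult abs_minus_cancel using 1 by (intro mult_mono) auto
  qed
  have gap: "x + 2 * c / L \<le> y" if "x \<in> Z" "y \<in> Z" "x < y" for x y
  proof -
    have x: "x > 0" "x \<ge> a" using that Za unfolding Z_def by auto
    \<comment> \<open>Rolle: between two zeros \<open>U'\<close> vanishes. It has to drop there from
      modulus 2 c to 0 at rate at most L, which takes length 2 c / L.\<close>
    have "\<exists>m. x < m \<and> m < y \<and> U' m = 0"
    proof -
      have "\<exists>m>x. m < y \<and> U y - U x = (y - x) * U' m"
        by (rule MVT2[OF that(3)]) (use dU x in auto)
      then show ?thesis using UZ that by auto
    qed
    then obtain m where m: "x < m" "m < y" "U' m = 0" by blast
    obtain \<xi> where \<xi>: "x < \<xi>" "\<xi> < m" "U' m - U' x = (m - x) * (- (1 - \<kappa> / \<xi>\<^sup>2) * U \<xi>)"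
      using MVT2[OF m(1), of U' "\<lambda>x. - (1 - \<kappa> / x\<^sup>2) * U x"] dU' x by auto
    have "2 * c \<le> \<bar>U' m - U' x\<bar>" using UZ(2)[OF that(1)] m by simp
    also have "\<dots> \<le> (m - x) * L" unfolding \<xi>(3) abs_mult[of "m - x"] using U''bd[of \<xi>] \<xi> x m by (intro mult_mono) auto
    finally have "2 * c / L \<le> m - x" using L by (simp add: field_simps)
    then show ?thesis using m by linarith
  qed
  show ?thesis
  proof (rule that[of "min a (2 * c / L)" "2 * c"])
    show "0 < min a (2 * c / L)" "0 < 2 * c" using a c L by auto
    show "min a (2 * c / L) \<le> x" if "x \<in> Z" for x using Za[OF that] by simp
    show "x + min a (2 * c / L) \<le> y" if "x \<in> Z" "y \<in> Z" "x < y" for x y using gap[OF that] by simp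
    fix x assume xZ: "x \<in> Z"
    have x: "x > 0" using xZ unfolding Z_def by auto
    have "U' x = x powr \<sigma> * Re (g' (of_real x))" unfolding U'_def u_of_real(2)[OF x] using xZ unfolding Z_def by simp
    then have "2 * c \<le> x powr \<sigma> * \<bar>Re (g' (of_real x))\<bar>" using UZ(2)[OF xZ] by (simp add: abs_mult)
    then show "2 * c * x powr (- \<sigma>) \<le> \<bar>Re (g' (of_real x))\<bar>" using x by (simp add: powr_minus field_simps)
  qed
qed

text \<open>Self-adjointness of the Sturm-Liouville problem on (0, 1), for h x = g (z x). The
  Wronskian of h and its conjugate, with weight x powr (2 \<sigma>), has derivative - Im (z^2) x
  powr (2 \<sigma>) |h|^2, of constant sign unless z is real or imaginary, and vanishes at both
  ends. So h would be 0, against g 0 > 0.\<close>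

lemma g_zeros_real:
  assumes z: "g z = 0" and Re: "Re z \<ge> 0"
  shows "of_real (Re z) = z \<and> Re z \<in> Z"
proof -
  have Rez: "Re z \<noteq> 0"
  proof
    assume "Re z = 0"
    then have "z = \<i> * of_real (Im z)" by (simp add: complex_eq_iff)
    then show False using g_imag_axis[of "Im z"] z by simp
  qed
  have "Im z = 0"
  proof (rule ccontr)
    assume Im: "Im z \<noteq> 0"
    define q where "q = Im (z\<^sup>2)"
    have q: "q \<noteq> 0" unfolding q_def using Im Rez by (simp add: Im_power2)
    define h where "h = (\<lambda>x::real. g (z * of_real x))"
    define h1 where "h1 = (\<lambda>x::real. z * g' (z * of_real x))"
    define W where "W = (\<lambda>x::real. x powr (2 * \<sigma>) * Im (cnj (h x) * h1 x))"
    have dz: "((\<lambda>x. z * of_real x) has_vector_derivative z) (at x)" for x :: real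
      by (auto intro!: derivative_eq_intros)
    have dh: "(h has_vector_derivative h1 x) (at x)" for x
      unfolding h_def h1_def using field_vector_diff_chain_at[OF dz g_deriv] by (simp add: o_def)
    have dh1: "(h1 has_vector_derivative z * (z * g'' (z * of_real x))) (at x)" for x
      unfolding h1_def using has_vector_derivative_mult_right[OF field_vector_diff_chain_at[OF dz g'_deriv]] by (simp add: o_def)
    have ode: "of_real x * (z * (z * g'' (z * of_real x))) = - 2 * of_real \<sigma> * h1 x - of_real x * (z\<^sup>2 * h x)" for x
    proof -
      have "z * (z * of_real x * g'' (z * of_real x) + 2 * of_real \<sigma> * g' (z * of_real x) + z * of_real x * g (z * of_real x)) = 0"
        using g_ode[of "z * of_real x"] by simp
      moreover have "of_real x * (z * (z * g'' (z * of_real x))) - (- 2 * of_real \<sigma> * h1 x - of_real x * (z\<^sup>2 * h x)) = 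
        z * (z * of_real x * g'' (z * of_real x) + 2 * of_real \<sigma> * g' (z * of_real x) + z * of_real x * g (z * of_real x))"
        unfolding h1_def h_def by (simp add: algebra_simps power2_eq_square)
      ultimately have "of_real x * (z * (z * g'' (z * of_real x))) - (- 2 * of_real \<sigma> * h1 x - of_real x * (z\<^sup>2 * h x)) = 0"
        by (simp only:)
      then show ?thesis by (simp only: right_minus_eq)
    qed
    have dW: "(W has_real_derivative - q * (x powr (2 * \<sigma>) * (norm (h x))\<^sup>2)) (at x)" if x: "x > 0" for x
    proof -
      define h2 where "h2 = z * (z * g'' (z * of_real x))"
      have "((\<lambda>x. cnj (h x) * h1 x) has_vector_derivative cnj (h x) * h2 + cnj (h1 x) * h1 x) (at x)"
        unfolding h2_def
        by (rule has_vector_derivative_mult[OF bounded_linear.has_vector_derivative[OF bounded_linear_cnj dh] dh1])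
      from bounded_linear.has_vector_derivative[OF bounded_linear_Im this]
      have "((\<lambda>x. Im (cnj (h x) * h1 x)) has_real_derivative Im (cnj (h x) * h2 + cnj (h1 x) * h1 x)) (at x)"
        unfolding has_real_derivative_iff_has_vector_derivative .
      then have "(W has_real_derivative 2 * \<sigma> * x powr (2 * \<sigma> - 1) * Im (cnj (h x) * h1 x) + x powr (2 * \<sigma>) * Im (cnj (h x) * h2 + cnj (h1 x) * h1 x)) (at x)"
        unfolding W_def
        by (rule DERIV_cong[OF DERIV_mult[OF has_real_derivative_powr[OF x, of "2 * \<sigma>"]]]) simp
      moreover have "2 * \<sigma> * x powr (2 * \<sigma> - 1) * Im (cnj (h x) * h1 x) + x powr (2 * \<sigma>) * Im (cnj (h x) * h2 + cnj (h1 x) * h1 x)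
         = - q * (x powr (2 * \<sigma>) * (norm (h x))\<^sup>2)"
      proof -
        have "x * Im (cnj (h x) * h2) = Im (cnj (h x) * (of_real x * h2))" by (simp add: algebra_simps)
        also have "\<dots> = - 2 * \<sigma> * Im (cnj (h x) * h1 x) - x * (q * (norm (h x))\<^sup>2)"
          unfolding ode[of x, folded h2_def] q_def cmod_power2
          by (simp add: algebra_simps power2_eq_square)
        finally have e: "x * Im (cnj (h x) * h2) = - 2 * \<sigma> * Im (cnj (h x) * h1 x) - x * (q * (norm (h x))\<^sup>2)" .
        have i0: "Im (cnj (h1 x) * h1 x) = 0" by (simp add: algebra_simps)
        have pw: "x powr (2 * \<sigma>) = x * x powr (2 * \<sigma> - 1)" using x by (simp add: powr_diff)
        have "2 * \<sigma> * x powr (2 * \<sigma> - 1) * Im (cnj (h x) * h1 x) + x powr (2 * \<sigma>) * (Im (cnj (h x) * h2) + 0)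
          = x powr (2 * \<sigma> - 1) * (2 * \<sigma> * Im (cnj (h x) * h1 x) + x * Im (cnj (h x) * h2))"
          unfolding pw by (simp add: algebra_simps)
        also have "\<dots> = - q * (x powr (2 * \<sigma>) * (norm (h x))\<^sup>2)" unfolding e pw by (simp add: algebra_simps)
        finally show ?thesis using i0 by simp
      qed
      ultimately show ?thesis by simp
    qed
    have W1: "W 1 = 0" unfolding W_def h_def using z by simp
    \<comment> \<open>The boundary term at 0 is O(x powr (2 \<sigma> + 1)), since \<open>g'\<close>
      contributes one more factor x; the exponent is positive precisely because \<nu> > -1.\<close>
    have W0: "(W \<longlongrightarrow> 0) (at_right 0)"
    proof -
      have Weq: "x powr (2 * \<sigma> + 1) * Im (cnj (h x) * (2 * z\<^sup>2 * P1 ((z * of_real x)\<^sup>2))) = W x" if "x > 0" for x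
        unfolding W_def h1_def g'_def using that by (simp add: powr_add power2_eq_square algebra_simps)
      have "((\<lambda>x. x powr (2 * \<sigma> + 1) * Im (cnj (h x) * (2 * z\<^sup>2 * P1 ((z * of_real x)\<^sup>2)))) \<longlongrightarrow>
          0 powr (2 * \<sigma> + 1) * Im (cnj (h 0) * (2 * z\<^sup>2 * P1 ((z * of_real 0)\<^sup>2)))) (at_right 0)"
      proof (intro tendsto_mult tendsto_Im tendsto_cnj tendsto_const)
        show "((\<lambda>x. x powr (2 * \<sigma> + 1)) \<longlongrightarrow> 0 powr (2 * \<sigma> + 1)) (at_right 0)"
        proof -
          have "((\<lambda>x. x powr (2 * \<sigma> + 1)) \<longlongrightarrow> 0 powr (2 * \<sigma> + 1)) (at_right (0::real))"
            by (rule tendsto_powr2) (use nu in \<open>auto simp: \<sigma>_def eventually_at_filter intro!: tendsto_intros\<close>)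
          then show ?thesis .
        qed
        show "(h \<longlongrightarrow> h 0) (at_right 0)"
          using has_vector_derivative_continuous[OF dh[of 0]] unfolding continuous_at
          by (rule tendsto_mono[rotated]) (simp add: at_le)
        have "isCont (\<lambda>x. P1 ((z * of_real x)\<^sup>2)) (0::real)"
          by (intro isCont_o2[OF _ DERIV_isCont[OF P1_deriv]] continuous_intros)
        then show "((\<lambda>x. P1 ((z * of_real x)\<^sup>2)) \<longlongrightarrow> P1 ((z * of_real 0)\<^sup>2)) (at_right (0::real))"
          unfolding isCont_def by (rule tendsto_mono[rotated]) (simp add: at_le)
      qed
      also have "0 powr (2 * \<sigma> + 1) * Im (cnj (h 0) * (2 * z\<^sup>2 * P1 ((z * of_real 0)\<^sup>2))) = 0" by simp
      finally show ?thesis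
        by (rule Lim_transform_eventually) (rule eventually_mono[OF eventually_at_right_less Weq])
    qed
    \<comment> \<open>Normalises the sign of \<open>q\<close>, so that both signs of Im (z^2) are
      handled as one monotone function.\<close>
    define s where "s = sgn q"
    have s: "s * q > 0" "s \<noteq> 0" unfolding s_def using q by (auto simp: sgn_if)
    have mono: "s * W y \<le> s * W x" if "0 < x" "x \<le> y" for x y
    proof (rule DERIV_nonpos_imp_nonincreasing[OF that(2)])
      fix t assume t: "x \<le> t" "t \<le> y"
      have "((\<lambda>t. s * W t) has_real_derivative s * (- q * (t powr (2 * \<sigma>) * (norm (h t))\<^sup>2))) (at t)"
        using dW[of t] t that by (intro DERIV_cmult) auto
      moreover have "(s * q) * (t powr (2 * \<sigma>) * (norm (h t))\<^sup>2) \<ge> 0" by (rule mult_nonneg_nonneg[OF less_imp_le[OF s(1)]]) simp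
      ultimately show "\<exists>y. ((\<lambda>t. s * W t) has_real_derivative y) (at t) \<and> y \<le> 0"
        by (intro exI[of _ "s * (- q * (t powr (2 * \<sigma>) * (norm (h t))\<^sup>2))"]) (auto simp: mult.assoc)
    qed
    have Wz: "W x = 0" if x: "0 < x" "x \<le> 1" for x
    proof -
      have "s * W 1 \<le> s * W x" using mono x by blast
      moreover have "s * W x \<le> s * 0"
      proof (rule tendsto_lowerbound)
        show "((\<lambda>e. s * W e) \<longlongrightarrow> s * 0) (at_right 0)" by (intro tendsto_intros W0)
        show "\<forall>\<^sub>F e in at_right 0. s * W x \<le> s * W e"
          using x mono by (intro eventually_at_rightI[of 0 x]) auto
      qed simp
      ultimately show ?thesis using W1 s by simp
    qed
    have "h x = 0" if x: "0 < x" "x < 1" for x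
    proof -
      have "((\<lambda>x. 0) has_real_derivative - q * (x powr (2 * \<sigma>) * (norm (h x))\<^sup>2)) (at x)"
        by (rule has_field_derivative_transform_within_open[OF dW[OF x(1)], of "{0<..<1}"]) (use x Wz in auto)
      then have "- q * (x powr (2 * \<sigma>) * (norm (h x))\<^sup>2) = 0" using DERIV_unique[OF _ DERIV_const] by blast
      then show ?thesis using q x by simp
    qed
    moreover have "(h \<longlongrightarrow> h 0) (at_right 0)"
      using has_vector_derivative_continuous[OF dh[of 0]] unfolding continuous_at
      by (rule tendsto_mono[rotated]) (simp add: at_le)
    ultimately have "((\<lambda>x. 0) \<longlongrightarrow> h 0) (at_right (0::real))"
      by (elim Lim_transform_eventually) (auto intro!: eventually_at_rightI[of 0 1])
    then have "h 0 = 0" using tendsto_unique[OF _ _ tendsto_const] by (metis trivial_limit_at_right_real)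
    then show False unfolding h_def using g_0_pos coef_0_pos by simp
  qed
  then have "of_real (Re z) = z" by (simp add: complex_eq_iff)
  then show ?thesis using z Re Rez Z_g[of "Re z"] by auto
qed

end

section \<open>The second solution\<close>

text \<open>Taylor coefficients of the solution of \<open>F'' = (k / (1 - s)\<^sup>2 - l) * F\<close> with \<open>F 0 = 0\<close> and
  \<open>F' 0 = 1\<close>.\<close>
fun bseq :: "'a::real_normed_field \<Rightarrow> 'a \<Rightarrow> nat \<Rightarrow> 'a" where
  "bseq k l 0 = 0"
| "bseq k l (Suc 0) = 1"
| "bseq k l (Suc (Suc n)) =
     (k * (\<Sum>i\<le>n. bseq k l i * of_nat (Suc (n - i))) - l * bseq k l n) / (of_nat (Suc (Suc n)) * of_nat (Suc n))"

text \<open>Replacing k by k' and - l by L makes every term of the recursion nonnegative, so the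
  triangle inequality propagates by induction.\<close>

lemma bseq_majorant:
  fixes k l :: complex
  assumes "norm k \<le> k'" "norm l \<le> L"
  shows "norm (bseq k l n) \<le> bseq k' (- L) n"
proof (induction n rule: less_induct)
  case (less n)
  consider "n = 0" | "n = Suc 0" | m where "n = Suc (Suc m)" by (metis not0_implies_Suc)
  then show ?case
  proof cases
    case (3 m)
    have k'0: "k' \<ge> 0" and L0: "L \<ge> 0" using assms norm_ge_zero order_trans by blast+
    have "norm (\<Sum>i\<le>m. bseq k l i * of_nat (Suc (m - i))) \<le> (\<Sum>i\<le>m. bseq k' (- L) i * of_nat (Suc (m - i)))"
      by (rule order_trans[OF norm_sum sum_mono]) 
         (auto simp: norm_mult 3 intro!: mult_right_mono less simp del: of_nat_Suc)
    then have "norm (k * (\<Sum>i\<le>m. bseq k l i * of_nat (Suc (m - i)))) \<le> k' * (\<Sum>i\<le>m. bseq k' (- L) i * of_nat (Suc (m - i)))"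
      unfolding norm_mult using assms k'0 by (intro mult_mono) auto
    moreover have "norm (l * bseq k l m) \<le> L * bseq k' (- L) m"
      unfolding norm_mult using assms L0 3 by (intro mult_mono less) auto
    ultimately have "norm (k * (\<Sum>i\<le>m. bseq k l i * of_nat (Suc (m - i))) - l * bseq k l m) \<le>
       k' * (\<Sum>i\<le>m. bseq k' (- L) i * of_nat (Suc (m - i))) - (- L) * bseq k' (- L) m"
      using norm_triangle_ineq4[of "k * (\<Sum>i\<le>m. bseq k l i * of_nat (Suc (m - i)))" "l * bseq k l m"] by simp
    then show ?thesis unfolding 3 bseq.simps norm_divide norm_mult norm_of_nat by (intro divide_right_mono) auto
  qed auto
qed

text \<open>Since \<rho> > 1, the convolution with n + 1 multiplies \<rho> ^ n by at most the
  constant Q, which the quadratic denominators of the recursion eventually absorb. As \<rho> may be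
  any number above 1, the Taylor series converges in the whole unit disc.\<close>

lemma bseq_growth:
  fixes k l \<rho> :: real
  assumes "\<rho> > 1" and pos: "\<And>n. bseq k (- l) n \<ge> 0" and "k \<ge> 0" "l \<ge> 0"
  obtains K where "\<And>n. bseq k (- l) n \<le> K * \<rho> ^ n"
proof -
  define b where "b = bseq k (- l)"
  define Q where "Q = 1 / (1 - 1 / \<rho>)\<^sup>2"
  have Q: "(\<Sum>i\<le>n. \<rho> ^ i * of_nat (Suc (n - i))) \<le> Q * \<rho> ^ n" for n
  proof -
    have s: "(\<lambda>j. of_nat (Suc j) * (1 / \<rho>) ^ j) sums Q"
      unfolding Q_def using assms by (intro geometric_deriv_sums) auto
    have "(\<Sum>i\<le>n. \<rho> ^ i * of_nat (Suc (n - i))) = (\<Sum>i\<le>n. \<rho> ^ (n - i) * of_nat (Suc i))"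
      by (rule sum.reindex_bij_witness[of _ "\<lambda>i. n - i" "\<lambda>i. n - i"]) auto
    also have "\<dots> = \<rho> ^ n * (\<Sum>i<Suc n. of_nat (Suc i) * (1 / \<rho>) ^ i)"
      unfolding sum_distrib_left lessThan_Suc_atMost using assms
      by (intro sum.cong) (auto simp: power_diff power_divide)
    also have "\<dots> \<le> \<rho> ^ n * Q"
      unfolding sums_unique[OF s] using assms
      by (intro mult_left_mono sum_le_suminf[OF sums_summable[OF s]]) (auto simp del: of_nat_Suc)
    finally show ?thesis by (simp add: mult.commute)
  qed
  \<comment> \<open>From this index on the denominators exceed k Q + l; the finitely many earlier
    coefficients are summed into K.\<close>
  obtain N :: nat where N: "k * Q + l < N" using reals_Archimedean2 by blast
  define K where "K = (\<Sum>n\<le>N + 1. b n / \<rho> ^ n)"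
  have K0: "K \<ge> 0" unfolding K_def b_def using assms by (intro sum_nonneg divide_nonneg_pos) auto
  have "b n \<le> K * \<rho> ^ n" for n
  proof (induction n rule: less_induct)
    case (less n)
    show ?case
    proof (cases "n \<le> N + 1")
      case True
      have "b n / \<rho> ^ n \<le> K" unfolding K_def
        by (rule member_le_sum) (use True assms in \<open>auto simp: b_def\<close>)
      then show ?thesis using assms by (simp add: field_simps)
    next
      case False
      then obtain m where m: "n = Suc (Suc m)" "N \<le> m" by (metis Suc_eq_plus1 Suc_le_D Suc_le_mono not_less_eq_eq)
      have bm: "b m \<le> K * \<rho> ^ m" using less m by simp
      have "(\<Sum>i\<le>m. b i * of_nat (Suc (m - i))) \<le> (\<Sum>i\<le>m. K * \<rho> ^ i * of_nat (Suc (m - i)))"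
        using m less by (intro sum_mono mult_right_mono) auto
      also have "\<dots> = K * (\<Sum>i\<le>m. \<rho> ^ i * of_nat (Suc (m - i)))" by (simp add: sum_distrib_left mult.assoc)
      also have "\<dots> \<le> K * (Q * \<rho> ^ m)" using Q K0 by (intro mult_left_mono)
      finally have 1: "k * (\<Sum>i\<le>m. b i * of_nat (Suc (m - i))) \<le> k * (K * (Q * \<rho> ^ m))"
        using assms by (intro mult_left_mono)
      have 2: "l * b m \<le> l * (K * \<rho> ^ m)" using bm assms by (intro mult_left_mono)
      have "b n = (k * (\<Sum>i\<le>m. b i * of_nat (Suc (m - i))) + l * b m) / (of_nat (Suc (Suc m)) * of_nat (Suc m))"
        unfolding b_def m by simp
      also have "\<dots> \<le> ((k * Q + l) * (K * \<rho> ^ m)) / (of_nat (Suc (Suc m)) * of_nat (Suc m))"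
        using 1 2 by (intro divide_right_mono) (auto simp: algebra_simps)
      also have "\<dots> \<le> K * \<rho> ^ m"
      proof -
        have "k * Q + l \<le> real (Suc m) * 1" using N m by simp
        also have "\<dots> \<le> real (Suc m) * real (Suc (Suc m))" by (intro mult_left_mono) auto
        finally have "(k * Q + l) * (K * \<rho> ^ m) \<le> (of_nat (Suc (Suc m)) * of_nat (Suc m)) * (K * \<rho> ^ m)"
          using K0 assms by (intro mult_right_mono) (auto simp: mult.commute)
        then show ?thesis by (simp add: divide_le_eq mult.commute del: of_nat_Suc)
      qed
      also have "\<dots> \<le> K * \<rho> ^ n" using K0 assms m by (intro mult_left_mono power_increasing) auto
      finally show ?thesis .
    qed
  qed
  then show ?thesis using that unfolding b_def by blast
qed

lemma summable_bseq_majorant: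
  fixes k l r :: real
  assumes "k \<ge> 0" "l \<ge> 0" "0 \<le> r" "r < 1"
  shows "summable (\<lambda>n. bseq k (- l) n * r ^ n)"
proof -
  have pos: "bseq k (- l) n \<ge> 0" for n
    using order_trans[OF norm_ge_zero bseq_majorant[of "of_real k" k "of_real l" l n]] assms by simp
  define \<rho> where "\<rho> = 2 / (1 + r)"
  have \<rho>: "\<rho> > 1" "\<rho> * r < 1" unfolding \<rho>_def using assms by (auto simp: field_simps)
  obtain K where K: "\<And>n. bseq k (- l) n \<le> K * \<rho> ^ n" using bseq_growth[OF \<rho>(1) pos assms(1,2)] by blast
  show ?thesis
  proof (rule summable_comparison_test')
    show "summable (\<lambda>n. K * (\<rho> * r) ^ n)" using \<rho> assms by (intro summable_mult summable_geometric) auto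
    fix n :: nat
    have "bseq k (- l) n * r ^ n \<le> K * \<rho> ^ n * r ^ n" using K assms by (intro mult_right_mono) auto
    then show "norm (bseq k (- l) n * r ^ n) \<le> K * (\<rho> * r) ^ n"
      using pos[of n] assms by (simp add: power_mult_distrib mult.assoc)
  qed
qed

lemma summable_norm_bseq:
  fixes k l s :: complex
  assumes "norm s < 1"
  shows "summable (\<lambda>n. norm (bseq k l n * s ^ n))"
  by (rule summable_comparison_test'[OF summable_bseq_majorant[of "norm k" "norm l" "norm s"]])
     (use assms bseq_majorant[of k "norm k" l "norm l"] in \<open>auto simp: norm_mult norm_power intro!: mult_right_mono\<close>)

definition Fs :: "complex \<Rightarrow> complex \<Rightarrow> complex \<Rightarrow> complex" where
  "Fs k l s = (\<Sum>n. bseq k l n * s ^ n)"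
definition Fs' :: "complex \<Rightarrow> complex \<Rightarrow> complex \<Rightarrow> complex" where
  "Fs' k l s = (\<Sum>n. diffs (bseq k l) n * s ^ n)"

lemma Fs_deriv:
  assumes "norm s < 1"
  shows "(Fs k l has_field_derivative Fs' k l s) (at s)"
proof -
  obtain r where r: "norm s < r" "r < 1" using dense assms by blast
  have "r > 0" using r norm_ge_zero[of s] by linarith
  then have r0: "norm (complex_of_real r) = r" by simp
  then have "summable (\<lambda>n. bseq k l n * of_real r ^ n)"
    using r by (intro summable_norm_cancel[OF summable_norm_bseq]) auto
  from termdiffs_strong[OF this, of s] show ?thesis
    unfolding Fs_def[abs_def] Fs'_def using r r0 by simp
qed

text \<open>1 / (1 - s)^2 is the power series with coefficients n + 1, and its Cauchy product with
  \<open>Fs\<close> is exactly the convolution in the recursion of \<open>bseq\<close>.\<close>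

lemma Fs'_deriv:
  assumes "norm s < 1"
  shows "(Fs' k l has_field_derivative (k / (1 - s)\<^sup>2 - l) * Fs k l s) (at s)"
proof -
  define b where "b = bseq k l"
  have sm: "summable (\<lambda>n. b n * x ^ n)" if "norm x < 1" for x
    unfolding b_def by (rule summable_norm_cancel[OF summable_norm_bseq[OF that]])
  have sm1: "summable (\<lambda>n. diffs b n * x ^ n)" if "norm x < 1" for x
    by (rule termdiff_converges[where K = 1, OF that sm])
  have sm2: "summable (\<lambda>n. diffs (diffs b) n * x ^ n)" if "norm x < 1" for x
    by (rule termdiff_converges[where K = 1, OF that sm1])
  obtain r where r: "norm s < r" "r < 1" using dense assms by blast
  have "r > 0" using r norm_ge_zero[of s] by linarith
  then have r0: "norm (complex_of_real r) = r" by simp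
  have d: "(Fs' k l has_field_derivative (\<Sum>n. diffs (diffs b) n * s ^ n)) (at s)"
    unfolding Fs'_def[abs_def] b_def[symmetric]
    by (rule termdiffs_strong[OF sm1[of "of_real r"]]) (use r r0 in auto)
  have "(\<lambda>n. k * (\<Sum>i\<le>n. (b i * s ^ i) * (of_nat (Suc (n - i)) * s ^ (n - i))) - l * (b n * s ^ n))
     sums (k * (Fs k l s * (1 / (1 - s)\<^sup>2)) - l * Fs k l s)"
  proof (intro sums_diff sums_mult)
    show "(\<lambda>n. b n * s ^ n) sums Fs k l s" unfolding Fs_def b_def[symmetric] by (rule summable_sums[OF sm[OF assms]])
    have geo: "(\<Sum>n. of_nat (Suc n) * s ^ n) = 1 / (1 - s)\<^sup>2" by (rule sums_unique[symmetric, OF geometric_deriv_sums[OF assms]])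
    have "summable (\<lambda>n. norm (of_nat (Suc n) * s ^ n))"
      using sums_summable[OF geometric_deriv_sums[of "norm s"]] assms by (simp add: norm_mult norm_power del: of_nat_Suc)
    from Cauchy_product_sums[OF _ this, of "\<lambda>n. b n * s ^ n"]
    show "(\<lambda>n. \<Sum>i\<le>n. (b i * s ^ i) * (of_nat (Suc (n - i)) * s ^ (n - i))) sums (Fs k l s * (1 / (1 - s)\<^sup>2))"
      using summable_norm_bseq[OF assms, of k l] unfolding geo Fs_def b_def[symmetric] by simp
  qed
  moreover have "k * (\<Sum>i\<le>n. (b i * s ^ i) * (of_nat (Suc (n - i)) * s ^ (n - i))) - l * (b n * s ^ n)
    = diffs (diffs b) n * s ^ n" for n
  proof -
    have nz: "(of_nat (Suc (Suc n)) * of_nat (Suc n) :: complex) \<noteq> 0"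
      by (simp del: of_nat_Suc)
    have "diffs (diffs b) n = of_nat (Suc (Suc n)) * of_nat (Suc n) * b (Suc (Suc n))"
      unfolding diffs_def by (simp only: mult_ac)
    also have "\<dots> = k * (\<Sum>i\<le>n. b i * of_nat (Suc (n - i))) - l * b n"
      unfolding b_def bseq.simps times_divide_eq_right by (rule nonzero_mult_div_cancel_left[OF nz])
    finally have e: "diffs (diffs b) n = k * (\<Sum>i\<le>n. b i * of_nat (Suc (n - i))) - l * b n" .
    have "(\<Sum>i\<le>n. (b i * s ^ i) * (of_nat (Suc (n - i)) * s ^ (n - i))) = (\<Sum>i\<le>n. b i * of_nat (Suc (n - i))) * s ^ n"
      unfolding sum_distrib_right
    proof (rule sum.cong[OF refl])
      fix i assume "i \<in> {..n}"
      then have "s ^ i * s ^ (n - i) = s ^ n" by (simp add: power_add[symmetric])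
      then show "(b i * s ^ i) * (of_nat (Suc (n - i)) * s ^ (n - i)) = b i * of_nat (Suc (n - i)) * s ^ n"
        by (metis (no_types, lifting) mult.assoc mult.left_commute)
    qed
    then show ?thesis unfolding e by (simp add: algebra_simps del: of_nat_Suc)
  qed
  ultimately have "(\<Sum>n. diffs (diffs b) n * s ^ n) = k * (Fs k l s * (1 / (1 - s)\<^sup>2)) - l * Fs k l s"
    by (simp add: sums_iff)
  then have "(\<Sum>n. diffs (diffs b) n * s ^ n) = (k / (1 - s)\<^sup>2 - l) * Fs k l s"
    by (simp add: left_diff_distrib)
  then show ?thesis using d by (simp only:)
qed

lemma Fs_0 [simp]: "Fs k l 0 = 0" "Fs' k l 0 = 1"
  unfolding Fs_def Fs'_def powser_zero by (simp_all add: diffs_def)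

lemma bseq_holomorphic: "(\<lambda>l. bseq k l n) holomorphic_on UNIV"
proof (induction n rule: less_induct)
  case (less n)
  consider "n = 0" | "n = Suc 0" | m where "n = Suc (Suc m)" by (metis not0_implies_Suc)
  then show ?case
  proof cases
    case (3 m)
    show ?thesis unfolding 3 bseq.simps
      by (intro holomorphic_intros less) (auto simp: 3 simp del: of_nat_Suc)
  qed auto
qed

text \<open>Each Taylor coefficient is entire in l, and the majorant sequence makes the series
  uniformly convergent on discs in l. Holomorphy in the spectral parameter is what lets the second
  solution enter a contour integral.\<close>

lemma Fs_holomorphic:
  assumes "norm s < 1"
  shows "(\<lambda>l. Fs k l s) holomorphic_on UNIV"
proof (rule holomorphic_uniform_sequence[OF open_UNIV])
  show "(\<lambda>l. \<Sum>i<n. bseq k l i * s ^ i) holomorphic_on UNIV" for n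
    by (intro holomorphic_intros bseq_holomorphic)
  fix x :: complex
  have "uniform_limit (cball x 1) (\<lambda>n l. \<Sum>i<n. bseq k l i * s ^ i) (\<lambda>l. \<Sum>i. bseq k l i * s ^ i) sequentially"
  proof (rule Weierstrass_m_test)
    fix n l assume "l \<in> cball x 1"
    then have "norm l \<le> norm x + 1" using norm_triangle_sub[of l x] by (simp add: dist_norm norm_minus_commute)
    then show "norm (bseq k l n * s ^ n) \<le> bseq (norm k) (- (norm x + 1)) n * norm s ^ n"
      unfolding norm_mult norm_power by (intro mult_right_mono bseq_majorant) auto
  qed (use summable_bseq_majorant[of "norm k" "norm x + 1" "norm s"] assms in auto)
  then show "\<exists>d>0. cball x d \<subseteq> UNIV \<and> uniform_limit (cball x d) (\<lambda>n l. \<Sum>i<n. bseq k l i * s ^ i) (\<lambda>l. Fs k l s) sequentially"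
    unfolding Fs_def by (intro exI[of _ 1]) auto
qed

text \<open>An energy estimate started at the right end point: p and q are the components of the two
  exponentials, and each grows at rate at most |Im z| plus the effect of the potential. It serves
  both as a bound and as a uniqueness theorem, because zero data at 1 give a zero solution.\<close>

lemma normal_form_bound:
  fixes W W' :: "real \<Rightarrow> complex" and z :: complex and k :: real
  assumes z: "z \<noteq> 0" and y: "0 < y" "y \<le> 1"
    and W: "\<And>t. 0 < t \<Longrightarrow> t \<le> 1 \<Longrightarrow> (W has_vector_derivative W' t) (at t)"
    and W': "\<And>t. 0 < t \<Longrightarrow> t \<le> 1 \<Longrightarrow> (W' has_vector_derivative (of_real (k / t\<^sup>2) - z\<^sup>2) * W t) (at t)"
  shows "norm (W y) \<le> exp (\<bar>Im z\<bar> * (1 - y) + \<bar>k\<bar> / (norm z * y)) * (norm (W 1) + norm (W' 1) / norm z)"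
proof -
  define p where "p = (\<lambda>s. (W (1 - s) - \<i> * W' (1 - s) / z) / 2)"
  define q where "q = (\<lambda>s. (W (1 - s) + \<i> * W' (1 - s) / z) / 2)"
  define e where "e = (\<lambda>s. \<i> * of_real (k / (1 - s)\<^sup>2) / (2 * z) * (p s + q s))"
  have pq: "p s + q s = W (1 - s)" for s unfolding p_def q_def by (simp add: field_simps)
  have d1: "((\<lambda>s. W (1 - s)) has_vector_derivative - W' (1 - s)) (at s)"
    and d2: "((\<lambda>s. W' (1 - s)) has_vector_derivative - ((of_real (k / (1 - s)\<^sup>2) - z\<^sup>2) * W (1 - s))) (at s)"
    if "0 \<le> s" "s < 1" for s
  proof -
    have "((\<lambda>s. 1 - s) has_vector_derivative (-1::real)) (at s)"
      unfolding has_real_derivative_iff_has_vector_derivative[symmetric] by (auto intro!: derivative_eq_intros)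
    from vector_diff_chain_at[OF this W[of "1 - s"]] vector_diff_chain_at[OF this W'[of "1 - s"]]
    show "((\<lambda>s. W (1 - s)) has_vector_derivative - W' (1 - s)) (at s)"
     "((\<lambda>s. W' (1 - s)) has_vector_derivative - ((of_real (k / (1 - s)\<^sup>2) - z\<^sup>2) * W (1 - s))) (at s)"
      using that by (simp_all add: o_def)
  qed
  have dp: "(p has_vector_derivative - (\<i> * z * p s) + e s) (at s)"
    and dq: "(q has_vector_derivative \<i> * z * q s - e s) (at s)" if s: "0 \<le> s" "s < 1" for s
  proof -
    note D = has_vector_derivative_mult_right[of _ _ _ "\<i> / z", OF d2[OF s]]
    have dp: "(p has_vector_derivative (1/2) * (- W' (1 - s) - \<i> / z * (- ((of_real (k / (1 - s)\<^sup>2) - z\<^sup>2) * W (1 - s))))) (at s)"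
      and dq: "(q has_vector_derivative (1/2) * (- W' (1 - s) + \<i> / z * (- ((of_real (k / (1 - s)\<^sup>2) - z\<^sup>2) * W (1 - s))))) (at s)"
      using has_vector_derivative_mult_right[of _ _ _ "1/2", OF has_vector_derivative_diff[OF d1[OF s] D]]
        has_vector_derivative_mult_right[of _ _ _ "1/2", OF has_vector_derivative_add[OF d1[OF s] D]]
      unfolding p_def q_def by (simp_all add: mult.commute[of "1/2"])
    define K where "K = complex_of_real (k / (1 - s)\<^sup>2)"
    have "(1/2) * (- W' (1 - s) - \<i> / z * (- ((K - z\<^sup>2) * W (1 - s)))) = - (\<i> * z * p s) + e s"
      "(1/2) * (- W' (1 - s) + \<i> / z * (- ((K - z\<^sup>2) * W (1 - s)))) = \<i> * z * q s - e s"
      unfolding e_def K_def[symmetric] pq unfolding p_def q_def using z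
      by (simp_all add: field_simps power2_eq_square)
    then show "(p has_vector_derivative - (\<i> * z * p s) + e s) (at s)"
      "(q has_vector_derivative \<i> * z * q s - e s) (at s)" using dp dq unfolding K_def by (simp_all only:)
  qed
  \<comment> \<open>A primitive of twice the growth rate in s = 1 - y; the integral of the potential
    is what yields |k| / (|z| y).\<close>
  define m where "m = (\<lambda>s. 2 * (\<bar>Im z\<bar> * s + \<bar>k\<bar> / norm z * (1 / (1 - s))))"
  have "(norm (p (1 - y)))\<^sup>2 + (norm (q (1 - y)))\<^sup>2 \<le> exp (m (1 - y) - m 0) * ((norm (p 0))\<^sup>2 + (norm (q 0))\<^sup>2)"
  proof (rule gronwall_pair[where k = "\<lambda>s. \<bar>Im z\<bar> + \<bar>k\<bar> / norm z * (1 / (1 - s)\<^sup>2)"])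
    fix s assume "0 \<le> s" "s \<le> 1 - y"
    then have s: "0 \<le> s" "s < 1" using y by auto
    show "(p has_vector_derivative - (\<i> * z * p s) + e s) (at s)"
      "(q has_vector_derivative \<i> * z * q s - e s) (at s)" using dp[OF s] dq[OF s] .
    show "(m has_real_derivative 2 * (\<bar>Im z\<bar> + \<bar>k\<bar> / norm z * (1 / (1 - s)\<^sup>2))) (at s)"
      unfolding m_def using s z by (auto intro!: derivative_eq_intros simp: power2_eq_square)
    have i1: "p s \<bullet> (- (\<i> * z * p s)) = Im z * (norm (p s))\<^sup>2" "q s \<bullet> (\<i> * z * q s) = - Im z * (norm (q s))\<^sup>2"
      unfolding cmod_power2 by (simp_all add: inner_complex_def algebra_simps power2_eq_square)
    have i2: "Im z * (norm (p s))\<^sup>2 \<le> \<bar>Im z\<bar> * (norm (p s))\<^sup>2" "- Im z * (norm (q s))\<^sup>2 \<le> \<bar>Im z\<bar> * (norm (q s))\<^sup>2"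
      by (intro mult_right_mono; simp)+
    have "norm (complex_of_real (1 - s)) = 1 - s" unfolding norm_of_real using s by simp
    then have n1: "norm (1 - complex_of_real s) = 1 - s" by simp
    \<comment> \<open>The inequality \<open>inner_le_norms\<close> lives in the locale and does not
      mention the order; it is instantiated at order 0.\<close>
    have "p s \<bullet> e s + q s \<bullet> (- e s) \<le> norm (e s) * (norm (p s) + norm (q s))"
      by (rule bessel_order.inner_le_norms[of 0]) (auto simp: bessel_order_def)
    also have "\<dots> = (\<bar>k\<bar> / (1 - s)\<^sup>2 / (2 * norm z)) * (norm (p s + q s) * (norm (p s) + norm (q s)))"
      unfolding e_def by (simp add: norm_mult norm_divide norm_power n1)
    also have "\<dots> \<le> (\<bar>k\<bar> / (1 - s)\<^sup>2 / (2 * norm z)) * ((norm (p s) + norm (q s)) * (norm (p s) + norm (q s)))"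
      by (intro mult_left_mono mult_right_mono norm_triangle_ineq) auto
    also have "\<dots> \<le> (\<bar>k\<bar> / (1 - s)\<^sup>2 / (2 * norm z)) * (2 * ((norm (p s))\<^sup>2 + (norm (q s))\<^sup>2))"
      using sum_norms_sq[of "p s" "q s"] by (intro mult_left_mono) (auto simp: power2_eq_square)
    also have "\<dots> = \<bar>k\<bar> / norm z * (1 / (1 - s)\<^sup>2) * ((norm (p s))\<^sup>2 + (norm (q s))\<^sup>2)"
      using s z by (simp add: field_simps)
    finally show "p s \<bullet> (- (\<i> * z * p s) + e s) + q s \<bullet> (\<i> * z * q s - e s)
      \<le> (\<bar>Im z\<bar> + \<bar>k\<bar> / norm z * (1 / (1 - s)\<^sup>2)) * ((norm (p s))\<^sup>2 + (norm (q s))\<^sup>2)"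
      unfolding inner_add_right inner_diff_right i1 distrib_right distrib_left using i2 by simp
  qed (use y in auto)
  also have "(norm (p 0))\<^sup>2 + (norm (q 0))\<^sup>2 = ((norm (W 1))\<^sup>2 + (norm (W' 1) / norm z)\<^sup>2) / 2"
  proof -
    have "(norm ((a - b) / 2))\<^sup>2 + (norm ((a + b) / 2))\<^sup>2 = ((norm a)\<^sup>2 + (norm b)\<^sup>2) / 2" for a b :: complex
      unfolding cmod_power2 by (simp add: power2_eq_square field_simps)
    from this[of "W 1" "\<i> * W' 1 / z"] show ?thesis unfolding p_def q_def by (simp add: norm_mult norm_divide)
  qed
  finally have S: "2 * ((norm (p (1 - y)))\<^sup>2 + (norm (q (1 - y)))\<^sup>2) \<le> exp (m (1 - y) - m 0) * ((norm (W 1))\<^sup>2 + (norm (W' 1) / norm z)\<^sup>2)"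
    by simp
  have "(norm (W y))\<^sup>2 \<le> (norm (p (1 - y)) + norm (q (1 - y)))\<^sup>2"
    using pq[of "1 - y"] norm_triangle_ineq[of "p (1 - y)" "q (1 - y)"] by (intro power_mono) auto
  also have "\<dots> \<le> exp (m (1 - y) - m 0) * ((norm (W 1))\<^sup>2 + (norm (W' 1) / norm z)\<^sup>2)"
    using sum_norms_sq[of "p (1 - y)" "q (1 - y)"] S by linarith
  also have "\<dots> \<le> (exp (\<bar>Im z\<bar> * (1 - y) + \<bar>k\<bar> / (norm z * y)))\<^sup>2 * (norm (W 1) + norm (W' 1) / norm z)\<^sup>2"
  proof (rule mult_mono)
    have "m (1 - y) - m 0 \<le> 2 * (\<bar>Im z\<bar> * (1 - y) + \<bar>k\<bar> / (norm z * y))"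
      unfolding m_def using y by (simp add: right_diff_distrib)
    then show "exp (m (1 - y) - m 0) \<le> (exp (\<bar>Im z\<bar> * (1 - y) + \<bar>k\<bar> / (norm z * y)))\<^sup>2"
      by (simp add: exp_double[symmetric])
    show "(norm (W 1))\<^sup>2 + (norm (W' 1) / norm z)\<^sup>2 \<le> (norm (W 1) + norm (W' 1) / norm z)\<^sup>2"
      by (simp add: power2_sum)
  qed auto
  finally show ?thesis unfolding power_mult_distrib[symmetric]
    by (rule power2_le_imp_le) (auto intro!: mult_nonneg_nonneg add_nonneg_nonneg)
qed

context bessel_order
begin

text \<open>As a function of \<open>y\<close>, \<open>V z\<close> and \<open>u (z * y)\<close> solve the same equation; \<open>V z 1 = 0\<close>, and \<open>V\<close> is entire
  in \<open>z\<close>.\<close>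
definition V :: "complex \<Rightarrow> real \<Rightarrow> complex" where "V z y = Fs (of_real \<kappa>) (z\<^sup>2) (of_real (1 - y))"

lemma V_deriv:
  assumes "0 < y" "y \<le> 1"
  shows "(V z has_vector_derivative - Fs' (of_real \<kappa>) (z\<^sup>2) (of_real (1 - y))) (at y)"
    and "((\<lambda>y. - Fs' (of_real \<kappa>) (z\<^sup>2) (of_real (1 - y))) has_vector_derivative (of_real (\<kappa> / y\<^sup>2) - z\<^sup>2) * V z y) (at y)"
proof -
  have n: "norm (complex_of_real (1 - y)) < 1" unfolding norm_of_real using assms by simp
  have d: "((\<lambda>y. complex_of_real (1 - y)) has_vector_derivative - 1) (at y)"
    by (auto intro!: derivative_eq_intros)
  show "(V z has_vector_derivative - Fs' (of_real \<kappa>) (z\<^sup>2) (of_real (1 - y))) (at y)"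
    using field_vector_diff_chain_at[OF d Fs_deriv[OF n]] unfolding V_def[abs_def] by (simp add: o_def)
  show "((\<lambda>y. - Fs' (of_real \<kappa>) (z\<^sup>2) (of_real (1 - y))) has_vector_derivative (of_real (\<kappa> / y\<^sup>2) - z\<^sup>2) * V z y) (at y)"
    using has_vector_derivative_minus[OF field_vector_diff_chain_at[OF d Fs'_deriv[OF n, of "of_real \<kappa>" "z\<^sup>2"]]] unfolding V_def by (simp add: o_def)
qed

lemma V_minus [simp]: "V (- z) y = V z y" unfolding V_def by simp

text \<open>At y = 1 the solution has value 0 and derivative of modulus 1, whence the single factor
  1 / |z|.\<close>

lemma V_bound:
  assumes "z \<noteq> 0" "0 < y" "y \<le> 1"
  shows "norm (V z y) \<le> exp (\<bar>Im z\<bar> * (1 - y) + \<bar>\<kappa>\<bar> / (norm z * y)) / norm z"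
  using normal_form_bound[OF assms V_deriv] by (simp add: V_def)

lemma V_holomorphic:
  assumes "0 < y" "y \<le> 1"
  shows "(\<lambda>z. V z y) holomorphic_on UNIV"
proof -
  have n: "norm (complex_of_real (1 - y)) < 1" unfolding norm_of_real using assms by simp
  have "(\<lambda>l. Fs (of_real \<kappa>) l (of_real (1 - y))) \<circ> (\<lambda>z. z\<^sup>2) holomorphic_on UNIV"
    by (rule holomorphic_on_compose_gen[OF _ Fs_holomorphic[OF n]]) (auto intro!: holomorphic_intros)
  then show ?thesis unfolding V_def by (simp add: o_def)
qed

text \<open>At a zero s of \<open>g\<close> both solutions vanish at y = 1, so they are
  proportional, with ratio fixed by the derivatives there. The proof applies the energy estimate to
  the combination with vanishing data.\<close>

lemma V_at_zero:
  assumes s: "s > 0" "g (of_real s) = 0" "g' (of_real s) \<noteq> 0" and y: "0 < y" "y \<le> 1"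
  shows "V (of_real s) y = - (of_real (y powr \<sigma>) * g (of_real (s * y)) / (of_real s * g' (of_real s)))"
proof -
  define c where "c = of_real s * u' (of_real s)"
  have u's: "u' (of_real s) = of_real (s powr \<sigma>) * g' (of_real s)" and us: "u (of_real s) = 0"
    unfolding u'_def u_def using s by (simp_all add: powr_of_real)
  have c: "c \<noteq> 0" unfolding c_def u's using s by simp
  have dm: "((\<lambda>t. of_real s * of_real t) has_vector_derivative complex_of_real s) (at t)" for t
    by (auto intro!: derivative_eq_intros)
  have d1: "((\<lambda>t. u (of_real s * of_real t)) has_vector_derivative of_real s * u' (of_real s * of_real t)) (at t)"
    and d2: "((\<lambda>t. of_real s * u' (of_real s * of_real t)) has_vector_derivative (of_real (\<kappa> / t\<^sup>2) - (of_real s)\<^sup>2) * u (of_real s * of_real t)) (at t)"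
    if t: "t > 0" for t
  proof -
    have np: "complex_of_real s * of_real t \<notin> \<real>\<^sub>\<le>\<^sub>0" using not_nonpos_real[of "s * t"] s t by simp
    show "((\<lambda>t. u (of_real s * of_real t)) has_vector_derivative of_real s * u' (of_real s * of_real t)) (at t)"
      using field_vector_diff_chain_at[OF dm u_deriv[OF np]] by (simp add: o_def)
      have "of_real s * (of_real s * (- (1 - of_real \<kappa> / (of_real s * of_real t)\<^sup>2) * u (of_real s * of_real t))) =
        (of_real (\<kappa> / t\<^sup>2) - (of_real s)\<^sup>2) * u (of_real s * of_real t)"
        using s t by (simp add: field_simps power2_eq_square)
      then show "((\<lambda>t. of_real s * u' (of_real s * of_real t)) has_vector_derivative (of_real (\<kappa> / t\<^sup>2) - (of_real s)\<^sup>2) * u (of_real s * of_real t)) (at t)"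
        using has_vector_derivative_mult_right[OF field_vector_diff_chain_at[OF dm u'_deriv[OF np]], of "of_real s"]
        by (simp only: o_def)
  qed
  \<comment> \<open>The coefficient 1 / c cancels the derivative - 1 of \<open>V\<close> at the
    right end point.\<close>
  define X where "X = (\<lambda>t. V (of_real s) t + inverse c * u (of_real s * of_real t))"
  define X' where "X' = (\<lambda>t. - Fs' (of_real \<kappa>) ((of_real s)\<^sup>2) (of_real (1 - t)) + inverse c * (of_real s * u' (of_real s * of_real t)))"
  have "norm (X y) \<le> exp (\<bar>Im (complex_of_real s)\<bar> * (1 - y) + \<bar>\<kappa>\<bar> / (norm (complex_of_real s) * y)) *
     (norm (X 1) + norm (X' 1) / norm (complex_of_real s))"
  proof (rule normal_form_bound)
    fix t :: real assume t: "0 < t" "t \<le> 1"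
    show "(X has_vector_derivative X' t) (at t)" unfolding X_def X'_def
      by (intro has_vector_derivative_add has_vector_derivative_mult_right V_deriv d1 t)
    have "(X' has_vector_derivative
      ((of_real (\<kappa> / t\<^sup>2) - (of_real s)\<^sup>2) * V (of_real s) t + inverse c * ((of_real (\<kappa> / t\<^sup>2) - (of_real s)\<^sup>2) * u (of_real s * of_real t)))) (at t)"
      unfolding X'_def by (intro has_vector_derivative_add has_vector_derivative_mult_right V_deriv d2 t)
    then show "(X' has_vector_derivative (of_real (\<kappa> / t\<^sup>2) - (of_real s)\<^sup>2) * X t) (at t)"
      unfolding X_def by (simp add: algebra_simps)
  qed (use s y in auto)
  also have "\<dots> = 0"
  proof -
    have "inverse c * (of_real s * u' (of_real s)) = 1" using left_inverse[OF c] unfolding c_def .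
    then show ?thesis unfolding X_def X'_def by (simp add: V_def us)
  qed
  finally have "X y = 0" by simp
  then have "V (of_real s) y = - (inverse c * u (of_real s * of_real y))" unfolding X_def by (simp add: add_eq_0_iff2)
  also have "u (of_real s * of_real y) = of_real (s powr \<sigma>) * of_real (y powr \<sigma>) * g (of_real (s * y))"
    unfolding u_def using s y powr_of_real[of "s * y" \<sigma>] by (simp add: powr_mult)
  finally show ?thesis unfolding c_def u's using s by (simp add: field_simps)
qed

end

section \<open>The kernel\<close>

text \<open>Makes the description of the zeros by \<open>THE\<close> meaningful: an increasing
  enumeration is determined by its range.\<close>

lemma strict_mono_range_unique:
  fixes s t :: "nat \<Rightarrow> 'a::linorder"
  assumes "strict_mono s" "strict_mono t" "range s = range t"
  shows "s = t"
proof
  fix n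
  show "s n = t n"
  proof (induction n rule: less_induct)
    case (less n)
    have le: "p n \<le> q n" if h: "strict_mono p" "strict_mono q" "range p = range q" "\<And>k. k < n \<Longrightarrow> p k = q k"
      for p q :: "nat \<Rightarrow> 'a"
    proof -
      obtain m where m: "q n = p m" using h(3) by (metis rangeE rangeI)
      have "\<not> m < n"
      proof
        assume "m < n"
        then have "q n = q m" using m h(4) by simp
        then show False using \<open>m < n\<close> h(2) by (metis strict_mono_eq less_irrefl)
      qed
      then show ?thesis using m h(1) by (simp add: strict_mono_less_eq)
    qed
    show ?case using le[OF assms less] le[OF assms(2,1) assms(3)[symmetric]] less by (simp add: order_antisym)
  qed
qed

text \<open>Comparison with the integral of the power, one summand at a time by the mean value
  theorem; the singularity at 0 is integrable because a > -1.\<close>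

lemma sum_powr_le:
  fixes a :: real
  assumes "-1 < a" "a \<le> 0"
  shows "(\<Sum>n=1..N. real n powr a) \<le> real N powr (a + 1) / (a + 1)"
proof (induction N)
  case (Suc N)
  have "(real N + 1) powr a \<le> ((real N + 1) powr (a + 1) - real N powr (a + 1)) / (a + 1)"
  proof (cases "N = 0")
    case True
    then show ?thesis using assms by (simp add: field_simps)
  next
    case False
    have "\<exists>z>real N. z < real N + 1 \<and> (real N + 1) powr (a + 1) - real N powr (a + 1) = (real N + 1 - real N) * ((a + 1) * z powr (a + 1 - 1))"
      by (rule MVT2) (use False in \<open>auto intro!: derivative_eq_intros\<close>)
    then obtain z where z: "real N < z" "z < real N + 1"
      "(real N + 1) powr (a + 1) - real N powr (a + 1) = (a + 1) * z powr a" by auto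
    have "(real N + 1) powr a \<le> z powr a" using z assms by (intro powr_mono2') auto
    then show ?thesis using z(3) assms by simp
  qed
  then show ?case using Suc by (simp add: diff_divide_distrib add.commute)
qed simp

context bessel_order
begin

text \<open>Two zeros never share a cell of length \<eta>. The cell index is therefore strictly
  increasing on \<open>Z\<close>, which reduces finiteness, counting and enumeration of zeros to
  natural numbers.\<close>

lemma Z_floor:
  obtains \<eta> where "0 < \<eta>" "\<And>x. x \<in> Z \<Longrightarrow> \<eta> \<le> x" 
    "\<And>x y. x \<in> Z \<Longrightarrow> y \<in> Z \<Longrightarrow> x < y \<Longrightarrow> nat \<lfloor>x / \<eta>\<rfloor> < nat \<lfloor>y / \<eta>\<rfloor>"
proof -
  obtain \<eta> where \<eta>: "0 < \<eta>" "\<And>x. x \<in> Z \<Longrightarrow> \<eta> \<le> x" "\<And>x y. x \<in> Z \<Longrightarrow> y \<in> Z \<Longrightarrow> x < y \<Longrightarrow> x + \<eta> \<le> y"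
    using Z_spacing by metis
  have "nat \<lfloor>x / \<eta>\<rfloor> < nat \<lfloor>y / \<eta>\<rfloor>" if "x \<in> Z" "y \<in> Z" "x < y" for x y
  proof -
    have "x / \<eta> + 1 \<le> y / \<eta>" using divide_right_mono[OF \<eta>(3)[OF that], of \<eta>] \<eta>(1) by (simp add: add_divide_distrib)
    moreover have "x / \<eta> > 0" using that \<eta>(1) by (simp add: Z_def)
    ultimately have "\<lfloor>x / \<eta>\<rfloor> + 1 \<le> \<lfloor>y / \<eta>\<rfloor>" "\<lfloor>x / \<eta>\<rfloor> \<ge> 0" by linarith+
    then show ?thesis by linarith
  qed
  with \<eta> that show ?thesis by blast
qed

lemma floor_inj_on_Z:
  assumes "\<And>x y. x \<in> Z \<Longrightarrow> y \<in> Z \<Longrightarrow> x < y \<Longrightarrow> nat \<lfloor>x / \<eta>\<rfloor> < nat \<lfloor>y / \<eta>\<rfloor>"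
  shows "inj_on (\<lambda>x. nat \<lfloor>x / \<eta>\<rfloor>) Z"
  using assms by (intro linorder_inj_onI') (metis less_irrefl)

lemma finite_Z: "finite (Z \<inter> {..<R})"
proof -
  obtain \<eta> where \<eta>: "0 < \<eta>" "\<And>x y. x \<in> Z \<Longrightarrow> y \<in> Z \<Longrightarrow> x < y \<Longrightarrow> nat \<lfloor>x / \<eta>\<rfloor> < nat \<lfloor>y / \<eta>\<rfloor>"
    using Z_floor by metis
  have "(\<lambda>x. nat \<lfloor>x / \<eta>\<rfloor>) ` (Z \<inter> {..<R}) \<subseteq> {..nat \<lfloor>R / \<eta>\<rfloor>}"
  proof
    fix k assume "k \<in> (\<lambda>x. nat \<lfloor>x / \<eta>\<rfloor>) ` (Z \<inter> {..<R})"
    then obtain x where "k = nat \<lfloor>x / \<eta>\<rfloor>" "x < R" by auto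
    then show "k \<in> {..nat \<lfloor>R / \<eta>\<rfloor>}" using \<eta>(1) by (auto intro!: nat_mono floor_mono divide_right_mono)
  qed
  then have "finite ((\<lambda>x. nat \<lfloor>x / \<eta>\<rfloor>) ` (Z \<inter> {..<R}))" by (rule finite_subset) simp
  then show ?thesis by (rule finite_imageD) (rule inj_on_subset[OF floor_inj_on_Z[OF \<eta>(2)]], auto)
qed

text \<open>The zeros have no largest element, so their cell indices form an infinite set of
  naturals; its enumeration, pulled back to \<open>Z\<close>, meets the characterisation that
  \<open>bessel_zero\<close> selects.\<close>

lemma bessel_zero_props: "strict_mono (bessel_zero \<nu>)" "range (bessel_zero \<nu>) = Z"
proof -
  obtain \<eta> where \<eta>: "0 < \<eta>" "\<And>x y. x \<in> Z \<Longrightarrow> y \<in> Z \<Longrightarrow> x < y \<Longrightarrow> nat \<lfloor>x / \<eta>\<rfloor> < nat \<lfloor>y / \<eta>\<rfloor>"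
    using Z_floor by metis
  define fl where "fl = (\<lambda>x::real. nat \<lfloor>x / \<eta>\<rfloor>)"
  have inj: "inj_on fl Z" unfolding fl_def by (rule floor_inj_on_Z[OF \<eta>(2)])
  have inf: "infinite (fl ` Z)"
  proof
    assume "finite (fl ` Z)"
    then have "finite Z" using inj by (rule finite_imageD)
    moreover have "Z \<noteq> {}" using Z_unbounded[of 0] by auto
    ultimately show False using Z_unbounded[of "Max Z"] by (meson Max_ge not_less)
  qed
  define s where "s = (\<lambda>n. the_inv_into Z fl (enumerate (fl ` Z) n))"
  have sZ: "s n \<in> Z" "fl (s n) = enumerate (fl ` Z) n" for n
    unfolding s_def using enumerate_in_set[OF inf, of n] the_inv_into_into[OF inj _ subset_refl] f_the_inv_into_f[OF inj] by auto
  have "strict_mono s"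
  proof (rule strict_monoI)
    fix m n :: nat assume "m < n"
    then have "fl (s m) < fl (s n)" unfolding sZ using inf by (rule enumerate_mono)
    then show "s m < s n" using \<eta>(2)[OF sZ(1) sZ(1), of n m] unfolding fl_def
      by (metis less_asym' linorder_neqE_linordered_idom less_irrefl)
  qed
  moreover have "range s = Z"
  proof
    show "range s \<subseteq> Z" using sZ by auto
    show "Z \<subseteq> range s"
    proof
      fix x assume x: "x \<in> Z"
      then obtain n where "fl x = enumerate (fl ` Z) n" using enumerate_Ex[of "fl ` Z" "fl x"] inf by (metis imageI)
      then have "s n = x" using sZ(1)[of n] sZ(2)[of n] x by (intro inj_onD[OF inj]) simp_all
      then show "x \<in> range s" by auto
    qed
  qed
  ultimately have s: "strict_mono s \<and> range s = {x. 0 < x \<and> besselJ \<nu> x = 0}" unfolding Z_eq by auto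
  have "bessel_zero \<nu> = s" unfolding bessel_zero_def
  proof (rule the_equality)
    show "strict_mono s \<and> range s = {x. 0 < x \<and> besselJ \<nu> x = 0}" by (rule s)
    show "r = s" if "strict_mono r \<and> range r = {x. 0 < x \<and> besselJ \<nu> x = 0}" for r
      using that s by (intro strict_mono_range_unique) auto
  qed
  then show "strict_mono (bessel_zero \<nu>)" "range (bessel_zero \<nu>) = Z" using s unfolding Z_eq by auto
qed

text \<open>The eigenfunction \<open>psi\<close> indexed by the zero itself; \<open>J\<close> of order \<open>\<nu> + 1\<close> at a zero \<open>s\<close> is
  \<open>- s powr \<nu> * g' s\<close>.\<close>
definition pz :: "real \<Rightarrow> real \<Rightarrow> real" where
  "pz s x = sqrt 2 * Re (g (of_real (s * x))) / \<bar>Re (g' (of_real s))\<bar>"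

lemma psi_eq: 
  assumes "x > 0"
  shows "psi \<nu> j x = pz (bessel_zero \<nu> j) x"
proof -
  define s where "s = bessel_zero \<nu> j"
  have "s \<in> Z" unfolding s_def using bessel_zero_props(2) by auto
  then have s: "s > 0" by (simp add: Z_def)
  have "besselJ (\<nu> + 1) s = - (s powr \<nu> * Re (g' (of_real s)))" by (rule besselJ_Suc_eq[OF s])
  moreover have "besselJ \<nu> (s * x) = s powr \<nu> * x powr \<nu> * Re (g (of_real (s * x)))"
    using besselJ_eq[of "s * x"] s assms by (simp add: powr_mult)
  ultimately show ?thesis unfolding psi_def s_def[symmetric] pz_def
    using s assms by (simp add: abs_mult powr_minus field_simps)
qed

text \<open>The cut-off at 0 is left out, since the sums in which it occurs run only over zeros
  below R, where the base is positive. In this form it agrees with the complex power in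
  \<open>FF\<close> on the real axis.\<close>

definition wt :: "real \<Rightarrow> real \<Rightarrow> real \<Rightarrow> real" where "wt \<delta> R s = (1 - s\<^sup>2 / R\<^sup>2) powr \<delta>"

definition K :: "real \<Rightarrow> real \<Rightarrow> real \<Rightarrow> real \<Rightarrow> real" where
  "K \<delta> R x y = (\<Sum>s\<in>Z \<inter> {..<R}. wt \<delta> R s * pz s x * pz s y)"

lemma K_sym: "K \<delta> R x y = K \<delta> R y x"
  unfolding K_def by (simp add: mult_ac)

lemma psi_measurable [measurable]: "psi \<nu> j \<in> borel_measurable borel"
  unfolding psi_def[abs_def] besselJ_def by measurable

lemma pz_measurable [measurable]: "pz s \<in> borel_measurable borel"
proof -
  have "continuous_on UNIV (\<lambda>x. Re (g (of_real (s * x))))"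
    by (rule continuous_on_compose2[OF g_real_cont[of UNIV]]) (auto intro!: continuous_intros)
  then have [measurable]: "(\<lambda>x. Re (g (of_real (s * x)))) \<in> borel_measurable borel"
    by (rule borel_measurable_continuous_onI)
  show ?thesis unfolding pz_def[abs_def] by measurable
qed

lemma sets_mu_nu [simp, measurable_cong]: "sets (mu_nu \<nu>) = sets borel"
  unfolding mu_nu_def by simp

lemma bochner_riesz_eq:
  assumes R: "R > 0" and x: "x > 0" and [measurable]: "f \<in> borel_measurable borel"
  shows "bochner_riesz \<nu> \<delta> R f x = (\<Sum>s\<in>Z \<inter> {..<R}. wt \<delta> R s * (\<integral>y. f y * pz s y \<partial>mu_nu \<nu>) * pz s x)"
proof -
  define J where "J = {j. bessel_zero \<nu> j < R}"
  have inj: "inj_on (bessel_zero \<nu>) J" using bessel_zero_props(1) by (meson inj_on_subset strict_mono_imp_inj_on subset_UNIV)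
  have img: "bessel_zero \<nu> ` J = Z \<inter> {..<R}" using bessel_zero_props(2) unfolding J_def by auto
  have fin: "finite J" by (rule finite_imageD[OF _ inj]) (simp add: img finite_Z)
  have coeff: "fourier_bessel_coeff \<nu> f j = (\<integral>y. f y * pz (bessel_zero \<nu> j) y \<partial>mu_nu \<nu>)" for j
    unfolding fourier_bessel_coeff_def
  proof (rule integral_cong_AE)
    show "AE y in mu_nu \<nu>. f y * psi \<nu> j y = f y * pz (bessel_zero \<nu> j) y"
      unfolding mu_nu_def by (subst AE_density) (auto simp: psi_eq split: split_indicator)
  qed measurable
  have "bochner_riesz \<nu> \<delta> R f x = 
    (\<Sum>j\<in>J. (max (1 - (bessel_zero \<nu> j)\<^sup>2 / R\<^sup>2) 0) powr \<delta> * fourier_bessel_coeff \<nu> f j * psi \<nu> j x)"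
    unfolding bochner_riesz_def
  proof (rule suminf_finite[OF fin])
    \<comment> \<open>For zeros at or beyond R the base is 0, and 0 powr \<delta> = 0; the series is
      a finite sum.\<close>
    fix j assume "j \<notin> J"
    then have "R\<^sup>2 \<le> (bessel_zero \<nu> j)\<^sup>2" unfolding J_def using R by (intro power_mono) auto
    then have "max (1 - (bessel_zero \<nu> j)\<^sup>2 / R\<^sup>2) 0 = 0" using R by (simp add: field_simps)
    then show "(max (1 - (bessel_zero \<nu> j)\<^sup>2 / R\<^sup>2) 0) powr \<delta> * fourier_bessel_coeff \<nu> f j * psi \<nu> j x = 0" by simp
  qed
  also have "\<dots> = (\<Sum>j\<in>J. wt \<delta> R (bessel_zero \<nu> j) * (\<integral>y. f y * pz (bessel_zero \<nu> j) y \<partial>mu_nu \<nu>) * pz (bessel_zero \<nu> j) x)"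
  proof (rule sum.cong[OF refl])
    fix j assume j: "j \<in> J"
    have "bessel_zero \<nu> j \<in> Z" using bessel_zero_props(2) by auto
    then have "0 < bessel_zero \<nu> j" by (simp add: Z_def)
    then have "(bessel_zero \<nu> j)\<^sup>2 \<le> R\<^sup>2" using j unfolding J_def by (intro power_mono) auto
    then have "max (1 - (bessel_zero \<nu> j)\<^sup>2 / R\<^sup>2) 0 = 1 - (bessel_zero \<nu> j)\<^sup>2 / R\<^sup>2" using R by (simp add: field_simps)
    then show "(max (1 - (bessel_zero \<nu> j)\<^sup>2 / R\<^sup>2) 0) powr \<delta> * fourier_bessel_coeff \<nu> f j * psi \<nu> j x
      = wt \<delta> R (bessel_zero \<nu> j) * (\<integral>y. f y * pz (bessel_zero \<nu> j) y \<partial>mu_nu \<nu>) * pz (bessel_zero \<nu> j) x"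
      unfolding wt_def coeff psi_eq[OF x] by simp
  qed
  also have "\<dots> = (\<Sum>s\<in>bessel_zero \<nu> ` J. wt \<delta> R s * (\<integral>y. f y * pz s y \<partial>mu_nu \<nu>) * pz s x)"
    by (simp add: sum.reindex[OF inj] o_def)
  finally show ?thesis unfolding img .
qed

section \<open>Size of the eigenfunctions and the kernel bound without cancellation\<close>

lemma \<Phi>_nonneg: "\<Phi> t \<ge> 0" unfolding \<Phi>_def by simp
lemma \<Phi>_ge1: "t \<ge> 1 \<Longrightarrow> \<Phi> t = 1" unfolding \<Phi>_def by simp

text \<open>Slow variation of \<open>\<Phi>\<close>, whatever the sign of \<open>\<sigma>\<close>.\<close>
lemma \<Phi>_scale:
  assumes "0 < a" "0 < t" "1 \<le> b" "1 / b \<le> a" "a \<le> b"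
  shows "\<Phi> (a * t) \<le> b powr \<bar>\<sigma>\<bar> * \<Phi> t"
proof (cases "\<sigma> \<ge> 0")
  case True
  have "min 1 (a * t) \<le> b * min 1 t"
  proof (cases "t \<le> 1")
    case True
    have "a * t \<le> b * t" using assms by (intro mult_right_mono) auto
    then show ?thesis using True by (simp add: min_def)
  qed (use assms in \<open>simp add: min_def\<close>)
  then have "(min 1 (a * t)) powr \<sigma> \<le> (b * min 1 t) powr \<sigma>" using True assms by (intro powr_mono2) auto
  then show ?thesis using assms True unfolding \<Phi>_def by (simp add: powr_mult)
next
  case False
  have "min 1 t / b \<le> min 1 (a * t)"
  proof (cases "a * t \<le> 1")
    case True
    have "min 1 t / b \<le> t * (1 / b)" using assms by (simp add: divide_right_mono)
    also have "\<dots> \<le> t * a" using assms by (intro mult_left_mono) auto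
    finally show ?thesis using True by (simp add: mult.commute min_def)
  next
    case False
    have "min 1 t / b \<le> 1 / 1" using assms by (intro frac_le) auto
    then show ?thesis using False by (simp add: min_def)
  qed
  then have "(min 1 (a * t)) powr \<sigma> \<le> (min 1 t / b) powr \<sigma>" using False assms by (intro powr_mono2') auto
  also have "\<dots> = b powr \<bar>\<sigma>\<bar> * (min 1 t) powr \<sigma>" using assms False by (simp add: powr_divide powr_minus_divide)
  finally show ?thesis unfolding \<Phi>_def .
qed

text \<open>The envelope of \<open>g\<close> at s x divided by the lower bound of \<open>g'\<close>
  at the zero s: the powers of s cancel, and only \<Phi> (s x) still depends on s.\<close>

lemma pz_bound:
  obtains C where "0 < C" "\<And>s x. s \<in> Z \<Longrightarrow> 0 < x \<Longrightarrow> \<bar>pz s x\<bar> \<le> C * (x powr (- \<sigma>) * \<Phi> (s * x))"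
proof -
  obtain C where C: "0 < C" "\<And>w. 0 \<le> Re w \<Longrightarrow> w \<noteq> 0 \<Longrightarrow> norm (g w) \<le> C * (norm w powr (- \<sigma>) * \<Phi> (norm w)) * exp \<bar>Im w\<bar>"
    using g_upper by blast
  obtain c where c: "0 < c" "\<And>x. x \<in> Z \<Longrightarrow> c * x powr (- \<sigma>) \<le> \<bar>Re (g' (of_real x))\<bar>" using Z_spacing by metis
  show ?thesis
  proof (rule that[of "sqrt 2 * C / c"])
    show "0 < sqrt 2 * C / c" using C c by simp
    fix s x :: real assume s: "s \<in> Z" and x: "0 < x"
    have s0: "s > 0" using s by (simp add: Z_def)
    have "\<bar>Re (g (of_real (s * x)))\<bar> \<le> norm (g (of_real (s * x)))" by (rule abs_Re_le_cmod)
    also have "\<dots> \<le> C * (norm (complex_of_real (s * x)) powr (- \<sigma>) * \<Phi> (norm (complex_of_real (s * x)))) * exp \<bar>Im (complex_of_real (s * x))\<bar>"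
      by (rule C(2)) (use s0 x in auto)
    also have "\<dots> = C * (s powr (- \<sigma>) * x powr (- \<sigma>) * \<Phi> (s * x))"
      using s0 x unfolding norm_of_real by (simp add: powr_mult)
    finally have n: "\<bar>Re (g (of_real (s * x)))\<bar> \<le> C * (s powr (- \<sigma>) * x powr (- \<sigma>) * \<Phi> (s * x))" .
    have "\<bar>pz s x\<bar> = sqrt 2 * \<bar>Re (g (of_real (s * x)))\<bar> / \<bar>Re (g' (of_real s))\<bar>" unfolding pz_def by (simp add: abs_mult)
    also have "\<dots> \<le> sqrt 2 * (C * (s powr (- \<sigma>) * x powr (- \<sigma>) * \<Phi> (s * x))) / (c * s powr (- \<sigma>))"
      using n c(2)[OF s] c(1) C(1) s0 by (intro frac_le mult_left_mono mult_nonneg_nonneg \<Phi>_nonneg) auto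
    also have "\<dots> = sqrt 2 * C / c * (x powr (- \<sigma>) * \<Phi> (s * x))" using s0 c by simp
    finally show "\<bar>pz s x\<bar> \<le> sqrt 2 * C / c * (x powr (- \<sigma>) * \<Phi> (s * x))" .
  qed
qed

text \<open>For \<sigma> \<ge> 0 the largest summand times the number of zeros suffices. For
  \<sigma> < 0 the summands blow up at small s, and the cell indices turn the sum into one of n powr
  (2 \<sigma>); this is still of the size of its last term times its length because 2 \<sigma> > -1,
  that is \<nu> > -1.\<close>

lemma sum_\<Phi>_sq:
  obtains C where "0 < C" "\<And>R x. 0 < R \<Longrightarrow> 0 < x \<Longrightarrow> (\<Sum>s\<in>Z \<inter> {..<R}. (\<Phi> (s * x))\<^sup>2) \<le> C * R * (\<Phi> (R * x))\<^sup>2"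
proof -
  obtain \<eta> where \<eta>: "0 < \<eta>" "\<And>x. x \<in> Z \<Longrightarrow> \<eta> \<le> x" "\<And>x y. x \<in> Z \<Longrightarrow> y \<in> Z \<Longrightarrow> x < y \<Longrightarrow> nat \<lfloor>x / \<eta>\<rfloor> < nat \<lfloor>y / \<eta>\<rfloor>"
    using Z_floor by metis
  define fl where "fl = (\<lambda>x::real. nat \<lfloor>x / \<eta>\<rfloor>)"
  have inj: "inj_on fl (Z \<inter> {..<R})" for R using floor_inj_on_Z[OF \<eta>(3)] unfolding fl_def by (rule inj_on_subset) auto
  define N where "N = (\<lambda>R. nat \<lfloor>R / \<eta>\<rfloor>)"
  have N: "real (N R) \<le> R / \<eta>" if "R > 0" for R unfolding N_def using that \<eta>(1) by simp
  have sub: "fl ` (Z \<inter> {..<R}) \<subseteq> {1..N R}" for R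
  proof
    fix k assume "k \<in> fl ` (Z \<inter> {..<R})"
    then obtain x where x: "k = fl x" "x \<in> Z" "x < R" by auto
    have "1 \<le> x / \<eta>" using \<eta>(2)[OF x(2)] \<eta>(1) by simp
    then have "1 \<le> fl x" unfolding fl_def by linarith
    moreover have "fl x \<le> N R" unfolding fl_def N_def using x \<eta>(1) by (intro nat_mono floor_mono divide_right_mono) auto
    ultimately show "k \<in> {1..N R}" using x by simp
  qed
  show ?thesis
  proof (cases "\<sigma> \<ge> 0")
    case True
    show ?thesis
    proof (rule that[of "1 / \<eta>"])
      show "0 < 1 / \<eta>" using \<eta> by simp
      fix R x :: real assume R: "0 < R" and x: "0 < x"
      have "(\<Sum>s\<in>Z \<inter> {..<R}. (\<Phi> (s * x))\<^sup>2) \<le> (\<Sum>s\<in>Z \<inter> {..<R}. (\<Phi> (R * x))\<^sup>2)"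
      proof (intro sum_mono power_mono)
        fix s assume s: "s \<in> Z \<inter> {..<R}"
        then have "s > 0" by (auto simp: Z_def)
        then show "\<Phi> (s * x) \<le> \<Phi> (R * x)" unfolding \<Phi>_def using True s x by (intro powr_mono2 min.mono mult_right_mono) auto
      qed (rule \<Phi>_nonneg)
      also have "\<dots> = real (card (Z \<inter> {..<R})) * (\<Phi> (R * x))\<^sup>2" by simp
      also have "\<dots> \<le> R / \<eta> * (\<Phi> (R * x))\<^sup>2"
      proof (intro mult_right_mono)
        have "card (Z \<inter> {..<R}) = card (fl ` (Z \<inter> {..<R}))" by (simp add: card_image[OF inj])
        also have "\<dots> \<le> card {1..N R}" by (intro card_mono sub) auto
        finally show "real (card (Z \<inter> {..<R})) \<le> R / \<eta>" using N[OF R] by simp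
      qed auto
      finally show "(\<Sum>s\<in>Z \<inter> {..<R}. (\<Phi> (s * x))\<^sup>2) \<le> 1 / \<eta> * R * (\<Phi> (R * x))\<^sup>2" by simp
    qed
  next
    case False
    define a where "a = 2 * \<sigma>"
    have a: "-1 < a" "a \<le> 0" unfolding a_def \<sigma>_def using nu False[unfolded \<sigma>_def] by auto
    have sq: "(\<Phi> t)\<^sup>2 = (min 1 t) powr a" if "t > 0" for t
      unfolding \<Phi>_def a_def using that by (simp add: powr_powr[symmetric] power2_eq_square powr_add[symmetric])
    have le: "(min 1 t) powr a \<le> 1 + t powr a" if "t > 0" for t unfolding min_def by simp
    define C where "C = 1 / \<eta> * (2 / (a + 1))"
    have C: "C > 0" unfolding C_def using a \<eta> by simp
    show ?thesis
    proof (rule that[of "2 * C"])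
      show "0 < 2 * C" using C by simp
      fix R x :: real assume R: "0 < R" and x: "0 < x"
      have "(\<Sum>s\<in>Z \<inter> {..<R}. (\<Phi> (s * x))\<^sup>2) \<le> (\<Sum>s\<in>Z \<inter> {..<R}. 1 + (real (fl s) * \<eta> * x) powr a)"
      proof (rule sum_mono)
        fix s assume s: "s \<in> Z \<inter> {..<R}"
        have s0: "s > 0" "1 \<le> s / \<eta>" using s \<eta> by (auto simp: Z_def)
        have f1: "1 \<le> fl s" unfolding fl_def using s0 by linarith
        have "real (fl s) \<le> s / \<eta>" unfolding fl_def using s0 by simp
        then have "real (fl s) * \<eta> * x \<le> s * x" using \<eta> x by (simp add: field_simps)
        then have "(s * x) powr a \<le> (real (fl s) * \<eta> * x) powr a" using f1 \<eta> x a by (intro powr_mono2') auto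
        then show "(\<Phi> (s * x))\<^sup>2 \<le> 1 + (real (fl s) * \<eta> * x) powr a" using le[of "s * x"] s0 x by (simp add: sq)
      qed
      also have "\<dots> = (\<Sum>n\<in>fl ` (Z \<inter> {..<R}). 1 + (real n * \<eta> * x) powr a)"
        by (simp add: sum.reindex[OF inj] o_def)
      also have "\<dots> \<le> (\<Sum>n=1..N R. 1 + (real n * \<eta> * x) powr a)" by (intro sum_mono2 sub) auto
      also have "\<dots> = real (N R) + (\<eta> * x) powr a * (\<Sum>n=1..N R. real n powr a)"
        using \<eta> x by (simp add: sum.distrib sum_distrib_left powr_mult mult_ac)
      also have "\<dots> \<le> real (N R) + (\<eta> * x) powr a * (real (N R) powr (a + 1) / (a + 1))"
        by (intro add_left_mono mult_left_mono sum_powr_le a) auto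
      also have "\<dots> \<le> R / \<eta> + (\<eta> * x) powr a * ((R / \<eta>) powr (a + 1) / (a + 1))"
        using N[OF R] a by (intro add_mono mult_left_mono divide_right_mono powr_mono2) auto
      also have "(\<eta> * x) powr a * ((R / \<eta>) powr (a + 1) / (a + 1)) = R / \<eta> * (R * x) powr a / (a + 1)"
      proof -
        have "(\<eta> * x) powr a * (R / \<eta>) powr a = (R * x) powr a"
          using \<eta>(1) x R by (subst powr_mult[symmetric]) (auto simp: mult.commute)
        moreover have "(R / \<eta>) powr (a + 1) = (R / \<eta>) powr a * (R / \<eta>)" using \<eta>(1) R by (simp add: powr_add)
        ultimately show ?thesis by (simp add: mult.assoc[symmetric])
      qed
      also have "R / \<eta> + R / \<eta> * (R * x) powr a / (a + 1) \<le> C * R * (1 + (R * x) powr a)"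
      proof -
        have "R / \<eta> * 1 \<le> R / \<eta> * (2 / (a + 1))" using a R \<eta> by (intro mult_left_mono) (auto simp: field_simps)
        moreover have "R / \<eta> * (R * x) powr a / (a + 1) \<le> R / \<eta> * (R * x) powr a * (2 / (a + 1))"
        proof -
          have "0 \<le> R / \<eta> * (R * x) powr a / (a + 1)" using a(1) R \<eta>(1) by simp
          moreover have "R / \<eta> * (R * x) powr a * (2 / (a + 1)) = 2 * (R / \<eta> * (R * x) powr a / (a + 1))" by simp
          ultimately show ?thesis by linarith
        qed
        moreover have "C * R * (1 + (R * x) powr a) = R / \<eta> * (2 / (a + 1)) + R / \<eta> * (R * x) powr a * (2 / (a + 1))"
          unfolding C_def by (simp add: distrib_left add_divide_distrib mult_ac)
        ultimately show ?thesis by linarith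
      qed
      also have "\<dots> \<le> C * R * (2 * (\<Phi> (R * x))\<^sup>2)"
      proof (intro mult_left_mono)
        show "1 + (R * x) powr a \<le> 2 * (\<Phi> (R * x))\<^sup>2"
        proof (cases "R * x \<le> 1")
          case True
          then have "1 powr a \<le> (R * x) powr a" using R x a by (intro powr_mono2') auto
          then show ?thesis using True R x by (simp add: sq min_def)
        next
          case False
          then have "(R * x) powr a \<le> 1 powr a" using a by (intro powr_mono2') auto
          then show ?thesis using False R x by (simp add: sq min_def)
        qed
      qed (use C R in auto)
      finally show "(\<Sum>s\<in>Z \<inter> {..<R}. (\<Phi> (s * x))\<^sup>2) \<le> 2 * C * R * (\<Phi> (R * x))\<^sup>2" by (simp add: mult_ac)
    qed
  qed
qed

lemma wt_le1: "s \<in> Z \<Longrightarrow> s < R \<Longrightarrow> \<delta> > 0 \<Longrightarrow> 0 \<le> wt \<delta> R s \<and> wt \<delta> R s \<le> 1"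
proof -
  assume s: "s \<in> Z" "s < R" "\<delta> > 0"
  then have "0 < s" by (simp add: Z_def)
  then have "s\<^sup>2 \<le> R\<^sup>2" "R > 0" using s by (auto intro!: power_mono)
  then have "0 \<le> 1 - s\<^sup>2 / R\<^sup>2" "1 - s\<^sup>2 / R\<^sup>2 \<le> 1" by (auto simp: field_simps)
  then show ?thesis unfolding wt_def using powr_mono2[of \<delta> "1 - s\<^sup>2 / R\<^sup>2" 1] s by simp
qed

text \<open>Cauchy-Schwarz over the zeros separates x from y. All cancellation is discarded, so this
  is used only where it cannot help: near the diagonal, near the origin, or for bounded R.\<close>

lemma K_diag:
  assumes \<delta>: "\<delta> > 0"
  obtains C where "0 < C" "\<And>R x y. 0 < R \<Longrightarrow> 0 < x \<Longrightarrow> 0 < y \<Longrightarrow>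
     \<bar>K \<delta> R x y\<bar> \<le> C * ((x * y) powr (- \<sigma>) * (\<Phi> (R * x) * \<Phi> (R * y)) * R)"
proof -
  obtain C1 where C1: "0 < C1" "\<And>s x. s \<in> Z \<Longrightarrow> 0 < x \<Longrightarrow> \<bar>pz s x\<bar> \<le> C1 * (x powr (- \<sigma>) * \<Phi> (s * x))"
    using pz_bound by blast
  obtain C2 where C2: "0 < C2" "\<And>R x. 0 < R \<Longrightarrow> 0 < x \<Longrightarrow> (\<Sum>s\<in>Z \<inter> {..<R}. (\<Phi> (s * x))\<^sup>2) \<le> C2 * R * (\<Phi> (R * x))\<^sup>2"
    using sum_\<Phi>_sq by blast
  show ?thesis
  proof (rule that[of "C1 * C1 * C2"])
    show "0 < C1 * C1 * C2" using C1 C2 by simp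
    fix R x y :: real assume R: "0 < R" and x: "0 < x" and y: "0 < y"
    have L: "L2_set (\<lambda>s. \<Phi> (s * x)) (Z \<inter> {..<R}) \<le> sqrt (C2 * R) * \<Phi> (R * x)" if "x > 0" for x
    proof -
      have "L2_set (\<lambda>s. \<Phi> (s * x)) (Z \<inter> {..<R}) \<le> sqrt (C2 * R * (\<Phi> (R * x))\<^sup>2)"
        unfolding L2_set_def by (rule real_sqrt_le_mono[OF C2(2)[OF R that]])
      then show ?thesis using \<Phi>_nonneg by (simp add: real_sqrt_mult)
    qed
    have "\<bar>K \<delta> R x y\<bar> \<le> (\<Sum>s\<in>Z \<inter> {..<R}. \<bar>wt \<delta> R s * pz s x * pz s y\<bar>)" unfolding K_def by (rule sum_abs)
    also have "\<dots> \<le> (\<Sum>s\<in>Z \<inter> {..<R}. (C1 * (x powr (- \<sigma>) * \<Phi> (s * x))) * (C1 * (y powr (- \<sigma>) * \<Phi> (s * y))))"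
    proof (rule sum_mono)
      fix s assume s: "s \<in> Z \<inter> {..<R}"
      have w: "\<bar>wt \<delta> R s\<bar> \<le> 1" using wt_le1[of s R \<delta>] s \<delta> by auto
      have "\<bar>wt \<delta> R s * pz s x * pz s y\<bar> = \<bar>wt \<delta> R s\<bar> * (\<bar>pz s x\<bar> * \<bar>pz s y\<bar>)" by (simp add: abs_mult)
      also have "\<dots> \<le> 1 * (\<bar>pz s x\<bar> * \<bar>pz s y\<bar>)" using w by (intro mult_right_mono) auto
      also have "\<dots> \<le> 1 * ((C1 * (x powr (- \<sigma>) * \<Phi> (s * x))) * (C1 * (y powr (- \<sigma>) * \<Phi> (s * y))))"
        using C1(2)[of s x] C1(2)[of s y] s x y C1(1) by (intro mult_left_mono mult_mono) (auto intro!: mult_nonneg_nonneg \<Phi>_nonneg)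
      finally show "\<bar>wt \<delta> R s * pz s x * pz s y\<bar> \<le> (C1 * (x powr (- \<sigma>) * \<Phi> (s * x))) * (C1 * (y powr (- \<sigma>) * \<Phi> (s * y)))" by simp
    qed
    also have "\<dots> = C1 * C1 * (x powr (- \<sigma>) * y powr (- \<sigma>)) * (\<Sum>s\<in>Z \<inter> {..<R}. \<bar>\<Phi> (s * x)\<bar> * \<bar>\<Phi> (s * y)\<bar>)"
      using \<Phi>_nonneg by (simp add: sum_distrib_left mult_ac)
    also have "\<dots> \<le> C1 * C1 * (x powr (- \<sigma>) * y powr (- \<sigma>)) * (L2_set (\<lambda>s. \<Phi> (s * x)) (Z \<inter> {..<R}) * L2_set (\<lambda>s. \<Phi> (s * y)) (Z \<inter> {..<R}))"
      using C1 by (intro mult_left_mono L2_set_mult_ineq) auto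
    also have "\<dots> \<le> C1 * C1 * (x powr (- \<sigma>) * y powr (- \<sigma>)) * ((sqrt (C2 * R) * \<Phi> (R * x)) * (sqrt (C2 * R) * \<Phi> (R * y)))"
      using C1 C2 R x y by (intro mult_left_mono mult_mono L) (auto intro!: mult_nonneg_nonneg \<Phi>_nonneg)
    also have "\<dots> = C1 * C1 * (x powr (- \<sigma>) * y powr (- \<sigma>)) * ((sqrt (C2 * R) * sqrt (C2 * R)) * (\<Phi> (R * x) * \<Phi> (R * y)))"
      by (simp only: mult_ac)
    also have "sqrt (C2 * R) * sqrt (C2 * R) = C2 * R" using C2 R by simp
    also have "x powr (- \<sigma>) * y powr (- \<sigma>) = (x * y) powr (- \<sigma>)" using x y by (simp add: powr_mult)
    finally show "\<bar>K \<delta> R x y\<bar> \<le> C1 * C1 * C2 * ((x * y) powr (- \<sigma>) * (\<Phi> (R * x) * \<Phi> (R * y)) * R)" by (simp only: mult_ac)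
  qed
qed

end

section \<open>Off-diagonal decay by residues\<close>

lemma contour_integral_odd_linepath:
  assumes "\<And>z. f (- z) = - f z"
  shows "contour_integral (linepath a (- a)) f = 0"
proof -
  have "linepath a (- a) = uminus \<circ> linepath (- a) a" by (auto simp: linepath_def)
  then have "contour_integral (linepath a (- a)) f = - contour_integral (linepath (- a) a) (\<lambda>z. f (- z))"
    by (simp only: contour_integral_negatepath[OF valid_path_linepath])
  also have "\<dots> = - contour_integral (linepath (- a) a) (\<lambda>z. - f z)" by (simp only: assms)
  also have "\<dots> = contour_integral (linepath (- a) a) f" by (subst contour_integral_neg) simp
  also have "\<dots> = - contour_integral (linepath a (- a)) f"
    using contour_integral_reversepath[of "linepath a (- a)" f] by simp
  finally show ?thesis by simp
qed

text \<open>From 1 + s \<le> M (1 + s / M) \<le> M exp(s / M), raised to the power M.\<close>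

lemma exp_dominates:
  fixes M :: real
  assumes "M \<ge> 1" "s \<ge> 0"
  shows "(1 + s) powr M * exp (- s) \<le> M powr M"
proof -
  have "1 + s \<le> M * (1 + s / M)" using assms by (simp add: field_simps)
  also have "\<dots> \<le> M * exp (s / M)" using assms by (intro mult_left_mono exp_ge_add_one_self) auto
  finally have "(1 + s) powr M \<le> (M * exp (s / M)) powr M" using assms by (intro powr_mono2) auto
  also have "\<dots> = M powr M * exp s" using assms by (simp add: powr_mult exp_powr_real)
  finally show ?thesis by (simp add: exp_minus field_simps)
qed

context bessel_order
begin

text \<open>The poles are the zeros \<open>s\<close> of \<open>g\<close>, with residues \<open>wt \<delta> R s * pz s x * pz s y\<close>, and \<open>FF\<close> is odd in
  \<open>z\<close>, so that the imaginary axis contributes nothing to contour integrals.\<close>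
definition FF :: "real \<Rightarrow> real \<Rightarrow> real \<Rightarrow> real \<Rightarrow> complex \<Rightarrow> complex" where
  "FF \<delta> R x y z = - 2 * z * (1 - z\<^sup>2 / (of_real R)\<^sup>2) powr (of_real \<delta>) * g (z * of_real x) * (of_real (y powr (- \<sigma>)) * V z y) / g z"

lemma g_holo: "g holomorphic_on S"
  unfolding holomorphic_on_def field_differentiable_def using has_field_derivative_at_within[OF g_deriv] by blast

lemma FF_odd: "FF \<delta> R x y (- z) = - FF \<delta> R x y z"
  unfolding FF_def by simp

text \<open>The strip |Re z| < R stays off the branch cut of the principal power in
  \<open>FF\<close>; the contours must remain inside it.\<close>

lemma strip_not_nonpos:
  assumes "R > 0" "\<bar>Re z\<bar> < R"
  shows "1 - z\<^sup>2 / (of_real R)\<^sup>2 \<notin> \<real>\<^sub>\<le>\<^sub>0"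
proof
  assume h: "1 - z\<^sup>2 / (of_real R)\<^sup>2 \<in> \<real>\<^sub>\<le>\<^sub>0"
  have e: "z\<^sup>2 / (of_real R)\<^sup>2 = Complex (((Re z)\<^sup>2 - (Im z)\<^sup>2) / R\<^sup>2) (2 * Re z * Im z / R\<^sup>2)"
    unfolding of_real_power[symmetric] complex_eq_iff by (simp add: Re_power2 Im_power2 Re_divide_of_real Im_divide_of_real del: of_real_power)
  have "1 - ((Re z)\<^sup>2 - (Im z)\<^sup>2) / R\<^sup>2 \<le> 0" "2 * Re z * Im z / R\<^sup>2 = 0"
    using h unfolding e complex_nonpos_Reals_iff by auto
  then have "R\<^sup>2 \<le> (Re z)\<^sup>2 - (Im z)\<^sup>2" using assms by (simp add: field_simps)
  moreover have "(Re z)\<^sup>2 < R\<^sup>2" using assms by (simp add: abs_square_less_1 power2_strict_mono)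
  ultimately show False using zero_le_power2[of "Im z"] by linarith
qed

text \<open>The poles are simple because \<open>g'\<close> does not vanish at a zero, and
  \<open>V_at_zero\<close> turns the second solution into the eigenfunction in y over another factor
  \<open>g'\<close>. Only zeros below t are enclosed, although the weight belongs to R.\<close>

lemma FF_residue_sum:
  assumes \<delta>: "\<delta> > 0" and t: "0 < t" "t < R" "t \<notin> Z" and T: "T > 0" and xy: "0 < x" "x \<le> 1" "0 < y" "y \<le> 1"
  shows "contour_integral (rectpath (- \<i> * of_real T) (of_real t + \<i> * of_real T)) (FF \<delta> R x y)
    = 2 * pi * \<i> * of_real (\<Sum>s\<in>Z \<inter> {..<t}. wt \<delta> R s * pz s x * pz s y)"
proof -
  obtain \<eta>0 where \<eta>0: "0 < \<eta>0" "\<And>x. x \<in> Z \<Longrightarrow> \<eta>0 \<le> x" using Z_spacing by metis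
  \<comment> \<open>The domain reaches a little to the left of the imaginary axis, so that the left
    side of the rectangle is interior. Half the smallest positive zero excludes further poles, and
    the minimum with R keeps clear of the branch cut.\<close>
  define \<eta> where "\<eta> = min (\<eta>0 / 2) R"
  have \<eta>: "0 < \<eta>" "\<eta> \<le> R" "\<And>x. x \<in> Z \<Longrightarrow> \<eta> < x" proof -
    show "0 < \<eta>" "\<eta> \<le> R" using \<eta>0 t unfolding \<eta>_def by auto
    show "\<eta> < x" if "x \<in> Z" for x using \<eta>0(1) \<eta>0(2)[OF that] unfolding \<eta>_def by linarith
  qed
  obtain c where c: "0 < c" "\<And>x. x \<in> Z \<Longrightarrow> c * x powr (- \<sigma>) \<le> \<bar>Re (g' (of_real x))\<bar>" using Z_spacing by metis
  define S where "S = {z. - \<eta> < Re z \<and> Re z < R}"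
  have S: "open S" "convex S"
  proof -
    have "S = {z. Re z > - \<eta>} \<inter> {z. Re z < R}" unfolding S_def by auto
    then show "open S" "convex S"
      by (auto intro!: convex_Int open_halfspace_Re_gt open_halfspace_Re_lt convex_halfspace_Re_gt convex_halfspace_Re_lt open_Int)
  qed
  define pts where "pts = complex_of_real ` (Z \<inter> {..<R})"
  have fin: "finite pts" unfolding pts_def by (intro finite_imageI finite_Z)
  have zeros: "z \<in> pts" if "z \<in> S" "g z = 0" for z
  proof -
    have "Re z \<ge> 0"
    proof (rule ccontr)
      assume "\<not> Re z \<ge> 0"
      then have "Re (- z) \<in> Z" using g_zeros_real[of "- z"] that by simp
      then show False using \<eta>(3)[of "- Re z"] that unfolding S_def by simp
    qed
    then have "of_real (Re z) = z" "Re z \<in> Z" using g_zeros_real[of z] that by auto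
    then show ?thesis using that unfolding pts_def S_def by (intro image_eqI[of _ _ "Re z"]) auto
  qed
  define Nu where "Nu = (\<lambda>z. - 2 * z * (1 - z\<^sup>2 / (of_real R)\<^sup>2) powr (of_real \<delta>) * g (z * of_real x) * (of_real (y powr (- \<sigma>)) * V z y))"
  have Nu_holo: "Nu holomorphic_on S"
  proof -
    have h1: "(\<lambda>z. g (z * of_real x)) holomorphic_on S"
      using holomorphic_on_compose[of "\<lambda>z. z * of_real x" S g] g_holo by (simp add: o_def holomorphic_on_mult)
    have h2: "(\<lambda>z. V z y) holomorphic_on S" by (rule holomorphic_on_subset[OF V_holomorphic[OF xy(3,4)]]) simp
    have "\<bar>Re z\<bar> < R" if "z \<in> S" for z using that t \<eta>(1,2) unfolding S_def by (auto simp: abs_if)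
    then have h3: "1 - z\<^sup>2 / (of_real R)\<^sup>2 \<notin> \<real>\<^sub>\<le>\<^sub>0" if "z \<in> S" for z using strip_not_nonpos[of R z] t that by auto
    have h4: "(\<lambda>z. (1 - z\<^sup>2 / (of_real R)\<^sup>2) powr (of_real \<delta>)) holomorphic_on S"
      using t by (intro holomorphic_intros) (auto simp: h3)
    show ?thesis unfolding Nu_def by (intro holomorphic_intros h1 h2 h4)
  qed
  have FF: "FF \<delta> R x y = (\<lambda>z. Nu z / g z)" unfolding FF_def[abs_def] Nu_def by simp
  have holo: "FF \<delta> R x y holomorphic_on S - pts"
    unfolding FF by (intro holomorphic_on_divide holomorphic_on_subset[OF Nu_holo] g_holo) (use zeros in auto)
  have res: "residue (FF \<delta> R x y) (of_real s) = of_real (wt \<delta> R s * pz s x * pz s y)" if s: "s \<in> Z" "s < R" for s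
  proof -
    have s0: "s > 0" "g (of_real s) = 0" using s Z_g by auto
    have s1: "g' (of_real s) \<noteq> 0" 
    proof
      assume "g' (of_real s) = 0"
      then have "c * s powr (- \<sigma>) \<le> 0" using c(2)[OF s(1)] by simp
      then show False using c(1) s0 by (simp add: mult_le_0_iff)
    qed
    \<comment> \<open>The product with w - s is the numerator over the difference quotient of
      \<open>g\<close>, whose limit is the derivative at s.\<close>
    have r: "residue (FF \<delta> R x y) (of_real s) = Nu (of_real s) / g' (of_real s)"
    proof (rule residue_simple'[of "S - (pts - {of_real s})"])
      show "open (S - (pts - {of_real s}))" using fin S by (intro open_Diff finite_imp_closed) auto
      show "complex_of_real s \<in> S - (pts - {of_real s})" unfolding S_def using s \<eta> s0 by auto
      show "FF \<delta> R x y holomorphic_on S - (pts - {of_real s}) - {of_real s}"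
        by (rule holomorphic_on_subset[OF holo]) auto
      have "isCont Nu (of_real s)"
        using holomorphic_on_imp_continuous_on[OF Nu_holo] S(1) s s0 \<eta> unfolding S_def
        by (subst (asm) continuous_on_eq_continuous_at) auto
      then have l1: "(Nu \<longlongrightarrow> Nu (of_real s)) (at (of_real s))" by (simp add: isCont_def)
      have "((\<lambda>w. (g w - g (of_real s)) / (w - of_real s)) \<longlongrightarrow> g' (of_real s)) (at (of_real s))"
        using g_deriv[of "of_real s"] unfolding has_field_derivative_iff .
      then have "((\<lambda>w. Nu w / ((g w - g (of_real s)) / (w - of_real s))) \<longlongrightarrow> Nu (of_real s) / g' (of_real s)) (at (of_real s))"
        by (intro tendsto_divide l1 s1)
      then show "((\<lambda>w. FF \<delta> R x y w * (w - of_real s)) \<longlongrightarrow> Nu (of_real s) / g' (of_real s)) (at (of_real s))"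
        unfolding FF s0 by simp
    qed
    have rx: "g (of_real s * of_real x) = of_real (Re (g (of_real (s * x))))" using g_real[of "s * x"] by simp
    have ry: "g (of_real (s * y)) = of_real (Re (g (of_real (s * y))))" by (rule g_real)
    have rs: "g' (of_real s) = of_real (Re (g' (of_real s)))" by (rule g'_real)
    define a b d where "a = Re (g (of_real (s * x)))" and "b = Re (g (of_real (s * y)))" and "d = Re (g' (of_real s))"
    have d0: "d \<noteq> 0" using s1 rs unfolding d_def by (metis of_real_0)
    have base: "1 - (complex_of_real s)\<^sup>2 / (of_real R)\<^sup>2 = of_real (1 - s\<^sup>2 / R\<^sup>2)" by simp
    have nn: "0 \<le> 1 - s\<^sup>2 / R\<^sup>2" using s s0 t by (simp add: field_simps power_mono)
    have w: "(1 - (complex_of_real s)\<^sup>2 / (of_real R)\<^sup>2) powr (of_real \<delta>) = of_real (wt \<delta> R s)"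
      unfolding base wt_def using powr_of_real[OF nn] by simp
    have Vs: "of_real (y powr (- \<sigma>)) * V (of_real s) y = - (of_real b / (of_real s * of_real d))"
      proof -
      have "y powr (- \<sigma>) * y powr \<sigma> = 1" using xy by (simp add: powr_minus)
      then have "complex_of_real (y powr (- \<sigma>)) * of_real (y powr \<sigma>) = 1" by (metis of_real_1 of_real_mult)
      moreover have "complex_of_real (y powr (- \<sigma>)) * - (of_real (y powr \<sigma>) * of_real b / (of_real s * of_real d))
        = - ((of_real (y powr (- \<sigma>)) * of_real (y powr \<sigma>)) * of_real b / (of_real s * of_real d))" by simp
      ultimately show ?thesis unfolding V_at_zero[OF s0 s1 xy(3,4)] ry[folded b_def] rs[folded d_def] by (simp only: mult_1_left)
    qed
    have "Nu (of_real s) / g' (of_real s) = of_real (2 * wt \<delta> R s * a * b / (d * d))"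
      unfolding Nu_def w rx[folded a_def] Vs rs[folded d_def] using s0 d0 by (simp add: field_simps)
    also have "2 * wt \<delta> R s * a * b / (d * d) = wt \<delta> R s * pz s x * pz s y"
      unfolding pz_def a_def[symmetric] b_def[symmetric] d_def[symmetric] using d0 by (simp add: field_simps)
    finally show ?thesis unfolding r .
  qed
  define a1 a3 where "a1 = - \<i> * of_real T" and "a3 = of_real t + \<i> * of_real T"
  have a: "Re a1 = 0" "Im a1 = - T" "Re a3 = t" "Im a3 = T" unfolding a1_def a3_def by auto
  have img: "path_image (rectpath a1 a3) \<subseteq> S - pts"
  proof
    fix z assume z: "z \<in> path_image (rectpath a1 a3)"
    then have z': "Re z \<in> {0, t} \<and> Im z \<in> {-T..T} \<or> Im z \<in> {-T, T} \<and> Re z \<in> {0..t}"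
      using a t T by (subst (asm) path_image_rectpath) auto
    then have "z \<in> S" unfolding S_def using \<eta> t by auto
    moreover have "z \<notin> pts" using z' t T \<eta>(1,3) unfolding pts_def by (auto simp: Z_def)
    ultimately show "z \<in> S - pts" by simp
  qed
  have "contour_integral (rectpath a1 a3) (FF \<delta> R x y) = 2 * pi * \<i> * (\<Sum>p\<in>pts. winding_number (rectpath a1 a3) p * residue (FF \<delta> R x y) p)"
  proof (rule Residue_theorem[OF S(1) _ fin holo])
    show "connected S" using S(2) by (rule convex_connected)
    show "\<forall>z. z \<notin> S \<longrightarrow> winding_number (rectpath a1 a3) z = 0"
    proof (intro allI impI winding_number_rectpath_outside)
      fix z assume "z \<notin> S"
      then show "z \<notin> cbox a1 a3" unfolding S_def using a t \<eta> by (auto simp: in_cbox_complex_iff)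
    qed (use a t T in auto)
    show "valid_path (rectpath a1 a3)" "pathfinish (rectpath a1 a3) = pathstart (rectpath a1 a3)" by simp_all
    show "path_image (rectpath a1 a3) \<subseteq> S - pts" by (rule img)
  qed
  also have "(\<Sum>p\<in>pts. winding_number (rectpath a1 a3) p * residue (FF \<delta> R x y) p)
    = (\<Sum>s\<in>Z \<inter> {..<R}. winding_number (rectpath a1 a3) (of_real s) * of_real (wt \<delta> R s * pz s x * pz s y))"
  proof -
    have inj: "inj_on complex_of_real (Z \<inter> {..<R})" by (auto simp: inj_on_def)
    show ?thesis unfolding pts_def sum.reindex[OF inj] o_def by (rule sum.cong[OF refl]) (simp only: res Int_iff lessThan_iff)
  qed
  also have "\<dots> = (\<Sum>s\<in>Z \<inter> {..<t}. of_real (wt \<delta> R s * pz s x * pz s y))"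
  proof (rule sum.mono_neutral_cong_right[OF finite_Z])
    show "\<forall>s\<in>Z \<inter> {..<R} - Z \<inter> {..<t}. winding_number (rectpath a1 a3) (of_real s) * of_real (wt \<delta> R s * pz s x * pz s y) = 0"
    proof
      fix s assume "s \<in> Z \<inter> {..<R} - Z \<inter> {..<t}"
      then have "s > t" using t(3) by (cases "s = t") auto
      then have "winding_number (rectpath a1 a3) (of_real s) = 0"
        using a t T by (intro winding_number_rectpath_outside) (auto simp: in_cbox_complex_iff)
      then show "winding_number (rectpath a1 a3) (of_real s) * of_real (wt \<delta> R s * pz s x * pz s y) = 0" by simp
    qed
    fix s assume "s \<in> Z \<inter> {..<t}"
    then have "winding_number (rectpath a1 a3) (of_real s) = 1"
      using a T by (intro winding_number_rectpath) (auto simp: Z_def in_box_complex_iff)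
    then show "winding_number (rectpath a1 a3) (of_real s) * of_real (wt \<delta> R s * pz s x * pz s y) = of_real (wt \<delta> R s * pz s x * pz s y)" by simp
  qed (use t in auto)
  finally show ?thesis unfolding a1_def a3_def of_real_sum .
qed

lemma FF_holo:
  assumes R: "R > 0" and y: "0 < y" "y \<le> 1" and X: "\<And>z. z \<in> X \<Longrightarrow> \<bar>Re z\<bar> < R \<and> g z \<noteq> 0"
  shows "FF \<delta> R x y holomorphic_on X"
proof -
  have h1: "(\<lambda>z. g (z * of_real x)) holomorphic_on X"
    using holomorphic_on_compose[of "\<lambda>z. z * of_real x" X g] g_holo by (simp add: o_def holomorphic_on_mult)
  have h2: "(\<lambda>z. V z y) holomorphic_on X" by (rule holomorphic_on_subset[OF V_holomorphic[OF y]]) simp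
  have h3: "1 - z\<^sup>2 / (of_real R)\<^sup>2 \<notin> \<real>\<^sub>\<le>\<^sub>0" if "z \<in> X" for z using strip_not_nonpos[of R z] X[OF that] R by auto
  have h4: "(\<lambda>z. (1 - z\<^sup>2 / (of_real R)\<^sup>2) powr (of_real \<delta>)) holomorphic_on X"
    using R by (intro holomorphic_intros) (auto simp: h3)
  show ?thesis unfolding FF_def[abs_def] by (intro holomorphic_intros h1 h2 h4 g_holo) (use X in auto)
qed

text \<open>The powers of |z| cancel and the three exponentials combine to exp(- |Im z| (y - x)).
  The lower bound on \<open>g\<close> is a hypothesis, so that one estimate serves the vertical and
  the horizontal sides of the contour.\<close>

lemma FF_bound:
  assumes c: "c > 0"
  obtains C where "0 < C" "\<And>R x y z. 0 < R \<Longrightarrow> 0 < x \<Longrightarrow> x < y \<Longrightarrow> y \<le> 1 \<Longrightarrow> 1 / R \<le> y - x \<Longrightarrow> 0 \<le> Re z \<Longrightarrow>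
     R / 2 \<le> norm z \<Longrightarrow> norm z \<le> R + \<bar>Im z\<bar> \<Longrightarrow> c * norm z powr (- \<sigma>) * exp \<bar>Im z\<bar> \<le> norm (g z) \<Longrightarrow>
     norm (FF \<delta> R x y z) \<le> C * ((x * y) powr (- \<sigma>) * \<Phi> (R * x)) * norm (1 - z\<^sup>2 / (of_real R)\<^sup>2) powr \<delta>
       * ((1 + \<bar>Im z\<bar> * (y - x)) powr \<bar>\<sigma>\<bar> * exp (- (\<bar>Im z\<bar> * (y - x))))"
proof -
  obtain Cu where Cu: "0 < Cu" "\<And>w. 0 \<le> Re w \<Longrightarrow> w \<noteq> 0 \<Longrightarrow> norm (g w) \<le> Cu * (norm w powr (- \<sigma>) * \<Phi> (norm w)) * exp \<bar>Im w\<bar>"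
    using g_upper by blast
  define C where "C = 2 * Cu * exp (2 * \<bar>\<kappa>\<bar>) / c * 2 powr \<bar>\<sigma>\<bar>"
  show ?thesis
  proof (rule that[of C])
    show "0 < C" unfolding C_def using Cu c by simp
    fix R x y z assume R: "0 < R" and x: "0 < x" "x < y" and y: "y \<le> 1" and h: "1 / R \<le> y - x" and Re: "0 \<le> Re z"
      and z1: "R / 2 \<le> norm z" and z2: "norm z \<le> R + \<bar>Im z\<bar>" and low: "c * norm z powr (- \<sigma>) * exp \<bar>Im z\<bar> \<le> norm (g z)"
    define r where "r = norm z"
    define \<tau> where "\<tau> = \<bar>Im z\<bar>"
    define N where "N = norm (1 - z\<^sup>2 / (of_real R)\<^sup>2) powr \<delta>"
    have r: "r > 0" "z \<noteq> 0" using z1 R unfolding r_def by auto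
    have \<tau>: "\<tau> \<ge> 0" unfolding \<tau>_def by simp
    have y0: "0 < y" using x by simp
    have gx: "norm (g (z * of_real x)) \<le> Cu * (r powr (- \<sigma>) * x powr (- \<sigma>) * \<Phi> (r * x)) * exp (\<tau> * x)"
    proof -
      have "norm (g (z * of_real x)) \<le> Cu * (norm (z * of_real x) powr (- \<sigma>) * \<Phi> (norm (z * of_real x))) * exp \<bar>Im (z * of_real x)\<bar>"
        by (rule Cu(2)) (use Re r x in auto)
      then show ?thesis using x unfolding r_def \<tau>_def by (simp add: norm_mult powr_mult abs_mult)
    qed
    \<comment> \<open>y exceeds y - x \<ge> 1 / R and |z| \<ge> R / 2, so the potential term in the
      bound for \<open>V\<close> costs only the constant exp(2 |\<kappa>|).\<close>
    have ry: "1 / 2 \<le> r * y"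
    proof -
      have "1 / R \<le> y" using h x by simp
      then have "(R / 2) * (1 / R) \<le> r * y" using z1 R unfolding r_def by (intro mult_mono) auto
      then show ?thesis using R by simp
    qed
    have Vy: "norm (V z y) \<le> exp (\<tau> * (1 - y)) * exp (2 * \<bar>\<kappa>\<bar>) / r"
    proof -
      have "\<bar>\<kappa>\<bar> / (r * y) \<le> \<bar>\<kappa>\<bar> / (1 / 2)" using ry by (intro divide_left_mono) auto
      then have "exp (\<tau> * (1 - y) + \<bar>\<kappa>\<bar> / (r * y)) \<le> exp (\<tau> * (1 - y) + 2 * \<bar>\<kappa>\<bar>)" by simp
      moreover have "norm (V z y) \<le> exp (\<tau> * (1 - y) + \<bar>\<kappa>\<bar> / (r * y)) / r"
        using V_bound[OF r(2) y0 y] unfolding r_def \<tau>_def .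
      ultimately have "norm (V z y) \<le> exp (\<tau> * (1 - y) + 2 * \<bar>\<kappa>\<bar>) / r" using r by (meson divide_right_mono less_imp_le order_trans)
      then show ?thesis by (simp add: exp_add)
    qed
    have gz: "c * r powr (- \<sigma>) * exp \<tau> \<le> norm (g z)" using low unfolding r_def \<tau>_def .
    have "norm (FF \<delta> R x y z) = (2 * r * N) * norm (g (z * of_real x)) * (y powr (- \<sigma>) * norm (V z y)) / norm (g z)"
      unfolding FF_def N_def r_def by (simp add: norm_mult norm_divide norm_powr_real_powr')
    also have "\<dots> \<le> (2 * r * N) * (Cu * (r powr (- \<sigma>) * x powr (- \<sigma>) * \<Phi> (r * x)) * exp (\<tau> * x)) *
        (y powr (- \<sigma>) * (exp (\<tau> * (1 - y)) * exp (2 * \<bar>\<kappa>\<bar>) / r)) / (c * r powr (- \<sigma>) * exp \<tau>)"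
      using gx Vy gz r c Cu(1) by (intro frac_le mult_mono mult_nonneg_nonneg \<Phi>_nonneg) (auto simp: N_def intro!: mult_nonneg_nonneg \<Phi>_nonneg)
    also have "\<dots> = (2 * Cu * exp (2 * \<bar>\<kappa>\<bar>) / c) * (x powr (- \<sigma>) * y powr (- \<sigma>)) * \<Phi> (r * x) * N * (exp (\<tau> * x) * exp (\<tau> * (1 - y)) / exp \<tau>)"
      using r c by (simp add: field_simps)
    also have "exp (\<tau> * x) * exp (\<tau> * (1 - y)) / exp \<tau> = exp (- (\<tau> * (y - x)))"
      unfolding exp_add[symmetric] exp_diff[symmetric] by (simp add: algebra_simps)
    also have "x powr (- \<sigma>) * y powr (- \<sigma>) = (x * y) powr (- \<sigma>)" using x by (simp add: powr_mult)
    also have "(2 * Cu * exp (2 * \<bar>\<kappa>\<bar>) / c) * (x * y) powr (- \<sigma>) * \<Phi> (r * x) * N * exp (- (\<tau> * (y - x)))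
       \<le> (2 * Cu * exp (2 * \<bar>\<kappa>\<bar>) / c) * (x * y) powr (- \<sigma>) * ((2 * (1 + \<tau> * (y - x))) powr \<bar>\<sigma>\<bar> * \<Phi> (R * x)) * N * exp (- (\<tau> * (y - x)))"
    proof (intro mult_right_mono mult_left_mono)
      \<comment> \<open>|z| / R is at most 1 + \<tau> / R, and 1 / R \<le> y - x turns this into a
        multiple of 1 + \<tau> (y - x). Moving \<Phi> from |z| x to R x thus costs a polynomial that
        the exponential absorbs.\<close>
      have "\<tau> / R \<le> \<tau> * (y - x)" using mult_left_mono[OF h \<tau>] by simp
      define b where "b = 2 * (1 + \<tau> * (y - x))"
      have b: "1 + \<tau> / R \<le> b" "2 \<le> b" using \<open>\<tau> / R \<le> \<tau> * (y - x)\<close> mult_nonneg_nonneg[OF \<tau>, of "y - x"] x unfolding b_def distrib_left by linarith+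
      have "\<Phi> ((r / R) * (R * x)) \<le> b powr \<bar>\<sigma>\<bar> * \<Phi> (R * x)"
      proof (rule \<Phi>_scale)
        have "1 / b \<le> 1 / 2" using b by (intro frac_le) auto
        also have "1 / 2 \<le> r / R" using z1 R unfolding r_def by (simp add: field_simps)
        finally show "1 / b \<le> r / R" .
        have "r / R \<le> 1 + \<tau> / R" using z2 R unfolding r_def \<tau>_def by (simp add: field_simps)
        then show "r / R \<le> b" using b by simp
      qed (use r R x b in auto)
      then show "\<Phi> (r * x) \<le> (2 * (1 + \<tau> * (y - x))) powr \<bar>\<sigma>\<bar> * \<Phi> (R * x)" unfolding b_def using R by simp
    qed (use Cu c in \<open>auto simp: N_def\<close>)
    also have "(2 * (1 + \<tau> * (y - x))) powr \<bar>\<sigma>\<bar> = 2 powr \<bar>\<sigma>\<bar> * (1 + \<tau> * (y - x)) powr \<bar>\<sigma>\<bar>"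
      by (rule powr_mult)
    finally show "norm (FF \<delta> R x y z) \<le> C * ((x * y) powr (- \<sigma>) * \<Phi> (R * x)) * norm (1 - z\<^sup>2 / (of_real R)\<^sup>2) powr \<delta>
       * ((1 + \<bar>Im z\<bar> * (y - x)) powr \<bar>\<sigma>\<bar> * exp (- (\<bar>Im z\<bar> * (y - x))))"
      unfolding C_def N_def[symmetric] \<tau>_def[symmetric] by (simp add: mult_ac)
  qed
qed

lemma norm_one_minus_sq:
  fixes z :: complex
  assumes "R > 0"
  shows "norm (1 - z\<^sup>2 / (of_real R)\<^sup>2) = norm (of_real R - z) * norm (of_real R + z) / R\<^sup>2"
proof -
  have "1 - z\<^sup>2 / (of_real R)\<^sup>2 = (of_real R - z) * (of_real R + z) / (of_real R)\<^sup>2"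
  proof -
    have "(of_real R - z) * (of_real R + z) = (of_real R)\<^sup>2 - z\<^sup>2" by (simp add: algebra_simps power2_eq_square)
    then show ?thesis using assms by (simp add: diff_divide_distrib)
  qed
  then show ?thesis using assms by (simp add: norm_mult norm_divide norm_power)
qed

lemma integral_inverse_quadratic:
  fixes h T :: real
  assumes "h > 0" "T > 0"
  shows "(\<lambda>\<tau>. 1 / (1 + (\<tau> * h)\<^sup>2)) integrable_on {-T..T}" "integral {-T..T} (\<lambda>\<tau>. 1 / (1 + (\<tau> * h)\<^sup>2)) \<le> pi / h"
proof -
  have "((\<lambda>\<tau>. 1 / (1 + (\<tau> * h)\<^sup>2)) has_integral (arctan (T * h) / h - arctan (- T * h) / h)) {-T..T}"
  proof (rule fundamental_theorem_of_calculus)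
    fix t assume "t \<in> {-T..T}"
    have "((\<lambda>\<tau>. arctan (\<tau> * h) / h) has_real_derivative 1 / (1 + (t * h)\<^sup>2)) (at t)"
      using assms by (auto intro!: derivative_eq_intros simp: inverse_eq_divide)
    then show "((\<lambda>\<tau>. arctan (\<tau> * h) / h) has_vector_derivative 1 / (1 + (t * h)\<^sup>2)) (at t within {-T..T})"
      by (simp add: has_real_derivative_iff_has_vector_derivative has_vector_derivative_at_within)
  qed (use assms in auto)
  moreover have "arctan (T * h) / h - arctan (- T * h) / h \<le> pi / h"
    using arctan_ubound[of "T * h"] arctan_minus[of "T * h"] assms
    unfolding diff_divide_distrib[symmetric] by (intro divide_right_mono) auto
  ultimately show "(\<lambda>\<tau>. 1 / (1 + (\<tau> * h)\<^sup>2)) integrable_on {-T..T}" "integral {-T..T} (\<lambda>\<tau>. 1 / (1 + (\<tau> * h)\<^sup>2)) \<le> pi / h"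
    by (auto simp: has_integral_iff)
qed

text \<open>Trades the exponential for a majorant with an elementary integral: over a vertical line
  it gives pi / (y - x), the last factor of the off-diagonal decay.\<close>

lemma decay_bound:
  fixes s N :: real
  assumes "s \<ge> 0" "N \<ge> 0"
  shows "(1 + s) powr N * exp (- s) \<le> (N + 2) powr (N + 2) * (1 / (1 + s\<^sup>2))"
proof -
  have "(1 + s) powr N * exp (- s) * (1 + s\<^sup>2) \<le> (1 + s) powr N * exp (- s) * (1 + s) powr 2"
  proof (intro mult_left_mono)
    have "1 + s\<^sup>2 \<le> (1 + s)\<^sup>2" using assms by (simp add: power2_sum)
    also have "\<dots> = (1 + s) powr 2" using assms by simp
    finally show "1 + s\<^sup>2 \<le> (1 + s) powr 2" .
  qed simp
  also have "\<dots> = (1 + s) powr (N + 2) * exp (- s)" unfolding powr_add by (simp only: mult_ac)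
  also have "\<dots> \<le> (N + 2) powr (N + 2)" using assms by (intro exp_dominates) auto
  finally show ?thesis using zero_le_power2[of s] by (simp add: pos_le_divide_eq add_pos_nonneg)
qed

text \<open>On a line at bounded distance from R the weight is at most a constant times ((1 + s)^2 /
  (R (y - x))) powr \<delta> with s = |Im z| (y - x), and integrating the decay in s gives one more
  factor 1 / (y - x).\<close>

lemma K_off:
  assumes \<delta>: "\<delta> > 0"
  obtains C R1 where "0 < C" "0 < R1" "\<And>R x y. R1 \<le> R \<Longrightarrow> 0 < x \<Longrightarrow> x < y \<Longrightarrow> y \<le> 1 \<Longrightarrow> 1 / R \<le> y - x \<Longrightarrow>
     \<bar>K \<delta> R x y\<bar> \<le> C * ((x * y) powr (- \<sigma>) * \<Phi> (R * x) * (R powr (- \<delta>) * (y - x) powr (- \<delta> - 1)))"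
proof -
  obtain c r0 \<theta> where c: "0 < c" and r0: "1 \<le> r0" and \<theta>: "\<bar>\<theta>\<bar> \<le> pi"
    and line: "\<And>z n. 0 \<le> Re z \<Longrightarrow> r0 \<le> norm z \<Longrightarrow> Re z = \<theta> + of_nat n * pi \<Longrightarrow> c * norm z powr (- \<sigma>) * exp \<bar>Im z\<bar> \<le> norm (g z)"
    and top: "\<And>z. 0 \<le> Re z \<Longrightarrow> r0 \<le> \<bar>Im z\<bar> \<Longrightarrow> c * norm z powr (- \<sigma>) * exp \<bar>Im z\<bar> \<le> norm (g z)"
    by (rule g_lower) blast
  obtain CF where CF: "0 < CF" "\<And>R x y z. 0 < R \<Longrightarrow> 0 < x \<Longrightarrow> x < y \<Longrightarrow> y \<le> 1 \<Longrightarrow> 1 / R \<le> y - x \<Longrightarrow> 0 \<le> Re z \<Longrightarrow>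
     R / 2 \<le> norm z \<Longrightarrow> norm z \<le> R + \<bar>Im z\<bar> \<Longrightarrow> c * norm z powr (- \<sigma>) * exp \<bar>Im z\<bar> \<le> norm (g z) \<Longrightarrow>
     norm (FF \<delta> R x y z) \<le> CF * ((x * y) powr (- \<sigma>) * \<Phi> (R * x)) * norm (1 - z\<^sup>2 / (of_real R)\<^sup>2) powr \<delta>
       * ((1 + \<bar>Im z\<bar> * (y - x)) powr \<bar>\<sigma>\<bar> * exp (- (\<bar>Im z\<bar> * (y - x))))"
    by (rule FF_bound[OF c, where \<delta> = \<delta>], rule that)
  obtain Cp where Cp: "0 < Cp" "\<And>s x. s \<in> Z \<Longrightarrow> 0 < x \<Longrightarrow> \<bar>pz s x\<bar> \<le> Cp * (x powr (- \<sigma>) * \<Phi> (s * x))"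
    using pz_bound by blast
  obtain \<eta> where \<eta>: "0 < \<eta>" "\<And>x y. x \<in> Z \<Longrightarrow> y \<in> Z \<Longrightarrow> x < y \<Longrightarrow> x + \<eta> \<le> y"
    using Z_spacing by metis
  \<comment> \<open>Large enough that the line t \<ge> R - 2 pi satisfies both t \<ge> r0 and t
    \<ge> R / 2.\<close>
  define R1 where "R1 = 2 * r0 + 4 * pi"
  \<comment> \<open>The total polynomial growth in s: 2 \<delta> from the weight, |\<sigma>| from
    moving \<Phi> to R x.\<close>
  define N where "N = 2 * \<delta> + \<bar>\<sigma>\<bar>"
  have N: "N \<ge> 0" unfolding N_def using \<delta> by simp
  define M where "M = (N + 2) powr (N + 2)"
  have M: "M > 0" unfolding M_def using N by simp
  define C1 where "C1 = CF * (4 * pi) powr \<delta> * M"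
  have C1: "C1 > 0" unfolding C1_def using CF M by simp
  define nz where "nz = 2 * pi / \<eta> + 2"
  define C2 where "C2 = nz * ((4 * pi) powr \<delta> * (Cp * Cp) * (2 powr \<bar>\<sigma>\<bar> * 2 powr \<bar>\<sigma>\<bar>))"
  have nz: "nz > 0" unfolding nz_def using \<eta> by (intro add_nonneg_pos) auto
  have C2: "C2 > 0" unfolding C2_def using nz Cp by simp
  have R1pos: "R1 > 0" unfolding R1_def using r0 pi_gt_zero by linarith
  show ?thesis
  proof (rule that[of "C1 + C2" R1])
    show "0 < C1 + C2" "0 < R1" using C1 C2 R1pos by auto
    fix R x y :: real assume RR: "R1 \<le> R" and x: "0 < x" "x < y" and y: "y \<le> 1" and h: "1 / R \<le> y - x"
    define H where "H = y - x"
    have H: "0 < H" "H \<le> 1" "1 / R \<le> H" unfolding H_def using x y h by auto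
    have R: "R > 0" using RR R1pos by simp
    have y0: "0 < y" using x by simp
    \<comment> \<open>The admissible lines are spaced by pi, so one of them lies between distance pi
      and 2 pi from R: away from the branch point, yet close enough for the weight to be
      small.\<close>
    obtain n :: nat where n: "R - 2 * pi \<le> \<theta> + of_nat n * pi" "\<theta> + of_nat n * pi \<le> R - pi"
    proof -
      define k where "k = \<lfloor>(R - pi - \<theta>) / pi\<rfloor>"
      have "R - pi - \<theta> \<ge> 0" using RR \<theta> r0 pi_gt_zero unfolding R1_def by linarith
      then have "(R - pi - \<theta>) / pi \<ge> 0" using pi_gt_zero by simp
      then have k0: "k \<ge> 0" unfolding k_def by simp
      have "real_of_int k \<le> (R - pi - \<theta>) / pi" "(R - pi - \<theta>) / pi < real_of_int k + 1" unfolding k_def by linarith+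
      then have "real_of_int k * pi \<le> R - pi - \<theta>" "R - pi - \<theta> < (real_of_int k + 1) * pi"
        using pos_le_divide_eq[OF pi_gt_zero] pos_divide_less_eq[OF pi_gt_zero] by blast+
      moreover have e: "real (nat k) = real_of_int k" using k0 by simp
      ultimately show ?thesis by (intro that[of "nat k"]; unfold e distrib_right) linarith+
    qed
    define t where "t = \<theta> + of_nat n * pi"
    have t: "R - 2 * pi \<le> t" "t \<le> R - pi" using n unfolding t_def by auto
    have t2: "R / 2 \<le> t" "r0 \<le> t" "t < R" "0 < t" using t RR r0 pi_gt_zero unfolding R1_def by linarith+
    have glow: "c * norm z powr (- \<sigma>) * exp \<bar>Im z\<bar> \<le> norm (g z)" if "Re z = t" for z
    proof (rule line[of z n])
      show "r0 \<le> norm z" using that t2 abs_Re_le_cmod[of z] by linarith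
    qed (use that t2 t_def in auto)
    have gpos: "g z \<noteq> 0" if "c * norm z powr (- \<sigma>) * exp \<bar>Im z\<bar> \<le> norm (g z)" "z \<noteq> 0" for z
    proof
      assume "g z = 0"
      then have "c * norm z powr (- \<sigma>) * exp \<bar>Im z\<bar> \<le> 0" using that by simp
      moreover have "0 < c * norm z powr (- \<sigma>) * exp \<bar>Im z\<bar>" using c that by simp
      ultimately show False by simp
    qed
    have tZ: "t \<notin> Z" using gpos[OF glow[of "of_real t"]] t2 by (auto simp: Z_g)
    define E where "E = (x * y) powr (- \<sigma>) * \<Phi> (R * x)"
    have E: "E \<ge> 0" unfolding E_def by (simp add: \<Phi>_nonneg)
    have nle: "norm z \<le> R + \<bar>Im z\<bar>" if "0 \<le> Re z" "Re z \<le> R" for z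
      using cmod_le[of z] that by simp
    have rightb: "norm (FF \<delta> R x y z) \<le> C1 * (E * (R powr (- \<delta>) * H powr (- \<delta>))) * (1 / (1 + (Im z * H)\<^sup>2))" if z: "Re z = t" for z
    proof -
      define \<tau> where "\<tau> = \<bar>Im z\<bar>"
      have \<tau>: "\<tau> \<ge> 0" unfolding \<tau>_def by simp
      define s where "s = \<tau> * H"
      have s: "s \<ge> 0" unfolding s_def using \<tau> H by simp
      have sR: "\<tau> / R \<le> s" unfolding s_def using mult_left_mono[OF H(3) \<tau>] by simp
      have "R / 2 \<le> norm z" using z t2 abs_Re_le_cmod[of z] by linarith
      then have "norm (FF \<delta> R x y z) \<le> CF * E * norm (1 - z\<^sup>2 / (of_real R)\<^sup>2) powr \<delta> * ((1 + s) powr \<bar>\<sigma>\<bar> * exp (- s))"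
        unfolding E_def s_def H_def \<tau>_def using z t2 by (intro CF(2) R x y h glow nle) auto
      also have "\<dots> \<le> CF * E * ((4 * pi) * ((1 + s)\<^sup>2 / (R * H))) powr \<delta> * ((1 + s) powr \<bar>\<sigma>\<bar> * exp (- s))"
      proof (intro mult_right_mono mult_left_mono powr_mono2)
        have a: "norm (of_real R - z) \<le> 2 * pi * ((1 + s) / H)"
        proof -
          have "norm (of_real R - z) \<le> \<bar>R - t\<bar> + \<tau>" using cmod_le[of "of_real R - z"] z unfolding \<tau>_def by simp
          also have "\<dots> \<le> 2 * pi * 1 + 2 * pi * \<tau>" 
          proof (intro add_mono)
            show "\<bar>R - t\<bar> \<le> 2 * pi * 1" using t pi_gt_zero by simp
            have "1 * \<tau> \<le> 2 * pi * \<tau>" using \<tau> pi_gt3 by (intro mult_right_mono) auto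
            then show "\<tau> \<le> 2 * pi * \<tau>" by simp
          qed
          also have "\<dots> \<le> 2 * pi * ((1 + s) / H)"
          proof -
            have "1 \<le> 1 / H" using H by simp
            then have "1 + \<tau> \<le> (1 + s) / H" unfolding s_def using H by (simp add: add_divide_distrib)
            then have "2 * pi * (1 + \<tau>) \<le> 2 * pi * ((1 + s) / H)" by (intro mult_left_mono) auto
            then show ?thesis by (simp add: distrib_left)
          qed
          finally show ?thesis .
        qed
        have b: "norm (of_real R + z) \<le> 2 * R * (1 + s)"
        proof -
          have "norm (of_real R + z) \<le> \<bar>R + t\<bar> + \<tau>" using cmod_le[of "of_real R + z"] z unfolding \<tau>_def by simp
          also have "\<dots> \<le> 2 * R + 2 * \<tau>" using t2 \<tau> by simp
          also have "\<dots> = 2 * R * (1 + \<tau> / R)" using R by (simp add: field_simps)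
          also have "\<dots> \<le> 2 * R * (1 + s)" using sR R by (intro mult_left_mono) auto
          finally show ?thesis .
        qed
        have "norm (1 - z\<^sup>2 / (of_real R)\<^sup>2) \<le> (2 * pi * ((1 + s) / H)) * (2 * R * (1 + s)) / R\<^sup>2"
          unfolding norm_one_minus_sq[OF R] using a b s H R by (intro divide_right_mono mult_mono) auto
        also have "\<dots> = (4 * pi) * ((1 + s)\<^sup>2 / (R * H))" using R H by (simp add: field_simps power2_eq_square)
        finally show "norm (1 - z\<^sup>2 / (of_real R)\<^sup>2) \<le> (4 * pi) * ((1 + s)\<^sup>2 / (R * H))" .
      qed (use CF E \<delta> s in auto)
      also have "((4 * pi) * ((1 + s)\<^sup>2 / (R * H))) powr \<delta> = (4 * pi) powr \<delta> * ((1 + s) powr (2 * \<delta>) * (R powr (- \<delta>) * H powr (- \<delta>)))"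
      proof -
        have "((1 + s)\<^sup>2) powr \<delta> = (1 + s) powr (2 * \<delta>)" using s by (simp add: powr_powr flip: powr_numeral)
        moreover have "((4 * pi) * ((1 + s)\<^sup>2 / (R * H))) powr \<delta> = (4 * pi) powr \<delta> * (((1 + s)\<^sup>2) powr \<delta> / (R powr \<delta> * H powr \<delta>))"
          using s R H by (simp add: powr_mult powr_divide)
        ultimately show ?thesis by (simp add: powr_minus divide_inverse mult_ac)
      qed
      also have "CF * E * ((4 * pi) powr \<delta> * ((1 + s) powr (2 * \<delta>) * (R powr (- \<delta>) * H powr (- \<delta>)))) * ((1 + s) powr \<bar>\<sigma>\<bar> * exp (- s))
        = (CF * (4 * pi) powr \<delta> * (E * (R powr (- \<delta>) * H powr (- \<delta>)))) * ((1 + s) powr N * exp (- s))"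
        unfolding N_def powr_add by (simp only: mult_ac)
      also have "\<dots> \<le> (CF * (4 * pi) powr \<delta> * (E * (R powr (- \<delta>) * H powr (- \<delta>)))) * (M * (1 / (1 + s\<^sup>2)))"
        unfolding M_def using CF E by (intro mult_left_mono decay_bound s N) auto
      also have "s\<^sup>2 = (Im z * H)\<^sup>2" unfolding s_def \<tau>_def by (simp add: power_mult_distrib)
      finally show ?thesis unfolding C1_def by (simp only: mult_ac)
    qed
    define P where "P = (\<Sum>s\<in>Z \<inter> {..<t}. wt \<delta> R s * pz s x * pz s y)"
    have main: "\<bar>P\<bar> \<le> C1 * (E * (R powr (- \<delta>) * H powr (- \<delta> - 1)))"
    proof -
      define D where "D = C1 * (E * (R powr (- \<delta>) * H powr (- \<delta>)))"
      have D: "D \<ge> 0" unfolding D_def using C1 E by simp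
      define D2 where "D2 = CF * E * 4 powr \<delta> * M"
      have D2: "D2 \<ge> 0" unfolding D2_def using CF E M by simp
      \<comment> \<open>T is the height of the rectangle. The second summand bounds the two
        horizontal sides and is removed by letting T tend to infinity.\<close>
      have est: "2 * pi * \<bar>P\<bar> \<le> D * (pi / H) + 2 * (D2 * (1 / (1 + (T * H)\<^sup>2)) * t)" if T: "T \<ge> R + r0" for T
      proof -
        have T0: "T > 0" "T \<ge> R" "T \<ge> r0" using T R r0 by auto
        have topb: "norm (FF \<delta> R x y z) \<le> D2 * (1 / (1 + (T * H)\<^sup>2))" if z: "0 \<le> Re z" "Re z \<le> t" "\<bar>Im z\<bar> = T" for z
        proof -
          define s where "s = T * H"
          have s: "s \<ge> 0" unfolding s_def using T0 H by simp
          have sR: "T / R \<le> s" unfolding s_def using mult_left_mono[OF H(3), of T] T0 by simp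
          have "R / 2 \<le> norm z" using z T0 R abs_Im_le_cmod[of z] by linarith
          then have "norm (FF \<delta> R x y z) \<le> CF * E * norm (1 - z\<^sup>2 / (of_real R)\<^sup>2) powr \<delta> * ((1 + s) powr \<bar>\<sigma>\<bar> * exp (- s))"
            unfolding E_def s_def H_def z(3)[symmetric] using z t2 T0 by (intro CF(2) R x y h top nle) auto
          also have "\<dots> \<le> CF * E * (4 * (1 + s)\<^sup>2) powr \<delta> * ((1 + s) powr \<bar>\<sigma>\<bar> * exp (- s))"
          proof (intro mult_right_mono mult_left_mono powr_mono2)
            have ab: "norm (of_real R - z) \<le> 2 * R * (1 + s)" "norm (of_real R + z) \<le> 2 * R * (1 + s)"
            proof -
              have "norm (of_real R - z) \<le> \<bar>R - Re z\<bar> + T" "norm (of_real R + z) \<le> \<bar>R + Re z\<bar> + T"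
                using cmod_le[of "of_real R - z"] cmod_le[of "of_real R + z"] z by auto
              moreover have "\<bar>R - Re z\<bar> + T \<le> 2 * R + 2 * T" "\<bar>R + Re z\<bar> + T \<le> 2 * R + 2 * T" using z t2 T0 R by auto
              moreover have "2 * R + 2 * T = 2 * R * (1 + T / R)" using R by (simp add: field_simps)
              moreover have "2 * R * (1 + T / R) \<le> 2 * R * (1 + s)" using sR R by (intro mult_left_mono) auto
              ultimately show "norm (of_real R - z) \<le> 2 * R * (1 + s)" "norm (of_real R + z) \<le> 2 * R * (1 + s)" by linarith+
            qed
            have "norm (1 - z\<^sup>2 / (of_real R)\<^sup>2) \<le> (2 * R * (1 + s)) * (2 * R * (1 + s)) / R\<^sup>2"
              unfolding norm_one_minus_sq[OF R] using ab s R by (intro divide_right_mono mult_mono) auto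
            also have "\<dots> = 4 * (1 + s)\<^sup>2" using R by (simp add: field_simps power2_eq_square)
            finally show "norm (1 - z\<^sup>2 / (of_real R)\<^sup>2) \<le> 4 * (1 + s)\<^sup>2" .
          qed (use CF E \<delta> s in auto)
          also have "(4 * (1 + s)\<^sup>2) powr \<delta> = 4 powr \<delta> * (1 + s) powr (2 * \<delta>)"
          proof -
            have "((1 + s)\<^sup>2) powr \<delta> = (1 + s) powr (2 * \<delta>)" using s by (simp add: powr_powr flip: powr_numeral)
            then show ?thesis using s by (simp add: powr_mult)
          qed
          also have "CF * E * (4 powr \<delta> * (1 + s) powr (2 * \<delta>)) * ((1 + s) powr \<bar>\<sigma>\<bar> * exp (- s))
            = (CF * E * 4 powr \<delta>) * ((1 + s) powr N * exp (- s))"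
            unfolding N_def powr_add by (simp only: mult_ac)
          also have "\<dots> \<le> (CF * E * 4 powr \<delta>) * (M * (1 / (1 + s\<^sup>2)))"
            unfolding M_def using CF E by (intro mult_left_mono decay_bound s N) auto
          finally show ?thesis unfolding D2_def s_def by (simp only: mult_ac)
        qed
        define F where "F = FF \<delta> R x y"
        define a1 a2 a3 a4 where "a1 = - \<i> * of_real T" and "a2 = Complex t (- T)" and "a3 = of_real t + \<i> * of_real T" and "a4 = \<i> * of_real T"
        have rp: "rectpath a1 a3 = linepath a1 a2 +++ linepath a2 a3 +++ linepath a3 a4 +++ linepath a4 a1"
        proof -
          have "Complex (Re a3) (Im a1) = a2" "Complex (Re a1) (Im a3) = a4"
            unfolding a1_def a2_def a3_def a4_def by (simp_all add: complex_eq_iff)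
          then show ?thesis unfolding rectpath_def Let_def by simp
        qed
        have seg1: "0 \<le> Re z" "Re z \<le> t" "Im z = - T" if "z \<in> closed_segment a1 a2" for z
          using that t2 closed_segment_same_Im[of a1 a2] unfolding a1_def a2_def by (auto simp: closed_segment_eq_real_ivl)
        have seg2: "Re z = t" if "z \<in> closed_segment a2 a3" for z
          using that closed_segment_same_Re[of a2 a3] unfolding a2_def a3_def by auto
        have seg3: "0 \<le> Re z" "Re z \<le> t" "Im z = T" if "z \<in> closed_segment a3 a4" for z
          using that t2 closed_segment_same_Im[of a3 a4] unfolding a3_def a4_def by (auto simp: closed_segment_eq_real_ivl)
        have seg4: "Re z = 0" if "z \<in> closed_segment a4 a1" for z
          using that closed_segment_same_Re[of a4 a1] unfolding a4_def a1_def by auto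
        have hol: "F contour_integrable_on linepath a b" if "\<And>z. z \<in> closed_segment a b \<Longrightarrow> \<bar>Re z\<bar> < R \<and> g z \<noteq> 0" for a b
          unfolding F_def by (intro contour_integrable_continuous_linepath holomorphic_on_imp_continuous_on FF_holo that R y0 y) auto
        have i1: "F contour_integrable_on linepath a1 a2"
        proof (rule hol)
          fix z assume "z \<in> closed_segment a1 a2"
          then have z: "0 \<le> Re z" "Re z \<le> t" "Im z = - T" using seg1 by auto
          then have "g z \<noteq> 0" using T0 by (intro gpos top) auto
          then show "\<bar>Re z\<bar> < R \<and> g z \<noteq> 0" using z t2 by simp
        qed
        have i2: "F contour_integrable_on linepath a2 a3"
        proof (rule hol)
          fix z assume "z \<in> closed_segment a2 a3"
          then have z: "Re z = t" using seg2 by auto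
          then have "g z \<noteq> 0" using t2 by (intro gpos glow) auto
          then show "\<bar>Re z\<bar> < R \<and> g z \<noteq> 0" using z t2 by simp
        qed
        have i3: "F contour_integrable_on linepath a3 a4"
        proof (rule hol)
          fix z assume "z \<in> closed_segment a3 a4"
          then have z: "0 \<le> Re z" "Re z \<le> t" "Im z = T" using seg3 by auto
          then have "g z \<noteq> 0" using T0 by (intro gpos top) auto
          then show "\<bar>Re z\<bar> < R \<and> g z \<noteq> 0" using z t2 by simp
        qed
        have i4: "F contour_integrable_on linepath a4 a1"
        proof (rule hol)
          fix z assume "z \<in> closed_segment a4 a1"
          then have z: "Re z = 0" using seg4 by auto
          then have "z = \<i> * of_real (Im z)" by (simp add: complex_eq_iff)
          then have "g z \<noteq> 0" using g_imag_axis[of "Im z"] by auto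
          then show "\<bar>Re z\<bar> < R \<and> g z \<noteq> 0" using z R by simp
        qed
        have n1: "norm (contour_integral (linepath a1 a2) F) \<le> D2 * (1 / (1 + (T * H)\<^sup>2)) * norm (a2 - a1)"
          by (rule contour_integral_bound_linepath[OF i1]) (use D2 topb seg1 T0 in \<open>auto simp: F_def add_nonneg_nonneg\<close>)
        have n3: "norm (contour_integral (linepath a3 a4) F) \<le> D2 * (1 / (1 + (T * H)\<^sup>2)) * norm (a4 - a3)"
          by (rule contour_integral_bound_linepath[OF i3]) (use D2 topb seg3 T0 in \<open>auto simp: F_def add_nonneg_nonneg\<close>)
        have len: "norm (a2 - a1) = t" "norm (a4 - a3) = t" 
        proof -
          have "a2 - a1 = of_real t" "a4 - a3 = - of_real t" unfolding a1_def a2_def a3_def a4_def by (simp_all add: complex_eq_iff)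
          then show "norm (a2 - a1) = t" "norm (a4 - a3) = t" using t2 by simp_all
        qed
        have n4: "contour_integral (linepath a4 a1) F = 0"
        proof -
          have "a1 = - a4" unfolding a1_def a4_def by simp
          then show ?thesis unfolding F_def using contour_integral_odd_linepath[where f = "FF \<delta> R x y" and a = a4, OF FF_odd] by simp
        qed
        have n2: "norm (contour_integral (linepath a2 a3) F) \<le> D * (pi / H)"
        proof -
          have eq: "contour_integral (linepath a2 a3) F = \<i> * integral {-T..T} (\<lambda>\<tau>. F (Complex t \<tau>))"
            by (rule contour_integral_linepath_same_Re) (use T0 in \<open>auto simp: a2_def a3_def\<close>)
          have "norm (integral {-T..T} (\<lambda>\<tau>. F (Complex t \<tau>))) \<le> integral {-T..T} (\<lambda>\<tau>. D * (1 / (1 + (\<tau> * H)\<^sup>2)))"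
          proof (rule integral_norm_bound_integral)
            have "continuous_on {-T..T} (F \<circ> (\<lambda>\<tau>. Complex t \<tau>))"
            proof (rule continuous_on_compose)
              show "continuous_on {-T..T} (Complex t)"
                unfolding Complex_eq by (intro continuous_intros)
              show "continuous_on (Complex t ` {-T..T}) F" unfolding F_def
              proof (intro holomorphic_on_imp_continuous_on FF_holo R y0 y)
                fix z assume "z \<in> Complex t ` {-T..T}"
                then have z: "Re z = t" by auto
                then have "g z \<noteq> 0" using t2 by (intro gpos glow) auto
                then show "\<bar>Re z\<bar> < R \<and> g z \<noteq> 0" using z t2 by simp
              qed
            qed
            then show "(\<lambda>\<tau>. F (Complex t \<tau>)) integrable_on {-T..T}"
              by (intro integrable_continuous_real) (simp add: o_def)
            show "(\<lambda>\<tau>. D * (1 / (1 + (\<tau> * H)\<^sup>2))) integrable_on {-T..T}"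
              using integrable_on_cmult_left[OF integral_inverse_quadratic(1)[OF H(1) T0(1)], of D] by simp
            show "norm (F (Complex t \<tau>)) \<le> D * (1 / (1 + (\<tau> * H)\<^sup>2))" for \<tau>
              using rightb[of "Complex t \<tau>"] unfolding F_def D_def by simp
          qed
          also have "\<dots> = D * integral {-T..T} (\<lambda>\<tau>. 1 / (1 + (\<tau> * H)\<^sup>2))" by (rule integral_mult_right)
          also have "\<dots> \<le> D * (pi / H)" by (rule mult_left_mono[OF integral_inverse_quadratic(2)[OF H(1) T0(1)] D])
          finally show ?thesis unfolding eq by (simp add: norm_mult)
        qed
        have "contour_integral (rectpath a1 a3) F = contour_integral (linepath a1 a2) F + (contour_integral (linepath a2 a3) F
           + (contour_integral (linepath a3 a4) F + contour_integral (linepath a4 a1) F))"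
          unfolding rp using i1 i2 i3 i4 by (simp add: contour_integrable_joinI)
        moreover have "contour_integral (rectpath a1 a3) F = 2 * pi * \<i> * of_real P"
          unfolding a1_def a3_def F_def P_def by (rule FF_residue_sum[OF \<delta> t2(4,3) tZ T0(1)]) (use x y y0 in auto)
        ultimately have "2 * pi * \<i> * of_real P = contour_integral (linepath a1 a2) F + (contour_integral (linepath a2 a3) F
           + contour_integral (linepath a3 a4) F)" using n4 by simp
        then have "norm (2 * pi * \<i> * complex_of_real P) \<le> D2 * (1 / (1 + (T * H)\<^sup>2)) * t + (D * (pi / H) + D2 * (1 / (1 + (T * H)\<^sup>2)) * t)"
          using norm_triangle_mono[OF n1[unfolded len] norm_triangle_mono[OF n2 n3[unfolded len]]] by simp
        then show ?thesis by (simp add: norm_mult)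
      qed
      have "2 * pi * \<bar>P\<bar> \<le> D * (pi / H) + 2 * (D2 * 0 * t)"
      proof (rule tendsto_lowerbound)
        have "filterlim (\<lambda>T::real. 1 + (T * H)\<^sup>2) at_top at_top" using H by real_asymp
        then have "((\<lambda>T::real. 1 / (1 + (T * H)\<^sup>2)) \<longlongrightarrow> 0) at_top"
          by (intro tendsto_divide_0[OF tendsto_const] filterlim_at_top_imp_at_infinity)
        then show "((\<lambda>T. D * (pi / H) + 2 * (D2 * (1 / (1 + (T * H)\<^sup>2)) * t)) \<longlongrightarrow> D * (pi / H) + 2 * (D2 * 0 * t)) at_top"
          by (intro tendsto_intros)
        show "\<forall>\<^sub>F T in at_top. 2 * pi * \<bar>P\<bar> \<le> D * (pi / H) + 2 * (D2 * (1 / (1 + (T * H)\<^sup>2)) * t)"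
          using eventually_ge_at_top[of "R + r0"] by eventually_elim (rule est)
      qed simp
      then have "pi * (2 * \<bar>P\<bar>) \<le> pi * (D / H)" by (simp add: mult_ac)
      then have "2 * \<bar>P\<bar> \<le> D / H" using pi_gt_zero by (simp only: mult_le_cancel_left_pos)
      moreover have "0 \<le> D / H" using D H by simp
      ultimately have "\<bar>P\<bar> \<le> D / H" by linarith
      also have "D / H = C1 * (E * (R powr (- \<delta>) * H powr (- \<delta> - 1)))"
        unfolding D_def using H by (simp add: powr_diff)
      finally show ?thesis .
    qed
    define Q where "Q = (\<Sum>s\<in>Z \<inter> {t<..<R}. wt \<delta> R s * pz s x * pz s y)"
    have KPQ: "K \<delta> R x y = P + Q"
    proof -
      have un: "Z \<inter> {..<R} = (Z \<inter> {..<t}) \<union> (Z \<inter> {t<..<R})" using t2(3) tZ by (auto simp: not_less less_le)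
      have "finite (Z \<inter> {t<..<R})" by (rule finite_subset[OF _ finite_Z[of R]]) auto
      then show ?thesis unfolding K_def P_def Q_def un by (intro sum.union_disjoint finite_Z) auto
    qed
    \<comment> \<open>The zeros between t and R are within 2 pi of R, so each weight is O(R powr (-
      \<delta>)); the spacing of zeros bounds how many there are, and R y \<ge> 1 removes \<Phi> (R
      y).\<close>
    have Qb: "\<bar>Q\<bar> \<le> C2 * (E * R powr (- \<delta>))"
    proof -
      have tm: "\<bar>wt \<delta> R s * pz s x * pz s y\<bar> \<le> ((4 * pi) powr \<delta> * (Cp * Cp) * (2 powr \<bar>\<sigma>\<bar> * 2 powr \<bar>\<sigma>\<bar>)) * (E * R powr (- \<delta>))"
        if s: "s \<in> Z" "t < s" "s < R" for s
      proof -
        have s0: "s > 0" using s by (simp add: Z_def)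
        have w: "\<bar>wt \<delta> R s\<bar> \<le> (4 * pi) powr \<delta> * R powr (- \<delta>)"
        proof -
          have "1 - s\<^sup>2 / R\<^sup>2 = (R - s) * (R + s) / R\<^sup>2" using R by (simp add: field_simps power2_eq_square)
          also have "\<dots> \<le> (2 * pi) * (2 * R) / R\<^sup>2" using s t s0 R by (intro divide_right_mono mult_mono) auto
          also have "\<dots> = 4 * pi / R" using R by (simp add: power2_eq_square)
          finally have "1 - s\<^sup>2 / R\<^sup>2 \<le> 4 * pi / R" .
          moreover have "0 \<le> 1 - s\<^sup>2 / R\<^sup>2" using s s0 R by (simp add: field_simps power_mono)
          ultimately have "wt \<delta> R s \<le> (4 * pi / R) powr \<delta>" unfolding wt_def using \<delta> by (intro powr_mono2) auto
          also have "(4 * pi / R) powr \<delta> = (4 * pi) powr \<delta> * R powr (- \<delta>)"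
            using powr_divide[of "4 * pi" R \<delta>] powr_minus_divide[of R \<delta>] R by simp
          finally show ?thesis unfolding wt_def by simp
        qed
        have ph: "\<Phi> (s * v) \<le> 2 powr \<bar>\<sigma>\<bar> * \<Phi> (R * v)" if "v > 0" for v
        proof -
          have "1 / 2 \<le> s / R" using s t2 R by (simp add: field_simps)
          moreover have "s / R \<le> 1" using s R by simp
          ultimately have "s / R \<le> 2" "1 / 2 \<le> s / R" by linarith+
          then have "\<Phi> ((s / R) * (R * v)) \<le> 2 powr \<bar>\<sigma>\<bar> * \<Phi> (R * v)"
            using s0 R that by (intro \<Phi>_scale) auto
          then show ?thesis using R by simp
        qed
        have "1 / R \<le> y" using h x by simp
        then have "\<Phi> (R * y) = 1" using R by (intro \<Phi>_ge1) (simp add: field_simps)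
        then have phy: "\<Phi> (s * y) \<le> 2 powr \<bar>\<sigma>\<bar>" using ph[OF y0] by simp
        have "\<bar>wt \<delta> R s * pz s x * pz s y\<bar> = \<bar>wt \<delta> R s\<bar> * (\<bar>pz s x\<bar> * \<bar>pz s y\<bar>)" by (simp add: abs_mult)
        also have "\<dots> \<le> ((4 * pi) powr \<delta> * R powr (- \<delta>)) * ((Cp * (x powr (- \<sigma>) * (2 powr \<bar>\<sigma>\<bar> * \<Phi> (R * x)))) * (Cp * (y powr (- \<sigma>) * 2 powr \<bar>\<sigma>\<bar>)))"
        proof (intro mult_mono w)
          show "\<bar>pz s x\<bar> \<le> Cp * (x powr (- \<sigma>) * (2 powr \<bar>\<sigma>\<bar> * \<Phi> (R * x)))"
            by (rule order_trans[OF Cp(2)[OF s(1) x(1)]]) (use Cp(1) ph[OF x(1)] in \<open>auto intro!: mult_left_mono\<close>)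
          show "\<bar>pz s y\<bar> \<le> Cp * (y powr (- \<sigma>) * 2 powr \<bar>\<sigma>\<bar>)"
            by (rule order_trans[OF Cp(2)[OF s(1) y0]]) (use Cp(1) phy in \<open>auto intro!: mult_left_mono\<close>)
        qed (use Cp(1) in \<open>auto intro!: mult_nonneg_nonneg \<Phi>_nonneg\<close>)
        also have "\<dots> = ((4 * pi) powr \<delta> * (Cp * Cp) * (2 powr \<bar>\<sigma>\<bar> * 2 powr \<bar>\<sigma>\<bar>)) * (((x powr (- \<sigma>) * y powr (- \<sigma>)) * \<Phi> (R * x)) * R powr (- \<delta>))"
          by (simp only: mult_ac)
        also have "x powr (- \<sigma>) * y powr (- \<sigma>) = (x * y) powr (- \<sigma>)" using x by (simp add: powr_mult)
        finally show ?thesis unfolding E_def .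
      qed
      define X where "X = ((4 * pi) powr \<delta> * (Cp * Cp) * (2 powr \<bar>\<sigma>\<bar> * 2 powr \<bar>\<sigma>\<bar>)) * (E * R powr (- \<delta>))"
      have X: "X \<ge> 0" unfolding X_def using Cp E by simp
      have "\<bar>Q\<bar> \<le> (\<Sum>s\<in>Z \<inter> {t<..<R}. \<bar>wt \<delta> R s * pz s x * pz s y\<bar>)" unfolding Q_def by (rule sum_abs)
      also have "\<dots> \<le> real (card (Z \<inter> {t<..<R})) * X"
        by (rule sum_bounded_above) (use tm in \<open>auto simp: X_def\<close>)
      also have "\<dots> \<le> nz * X"
      proof (intro mult_right_mono X)
        define fl where "fl = (\<lambda>s::real. nat \<lfloor>(s - t) / \<eta>\<rfloor>)"
        have "inj_on fl (Z \<inter> {t<..<R})"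
        proof (rule linorder_inj_onI')
          fix a b assume ab: "a \<in> Z \<inter> {t<..<R}" "b \<in> Z \<inter> {t<..<R}" "a < b"
          have "(a - t) / \<eta> + 1 \<le> (b - t) / \<eta>"
            using divide_right_mono[of "a - t + \<eta>" "b - t" \<eta>] \<eta>(2)[of a b] ab \<eta>(1) by (simp add: add_divide_distrib)
          moreover have "0 \<le> (a - t) / \<eta>" using ab \<eta> by simp
          ultimately have "\<lfloor>(a - t) / \<eta>\<rfloor> + 1 \<le> \<lfloor>(b - t) / \<eta>\<rfloor>" "\<lfloor>(a - t) / \<eta>\<rfloor> \<ge> 0" by linarith+
          then show "fl a \<noteq> fl b" unfolding fl_def by linarith
        qed
        moreover have "fl ` (Z \<inter> {t<..<R}) \<subseteq> {..nat \<lfloor>2 * pi / \<eta>\<rfloor>}"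
        proof
          fix k assume "k \<in> fl ` (Z \<inter> {t<..<R})"
          then obtain s where "k = fl s" "s < R" by auto
          then show "k \<in> {..nat \<lfloor>2 * pi / \<eta>\<rfloor>}" unfolding fl_def using t \<eta>(1) by (auto intro!: nat_mono floor_mono divide_right_mono)
        qed
        ultimately have "card (Z \<inter> {t<..<R}) \<le> card {..nat \<lfloor>2 * pi / \<eta>\<rfloor>}" by (intro card_inj_on_le) auto
        then have "real (card (Z \<inter> {t<..<R})) \<le> real (nat \<lfloor>2 * pi / \<eta>\<rfloor>) + 1" by simp
        moreover have "real (nat \<lfloor>2 * pi / \<eta>\<rfloor>) \<le> 2 * pi / \<eta>" using \<eta> by simp
        ultimately show "real (card (Z \<inter> {t<..<R})) \<le> nz" unfolding nz_def by linarith
      qed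
      finally show ?thesis unfolding X_def C2_def by (simp only: mult_ac)
    qed
    \<comment> \<open>The leftover zeros show no decay in y - x, but y - x \<le> 1, so the factor
      can be inserted for free.\<close>
    have "1 \<le> H powr (- \<delta> - 1)" using H \<delta> powr_mono2'[of "- \<delta> - 1" H 1] by simp
    then have "(E * R powr (- \<delta>)) * 1 \<le> (E * R powr (- \<delta>)) * H powr (- \<delta> - 1)" using E by (intro mult_left_mono) auto
    then have "E * R powr (- \<delta>) \<le> E * (R powr (- \<delta>) * H powr (- \<delta> - 1))" by (simp only: mult_1_right mult.assoc)
    from mult_left_mono[OF this less_imp_le[OF C2]]
    have C2b: "C2 * (E * R powr (- \<delta>)) \<le> C2 * (E * (R powr (- \<delta>) * H powr (- \<delta> - 1)))" .
    have "\<bar>K \<delta> R x y\<bar> \<le> (C1 + C2) * (E * (R powr (- \<delta>) * H powr (- \<delta> - 1)))"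
      unfolding KPQ distrib_right using main Qb C2b abs_triangle_ineq[of P Q] by linarith
    then show "\<bar>K \<delta> R x y\<bar> \<le> (C1 + C2) * ((x * y) powr (- \<sigma>) * \<Phi> (R * x) * (R powr (- \<delta>) * (y - x) powr (- \<delta> - 1)))"
      unfolding E_def H_def .
  qed
qed

end

section \<open>The maximal function\<close>

text \<open>If three intervals share a point, one of them lies in the union of the other two.\<close>
lemma finite_intervals_overlap:
  fixes F :: "(real \<times> real) set"
  assumes "finite F"
  obtains G where "G \<subseteq> F" "(\<Union>I\<in>G. {fst I<..<snd I}) = (\<Union>I\<in>F. {fst I<..<snd I})"
    "\<And>x. card {I \<in> G. x \<in> {fst I<..<snd I}} \<le> 2"
proof -
  have "\<exists>G. G \<subseteq> F \<and> (\<Union>I\<in>G. {fst I<..<snd I}) = (\<Union>I\<in>F. {fst I<..<snd I}) \<and>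
    (\<forall>x. card {I \<in> G. x \<in> {fst I<..<snd I}} \<le> 2)"
    using assms
  proof (induction F rule: finite_psubset_induct)
    case (psubset F)
    show ?case
    proof (cases "\<forall>x. card {I \<in> F. x \<in> {fst I<..<snd I}} \<le> 2")
      case True
      then show ?thesis by blast
    next
      case False
      then obtain x where x: "\<not> card {I \<in> F. x \<in> {fst I<..<snd I}} \<le> 2" by blast
      define S where "S = {I \<in> F. x \<in> {fst I<..<snd I}}"
      have S: "finite S" "card S > 2" using x psubset.hyps unfolding S_def by auto
      then have S2: "S \<noteq> {}" by auto
      \<comment> \<open>Among the intervals through x, keep the one that reaches furthest left and
        the one that reaches furthest right; any other is covered by these two.\<close>
      obtain I1 where "I1 \<in> S" "fst I1 = Min (fst ` S)" using Min_in[of "fst ` S"] S S2 by fastforce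
      then have I1: "I1 \<in> S" "\<And>I. I \<in> S \<Longrightarrow> fst I1 \<le> fst I" using S by auto
      obtain I2 where "I2 \<in> S" "snd I2 = Max (snd ` S)" using Max_in[of "snd ` S"] S S2 by fastforce
      then have I2: "I2 \<in> S" "\<And>I. I \<in> S \<Longrightarrow> snd I \<le> snd I2" using S by auto
      have "\<not> S \<subseteq> {I1, I2}"
      proof
        assume "S \<subseteq> {I1, I2}"
        then have "card S \<le> card {I1, I2}" by (intro card_mono) auto
        also have "\<dots> \<le> 2" by (simp add: card_insert_if)
        finally show False using S by simp
      qed
      then obtain I3 where I3: "I3 \<in> S" "I3 \<noteq> I1" "I3 \<noteq> I2" by blast
      have sub: "{fst I3<..<snd I3} \<subseteq> {fst I1<..<snd I1} \<union> {fst I2<..<snd I2}"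
      proof
        fix y assume y: "y \<in> {fst I3<..<snd I3}"
        have "fst I1 \<le> fst I3" "snd I3 \<le> snd I2" "x < snd I1" "fst I2 < x"
          using I1 I2 I3 unfolding S_def by auto
        then show "y \<in> {fst I1<..<snd I1} \<union> {fst I2<..<snd I2}" using y by (cases "y < x") auto
      qed
      have "F - {I3} \<subset> F" using I3 unfolding S_def by auto
      from psubset.IH[OF this] obtain G where G: "G \<subseteq> F - {I3}" "(\<Union>I\<in>G. {fst I<..<snd I}) = (\<Union>I\<in>F - {I3}. {fst I<..<snd I})"
        "\<forall>x. card {I \<in> G. x \<in> {fst I<..<snd I}} \<le> 2" by blast
      have "(\<Union>I\<in>F - {I3}. {fst I<..<snd I}) = (\<Union>I\<in>F. {fst I<..<snd I})"
      proof
        show "(\<Union>I\<in>F. {fst I<..<snd I}) \<subseteq> (\<Union>I\<in>F - {I3}. {fst I<..<snd I})"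
        proof
          fix y assume "y \<in> (\<Union>I\<in>F. {fst I<..<snd I})"
          then obtain I where I: "I \<in> F" "y \<in> {fst I<..<snd I}" by blast
          have "I1 \<in> F - {I3}" "I2 \<in> F - {I3}" using I1 I2 I3 unfolding S_def by auto
          then show "y \<in> (\<Union>I\<in>F - {I3}. {fst I<..<snd I})" using I sub by (cases "I = I3") blast+
        qed
      qed auto
      then show ?thesis using G by (intro exI[of _ G]) auto
    qed
  qed
  then show ?thesis using that by blast
qed

text \<open>The set where the uncentred maximal function of F exceeds l. As a union of open
  intervals it is open, hence Borel; the averages are compared without division, so intervals of
  measure 0 need no convention.\<close>

definition bad_set :: "real measure \<Rightarrow> (real \<Rightarrow> ennreal) \<Rightarrow> ennreal \<Rightarrow> real set" where
  "bad_set M F l = (\<Union>I\<in>{I. l * emeasure M {fst I<..<snd I} < (\<integral>\<^sup>+x\<in>{fst I<..<snd I}. F x \<partial>M)}. {fst I<..<snd I})"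

lemma open_bad_set: "open (bad_set M F l)"
  unfolding bad_set_def by auto

text \<open>Thinning to overlap at most 2 replaces the usual dilation of the selected intervals; the
  constant is 2 for every Borel measure, and no doubling enters. Lindelof and increasing finite
  unions pass from finite families to the whole union.\<close>

lemma weak_type_maximal:
  assumes sets: "sets M = sets borel" and F[measurable]: "F \<in> borel_measurable M"
  shows "l * emeasure M (bad_set M F l) \<le> 2 * (\<integral>\<^sup>+x. F x \<partial>M)"
proof -
  note [measurable_cong] = sets
  have fin: "l * emeasure M (\<Union>I\<in>H. {fst I<..<snd I}) \<le> 2 * (\<integral>\<^sup>+x. F x \<partial>M)"
    if H: "finite H" "H \<subseteq> {I. l * emeasure M {fst I<..<snd I} < (\<integral>\<^sup>+x\<in>{fst I<..<snd I}. F x \<partial>M)}" for H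
  proof -
    obtain G where G: "G \<subseteq> H" "(\<Union>I\<in>G. {fst I<..<snd I}) = (\<Union>I\<in>H. {fst I<..<snd I})"
      "\<And>x. card {I \<in> G. x \<in> {fst I<..<snd I}} \<le> 2" using finite_intervals_overlap[OF H(1)] by blast
    have fG: "finite G" using G(1) H(1) by (rule finite_subset)
    have "l * emeasure M (\<Union>I\<in>H. {fst I<..<snd I}) \<le> l * (\<Sum>I\<in>G. emeasure M {fst I<..<snd I})"
      unfolding G(2)[symmetric] using fG by (intro mult_left_mono emeasure_subadditive_finite) (auto simp: sets)
    also have "\<dots> = (\<Sum>I\<in>G. l * emeasure M {fst I<..<snd I})" by (simp add: sum_distrib_left)
    also have "\<dots> \<le> (\<Sum>I\<in>G. \<integral>\<^sup>+x\<in>{fst I<..<snd I}. F x \<partial>M)" using G(1) H(2) by (intro sum_mono) (auto intro!: less_imp_le)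
    also have "\<dots> = (\<integral>\<^sup>+x. (\<Sum>I\<in>G. F x * indicator {fst I<..<snd I} x) \<partial>M)"
      by (subst nn_integral_sum) auto
    also have "\<dots> \<le> (\<integral>\<^sup>+x. 2 * F x \<partial>M)"
    proof (rule nn_integral_mono)
      fix x
      have "(\<Sum>I\<in>G. F x * indicator {fst I<..<snd I} x) = F x * (\<Sum>I\<in>G. indicator {fst I<..<snd I} x)"
        by (simp add: sum_distrib_left)
      also have "(\<Sum>I\<in>G. indicator {fst I<..<snd I} x :: ennreal) = (\<Sum>I\<in>{I \<in> G. x \<in> {fst I<..<snd I}}. 1)"
        unfolding sum.inter_filter[OF fG] indicator_def by (rule sum.cong) simp_all
      also have "\<dots> = of_nat (card {I \<in> G. x \<in> {fst I<..<snd I}})" by simp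
      also have "F x * \<dots> \<le> F x * of_nat 2" using G(3)[of x] by (intro mult_left_mono of_nat_mono) auto
      finally show "(\<Sum>I\<in>G. F x * indicator {fst I<..<snd I} x) \<le> 2 * F x" by (simp add: mult.commute)
    qed
    also have "\<dots> = 2 * (\<integral>\<^sup>+x. F x \<partial>M)" by (rule nn_integral_cmult) measurable
    finally show ?thesis .
  qed
  define Fam where "Fam = {I. l * emeasure M {fst I<..<snd I} < (\<integral>\<^sup>+x\<in>{fst I<..<snd I}. F x \<partial>M)}"
  obtain F' where F': "F' \<subseteq> (\<lambda>I. {fst I<..<snd I}) ` Fam" "countable F'" "\<Union>F' = \<Union>((\<lambda>I. {fst I<..<snd I}) ` Fam)"
    by (rule Lindelof[of "(\<lambda>I. {fst I<..<snd I}) ` Fam"]) auto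
  then obtain C where C: "C \<subseteq> Fam" "countable C" "F' = (\<lambda>I. {fst I<..<snd I}) ` C"
    using countable_subset_image[of F' "\<lambda>I. {fst I<..<snd I}" Fam] by auto
  have E: "bad_set M F l = (\<Union>I\<in>C. {fst I<..<snd I})" unfolding bad_set_def Fam_def[symmetric] using F'(3) C(3) by simp
  show ?thesis
  proof (cases "C = {}")
    case True
    then show ?thesis unfolding E by simp
  next
    case False
    define h where "h = from_nat_into C"
    have h: "range h = C" unfolding h_def using False C(2) by (rule range_from_nat_into)
    define A where "A = (\<lambda>n. \<Union>I\<in>h ` {..n}. {fst I<..<snd I})"
    have "(\<Union>n. A n) = bad_set M F l" unfolding E A_def h[symmetric] by auto
    moreover have "(SUP n. emeasure M (A n)) = emeasure M (\<Union>n. A n)"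
      proof (rule SUP_emeasure_incseq)
      show "range A \<subseteq> sets M" by (auto simp: A_def sets)
      show "incseq A" unfolding incseq_def A_def by (intro allI impI UN_mono image_mono) auto
    qed
    ultimately have "l * emeasure M (bad_set M F l) = (SUP n. l * emeasure M (A n))" by (metis SUP_mult_left_ennreal)
    also have "\<dots> \<le> 2 * (\<integral>\<^sup>+x. F x \<partial>M)"
    proof (rule SUP_least)
      fix n show "l * emeasure M (A n) \<le> 2 * (\<integral>\<^sup>+x. F x \<partial>M)"
        unfolding A_def by (rule fin) (use h C(1) in \<open>auto simp: Fam_def[symmetric]\<close>)
    qed
    finally show ?thesis .
  qed
qed

lemma not_bad_set:
  assumes "x \<notin> bad_set M F l" "a < x" "x < b"
  shows "(\<integral>\<^sup>+y\<in>{a<..<b}. F y \<partial>M) \<le> l * emeasure M {a<..<b}"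
  using assms unfolding bad_set_def by (force simp: not_less)

text \<open>G and H are upper bounds for the norms rather than the norms themselves. After scaling
  by G and H the claim is Young's inequality integrated; the degenerate cases, where this scaling
  would divide by 0, force the product to vanish almost everywhere.\<close>

lemma nn_Holder:
  fixes f g :: "'a \<Rightarrow> real"
  assumes [measurable]: "f \<in> borel_measurable M" "g \<in> borel_measurable M"
    and f0: "\<And>x. 0 \<le> f x" and g0: "\<And>x. 0 \<le> g x"
    and pq: "p > 1" "q > 1" "1 / p + 1 / q = 1" and GH: "0 \<le> G" "0 \<le> H"
    and fp: "(\<integral>\<^sup>+x. ennreal (f x powr p) \<partial>M) \<le> ennreal (G powr p)"
    and gq: "(\<integral>\<^sup>+x. ennreal (g x powr q) \<partial>M) \<le> ennreal (H powr q)"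
  shows "(\<integral>\<^sup>+x. ennreal (f x * g x) \<partial>M) \<le> ennreal (G * H)"
proof -
  have zero: "(\<integral>\<^sup>+x. ennreal (u x * v x) \<partial>M) = 0" if [measurable]: "u \<in> borel_measurable M" 
    and u0: "\<And>x. 0 \<le> u x" and "(\<integral>\<^sup>+x. ennreal (u x powr r) \<partial>M) \<le> 0" for u v r
  proof -
    have "(\<integral>\<^sup>+x. ennreal (u x powr r) \<partial>M) = 0" using that by simp
    then have "AE x in M. ennreal (u x powr r) = 0" by (subst (asm) nn_integral_0_iff_AE) measurable
    then have "AE x in M. ennreal (u x * v x) = 0" by eventually_elim (simp add: powr_eq_0_iff u0 ennreal_eq_0_iff)
    then show ?thesis by (simp add: nn_integral_cong_AE[of _ "\<lambda>x. 0"])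
  qed
  show ?thesis
  proof (cases "G = 0 \<or> H = 0")
    case True
    then show ?thesis
    proof
      assume "G = 0" then show ?thesis using zero[of f p g] fp f0 by simp
    next
      assume "H = 0" then show ?thesis using zero[of g q f] gq g0 by (simp add: mult.commute)
    qed
  next
    case False
    then have G: "G > 0" and H: "H > 0" using GH by auto
    have "(\<integral>\<^sup>+x. ennreal (f x * g x) \<partial>M) \<le> (\<integral>\<^sup>+x. ennreal (G * H / (p * G powr p)) * ennreal (f x powr p) + ennreal (G * H / (q * H powr q)) * ennreal (g x powr q) \<partial>M)"
    proof (rule nn_integral_mono)
      fix x
      have "(f x / G) * (g x / H) \<le> (f x / G) powr p / p + (g x / H) powr q / q"
        using f0 g0 G H pq by (intro Youngs_inequality) auto
      then have "G * H * ((f x / G) * (g x / H)) \<le> G * H * ((f x / G) powr p / p + (g x / H) powr q / q)"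
        using G H by (intro mult_left_mono) auto
      also have "G * H * ((f x / G) * (g x / H)) = f x * g x" using G H by simp
      also have "G * H * ((f x / G) powr p / p + (g x / H) powr q / q) = G * H / (p * G powr p) * f x powr p + G * H / (q * H powr q) * g x powr q"
        using f0 g0 G H by (simp add: powr_divide distrib_left mult.commute)
      finally show "ennreal (f x * g x) \<le> ennreal (G * H / (p * G powr p)) * ennreal (f x powr p) + ennreal (G * H / (q * H powr q)) * ennreal (g x powr q)"
        using G H pq by (simp add: ennreal_mult[symmetric] ennreal_plus[symmetric] del: ennreal_plus)
    qed
    also have "\<dots> = ennreal (G * H / (p * G powr p)) * (\<integral>\<^sup>+x. ennreal (f x powr p) \<partial>M) + ennreal (G * H / (q * H powr q)) * (\<integral>\<^sup>+x. ennreal (g x powr q) \<partial>M)"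
      by (subst nn_integral_add) (auto simp: nn_integral_cmult)
    also have "\<dots> \<le> ennreal (G * H / (p * G powr p)) * ennreal (G powr p) + ennreal (G * H / (q * H powr q)) * ennreal (H powr q)"
      by (intro add_mono mult_left_mono fp gq) auto
    also have "\<dots> = ennreal (G * H / p + G * H / q)"
      using G H pq by (simp add: ennreal_mult[symmetric] ennreal_plus[symmetric] del: ennreal_plus)
    also have "G * H / p + G * H / q = G * H * (1 / p + 1 / q)" by (simp add: distrib_left)
    finally show ?thesis using pq by simp
  qed
qed

text \<open>Keeps from the sum only the least k with w < 2 ^ k: then 2 ^ (k - 1) \<le> w unless k =
  0, and the factor 2 powr (1 + \<delta>) pays for the shift by one.\<close>

lemma sum_dyadic_decay:
  fixes w \<delta> :: real
  assumes "w \<ge> 0" "\<delta> > 0"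
  shows "ennreal (if w < 1 then 1 else w powr (- \<delta> - 1)) \<le> (\<Sum>k. ennreal (2 powr (1 + \<delta>) * 2 powr (- (real k * (1 + \<delta>)))) * indicator {w. w < 2 ^ k} w)"
proof -
  have "\<exists>k. w < 2 ^ k" by (meson one_less_numeral_iff real_arch_pow semiring_norm(76))
  define k where "k = (LEAST k. w < 2 ^ k)"
  have k: "w < 2 ^ k" unfolding k_def using \<open>\<exists>k. w < 2 ^ k\<close> by (rule LeastI_ex)
  have b: "(if w < 1 then 1 else w powr (- \<delta> - 1)) \<le> 2 powr (1 + \<delta>) * 2 powr (- (real k * (1 + \<delta>)))"
  proof (cases k)
    case 0
    have "1 \<le> 2 powr (1 + \<delta>)" using assms by (intro ge_one_powr_ge_zero) auto
    then show ?thesis using 0 k by simp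
  next
    case (Suc j)
    have "\<not> w < 2 ^ j" using not_less_Least[of j "\<lambda>k. w < 2 ^ k"] Suc unfolding k_def by simp
    then have "2 powr real j \<le> w" by (simp add: powr_realpow)
    then have "w powr (- \<delta> - 1) \<le> (2 powr real j) powr (- \<delta> - 1)" using assms by (intro powr_mono2') auto
    also have "\<dots> = 2 powr (real j * (- \<delta> - 1))" by (rule powr_powr)
    also have "\<dots> = 2 powr (1 + \<delta>) * 2 powr (- (real k * (1 + \<delta>)))"
    proof -
      have "real j * (- \<delta> - 1) = 1 + \<delta> + - (real k * (1 + \<delta>))" unfolding Suc by (simp add: algebra_simps)
      then show ?thesis by (simp only: powr_add)
    qed
    moreover have "\<not> w < 1" using \<open>\<not> w < 2 ^ j\<close> one_le_power[of "2::real" j] by linarith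
    ultimately show ?thesis by simp
  qed
  define e where "e = (\<lambda>k::nat. ennreal (2 powr (1 + \<delta>) * 2 powr (- (real k * (1 + \<delta>)))) * indicator {w. w < 2 ^ k} w)"
  have "ennreal (if w < 1 then 1 else w powr (- \<delta> - 1)) \<le> e k"
    unfolding e_def using k b by (simp add: ennreal_leI)
  also have "e k = sum e {k}" by simp
  also have "\<dots> \<le> suminf e" by (rule sum_le_suminf) auto
  finally show ?thesis unfolding e_def .
qed

section \<open>Masses and moments of the measure\<close>

context bessel_order
begin

text \<open>The homogeneous dimension 2 \<nu> + 2: the interval (0, a) with a \<le> 1 has mass a
  powr d / d.\<close>

definition d :: real where "d = 2 * \<sigma> + 1"

lemma d_pos: "d > 0" unfolding d_def \<sigma>_def using nu by simp

lemma nn_integral_mu: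
  assumes "f \<in> borel_measurable borel"
  shows "(\<integral>\<^sup>+x. f x \<partial>mu_nu \<nu>) = (\<integral>\<^sup>+x. ennreal (indicator {0<..<1} x * x powr (2 * \<sigma>)) * f x \<partial>lborel)"
  unfolding mu_nu_def using assms by (subst nn_integral_density) (auto simp: \<sigma>_def algebra_simps)

lemma AE_mu: "AE x in mu_nu \<nu>. 0 < x \<and> x < 1"
  unfolding mu_nu_def by (subst AE_density) (auto split: split_indicator)

lemma mu_less:
  assumes "a \<ge> 0"
  shows "(\<integral>\<^sup>+x. indicator {x. x < a} x \<partial>mu_nu \<nu>) \<le> ennreal (a powr d / d)"
proof -
  have "(\<integral>\<^sup>+x. indicator {x. x < a} x \<partial>mu_nu \<nu>) = (\<integral>\<^sup>+x. ennreal (indicator {0<..<1} x * x powr (2 * \<sigma>)) * indicator {x. x < a} x \<partial>lborel)"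
    by (rule nn_integral_mu) measurable
  also have "\<dots> \<le> (\<integral>\<^sup>+x. ennreal (x powr (2 * \<sigma>)) * indicator {0..a} x \<partial>lborel)"
    by (rule nn_integral_mono) (auto split: split_indicator)
  also have "\<dots> = ennreal (a powr (2 * \<sigma> + 1) / (2 * \<sigma> + 1))"
    by (rule nn_integral_has_integral_lebesgue'[OF _ has_integral_powr_from_0]) (use assms d_pos in \<open>auto simp: d_def\<close>)
  finally show ?thesis by (simp add: d_def)
qed

lemma mu_greater:
  assumes "a > 0" "e + d < 0"
  shows "(\<integral>\<^sup>+x. ennreal (x powr e) * indicator {a..} x \<partial>mu_nu \<nu>) \<le> ennreal (a powr (e + d) / (- (e + d)))"
proof -
  have "(\<integral>\<^sup>+x. ennreal (x powr e) * indicator {a..} x \<partial>mu_nu \<nu>) = (\<integral>\<^sup>+x. ennreal (indicator {0<..<1} x * x powr (2 * \<sigma>)) * (ennreal (x powr e) * indicator {a..} x) \<partial>lborel)"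
    by (rule nn_integral_mu) measurable
  also have "\<dots> \<le> (\<integral>\<^sup>+x. ennreal (x powr (e + 2 * \<sigma>)) * indicator {a..} x \<partial>lborel)"
    by (rule nn_integral_mono) (auto split: split_indicator simp: ennreal_mult[symmetric] powr_add mult.commute)
  also have "\<dots> = ennreal (- (a powr (e + 2 * \<sigma> + 1)) / (e + 2 * \<sigma> + 1))"
    by (rule nn_integral_has_integral_lebesgue'[OF _ has_integral_powr_to_inf]) (use assms in \<open>auto simp: d_def\<close>)
  also have "- (a powr (e + 2 * \<sigma> + 1)) / (e + 2 * \<sigma> + 1) = a powr (e + d) / (- (e + d))"
    unfolding d_def by (simp only: add.assoc minus_divide_left[symmetric] minus_divide_right[symmetric])
  finally show ?thesis .
qed

lemma powr_between:
  fixes x y a :: real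
  assumes "0 < x" "x / 2 < y" "y < 2 * x"
  shows "y powr a \<le> 2 powr \<bar>a\<bar> * x powr a"
proof (cases "a \<ge> 0")
  case True
  have "y powr a \<le> (2 * x) powr a" using assms True by (intro powr_mono2) auto
  then show ?thesis using True by (simp add: powr_mult)
next
  case False
  have "y powr a \<le> (x / 2) powr a" using assms False by (intro powr_mono2') auto
  then show ?thesis using False by (simp add: powr_divide powr_minus_divide)
qed

text \<open>Between x / 2 and 2 x the density is comparable to the constant x powr (2 \<sigma>), so
  the measure acts like a multiple of Lebesgue measure.\<close>

lemma mu_local:
  assumes "0 < x" "a \<le> b" "x / 2 \<le> a" "b \<le> 2 * x"
  shows "emeasure (mu_nu \<nu>) {a<..<b} \<le> ennreal (2 powr \<bar>2 * \<sigma>\<bar> * x powr (2 * \<sigma>) * (b - a))"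
proof -
  have "emeasure (mu_nu \<nu>) {a<..<b} = (\<integral>\<^sup>+x. indicator {a<..<b} x \<partial>mu_nu \<nu>)" by simp
  also have "\<dots> = (\<integral>\<^sup>+x. ennreal (indicator {0<..<1} x * x powr (2 * \<sigma>)) * indicator {a<..<b} x \<partial>lborel)"
    by (rule nn_integral_mu) measurable
  also have "\<dots> \<le> (\<integral>\<^sup>+y. ennreal (2 powr \<bar>2 * \<sigma>\<bar> * x powr (2 * \<sigma>)) * indicator {a<..<b} y \<partial>lborel)"
    using assms powr_between[OF assms(1)] by (intro nn_integral_mono) (auto split: split_indicator intro!: ennreal_leI)
  also have "\<dots> = ennreal (2 powr \<bar>2 * \<sigma>\<bar> * x powr (2 * \<sigma>)) * ennreal (b - a)"
    using assms by (subst nn_integral_cmult_indicator) auto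
  finally show ?thesis using assms by (simp add: ennreal_mult[symmetric])
qed

section \<open>Kernel estimates\<close>

lemma K_diag_split:
  assumes "\<delta> > 0"
  obtains C where "0 < C" "\<And>R x y. 0 < R \<Longrightarrow> 0 < x \<Longrightarrow> 0 < y \<Longrightarrow>
     \<bar>K \<delta> R x y\<bar> \<le> C * ((x powr (- \<sigma>) * \<Phi> (R * x)) * (y powr (- \<sigma>) * \<Phi> (R * y)) * R)"
proof -
  obtain C where C: "0 < C" "\<And>R x y. 0 < R \<Longrightarrow> 0 < x \<Longrightarrow> 0 < y \<Longrightarrow>
     \<bar>K \<delta> R x y\<bar> \<le> C * ((x * y) powr (- \<sigma>) * (\<Phi> (R * x) * \<Phi> (R * y)) * R)"
    using K_diag[OF assms] by blast
  show ?thesis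
  proof (rule that[OF C(1)])
    fix R x y :: real assume h: "0 < R" "0 < x" "0 < y"
    have "(x * y) powr (- \<sigma>) = x powr (- \<sigma>) * y powr (- \<sigma>)" using h by (simp add: powr_mult)
    then show "\<bar>K \<delta> R x y\<bar> \<le> C * ((x powr (- \<sigma>) * \<Phi> (R * x)) * (y powr (- \<sigma>) * \<Phi> (R * y)) * R)"
      using C(2)[OF h] by (simp only: mult_ac)
  qed
qed

text \<open>For v up to a multiple of 1 / R the two powers of v cancel and only R powr \<sigma> is
  left, up to a constant.\<close>

lemma v\<Phi>_small:
  assumes "R > 0" "v > 0" "R * v \<le> b" "1 \<le> b"
  shows "v powr (- \<sigma>) * \<Phi> (R * v) \<le> b powr \<bar>\<sigma>\<bar> * R powr \<sigma>"
proof -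
  define t where "t = R * v"
  have t: "t > 0" "t \<le> b" unfolding t_def using assms by auto
  have b1: "1 \<le> b powr \<bar>\<sigma>\<bar>" using assms by (intro ge_one_powr_ge_zero) auto
  have "t powr (- \<sigma>) * \<Phi> t \<le> b powr \<bar>\<sigma>\<bar>"
  proof (cases "t \<le> 1")
    case True
    then show ?thesis using t b1 by (simp add: \<Phi>_def powr_minus)
  next
    case False
    have "t powr (- \<sigma>) \<le> t powr \<bar>\<sigma>\<bar>" using False by (intro powr_mono) auto
    also have "\<dots> \<le> b powr \<bar>\<sigma>\<bar>" using t by (intro powr_mono2) auto
    finally show ?thesis using False by (simp add: \<Phi>_def)
  qed
  moreover have "v powr (- \<sigma>) = R powr \<sigma> * t powr (- \<sigma>)"
    unfolding t_def using assms by (simp add: powr_mult powr_minus)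
  ultimately have "v powr (- \<sigma>) * \<Phi> (R * v) \<le> R powr \<sigma> * b powr \<bar>\<sigma>\<bar>"
    unfolding t_def by (simp add: mult.assoc mult_left_mono)
  then show ?thesis by (simp add: mult.commute)
qed

text \<open>Near the origin the kernel is no larger than a bump of width 1 / R normalised in
  dimension d.\<close>

lemma K_small:
  assumes "\<delta> > 0"
  obtains C where "0 < C" "\<And>R x y. 0 < R \<Longrightarrow> 0 < x \<Longrightarrow> 0 < y \<Longrightarrow> R * x \<le> 4 \<Longrightarrow> R * y \<le> 4 \<Longrightarrow> \<bar>K \<delta> R x y\<bar> \<le> C * R powr d"
proof -
  obtain C where C: "0 < C" "\<And>R x y. 0 < R \<Longrightarrow> 0 < x \<Longrightarrow> 0 < y \<Longrightarrow>
     \<bar>K \<delta> R x y\<bar> \<le> C * ((x powr (- \<sigma>) * \<Phi> (R * x)) * (y powr (- \<sigma>) * \<Phi> (R * y)) * R)"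
    using K_diag_split[OF assms] by blast
  show ?thesis
  proof (rule that[of "C * (4 powr \<bar>\<sigma>\<bar> * 4 powr \<bar>\<sigma>\<bar>)"])
    show "0 < C * (4 powr \<bar>\<sigma>\<bar> * 4 powr \<bar>\<sigma>\<bar>)" using C by simp
    fix R x y :: real assume h: "0 < R" "0 < x" "0 < y" "R * x \<le> 4" "R * y \<le> 4"
    have "\<bar>K \<delta> R x y\<bar> \<le> C * ((x powr (- \<sigma>) * \<Phi> (R * x)) * (y powr (- \<sigma>) * \<Phi> (R * y)) * R)" using C(2) h by blast
    also have "\<dots> \<le> C * ((4 powr \<bar>\<sigma>\<bar> * R powr \<sigma>) * (4 powr \<bar>\<sigma>\<bar> * R powr \<sigma>) * R)"
      using h C by (intro mult_left_mono mult_right_mono mult_mono v\<Phi>_small) (auto intro!: mult_nonneg_nonneg \<Phi>_nonneg)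
    also have "\<dots> = C * (4 powr \<bar>\<sigma>\<bar> * 4 powr \<bar>\<sigma>\<bar>) * (R powr \<sigma> * R powr \<sigma> * R)" by (simp only: mult_ac)
    also have "R powr \<sigma> * R powr \<sigma> * R = R powr d" unfolding d_def mult_2 powr_add using h by simp
    finally show "\<bar>K \<delta> R x y\<bar> \<le> C * (4 powr \<bar>\<sigma>\<bar> * 4 powr \<bar>\<sigma>\<bar>) * R powr d" .
  qed
qed

lemma K_off_sym:
  assumes "\<delta> > 0"
  obtains C R1 where "0 < C" "0 < R1" "\<And>R x y. R1 \<le> R \<Longrightarrow> 0 < x \<Longrightarrow> x \<le> 1 \<Longrightarrow> 0 < y \<Longrightarrow> y \<le> 1 \<Longrightarrow> 1 / R \<le> \<bar>x - y\<bar> \<Longrightarrow>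
     \<bar>K \<delta> R x y\<bar> \<le> C * ((x * y) powr (- \<sigma>) * \<Phi> (R * min x y) * (R powr (- \<delta>) * \<bar>x - y\<bar> powr (- \<delta> - 1)))"
proof -
  obtain C R1 where C: "0 < C" "0 < R1" "\<And>R x y. R1 \<le> R \<Longrightarrow> 0 < x \<Longrightarrow> x < y \<Longrightarrow> y \<le> 1 \<Longrightarrow> 1 / R \<le> y - x \<Longrightarrow>
     \<bar>K \<delta> R x y\<bar> \<le> C * ((x * y) powr (- \<sigma>) * \<Phi> (R * x) * (R powr (- \<delta>) * (y - x) powr (- \<delta> - 1)))"
    using K_off[OF assms] by blast
  show ?thesis
  proof (rule that[OF C(1,2)])
    fix R x y :: real assume h: "R1 \<le> R" "0 < x" "x \<le> 1" "0 < y" "y \<le> 1" "1 / R \<le> \<bar>x - y\<bar>"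
    have "R > 0" using h C by simp
    then have "0 < \<bar>x - y\<bar>" using h(6) by (meson divide_pos_pos less_le_trans zero_less_one)
    then consider "x < y" | "y < x" by linarith
    then show "\<bar>K \<delta> R x y\<bar> \<le> C * ((x * y) powr (- \<sigma>) * \<Phi> (R * min x y) * (R powr (- \<delta>) * \<bar>x - y\<bar> powr (- \<delta> - 1)))"
    proof cases
      case 1
      then show ?thesis using C(3)[of R x y] h by (simp add: abs_if min_def)
    next
      case 2
      then show ?thesis using C(3)[of R y x] h K_sym[of \<delta> R x y] by (simp add: abs_if min_def mult.commute[of x y])
    qed
  qed
qed

text \<open>For x \<ge> 2 / R and y comparable to x every \<Phi> equals 1. The factor x powr (- 2
  \<sigma>) compensates the density of the measure, so this is an ordinary approximate identity at
  scale 1 / R with integrable tail of order - 1 - \<delta>.\<close>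

lemma K_local:
  assumes \<delta>: "\<delta> > 0"
  obtains C R1 where "0 < C" "0 < R1" "\<And>R x y. R1 \<le> R \<Longrightarrow> 0 < x \<Longrightarrow> x < 1 \<Longrightarrow> y < 1 \<Longrightarrow> 2 \<le> R * x \<Longrightarrow> x / 2 < y \<Longrightarrow> y < 2 * x \<Longrightarrow>
     \<bar>K \<delta> R x y\<bar> \<le> C * x powr (- (2 * \<sigma>)) * R * (if R * \<bar>x - y\<bar> < 1 then 1 else (R * \<bar>x - y\<bar>) powr (- \<delta> - 1))"
proof -
  obtain CD where CD: "0 < CD" "\<And>R x y. 0 < R \<Longrightarrow> 0 < x \<Longrightarrow> 0 < y \<Longrightarrow>
     \<bar>K \<delta> R x y\<bar> \<le> CD * ((x powr (- \<sigma>) * \<Phi> (R * x)) * (y powr (- \<sigma>) * \<Phi> (R * y)) * R)"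
    using K_diag_split[OF \<delta>] by blast
  obtain CO R1 where CO: "0 < CO" "0 < R1" "\<And>R x y. R1 \<le> R \<Longrightarrow> 0 < x \<Longrightarrow> x \<le> 1 \<Longrightarrow> 0 < y \<Longrightarrow> y \<le> 1 \<Longrightarrow> 1 / R \<le> \<bar>x - y\<bar> \<Longrightarrow>
     \<bar>K \<delta> R x y\<bar> \<le> CO * ((x * y) powr (- \<sigma>) * \<Phi> (R * min x y) * (R powr (- \<delta>) * \<bar>x - y\<bar> powr (- \<delta> - 1)))"
    using K_off_sym[OF \<delta>] by blast
  define C where "C = max CD CO * 2 powr \<bar>\<sigma>\<bar>"
  show ?thesis
  proof (rule that[of C R1])
    show "0 < C" "0 < R1" unfolding C_def using CD CO by auto
    fix R x y assume h: "R1 \<le> R" "0 < x" "x < 1" "y < 1" "2 \<le> R * x" "x / 2 < y" "y < 2 * x"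
    have R: "R > 0" using h CO by simp
    have y0: "y > 0" using h by simp
    have "R * (x / 2) \<le> R * y" using h R by (intro mult_left_mono) auto
    then have Ry: "1 \<le> R * y" using h by simp
    have \<Phi>1: "\<Phi> (R * x) = 1" "\<Phi> (R * y) = 1" using h Ry by (auto intro: \<Phi>_ge1)
    have yx: "x powr (- \<sigma>) * y powr (- \<sigma>) \<le> 2 powr \<bar>\<sigma>\<bar> * x powr (- (2 * \<sigma>))"
    proof -
      have "x powr (- \<sigma>) * y powr (- \<sigma>) \<le> x powr (- \<sigma>) * (2 powr \<bar>- \<sigma>\<bar> * x powr (- \<sigma>))"
        using h by (intro mult_left_mono powr_between) auto
      also have "\<dots> = 2 powr \<bar>\<sigma>\<bar> * (x powr (- \<sigma>) * x powr (- \<sigma>))" by simp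
      also have "x powr (- \<sigma>) * x powr (- \<sigma>) = x powr (- (2 * \<sigma>))" by (simp add: powr_add[symmetric])
      finally show ?thesis .
    qed
    show "\<bar>K \<delta> R x y\<bar> \<le> C * x powr (- (2 * \<sigma>)) * R * (if R * \<bar>x - y\<bar> < 1 then 1 else (R * \<bar>x - y\<bar>) powr (- \<delta> - 1))"
    proof (cases "R * \<bar>x - y\<bar> < 1")
      case True
      have "\<bar>K \<delta> R x y\<bar> \<le> CD * ((x powr (- \<sigma>) * y powr (- \<sigma>)) * R)" using CD(2)[OF R h(2) y0] by (simp add: \<Phi>1)
      also have "\<dots> \<le> max CD CO * ((2 powr \<bar>\<sigma>\<bar> * x powr (- (2 * \<sigma>))) * R)"
        using CD R by (intro mult_mono[OF max.cobounded1 mult_right_mono[OF yx]]) auto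
      finally show ?thesis using True unfolding C_def by (simp add: mult_ac)
    next
      case False
      then have f: "1 / R \<le> \<bar>x - y\<bar>" using R by (simp add: field_simps)
      have xy: "\<bar>x - y\<bar> > 0" using f R by (meson divide_pos_pos less_le_trans zero_less_one)
      have "\<Phi> (R * min x y) = 1" using \<Phi>1 by (simp add: min_def)
      then have "\<bar>K \<delta> R x y\<bar> \<le> CO * ((x * y) powr (- \<sigma>) * (R powr (- \<delta>) * \<bar>x - y\<bar> powr (- \<delta> - 1)))"
        using CO(3)[of R x y] h y0 f by simp
      also have "R powr (- \<delta>) * \<bar>x - y\<bar> powr (- \<delta> - 1) = R * (R * \<bar>x - y\<bar>) powr (- \<delta> - 1)"
        using R xy by (simp add: powr_mult powr_diff)
      also have "(x * y) powr (- \<sigma>) = x powr (- \<sigma>) * y powr (- \<sigma>)" using h y0 by (simp add: powr_mult)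
      also have "CO * (x powr (- \<sigma>) * y powr (- \<sigma>) * (R * (R * \<bar>x - y\<bar>) powr (- \<delta> - 1))) 
         \<le> max CD CO * ((2 powr \<bar>\<sigma>\<bar> * x powr (- (2 * \<sigma>))) * (R * (R * \<bar>x - y\<bar>) powr (- \<delta> - 1)))"
        using CO R by (intro mult_mono[OF max.cobounded2 mult_right_mono[OF yx]]) auto
      finally show ?thesis using False unfolding C_def by (simp add: mult_ac)
    qed
  qed
qed

text \<open>y \<ge> 2 x gives y - x \<ge> y / 2, so the off-diagonal bound separates into a factor
  in x and a power of y.\<close>

lemma K_far:
  assumes \<delta>: "\<delta> > 0"
  obtains C R1 where "0 < C" "0 < R1" "\<And>R x y. R1 \<le> R \<Longrightarrow> 0 < x \<Longrightarrow> 2 * x \<le> y \<Longrightarrow> y \<le> 1 \<Longrightarrow> 2 \<le> R * y \<Longrightarrow>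
     \<bar>K \<delta> R x y\<bar> \<le> C * ((x powr (- \<sigma>) * \<Phi> (R * x) * R powr (- \<delta>)) * y powr (- (\<sigma> + \<delta> + 1)))"
proof -
  obtain CO R1 where CO: "0 < CO" "0 < R1" "\<And>R x y. R1 \<le> R \<Longrightarrow> 0 < x \<Longrightarrow> x < y \<Longrightarrow> y \<le> 1 \<Longrightarrow> 1 / R \<le> y - x \<Longrightarrow>
     \<bar>K \<delta> R x y\<bar> \<le> CO * ((x * y) powr (- \<sigma>) * \<Phi> (R * x) * (R powr (- \<delta>) * (y - x) powr (- \<delta> - 1)))"
    using K_off[OF \<delta>] by blast
  show ?thesis
  proof (rule that[of "CO * 2 powr (\<delta> + 1)" R1])
    show "0 < CO * 2 powr (\<delta> + 1)" "0 < R1" using CO by auto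
    fix R x y assume h: "R1 \<le> R" "0 < x" "2 * x \<le> y" "y \<le> 1" "2 \<le> R * y"
    have R: "R > 0" using h CO by simp
    have y0: "y > 0" using h by simp
    have hh: "y / 2 \<le> y - x" using h by simp
    have "1 / R \<le> y / 2" using h R by (simp add: field_simps)
    then have f: "1 / R \<le> y - x" using hh by linarith
    have "(y - x) powr (- \<delta> - 1) \<le> (y / 2) powr (- \<delta> - 1)" using hh y0 \<delta> by (intro powr_mono2') auto
    also have "\<dots> = 2 powr (\<delta> + 1) * y powr (- \<delta> - 1)"
      using powr_divide[of y 2 "- \<delta> - 1"] powr_minus_divide[of 2 "\<delta> + 1"] y0 by simp
    finally have p: "(y - x) powr (- \<delta> - 1) \<le> 2 powr (\<delta> + 1) * y powr (- \<delta> - 1)" .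
    have "\<bar>K \<delta> R x y\<bar> \<le> CO * ((x * y) powr (- \<sigma>) * \<Phi> (R * x) * (R powr (- \<delta>) * (y - x) powr (- \<delta> - 1)))"
      using h f by (intro CO(3)) auto
    also have "\<dots> \<le> CO * ((x * y) powr (- \<sigma>) * \<Phi> (R * x) * (R powr (- \<delta>) * (2 powr (\<delta> + 1) * y powr (- \<delta> - 1))))"
      using CO p by (intro mult_left_mono) (auto intro!: mult_nonneg_nonneg \<Phi>_nonneg)
    also have "(x * y) powr (- \<sigma>) = x powr (- \<sigma>) * y powr (- \<sigma>)" using h y0 by (simp add: powr_mult)
    also have "CO * (x powr (- \<sigma>) * y powr (- \<sigma>) * \<Phi> (R * x) * (R powr (- \<delta>) * (2 powr (\<delta> + 1) * y powr (- \<delta> - 1))))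
      = CO * 2 powr (\<delta> + 1) * ((x powr (- \<sigma>) * \<Phi> (R * x) * R powr (- \<delta>)) * (y powr (- \<sigma>) * y powr (- \<delta> - 1)))" by (simp only: mult_ac)
    also have "y powr (- \<sigma>) * y powr (- \<delta> - 1) = y powr (- (\<sigma> + \<delta> + 1))"
    proof -
      have "- \<sigma> + (- \<delta> - 1) = - (\<sigma> + \<delta> + 1)" by simp
      then show ?thesis by (metis powr_add)
    qed
    finally show "\<bar>K \<delta> R x y\<bar> \<le> CO * 2 powr (\<delta> + 1) * ((x powr (- \<sigma>) * \<Phi> (R * x) * R powr (- \<delta>)) * y powr (- (\<sigma> + \<delta> + 1)))" .
  qed
qed

section \<open>The kernel outside the local region\<close>

lemma \<Phi>_weight_small:
  assumes "R > 0" "v > 0" "R * v \<le> 1"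
  shows "v powr (- \<sigma>) * \<Phi> (R * v) = R powr \<sigma>"
  using assms by (simp add: \<Phi>_def powr_mult powr_minus)

text \<open>For \<sigma> \<le> \<delta> the controlling power of R is nonincreasing, so the worst
  admissible value is R = 1 / M. The result does not depend on the smaller point m.\<close>

lemma far_weight_supercritical:
  assumes \<delta>: "\<delta> > 0" "\<sigma> \<le> \<delta>" and h: "R > 0" "0 < m" "m \<le> M" "1 \<le> R * M"
  shows "m powr (- \<sigma>) * \<Phi> (R * m) * R powr (- \<delta>) \<le> M powr (\<delta> - \<sigma>)"
proof -
  have RM: "1 / M \<le> R" using h by (simp add: field_simps)
  have "R powr (\<sigma> - \<delta>) \<le> (1 / M) powr (\<sigma> - \<delta>)" using RM h \<delta> by (intro powr_mono2') auto
  also have "\<dots> = M powr (\<delta> - \<sigma>)" using h powr_divide[of 1 M "\<sigma> - \<delta>"] powr_minus_divide[of M "\<sigma> - \<delta>"] by simp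
  finally have base: "R powr (\<sigma> - \<delta>) \<le> M powr (\<delta> - \<sigma>)" .
  show ?thesis
  proof (cases "R * m \<le> 1")
    case True
    then show ?thesis using base h by (simp add: \<Phi>_weight_small powr_add[symmetric])
  next
    case False
    then have \<Phi>1: "\<Phi> (R * m) = 1" by (intro \<Phi>_ge1) simp
    show ?thesis
    proof (cases "\<sigma> \<ge> 0")
      case True
      have "1 / R \<le> m" using False h by (simp add: field_simps)
      then have "m powr (- \<sigma>) \<le> (1 / R) powr (- \<sigma>)" using h True by (intro powr_mono2') auto
      also have "\<dots> = R powr \<sigma>" using h powr_divide[of 1 R "- \<sigma>"] powr_minus_divide[of R "\<sigma>"] by simp
      finally have "m powr (- \<sigma>) * R powr (- \<delta>) \<le> R powr \<sigma> * R powr (- \<delta>)" by (intro mult_right_mono) auto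
      also have "\<dots> = R powr (\<sigma> - \<delta>)" by (simp add: powr_add[symmetric])
      finally show ?thesis using base \<Phi>1 by simp
    next
      case False
      have "m powr (- \<sigma>) \<le> M powr (- \<sigma>)" using False h by (intro powr_mono2) auto
      moreover have "R powr (- \<delta>) \<le> (1 / M) powr (- \<delta>)" using RM h \<delta> by (intro powr_mono2') auto
      moreover have "(1 / M) powr (- \<delta>) = M powr \<delta>" using h powr_divide[of 1 M "- \<delta>"] powr_minus_divide[of M "\<delta>"] by simp
      ultimately have "m powr (- \<sigma>) * R powr (- \<delta>) \<le> M powr (- \<sigma>) * M powr \<delta>" by (intro mult_mono) auto
      also have "\<dots> = M powr (\<delta> - \<sigma>)" by (simp add: powr_add[symmetric])
      finally show ?thesis using \<Phi>1 by simp
    qed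
  qed
qed

text \<open>For \<delta> < \<sigma> the left side increases in R up to R = 1 / m and decreases
  afterwards, so the supremum is governed by the smaller point.\<close>

lemma far_weight_subcritical:
  assumes \<delta>: "\<delta> > 0" "\<delta> < \<sigma>" and h: "R > 0" "0 < m"
  shows "m powr (- \<sigma>) * \<Phi> (R * m) * R powr (- \<delta>) \<le> m powr (\<delta> - \<sigma>)"
proof (cases "R * m \<le> 1")
  case True
  have "R \<le> 1 / m" using True h by (simp add: field_simps)
  then have "R powr (\<sigma> - \<delta>) \<le> (1 / m) powr (\<sigma> - \<delta>)" using h \<delta> by (intro powr_mono2) auto
  also have "\<dots> = m powr (\<delta> - \<sigma>)" using h powr_divide[of 1 m "\<sigma> - \<delta>"] powr_minus_divide[of m "\<sigma> - \<delta>"] by simp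
  finally show ?thesis using True h by (simp add: \<Phi>_weight_small powr_add[symmetric])
next
  case False
  then have \<Phi>1: "\<Phi> (R * m) = 1" by (intro \<Phi>_ge1) simp
  have "1 / m \<le> R" using False h by (simp add: field_simps)
  then have "R powr (- \<delta>) \<le> (1 / m) powr (- \<delta>)" using h \<delta> by (intro powr_mono2') auto
  also have "\<dots> = m powr \<delta>" using h powr_divide[of 1 m "- \<delta>"] powr_minus_divide[of m "\<delta>"] by simp
  finally have "m powr (- \<sigma>) * R powr (- \<delta>) \<le> m powr (- \<sigma>) * m powr \<delta>" by (intro mult_left_mono) auto
  also have "\<dots> = m powr (\<delta> - \<sigma>)" by (simp add: powr_add[symmetric])
  finally show ?thesis using \<Phi>1 by simp
qed

text \<open>The negation, 2 \<le> R x and x / 2 < y < 2 x, is the region where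
  \<open>K_local\<close> applies.\<close>

definition nonlocal :: "real \<Rightarrow> real \<Rightarrow> real \<Rightarrow> bool" where
  "nonlocal R x y \<longleftrightarrow> R * x < 2 \<or> y \<le> x / 2 \<or> 2 * x \<le> y"

lemma powr_d_le:
  assumes "0 < R" "0 < M" "R * M \<le> 4"
  shows "R powr d \<le> 4 powr d * M powr (- d)"
proof -
  have "R \<le> 4 / M" using assms by (simp add: field_simps)
  then have "R powr d \<le> (4 / M) powr d" using assms d_pos by (intro powr_mono2) auto
  then show ?thesis using powr_divide[of 4 M d] powr_minus_divide[of M d] assms by simp
qed

text \<open>The bound is uniform in R and y, so the nonlocal part of the maximal function is at most
  x powr (- d) times the L1 norm, and that power lies in weak L1.\<close>

lemma K_nonlocal_supercritical:
  assumes \<delta>: "\<delta> > 0" "\<sigma> \<le> \<delta>"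
  obtains C R1 where "0 < C" "0 < R1" "\<And>R x y. R1 \<le> R \<Longrightarrow> 0 < x \<Longrightarrow> x < 1 \<Longrightarrow> 0 < y \<Longrightarrow> y < 1 \<Longrightarrow> nonlocal R x y \<Longrightarrow>
     \<bar>K \<delta> R x y\<bar> \<le> C * x powr (- d)"
proof -
  obtain CS where CS: "0 < CS" "\<And>R x y. 0 < R \<Longrightarrow> 0 < x \<Longrightarrow> 0 < y \<Longrightarrow> R * x \<le> 4 \<Longrightarrow> R * y \<le> 4 \<Longrightarrow> \<bar>K \<delta> R x y\<bar> \<le> CS * R powr d"
    using K_small[OF \<delta>(1)] by blast
  obtain CF R1 where CF: "0 < CF" "0 < R1" "\<And>R x y. R1 \<le> R \<Longrightarrow> 0 < x \<Longrightarrow> 2 * x \<le> y \<Longrightarrow> y \<le> 1 \<Longrightarrow> 2 \<le> R * y \<Longrightarrow>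
     \<bar>K \<delta> R x y\<bar> \<le> CF * ((x powr (- \<sigma>) * \<Phi> (R * x) * R powr (- \<delta>)) * y powr (- (\<sigma> + \<delta> + 1)))"
    using K_far[OF \<delta>(1)] by blast
  have far: "\<bar>K \<delta> R m M\<bar> \<le> CF * M powr (- d)"
    if h: "R1 \<le> R" "0 < m" "2 * m \<le> M" "M \<le> 1" "2 \<le> R * M" for R m M
  proof -
    have "\<bar>K \<delta> R m M\<bar> \<le> CF * ((m powr (- \<sigma>) * \<Phi> (R * m) * R powr (- \<delta>)) * M powr (- (\<sigma> + \<delta> + 1)))" using h by (rule CF(3))
    also have "\<dots> \<le> CF * (M powr (\<delta> - \<sigma>) * M powr (- (\<sigma> + \<delta> + 1)))"
      using CF(1,2) h by (intro mult_left_mono mult_right_mono far_weight_supercritical \<delta>) auto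
    also have "M powr (\<delta> - \<sigma>) * M powr (- (\<sigma> + \<delta> + 1)) = M powr (- d)" unfolding d_def by (simp add: powr_add[symmetric])
    finally show ?thesis .
  qed
  have near: "\<bar>K \<delta> R m M\<bar> \<le> CS * 4 powr d * x powr (- d)"
    if h: "R1 \<le> R" "0 < m" "0 < M" "R * m \<le> 4" "R * M \<le> 4" "0 < x" "R * x \<le> 4" for R m M x
  proof -
    have R: "R > 0" using h CF by simp
    have "\<bar>K \<delta> R m M\<bar> \<le> CS * R powr d" using R h by (intro CS(2)) auto
    also have "\<dots> \<le> CS * (4 powr d * x powr (- d))" using R h CS by (intro mult_left_mono powr_d_le) auto
    finally show ?thesis by simp
  qed
  define C where "C = CF + CS * 4 powr d"
  show ?thesis
  proof (rule that[of C R1])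
    show "0 < C" "0 < R1" unfolding C_def using CF CS by (auto intro!: add_pos_pos)
    fix R x y assume h: "R1 \<le> R" "0 < x" "x < 1" "0 < y" "y < 1" "nonlocal R x y"
    have R: "R > 0" using h CF by simp
    have le1: "CF * x powr (- d) \<le> C * x powr (- d)" unfolding C_def using CS by (intro mult_right_mono) auto
    have le2: "CS * 4 powr d * x powr (- d) \<le> C * x powr (- d)" unfolding C_def using CF by (intro mult_right_mono) auto
    \<comment> \<open>In the first and last cases both variables are at most 4 / R; in the middle
      ones they are separated and the larger is at least 2 / R.\<close>
    have "(R * x < 2 \<and> y < 2 * x) \<or> (2 \<le> R * x \<and> y \<le> x / 2) \<or> (2 * x \<le> y \<and> 2 \<le> R * y) \<or> (2 * x \<le> y \<and> R * y < 2)"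
      using h(6) unfolding nonlocal_def by (auto simp: not_less)
    then consider "R * x < 2" "y < 2 * x" | "2 \<le> R * x" "y \<le> x / 2" | "2 * x \<le> y" "2 \<le> R * y" | "2 * x \<le> y" "R * y < 2"
      by blast
    then show "\<bar>K \<delta> R x y\<bar> \<le> C * x powr (- d)"
    proof cases
      case 1
      have "R * y \<le> R * (2 * x)" using 1 R by (intro mult_left_mono) auto
      then have "\<bar>K \<delta> R x y\<bar> \<le> CS * 4 powr d * x powr (- d)" using h 1 by (intro near[of R x y x]) auto
      then show ?thesis using le2 by linarith
    next
      case 2
      then have "\<bar>K \<delta> R y x\<bar> \<le> CF * x powr (- d)" using h by (intro far) auto
      then show ?thesis using le1 K_sym[of \<delta> R x y] by linarith
    next
      case 3
      have "y powr (- d) \<le> x powr (- d)" using 3 h d_pos by (intro powr_mono2') auto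
      then have "CF * y powr (- d) \<le> CF * x powr (- d)" using CF by (intro mult_left_mono) auto
      moreover have "\<bar>K \<delta> R x y\<bar> \<le> CF * y powr (- d)" using h 3 by (intro far) auto
      ultimately show ?thesis using le1 by linarith
    next
      case 4
      have "R * (2 * x) \<le> R * y" using 4 R by (intro mult_left_mono) auto
      then have "R * x \<le> 4" using 4 by linarith
      then have "\<bar>K \<delta> R x y\<bar> \<le> CS * 4 powr d * x powr (- d)" using h 4 by (intro near[of R x y x]) auto
      then show ?thesis using le2 by linarith
    qed
  qed
qed

text \<open>The terms stand for both points near the origin, for y beyond x, and for y below x. The
  third keeps R: its supremum over R is y powr (\<delta> - \<sigma>), whose power with the dual
  exponent d / (\<sigma> - \<delta>) is y powr (- d), not integrable at 0. It is Hoelder at fixed R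
  that makes this term harmless.\<close>

lemma K_nonlocal_subcritical:
  assumes \<delta>: "\<delta> > 0" "\<delta> < \<sigma>"
  obtains C R1 where "0 < C" "0 < R1" "\<And>R x y. R1 \<le> R \<Longrightarrow> 0 < x \<Longrightarrow> x < 1 \<Longrightarrow> 0 < y \<Longrightarrow> y < 1 \<Longrightarrow> nonlocal R x y \<Longrightarrow>
     \<bar>K \<delta> R x y\<bar> \<le> C * (x powr (- d) * indicator {y. y < 2 * x} y * (if R * x < 2 then 1 else 0)
        + x powr (\<delta> - \<sigma>) * (y powr (- (\<sigma> + \<delta> + 1)) * indicator {x..} y)
        + x powr (- (\<sigma> + \<delta> + 1)) * R powr (- \<delta>) * (y powr (- \<sigma>) * \<Phi> (R * y)))"
proof -
  obtain CS where CS: "0 < CS" "\<And>R x y. 0 < R \<Longrightarrow> 0 < x \<Longrightarrow> 0 < y \<Longrightarrow> R * x \<le> 4 \<Longrightarrow> R * y \<le> 4 \<Longrightarrow> \<bar>K \<delta> R x y\<bar> \<le> CS * R powr d"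
    using K_small[OF \<delta>(1)] by blast
  obtain CF R1 where CF: "0 < CF" "0 < R1" "\<And>R x y. R1 \<le> R \<Longrightarrow> 0 < x \<Longrightarrow> 2 * x \<le> y \<Longrightarrow> y \<le> 1 \<Longrightarrow> 2 \<le> R * y \<Longrightarrow>
     \<bar>K \<delta> R x y\<bar> \<le> CF * ((x powr (- \<sigma>) * \<Phi> (R * x) * R powr (- \<delta>)) * y powr (- (\<sigma> + \<delta> + 1)))"
    using K_far[OF \<delta>(1)] by blast
  define C where "C = CF + CS * 4 powr d"
  have C: "CF \<le> C" "CS * 4 powr d \<le> C" "0 < C" unfolding C_def using CF CS by (auto intro!: add_pos_pos)
  show ?thesis
  proof (rule that[of C R1])
    show "0 < C" "0 < R1" using C CF by auto
    fix R x y assume h: "R1 \<le> R" "0 < x" "x < 1" "0 < y" "y < 1" "nonlocal R x y"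
    have R: "R > 0" using h CF by simp
    define T1 where "T1 = x powr (- d) * indicator {y. y < 2 * x} y * (if R * x < 2 then 1 else 0)"
    define T2 where "T2 = x powr (\<delta> - \<sigma>) * (y powr (- (\<sigma> + \<delta> + 1)) * indicator {x..} y)"
    define T3 where "T3 = x powr (- (\<sigma> + \<delta> + 1)) * R powr (- \<delta>) * (y powr (- \<sigma>) * \<Phi> (R * y))"
    have nn: "T1 \<ge> 0" "T2 \<ge> 0" "T3 \<ge> 0" unfolding T1_def T2_def T3_def by (auto intro!: mult_nonneg_nonneg \<Phi>_nonneg)
    have S: "\<bar>K \<delta> R x y\<bar> \<le> C * v powr (- d)" if "R * x \<le> 4" "R * y \<le> 4" "0 < v" "R * v \<le> 4" for v
    proof -
      have "\<bar>K \<delta> R x y\<bar> \<le> CS * R powr d" using that R h by (intro CS(2)) auto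
      also have "\<dots> \<le> CS * (4 powr d * v powr (- d))" using that R CS by (intro mult_left_mono powr_d_le) auto
      also have "\<dots> = CS * 4 powr d * v powr (- d)" by simp
      also have "\<dots> \<le> C * v powr (- d)" using C by (intro mult_right_mono) auto
      finally show ?thesis .
    qed
    have "(R * x < 2 \<and> y < 2 * x) \<or> (2 \<le> R * x \<and> y \<le> x / 2) \<or> (2 * x \<le> y \<and> 2 \<le> R * y) \<or> (2 * x \<le> y \<and> R * y < 2)"
      using h(6) unfolding nonlocal_def by (auto simp: not_less)
    then consider "R * x < 2" "y < 2 * x" | "2 \<le> R * x" "y \<le> x / 2" | "2 * x \<le> y" "2 \<le> R * y" | "2 * x \<le> y" "R * y < 2"
      by blast
    then have "\<bar>K \<delta> R x y\<bar> \<le> C * T1 \<or> \<bar>K \<delta> R x y\<bar> \<le> C * T2 \<or> \<bar>K \<delta> R x y\<bar> \<le> C * T3"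
    proof cases
      case 1
      have "R * y \<le> R * (2 * x)" using 1 R by (intro mult_left_mono) auto
      then have "\<bar>K \<delta> R x y\<bar> \<le> C * x powr (- d)" using 1 h by (intro S) auto
      then show ?thesis unfolding T1_def using 1 by simp
    next
      case 2
      have "\<bar>K \<delta> R y x\<bar> \<le> CF * ((y powr (- \<sigma>) * \<Phi> (R * y) * R powr (- \<delta>)) * x powr (- (\<sigma> + \<delta> + 1)))"
        using 2 h by (intro CF(3)) auto
      also have "\<dots> = CF * T3" unfolding T3_def by (simp only: mult_ac)
      also have "\<dots> \<le> C * T3" using C nn by (intro mult_right_mono) auto
      finally show ?thesis using K_sym[of \<delta> R x y] by simp
    next
      case 3
      have "\<bar>K \<delta> R x y\<bar> \<le> CF * ((x powr (- \<sigma>) * \<Phi> (R * x) * R powr (- \<delta>)) * y powr (- (\<sigma> + \<delta> + 1)))"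
        using 3 h by (intro CF(3)) auto
      also have "\<dots> \<le> CF * (x powr (\<delta> - \<sigma>) * y powr (- (\<sigma> + \<delta> + 1)))"
        using CF R h by (intro mult_left_mono mult_right_mono far_weight_subcritical \<delta>) auto
      also have "\<dots> = CF * T2" unfolding T2_def using 3 h by simp
      also have "\<dots> \<le> C * T2" using C nn by (intro mult_right_mono) auto
      finally show ?thesis by simp
    next
      case 4
      have "R * (2 * x) \<le> R * y" using 4 R by (intro mult_left_mono) auto
      then have "R * x \<le> 4" using 4 by linarith
      then have "\<bar>K \<delta> R x y\<bar> \<le> C * y powr (- d)" using 4 h by (intro S) auto
      \<comment> \<open>Splits the power so that the part with exponent \<delta> - \<sigma> < 0 can
        be moved from y to the smaller x; this case then joins the second term.\<close>
      also have "y powr (- d) = y powr (\<delta> - \<sigma>) * y powr (- (\<sigma> + \<delta> + 1))" unfolding d_def by (simp add: powr_add[symmetric])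
      also have "C * (y powr (\<delta> - \<sigma>) * y powr (- (\<sigma> + \<delta> + 1))) \<le> C * (x powr (\<delta> - \<sigma>) * y powr (- (\<sigma> + \<delta> + 1)))"
        using C h 4 \<delta> by (intro mult_left_mono mult_right_mono powr_mono2') auto
      also have "\<dots> = C * T2" unfolding T2_def using 4 h by simp
      finally show ?thesis by simp
    qed
    moreover have "C * T1 \<ge> 0" "C * T2 \<ge> 0" "C * T3 \<ge> 0" using nn C by auto
    ultimately have "\<bar>K \<delta> R x y\<bar> \<le> C * (T1 + T2 + T3)" unfolding distrib_left by linarith
    then show "\<bar>K \<delta> R x y\<bar> \<le> C * (x powr (- d) * indicator {y. y < 2 * x} y * (if R * x < 2 then 1 else 0)
        + x powr (\<delta> - \<sigma>) * (y powr (- (\<sigma> + \<delta> + 1)) * indicator {x..} y)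
        + x powr (- (\<sigma> + \<delta> + 1)) * R powr (- \<delta>) * (y powr (- \<sigma>) * \<Phi> (R * y)))"
      unfolding T1_def T2_def T3_def .
  qed
qed

section \<open>From the kernel to the means, and the local part\<close>

lemma emeasure_mu_space: "emeasure (mu_nu \<nu>) UNIV \<le> ennreal (1 / d)"
proof -
  have "emeasure (mu_nu \<nu>) UNIV = (\<integral>\<^sup>+x. 1 \<partial>mu_nu \<nu>)" by (simp add: mu_nu_def)
  also have "\<dots> = (\<integral>\<^sup>+x. indicator {x. x < 1} x \<partial>mu_nu \<nu>)"
    by (rule nn_integral_cong_AE) (use AE_mu in eventually_elim, auto)
  also have "\<dots> \<le> ennreal (1 powr d / d)" by (rule mu_less) simp
  finally show ?thesis by simp
qed

lemma finite_mu: "finite_measure (mu_nu \<nu>)"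
proof
  show "emeasure (mu_nu \<nu>) (space (mu_nu \<nu>)) \<noteq> \<infinity>"
    using emeasure_mu_space by (auto simp: mu_nu_def top_unique)
qed

lemma pz_cont: "continuous_on UNIV (pz s)"
proof -
  have "continuous_on UNIV (\<lambda>x. Re (g (of_real (s * x))))"
    by (rule continuous_on_compose2[OF g_real_cont[of UNIV]]) (auto intro!: continuous_intros)
  then show ?thesis unfolding pz_def[abs_def] divide_inverse
    by (rule continuous_on_mult_right[OF continuous_on_mult_left])
qed

lemma K_measurable [measurable]: "K \<delta> R x \<in> borel_measurable borel"
  unfolding K_def[abs_def] by measurable

text \<open>Each eigenfunction is continuous, hence bounded on (0, 1), so integrability of f lets
  the finite sum pass under the integral.\<close>

lemma bochner_riesz_kernel_bound:
  assumes R: "R > 0" and x: "x > 0" and [measurable]: "f \<in> borel_measurable borel" and f: "integrable (mu_nu \<nu>) f"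
  shows "bochner_riesz \<nu> \<delta> R f x = (\<integral>y. K \<delta> R x y * f y \<partial>mu_nu \<nu>)"
    and "ennreal \<bar>bochner_riesz \<nu> \<delta> R f x\<bar> \<le> (\<integral>\<^sup>+y. ennreal (\<bar>K \<delta> R x y\<bar> * \<bar>f y\<bar>) \<partial>mu_nu \<nu>)"
proof -
  have int: "integrable (mu_nu \<nu>) (\<lambda>y. f y * pz s y)" for s
  proof -
    have "compact (pz s ` {0..1})" by (intro compact_continuous_image continuous_on_subset[OF pz_cont]) auto
    then have "bounded (pz s ` {0..1})" by (rule compact_imp_bounded)
    then obtain B where "\<forall>z\<in>pz s ` {0..1}. norm z \<le> B" unfolding bounded_iff by blast
    then have B: "\<bar>pz s y\<bar> \<le> B" if "0 < y" "y < 1" for y using that by auto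
    show ?thesis
    proof (rule Bochner_Integration.integrable_bound)
      show "integrable (mu_nu \<nu>) (\<lambda>y. B * f y)" using f by simp
      show "AE y in mu_nu \<nu>. norm (f y * pz s y) \<le> norm (B * f y)"
        using AE_mu
      proof eventually_elim
        case (elim y)
        then have "\<bar>pz s y\<bar> \<le> \<bar>B\<bar>" using B[of y] by linarith
        then have "\<bar>pz s y\<bar> * \<bar>f y\<bar> \<le> \<bar>B\<bar> * \<bar>f y\<bar>" by (rule mult_right_mono) simp
        then show ?case by (simp add: abs_mult mult.commute)
      qed
    qed measurable
  qed
  have eq: "bochner_riesz \<nu> \<delta> R f x = (\<Sum>s\<in>Z \<inter> {..<R}. wt \<delta> R s * (\<integral>y. f y * pz s y \<partial>mu_nu \<nu>) * pz s x)"
    by (rule bochner_riesz_eq[OF R x]) measurable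
  also have "\<dots> = (\<Sum>s\<in>Z \<inter> {..<R}. \<integral>y. (wt \<delta> R s * pz s x) * (f y * pz s y) \<partial>mu_nu \<nu>)"
    by (intro sum.cong refl, subst integral_mult_right_zero) (simp add: mult_ac)
  also have "\<dots> = (\<integral>y. (\<Sum>s\<in>Z \<inter> {..<R}. (wt \<delta> R s * pz s x) * (f y * pz s y)) \<partial>mu_nu \<nu>)"
    using int by (intro Bochner_Integration.integral_sum[symmetric]) auto
  also have "(\<lambda>y. \<Sum>s\<in>Z \<inter> {..<R}. (wt \<delta> R s * pz s x) * (f y * pz s y)) = (\<lambda>y. K \<delta> R x y * f y)"
    unfolding K_def sum_distrib_right by (simp add: mult_ac)
  finally show *: "bochner_riesz \<nu> \<delta> R f x = (\<integral>y. K \<delta> R x y * f y \<partial>mu_nu \<nu>)" .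
  have "integrable (mu_nu \<nu>) (\<lambda>y. \<Sum>s\<in>Z \<inter> {..<R}. (wt \<delta> R s * pz s x) * (f y * pz s y))"
    using int by (intro Bochner_Integration.integrable_sum) auto
  also have "(\<lambda>y. \<Sum>s\<in>Z \<inter> {..<R}. (wt \<delta> R s * pz s x) * (f y * pz s y)) = (\<lambda>y. K \<delta> R x y * f y)"
    unfolding K_def sum_distrib_right by (simp add: mult_ac)
  finally have "integrable (mu_nu \<nu>) (\<lambda>y. K \<delta> R x y * f y)" .
  from integral_norm_bound_ennreal[OF this]
  show "ennreal \<bar>bochner_riesz \<nu> \<delta> R f x\<bar> \<le> (\<integral>\<^sup>+y. ennreal (\<bar>K \<delta> R x y\<bar> * \<bar>f y\<bar>) \<partial>mu_nu \<nu>)"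
    unfolding * by (simp add: abs_mult)
qed

text \<open>The approximate identity is decomposed into dyadic intervals around x, each bounded by
  the interval averages. The length 2 ^ k / R against the decay 2 powr (- k (1 + \<delta>)) leaves a
  geometric series of ratio 2 powr (- \<delta>), summable because \<delta> > 0.\<close>

lemma local_part:
  assumes \<delta>: "\<delta> > 0"
  obtains C R1 where "0 < C" "0 < R1" "\<And>R x f L. R1 \<le> R \<Longrightarrow> 0 < x \<Longrightarrow> x < 1 \<Longrightarrow> 2 \<le> R * x \<Longrightarrow> 
     f \<in> borel_measurable borel \<Longrightarrow> 0 \<le> L \<Longrightarrow>
     \<forall>a b. a < x \<longrightarrow> x < b \<longrightarrow> (\<integral>\<^sup>+y\<in>{a<..<b}. ennreal \<bar>f y\<bar> \<partial>mu_nu \<nu>) \<le> ennreal L * emeasure (mu_nu \<nu>) {a<..<b} \<Longrightarrow>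
     (\<integral>\<^sup>+y. ennreal (\<bar>K \<delta> R x y\<bar> * \<bar>f y\<bar>) * indicator {x / 2<..<2 * x} y \<partial>mu_nu \<nu>) \<le> ennreal (C * L)"
proof -
  obtain C1 R1 where C1: "0 < C1" "0 < R1" "\<And>R x y. R1 \<le> R \<Longrightarrow> 0 < x \<Longrightarrow> x < 1 \<Longrightarrow> y < 1 \<Longrightarrow> 2 \<le> R * x \<Longrightarrow> x / 2 < y \<Longrightarrow> y < 2 * x \<Longrightarrow>
     \<bar>K \<delta> R x y\<bar> \<le> C1 * x powr (- (2 * \<sigma>)) * R * (if R * \<bar>x - y\<bar> < 1 then 1 else (R * \<bar>x - y\<bar>) powr (- \<delta> - 1))"
    using K_local[OF \<delta>] by blast
  define \<rho> where "\<rho> = (2::real) powr (- \<delta>)"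
  have \<rho>: "0 < \<rho>" "\<rho> < 1" unfolding \<rho>_def using \<delta> powr_less_mono[of "- \<delta>" 0 "2::real"] by auto
  define Q where "Q = C1 * 2 powr (1 + \<delta>) * 2 powr \<bar>2 * \<sigma>\<bar> * 2"
  have Q: "Q > 0" unfolding Q_def using C1 by simp
  show ?thesis
  proof (rule that[of "Q / (1 - \<rho>)" R1])
    show "0 < Q / (1 - \<rho>)" "0 < R1" using Q \<rho> C1 by auto
    fix R x :: real and f :: "real \<Rightarrow> real" and L :: real assume h: "R1 \<le> R" "0 < x" "x < 1" "2 \<le> R * x" and f[measurable]: "f \<in> borel_measurable borel" and L: "0 \<le> (L::real)"
      and HP': "\<forall>a b. a < x \<longrightarrow> x < b \<longrightarrow> (\<integral>\<^sup>+y\<in>{a<..<b}. ennreal \<bar>f y\<bar> \<partial>mu_nu \<nu>) \<le> ennreal L * emeasure (mu_nu \<nu>) {a<..<b}"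
    have HP: "(\<integral>\<^sup>+y\<in>{a<..<b}. ennreal \<bar>f y\<bar> \<partial>mu_nu \<nu>) \<le> ennreal L * emeasure (mu_nu \<nu>) {a<..<b}" if "a < x" "x < b" for a b
      using HP' that by blast
    have R: "R > 0" using h C1 by simp
    define c0 where "c0 = C1 * x powr (- (2 * \<sigma>)) * R"
    have c0: "c0 \<ge> 0" unfolding c0_def using C1 R by simp
    define e where "e = (\<lambda>k::nat. 2 powr (1 + \<delta>) * 2 powr (- (real k * (1 + \<delta>))) :: real)"
    have e0: "e k \<ge> 0" for k unfolding e_def by simp
    \<comment> \<open>The dyadic intervals are cut off at x / 2 and 2 x, so that
      \<open>mu_local\<close> applies to each.\<close>
    define a where "a = (\<lambda>k::nat. max (x / 2) (x - 2 ^ k / R))"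
    define b where "b = (\<lambda>k::nat. min (2 * x) (x + 2 ^ k / R))"
    have ab: "a k < x" "x < b k" "x / 2 \<le> a k" "b k \<le> 2 * x" "b k - a k \<le> 2 * 2 ^ k / R" for k
    proof -
      have "2 ^ k / R > 0" using R by simp
      then show "a k < x" "x < b k" "x / 2 \<le> a k" "b k \<le> 2 * x" "b k - a k \<le> 2 * 2 ^ k / R"
        unfolding a_def b_def using h by auto
    qed
    have ind: "indicator {w. w < 2 ^ k} (R * \<bar>x - y\<bar>) * indicator {x / 2<..<2 * x} y = (indicator {a k<..<b k} y :: ennreal)" for k y
    proof -
      have "R * \<bar>x - y\<bar> < 2 ^ k \<longleftrightarrow> \<bar>x - y\<bar> < 2 ^ k / R" using R by (simp add: field_simps)
      then show ?thesis unfolding a_def b_def by (auto simp: indicator_def abs_less_iff)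
    qed
    have "(\<integral>\<^sup>+y. ennreal (\<bar>K \<delta> R x y\<bar> * \<bar>f y\<bar>) * indicator {x / 2<..<2 * x} y \<partial>mu_nu \<nu>)
      \<le> (\<integral>\<^sup>+y. (\<Sum>k. ennreal (c0 * e k) * (ennreal \<bar>f y\<bar> * indicator {a k<..<b k} y)) \<partial>mu_nu \<nu>)"
    proof (rule nn_integral_mono_AE)
      show "AE y in mu_nu \<nu>. ennreal (\<bar>K \<delta> R x y\<bar> * \<bar>f y\<bar>) * indicator {x / 2<..<2 * x} y
         \<le> (\<Sum>k. ennreal (c0 * e k) * (ennreal \<bar>f y\<bar> * indicator {a k<..<b k} y))"
        using AE_mu
      proof eventually_elim
        case (elim y)
        show ?case
        proof (cases "y \<in> {x / 2<..<2 * x}")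
          case True
          define w where "w = R * \<bar>x - y\<bar>"
          have w: "w \<ge> 0" unfolding w_def using R by simp
          have "\<bar>K \<delta> R x y\<bar> * \<bar>f y\<bar> \<le> (c0 * (if w < 1 then 1 else w powr (- \<delta> - 1))) * \<bar>f y\<bar>"
            unfolding c0_def w_def using True elim h by (intro mult_right_mono C1(3)) auto
          then have "ennreal (\<bar>K \<delta> R x y\<bar> * \<bar>f y\<bar>) \<le> ennreal c0 * ennreal \<bar>f y\<bar> * ennreal (if w < 1 then 1 else w powr (- \<delta> - 1))"
            using c0 by (simp add: ennreal_mult[symmetric] mult_ac ennreal_leI)
          also have "\<dots> \<le> ennreal c0 * ennreal \<bar>f y\<bar> * (\<Sum>k. ennreal (e k) * indicator {w. w < 2 ^ k} w)"
            unfolding e_def by (intro mult_left_mono sum_dyadic_decay w \<delta>) auto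
          also have "\<dots> = (\<Sum>k. ennreal c0 * ennreal \<bar>f y\<bar> * (ennreal (e k) * indicator {w. w < 2 ^ k} w))"
            by (rule ennreal_suminf_cmult[symmetric])
          also have "(\<lambda>k. ennreal c0 * ennreal \<bar>f y\<bar> * (ennreal (e k) * indicator {w. w < 2 ^ k} w)) = 
            (\<lambda>k. ennreal (c0 * e k) * (ennreal \<bar>f y\<bar> * indicator {a k<..<b k} y))"
            using True c0 e0 unfolding ind[symmetric] w_def by (simp add: ennreal_mult mult_ac)
          finally show ?thesis using True by simp
        qed simp
      qed
    qed
    also have "\<dots> = (\<Sum>k. \<integral>\<^sup>+y. ennreal (c0 * e k) * (ennreal \<bar>f y\<bar> * indicator {a k<..<b k} y) \<partial>mu_nu \<nu>)"
      by (rule nn_integral_suminf) measurable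
    also have "\<dots> \<le> (\<Sum>k. ennreal (Q * L * \<rho> ^ k))"
    proof (rule suminf_le)
      fix k
      have "(\<integral>\<^sup>+y. ennreal (c0 * e k) * (ennreal \<bar>f y\<bar> * indicator {a k<..<b k} y) \<partial>mu_nu \<nu>)
        = ennreal (c0 * e k) * (\<integral>\<^sup>+y\<in>{a k<..<b k}. ennreal \<bar>f y\<bar> \<partial>mu_nu \<nu>)"
        by (rule nn_integral_cmult) measurable
      also have "\<dots> \<le> ennreal (c0 * e k) * (ennreal L * ennreal (2 powr \<bar>2 * \<sigma>\<bar> * x powr (2 * \<sigma>) * (b k - a k)))"
        using ab[of k] h by (intro mult_left_mono order_trans[OF HP] mu_local) auto
      also have "\<dots> = ennreal (c0 * e k * (L * (2 powr \<bar>2 * \<sigma>\<bar> * x powr (2 * \<sigma>) * (b k - a k))))"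
        using c0 e0[of k] L ab[of k] by (simp add: ennreal_mult[symmetric])
      also have "\<dots> \<le> ennreal (c0 * e k * (L * (2 powr \<bar>2 * \<sigma>\<bar> * x powr (2 * \<sigma>) * (2 * 2 ^ k / R))))"
        using c0 e0[of k] L ab(5)[of k] by (intro ennreal_leI mult_left_mono) auto
      also have "c0 * e k * (L * (2 powr \<bar>2 * \<sigma>\<bar> * x powr (2 * \<sigma>) * (2 * 2 ^ k / R))) = Q * L * \<rho> ^ k"
      proof -
        have ek: "e k * 2 ^ k = 2 powr (1 + \<delta>) * \<rho> ^ k"
        proof -
          have "(2::real) powr (- (real k * (1 + \<delta>))) * 2 ^ k = 2 powr (- (real k * (1 + \<delta>))) * 2 powr (real k)"
            by (simp add: powr_realpow)
          also have "\<dots> = 2 powr (- \<delta> * real k)" unfolding powr_add[symmetric] by (simp add: algebra_simps)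
          also have "\<dots> = \<rho> powr real k" unfolding \<rho>_def by (simp only: powr_powr)
          also have "\<dots> = \<rho> ^ k" by (rule powr_realpow[OF \<rho>(1)])
          finally show ?thesis unfolding e_def by simp
        qed
        have xx: "x powr (- (2 * \<sigma>)) * x powr (2 * \<sigma>) = 1" using h by (simp add: powr_minus)
        have "c0 * e k * (L * (2 powr \<bar>2 * \<sigma>\<bar> * x powr (2 * \<sigma>) * (2 * 2 ^ k / R)))
          = C1 * (x powr (- (2 * \<sigma>)) * x powr (2 * \<sigma>)) * (e k * 2 ^ k) * L * 2 powr \<bar>2 * \<sigma>\<bar> * 2"
          unfolding c0_def using R by simp
        then show ?thesis unfolding xx ek Q_def by simp
      qed
      finally show "(\<integral>\<^sup>+y. ennreal (c0 * e k) * (ennreal \<bar>f y\<bar> * indicator {a k<..<b k} y) \<partial>mu_nu \<nu>) \<le> ennreal (Q * L * \<rho> ^ k)" .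
    qed auto
    also have "(\<Sum>k. ennreal (Q * L * \<rho> ^ k)) = ennreal (Q * L * (1 / (1 - \<rho>)))"
      using Q L \<rho> by (intro suminf_ennreal_eq sums_mult geometric_sums) auto
    finally show "(\<integral>\<^sup>+y. ennreal (\<bar>K \<delta> R x y\<bar> * \<bar>f y\<bar>) * indicator {x / 2<..<2 * x} y \<partial>mu_nu \<nu>) \<le> ennreal (Q / (1 - \<rho>) * L)"
      by (simp add: mult_ac)
  qed
qed

section \<open>The critical exponent and its dual\<close>

lemma p0_supercritical: "\<delta> > 0 \<Longrightarrow> \<sigma> \<le> \<delta> \<Longrightarrow> p0 \<nu> \<delta> = 1"
proof -
  assume \<delta>: "\<delta> > 0" "\<sigma> \<le> \<delta>"
  show ?thesis
  proof (cases "\<delta> > \<nu> + 1/2 \<or> \<nu> \<le> -1/2")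
    case True
    then show ?thesis by (simp add: p0_def)
  next
    case False
    \<comment> \<open>At this end point the second branch of \<open>p0\<close> applies and its
      quotient is also 1.\<close>
    then have "\<delta> = \<nu> + 1/2" using \<delta> unfolding \<sigma>_def by simp
    then show ?thesis using False nu unfolding p0_def by (simp add: field_simps)
  qed
qed

text \<open>4 (\<nu> + 1) = 2 d and 2 \<nu> + 3 + 2 \<delta> = 2 (\<sigma> + \<delta> + 1). The dual
  exponent is d / (\<sigma> - \<delta>), since the two denominators add up to d.\<close>

lemma p0_subcritical:
  assumes "\<delta> > 0" "\<delta> < \<sigma>"
  shows "p0 \<nu> \<delta> = d / (\<sigma> + \<delta> + 1)" "p0 \<nu> \<delta> > 1" "d / (\<sigma> - \<delta>) > 1" "1 / p0 \<nu> \<delta> + 1 / (d / (\<sigma> - \<delta>)) = 1"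
proof -
  show p: "p0 \<nu> \<delta> = d / (\<sigma> + \<delta> + 1)"
    using assms unfolding p0_def d_def \<sigma>_def by (auto simp: field_simps)
  show "p0 \<nu> \<delta> > 1" "d / (\<sigma> - \<delta>) > 1" unfolding p using assms unfolding d_def by (auto simp: field_simps)
  show "1 / p0 \<nu> \<delta> + 1 / (d / (\<sigma> - \<delta>)) = 1" unfolding p using d_pos assms
    by (simp add: add_divide_distrib[symmetric]) (simp add: d_def)
qed

lemma p0_ge1: "\<delta> > 0 \<Longrightarrow> p0 \<nu> \<delta> \<ge> 1"
  using p0_supercritical p0_subcritical(2) by (cases "\<sigma> \<le> \<delta>") force+

lemma holder_mu:
  fixes f w :: "real \<Rightarrow> real"
  assumes \<delta>: "\<delta> > 0" "\<delta> < \<sigma>" and [measurable]: "f \<in> borel_measurable borel" "w \<in> borel_measurable borel"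
    and w0: "\<And>y. w y \<ge> 0" and G: "G \<ge> 0" and H: "H \<ge> 0"
    and fG: "(\<integral>\<^sup>+y. ennreal (\<bar>f y\<bar> powr p0 \<nu> \<delta>) \<partial>mu_nu \<nu>) \<le> ennreal (G powr p0 \<nu> \<delta>)"
    and wH: "(\<integral>\<^sup>+y. ennreal (w y powr (d / (\<sigma> - \<delta>))) \<partial>mu_nu \<nu>) \<le> ennreal H"
  shows "(\<integral>\<^sup>+y. ennreal (w y * \<bar>f y\<bar>) \<partial>mu_nu \<nu>) \<le> ennreal (H powr ((\<sigma> - \<delta>) / d) * G)"
proof -
  have "(H powr ((\<sigma> - \<delta>) / d)) powr (d / (\<sigma> - \<delta>)) = H"
    using H d_pos \<delta> by (simp add: powr_powr)
  then have "(\<integral>\<^sup>+y. ennreal (\<bar>f y\<bar> * w y) \<partial>mu_nu \<nu>) \<le> ennreal (G * H powr ((\<sigma> - \<delta>) / d))"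
    using wH by (intro nn_Holder[OF _ _ _ _ p0_subcritical(2-4)[OF \<delta>] G _ fG]) (auto simp: w0)
  then show ?thesis by (simp add: mult.commute)
qed

section \<open>The weak type bound\<close>

text \<open>The measure is finite, so Hoelder against the constant 1 suffices. It is used for small
  R, where the kernel is merely bounded.\<close>

lemma L1_bound:
  assumes \<delta>: "\<delta> > 0"
  obtains C where "0 < C" "\<And>f G. f \<in> borel_measurable borel \<Longrightarrow> 0 \<le> G \<Longrightarrow>
    (\<integral>\<^sup>+y. ennreal (\<bar>f y\<bar> powr p0 \<nu> \<delta>) \<partial>mu_nu \<nu>) \<le> ennreal (G powr p0 \<nu> \<delta>) \<Longrightarrow>
    (\<integral>\<^sup>+y. ennreal \<bar>f y\<bar> \<partial>mu_nu \<nu>) \<le> ennreal (C * G)"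
proof (cases "\<sigma> \<le> \<delta>")
  case True
  then show ?thesis using that[of 1] p0_supercritical[OF \<delta> True] by simp
next
  case False
  show ?thesis
  proof (rule that[of "(1 / d) powr ((\<sigma> - \<delta>) / d)"])
    show "0 < (1 / d) powr ((\<sigma> - \<delta>) / d)" using d_pos by simp
    fix f G assume h: "f \<in> borel_measurable borel" "0 \<le> (G::real)" "(\<integral>\<^sup>+y. ennreal (\<bar>f y\<bar> powr p0 \<nu> \<delta>) \<partial>mu_nu \<nu>) \<le> ennreal (G powr p0 \<nu> \<delta>)"
    have "(\<integral>\<^sup>+y. ennreal (1 * \<bar>f y\<bar>) \<partial>mu_nu \<nu>) \<le> ennreal ((1 / d) powr ((\<sigma> - \<delta>) / d) * G)"
    proof (rule holder_mu[OF \<delta> _ h(1) _ _ h(2) _ h(3)])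
      have "(\<integral>\<^sup>+y. ennreal (1 powr (d / (\<sigma> - \<delta>))) \<partial>mu_nu \<nu>) = emeasure (mu_nu \<nu>) UNIV" by (simp add: mu_nu_def)
      then show "(\<integral>\<^sup>+y. ennreal (1 powr (d / (\<sigma> - \<delta>))) \<partial>mu_nu \<nu>) \<le> ennreal (1 / d)" using emeasure_mu_space by simp
    qed (use False d_pos in auto)
    then show "(\<integral>\<^sup>+y. ennreal \<bar>f y\<bar> \<partial>mu_nu \<nu>) \<le> ennreal ((1 / d) powr ((\<sigma> - \<delta>) / d) * G)" by simp
  qed
qed

text \<open>Hoelder on one interval passes from averages of the p-th power to averages of |f|.
  Working with the maximal function of the p-th power turns its weak (1,1) bound into the weak bound
  at exponent p.\<close>

lemma interval_average:
  assumes \<delta>: "\<delta> > 0" and f[measurable]: "f \<in> borel_measurable borel" and L: "0 \<le> L"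
    and x: "x \<notin> bad_set (mu_nu \<nu>) (\<lambda>y. ennreal (\<bar>f y\<bar> powr p0 \<nu> \<delta>)) (ennreal (L powr p0 \<nu> \<delta>))" and ab: "a < x" "x < b"
  shows "(\<integral>\<^sup>+y\<in>{a<..<b}. ennreal \<bar>f y\<bar> \<partial>mu_nu \<nu>) \<le> ennreal L * emeasure (mu_nu \<nu>) {a<..<b}"
proof (cases "\<sigma> \<le> \<delta>")
  case True
  show ?thesis using not_bad_set[OF x ab] L by (simp add: p0_supercritical[OF \<delta> True])
next
  case False
  then have \<delta>2: "\<delta> < \<sigma>" by simp
  define p where "p = p0 \<nu> \<delta>"
  have p: "p > 1" unfolding p_def by (rule p0_subcritical(2)[OF \<delta> \<delta>2])
  define m where "m = measure (mu_nu \<nu>) {a<..<b}"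
  have m: "emeasure (mu_nu \<nu>) {a<..<b} = ennreal m" "m \<ge> 0"
    unfolding m_def using finite_measure.emeasure_eq_measure[OF finite_mu] by auto
  have "(\<integral>\<^sup>+y. ennreal (indicator {a<..<b} y * \<bar>f y * indicator {a<..<b} y\<bar>) \<partial>mu_nu \<nu>) \<le> ennreal (m powr ((\<sigma> - \<delta>) / d) * (L * m powr (1 / p)))"
  proof (rule holder_mu[OF \<delta> \<delta>2])
    have "(\<integral>\<^sup>+y. ennreal (\<bar>f y * indicator {a<..<b} y\<bar> powr p) \<partial>mu_nu \<nu>) = (\<integral>\<^sup>+y\<in>{a<..<b}. ennreal (\<bar>f y\<bar> powr p) \<partial>mu_nu \<nu>)"
      by (rule nn_integral_cong) (auto split: split_indicator)
    also have "\<dots> \<le> ennreal (L powr p) * emeasure (mu_nu \<nu>) {a<..<b}"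
      using not_bad_set[OF x ab] unfolding p_def .
    also have "\<dots> = ennreal ((L * m powr (1 / p)) powr p)"
      using L m p by (simp add: powr_mult powr_powr ennreal_mult)
    finally show "(\<integral>\<^sup>+y. ennreal (\<bar>f y * indicator {a<..<b} y\<bar> powr p0 \<nu> \<delta>) \<partial>mu_nu \<nu>) \<le> ennreal ((L * m powr (1 / p)) powr p0 \<nu> \<delta>)"
      unfolding p_def .
    have "(\<integral>\<^sup>+y. ennreal (indicator {a<..<b} y powr (d / (\<sigma> - \<delta>))) \<partial>mu_nu \<nu>) = (\<integral>\<^sup>+y. indicator {a<..<b} y \<partial>mu_nu \<nu>)"
      by (rule nn_integral_cong) (auto split: split_indicator)
    then show "(\<integral>\<^sup>+y. ennreal (indicator {a<..<b} y powr (d / (\<sigma> - \<delta>))) \<partial>mu_nu \<nu>) \<le> ennreal m" using m by simp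
  qed (use L m in auto)
  also have "(\<integral>\<^sup>+y. ennreal (indicator {a<..<b} y * \<bar>f y * indicator {a<..<b} y\<bar>) \<partial>mu_nu \<nu>) = (\<integral>\<^sup>+y\<in>{a<..<b}. ennreal \<bar>f y\<bar> \<partial>mu_nu \<nu>)"
    by (rule nn_integral_cong) (auto split: split_indicator)
  also have "m powr ((\<sigma> - \<delta>) / d) * (L * m powr (1 / p)) = L * m"
  proof (cases "m = 0")
    case False
    have "(\<sigma> - \<delta>) / d + 1 / p = 1" using p0_subcritical(4)[OF \<delta> \<delta>2] unfolding p_def by (simp add: add.commute)
    then have "m powr ((\<sigma> - \<delta>) / d) * m powr (1 / p) = m" using m False by (simp add: powr_add[symmetric])
    then show ?thesis by (simp add: mult.left_commute)
  qed simp
  finally show ?thesis using m L by (simp add: ennreal_mult)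
qed

text \<open>Splitting at y = 1 / R, both pieces scale like the same power of R. The outer piece
  converges because \<sigma> q > d for the dual exponent q.\<close>

lemma weight_norm:
  assumes \<delta>: "\<delta> > 0" "\<delta> < \<sigma>" and R: "R > 0"
  shows "(\<integral>\<^sup>+y. ennreal ((y powr (- \<sigma>) * \<Phi> (R * y)) powr (d / (\<sigma> - \<delta>))) \<partial>mu_nu \<nu>)
    \<le> ennreal ((1 / d + 1 / (\<sigma> * (d / (\<sigma> - \<delta>)) - d)) * R powr (\<sigma> * (d / (\<sigma> - \<delta>)) - d))"
proof -
  define q where "q = d / (\<sigma> - \<delta>)"
  have q: "\<sigma> * q > d" "q > 0" unfolding q_def using \<delta> d_pos by (auto simp: field_simps)
  have \<sigma>0: "\<sigma> > 0" using \<delta> by simp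
  have "(\<integral>\<^sup>+y. ennreal ((y powr (- \<sigma>) * \<Phi> (R * y)) powr q) \<partial>mu_nu \<nu>)
    \<le> (\<integral>\<^sup>+y. ennreal (R powr (\<sigma> * q)) * indicator {y. y < 1 / R} y + ennreal (y powr (- \<sigma> * q)) * indicator {1 / R..} y \<partial>mu_nu \<nu>)"
  proof (rule nn_integral_mono_AE)
    show "AE y in mu_nu \<nu>. ennreal ((y powr (- \<sigma>) * \<Phi> (R * y)) powr q) \<le> 
      ennreal (R powr (\<sigma> * q)) * indicator {y. y < 1 / R} y + ennreal (y powr (- \<sigma> * q)) * indicator {1 / R..} y"
      using AE_mu
    proof eventually_elim
      case (elim y)
      show ?case
      proof (cases "y < 1 / R")
        case True
        then have "R * y \<le> 1" using R by (simp add: field_simps)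
        then have "y powr (- \<sigma>) * \<Phi> (R * y) = R powr \<sigma>" using R elim by (intro \<Phi>_weight_small) auto
        then show ?thesis using True by (simp add: powr_powr)
      next
        case False
        then have "R * y \<ge> 1" using R by (simp add: field_simps)
        then show ?thesis using False by (simp add: \<Phi>_ge1 powr_powr)
      qed
    qed
  qed
  also have "\<dots> = ennreal (R powr (\<sigma> * q)) * (\<integral>\<^sup>+y. indicator {y. y < 1 / R} y \<partial>mu_nu \<nu>) + (\<integral>\<^sup>+y. ennreal (y powr (- \<sigma> * q)) * indicator {1 / R..} y \<partial>mu_nu \<nu>)"
    by (subst nn_integral_add) (auto simp: nn_integral_cmult)
  also have "\<dots> \<le> ennreal (R powr (\<sigma> * q)) * ennreal ((1 / R) powr d / d) + ennreal ((1 / R) powr (- \<sigma> * q + d) / (- (- \<sigma> * q + d)))"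
    using R q by (intro add_mono mult_left_mono mu_less mu_greater) auto
  also have "\<dots> = ennreal (R powr (\<sigma> * q) * ((1 / R) powr d / d) + (1 / R) powr (- \<sigma> * q + d) / (- (- \<sigma> * q + d)))"
    using R q d_pos by (simp add: ennreal_mult[symmetric] ennreal_plus[symmetric] del: ennreal_plus)
  also have "(1 / R) powr d = R powr (- d)" using R powr_divide[of 1 R d] powr_minus_divide[of R d] by simp
  also have "(1 / R) powr (- \<sigma> * q + d) = R powr (\<sigma> * q - d)"
    using R powr_divide[of 1 R "- \<sigma> * q + d"] powr_minus_divide[of R "- \<sigma> * q + d"] by simp
  also have "R powr (\<sigma> * q) * (R powr (- d) / d) + R powr (\<sigma> * q - d) / (- (- \<sigma> * q + d)) = (1 / d + 1 / (\<sigma> * q - d)) * R powr (\<sigma> * q - d)"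
  proof -
    have "R powr (\<sigma> * q) * R powr (- d) = R powr (\<sigma> * q - d)" by (simp add: powr_add[symmetric])
    then show ?thesis by (simp add: distrib_right)
  qed
  finally show ?thesis unfolding q_def .
qed

text \<open>In the subcritical case Hoelder is applied to each of the three kernel terms, and by
  homogeneity each produces exactly x powr (- (\<sigma> + \<delta> + 1)), which is x powr (- (d /
  p0)).\<close>

lemma nonlocal_part:
  assumes \<delta>: "\<delta> > 0"
  obtains C R1 where "0 < C" "0 < R1" "\<And>R x f G. R1 \<le> R \<Longrightarrow> 0 < x \<Longrightarrow> x < 1 \<Longrightarrow> f \<in> borel_measurable borel \<Longrightarrow> 0 \<le> G \<Longrightarrow>
    (\<integral>\<^sup>+y. ennreal (\<bar>f y\<bar> powr p0 \<nu> \<delta>) \<partial>mu_nu \<nu>) \<le> ennreal (G powr p0 \<nu> \<delta>) \<Longrightarrow>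
    (\<integral>\<^sup>+y. ennreal (\<bar>K \<delta> R x y\<bar> * \<bar>f y\<bar>) * indicator {y. nonlocal R x y} y \<partial>mu_nu \<nu>) \<le> ennreal (C * x powr (- (d / p0 \<nu> \<delta>)) * G)"
proof (cases "\<sigma> \<le> \<delta>")
  case True
  note p1 = p0_supercritical[OF \<delta> True]
  obtain C R1 where C: "0 < C" "0 < R1" "\<And>R x y. R1 \<le> R \<Longrightarrow> 0 < x \<Longrightarrow> x < 1 \<Longrightarrow> 0 < y \<Longrightarrow> y < 1 \<Longrightarrow> nonlocal R x y \<Longrightarrow>
     \<bar>K \<delta> R x y\<bar> \<le> C * x powr (- d)" using K_nonlocal_supercritical[OF \<delta> True] by blast
  show ?thesis
  proof (rule that[OF C(1,2)])
    fix R x :: real and f :: "real \<Rightarrow> real" and G :: real assume h: "R1 \<le> R" "0 < x" "x < 1" and [measurable]: "f \<in> borel_measurable borel" and G: "0 \<le> (G::real)"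
      and fG: "(\<integral>\<^sup>+y. ennreal (\<bar>f y\<bar> powr p0 \<nu> \<delta>) \<partial>mu_nu \<nu>) \<le> ennreal (G powr p0 \<nu> \<delta>)"
    have "(\<integral>\<^sup>+y. ennreal (\<bar>K \<delta> R x y\<bar> * \<bar>f y\<bar>) * indicator {y. nonlocal R x y} y \<partial>mu_nu \<nu>)
      \<le> (\<integral>\<^sup>+y. ennreal (C * x powr (- d)) * ennreal \<bar>f y\<bar> \<partial>mu_nu \<nu>)"
    proof (rule nn_integral_mono_AE)
      show "AE y in mu_nu \<nu>. ennreal (\<bar>K \<delta> R x y\<bar> * \<bar>f y\<bar>) * indicator {y. nonlocal R x y} y \<le> ennreal (C * x powr (- d)) * ennreal \<bar>f y\<bar>"
        using AE_mu
      proof eventually_elim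
        case (elim y)
        show ?case
        proof (cases "nonlocal R x y")
          case True
          have "\<bar>K \<delta> R x y\<bar> * \<bar>f y\<bar> \<le> (C * x powr (- d)) * \<bar>f y\<bar>" using h elim True by (intro mult_right_mono C(3)) auto
          then show ?thesis using True C(1) by (simp add: ennreal_mult[symmetric] ennreal_leI)
        qed simp
      qed
    qed
    also have "\<dots> = ennreal (C * x powr (- d)) * (\<integral>\<^sup>+y. ennreal \<bar>f y\<bar> \<partial>mu_nu \<nu>)" by (rule nn_integral_cmult) measurable
    also have "\<dots> \<le> ennreal (C * x powr (- d)) * ennreal G" using fG G by (intro mult_left_mono) (auto simp: p1)
    also have "\<dots> = ennreal (C * x powr (- d) * G)" using C G by (simp add: ennreal_mult)
    finally show "(\<integral>\<^sup>+y. ennreal (\<bar>K \<delta> R x y\<bar> * \<bar>f y\<bar>) * indicator {y. nonlocal R x y} y \<partial>mu_nu \<nu>) \<le> ennreal (C * x powr (- (d / p0 \<nu> \<delta>)) * G)"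
      unfolding p1 by simp
  qed
next
  case False
  then have \<delta>2: "\<delta> < \<sigma>" by simp
  obtain C R1 where C: "0 < C" "0 < R1" "\<And>R x y. R1 \<le> R \<Longrightarrow> 0 < x \<Longrightarrow> x < 1 \<Longrightarrow> 0 < y \<Longrightarrow> y < 1 \<Longrightarrow> nonlocal R x y \<Longrightarrow>
     \<bar>K \<delta> R x y\<bar> \<le> C * (x powr (- d) * indicator {y. y < 2 * x} y * (if R * x < 2 then 1 else 0)
        + x powr (\<delta> - \<sigma>) * (y powr (- (\<sigma> + \<delta> + 1)) * indicator {x..} y)
        + x powr (- (\<sigma> + \<delta> + 1)) * R powr (- \<delta>) * (y powr (- \<sigma>) * \<Phi> (R * y)))"
    using K_nonlocal_subcritical[OF \<delta> \<delta>2] by blast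
  define q where "q = d / (\<sigma> - \<delta>)"
  define r where "r = (\<sigma> - \<delta>) / d"
  \<comment> \<open>This is (\<sigma> + \<delta> + 1) q > d after clearing the denominator \<sigma>
    - \<delta>.\<close>
  have "0 < d + \<delta> * (d * 2)" using d_pos \<delta> by (intro add_pos_pos mult_pos_pos) auto
  then have q: "q > 0" "q * r = 1" "\<sigma> * q > d" "(\<sigma> + \<delta> + 1) * q > d" unfolding q_def r_def using d_pos \<delta> \<delta>2 by (auto simp: field_simps)
  have dr: "d * r = \<sigma> - \<delta>" unfolding r_def using d_pos by simp
  have r0: "r > 0" unfolding r_def using d_pos \<delta>2 by simp
  define A1 where "A1 = (2 powr d / d) powr r"
  define A2 where "A2 = (1 / ((\<sigma> + \<delta> + 1) * q - d)) powr r"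
  define A3 where "A3 = (1 / d + 1 / (\<sigma> * q - d)) powr r"
  have "1 / d + 1 / (\<sigma> * q - d) > 0" using d_pos q by (intro add_pos_pos divide_pos_pos) auto
  then have A: "A1 > 0" "A2 > 0" "A3 > 0" unfolding A1_def A2_def A3_def using d_pos q by (auto intro!: add_pos_pos simp: powr_eq_0_iff)
  have pd: "d / p0 \<nu> \<delta> = \<sigma> + \<delta> + 1" unfolding p0_subcritical(1)[OF \<delta> \<delta>2] using d_pos \<delta> \<delta>2 by simp
  show ?thesis
  proof (rule that[of "C * (A1 + A2 + A3)" R1])
    show "0 < C * (A1 + A2 + A3)" "0 < R1" using C A by (auto intro!: mult_pos_pos add_pos_pos)
    fix R x :: real and f :: "real \<Rightarrow> real" and G :: real assume h: "R1 \<le> R" "0 < x" "x < 1" and f[measurable]: "f \<in> borel_measurable borel" and G: "0 \<le> (G::real)"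
      and fG: "(\<integral>\<^sup>+y. ennreal (\<bar>f y\<bar> powr p0 \<nu> \<delta>) \<partial>mu_nu \<nu>) \<le> ennreal (G powr p0 \<nu> \<delta>)"
    have R: "R > 0" using h C by simp
    define X where "X = x powr (- (\<sigma> + \<delta> + 1))"
    have [measurable]: "(\<lambda>y. \<Phi> (R * y)) \<in> borel_measurable borel" unfolding \<Phi>_def by measurable
    have H1: "(\<integral>\<^sup>+y. ennreal (indicator {y. y < 2 * x} y * \<bar>f y\<bar>) \<partial>mu_nu \<nu>) \<le> ennreal (((2 * x) powr d / d) powr r * G)"
      unfolding r_def
    proof (rule holder_mu[OF \<delta> \<delta>2 f _ _ G _ fG])
      have "(\<integral>\<^sup>+y. ennreal (indicator {y. y < 2 * x} y powr (d / (\<sigma> - \<delta>))) \<partial>mu_nu \<nu>) = (\<integral>\<^sup>+y. indicator {y. y < 2 * x} y \<partial>mu_nu \<nu>)"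
        by (rule nn_integral_cong) (auto split: split_indicator)
      also have "\<dots> \<le> ennreal ((2 * x) powr d / d)" by (rule mu_less) (use h in auto)
      finally show "(\<integral>\<^sup>+y. ennreal (indicator {y. y < 2 * x} y powr (d / (\<sigma> - \<delta>))) \<partial>mu_nu \<nu>) \<le> ennreal ((2 * x) powr d / d)" .
    qed (use d_pos in auto)
    have E1: "x powr (- d) * ((2 * x) powr d / d) powr r = A1 * X"
    proof -
      have "((2 * x) powr d / d) powr r = A1 * x powr (d * r)"
        unfolding A1_def using h d_pos by (simp add: powr_mult powr_divide powr_powr)
      then have "x powr (- d) * ((2 * x) powr d / d) powr r = A1 * (x powr (- d) * x powr (d * r))" by simp
      also have "x powr (- d) * x powr (d * r) = x powr (- d + (\<sigma> - \<delta>))" unfolding dr powr_add ..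
      also have "\<dots> = X" unfolding X_def d_def by (rule arg_cong[where f = "(powr) x"]) simp
      finally show ?thesis .
    qed
    define e where "e = - (\<sigma> + \<delta> + 1) * q"
    have ed: "e + d < 0" unfolding e_def using q(4) by (simp add: algebra_simps)
    have A2e: "A2 = (1 / (- (e + d))) powr r" unfolding A2_def e_def by (simp add: algebra_simps)
    have H2: "(\<integral>\<^sup>+y. ennreal ((y powr (- (\<sigma> + \<delta> + 1)) * indicator {x..} y) * \<bar>f y\<bar>) \<partial>mu_nu \<nu>) \<le> ennreal ((x powr (e + d) / (- (e + d))) powr r * G)"
      unfolding r_def
    proof (rule holder_mu[OF \<delta> \<delta>2 f _ _ G _ fG])
      have "(\<integral>\<^sup>+y. ennreal ((y powr (- (\<sigma> + \<delta> + 1)) * indicator {x..} y) powr (d / (\<sigma> - \<delta>))) \<partial>mu_nu \<nu>) = (\<integral>\<^sup>+y. ennreal (y powr e) * indicator {x..} y \<partial>mu_nu \<nu>)"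
        unfolding e_def q_def by (rule nn_integral_cong) (auto split: split_indicator simp: powr_powr)
      also have "\<dots> \<le> ennreal (x powr (e + d) / (- (e + d)))" by (rule mu_greater) (use h ed in auto)
      finally show "(\<integral>\<^sup>+y. ennreal ((y powr (- (\<sigma> + \<delta> + 1)) * indicator {x..} y) powr (d / (\<sigma> - \<delta>))) \<partial>mu_nu \<nu>) \<le> ennreal (x powr (e + d) / (- (e + d)))" .
    qed (use ed in auto)
    have E2: "x powr (\<delta> - \<sigma>) * (x powr (e + d) / (- (e + d))) powr r = A2 * X"
    proof -
      have "(x powr (e + d) / (- (e + d))) powr r = A2 * x powr ((e + d) * r)"
        unfolding A2e using h ed by (simp add: powr_divide powr_powr)
      then have "x powr (\<delta> - \<sigma>) * (x powr (e + d) / (- (e + d))) powr r = A2 * (x powr (\<delta> - \<sigma>) * x powr ((e + d) * r))" by simp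
      also have "(e + d) * r = - (\<sigma> + \<delta> + 1) + (\<sigma> - \<delta>)"
      proof -
        have "(e + d) * r = - (\<sigma> + \<delta> + 1) * (q * r) + d * r" unfolding e_def by (simp add: algebra_simps)
        then show ?thesis unfolding q dr by simp
      qed
      also have "x powr (\<delta> - \<sigma>) * x powr (- (\<sigma> + \<delta> + 1) + (\<sigma> - \<delta>)) = X" unfolding X_def powr_add[symmetric] by (rule arg_cong[where f = "(powr) x"]) simp
      finally show ?thesis .
    qed
    have H3: "(\<integral>\<^sup>+y. ennreal ((y powr (- \<sigma>) * \<Phi> (R * y)) * \<bar>f y\<bar>) \<partial>mu_nu \<nu>) \<le> ennreal (((1 / d + 1 / (\<sigma> * q - d)) * R powr (\<sigma> * q - d)) powr r * G)"
      unfolding r_def q_def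
      by (rule holder_mu[OF \<delta> \<delta>2 f _ _ G _ fG weight_norm[OF \<delta> \<delta>2 R]])
         (use d_pos q in \<open>auto simp: q_def intro!: mult_nonneg_nonneg add_nonneg_nonneg \<Phi>_nonneg\<close>)
    \<comment> \<open>The dual norm of the weight is a multiple of R powr \<delta>, which cancels
      the remaining R powr (- \<delta>).\<close>
    have E3: "X * R powr (- \<delta>) * ((1 / d + 1 / (\<sigma> * q - d)) * R powr (\<sigma> * q - d)) powr r = A3 * X"
    proof -
      have "((1 / d + 1 / (\<sigma> * q - d)) * R powr (\<sigma> * q - d)) powr r = A3 * R powr ((\<sigma> * q - d) * r)"
        unfolding A3_def powr_mult powr_powr ..
      also have "(\<sigma> * q - d) * r = \<delta>"
      proof -
        have "(\<sigma> * q - d) * r = \<sigma> * (q * r) - d * r" by (simp add: algebra_simps)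
        then show ?thesis unfolding q dr by simp
      qed
      finally have "X * R powr (- \<delta>) * ((1 / d + 1 / (\<sigma> * q - d)) * R powr (\<sigma> * q - d)) powr r = A3 * X * (R powr (- \<delta>) * R powr \<delta>)" by simp
      also have "R powr (- \<delta>) * R powr \<delta> = 1" using R by (simp add: powr_minus)
      finally show ?thesis by simp
    qed
    have "(\<integral>\<^sup>+y. ennreal (\<bar>K \<delta> R x y\<bar> * \<bar>f y\<bar>) * indicator {y. nonlocal R x y} y \<partial>mu_nu \<nu>)
      \<le> (\<integral>\<^sup>+y. ennreal C * (ennreal (x powr (- d)) * ennreal (indicator {y. y < 2 * x} y * \<bar>f y\<bar>)
          + ennreal (x powr (\<delta> - \<sigma>)) * ennreal ((y powr (- (\<sigma> + \<delta> + 1)) * indicator {x..} y) * \<bar>f y\<bar>)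
          + ennreal (X * R powr (- \<delta>)) * ennreal ((y powr (- \<sigma>) * \<Phi> (R * y)) * \<bar>f y\<bar>)) \<partial>mu_nu \<nu>)"
    proof (rule nn_integral_mono_AE)
      show "AE y in mu_nu \<nu>. ennreal (\<bar>K \<delta> R x y\<bar> * \<bar>f y\<bar>) * indicator {y. nonlocal R x y} y \<le> 
        ennreal C * (ennreal (x powr (- d)) * ennreal (indicator {y. y < 2 * x} y * \<bar>f y\<bar>)
          + ennreal (x powr (\<delta> - \<sigma>)) * ennreal ((y powr (- (\<sigma> + \<delta> + 1)) * indicator {x..} y) * \<bar>f y\<bar>)
          + ennreal (X * R powr (- \<delta>)) * ennreal ((y powr (- \<sigma>) * \<Phi> (R * y)) * \<bar>f y\<bar>))"
        using AE_mu
      proof eventually_elim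
        case (elim y)
        show ?case
        proof (cases "nonlocal R x y")
          case True
          define i1 :: real where "i1 = indicator {y. y < 2 * x} y"
          define i2 where "i2 = y powr (- (\<sigma> + \<delta> + 1)) * indicator {x..} y"
          define i3 where "i3 = y powr (- \<sigma>) * \<Phi> (R * y)"
          have i: "i1 \<ge> 0" "i2 \<ge> 0" "i3 \<ge> 0" "X \<ge> 0" unfolding i1_def i2_def i3_def X_def by (auto intro!: mult_nonneg_nonneg \<Phi>_nonneg)
          have "\<bar>K \<delta> R x y\<bar> \<le> C * (x powr (- d) * i1 * (if R * x < 2 then 1 else 0) + x powr (\<delta> - \<sigma>) * i2 + X * R powr (- \<delta>) * i3)"
            unfolding i1_def i2_def i3_def X_def using h elim True by (intro C(3)) auto
          also have "\<dots> \<le> C * (x powr (- d) * i1 * 1 + x powr (\<delta> - \<sigma>) * i2 + X * R powr (- \<delta>) * i3)"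
            using C(1) i by (intro mult_left_mono add_right_mono) auto
          finally have "\<bar>K \<delta> R x y\<bar> * \<bar>f y\<bar> \<le> C * (x powr (- d) * i1 * 1 + x powr (\<delta> - \<sigma>) * i2 + X * R powr (- \<delta>) * i3) * \<bar>f y\<bar>"
            by (rule mult_right_mono) simp
          also have "\<dots> = C * (x powr (- d) * (i1 * \<bar>f y\<bar>) + x powr (\<delta> - \<sigma>) * (i2 * \<bar>f y\<bar>) + X * R powr (- \<delta>) * (i3 * \<bar>f y\<bar>))"
            by (simp add: algebra_simps)
          finally have "ennreal (\<bar>K \<delta> R x y\<bar> * \<bar>f y\<bar>) \<le> ennreal (C * (x powr (- d) * (i1 * \<bar>f y\<bar>) + x powr (\<delta> - \<sigma>) * (i2 * \<bar>f y\<bar>) + X * R powr (- \<delta>) * (i3 * \<bar>f y\<bar>)))"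
            by (rule ennreal_leI)
          also have "\<dots> = ennreal C * (ennreal (x powr (- d)) * ennreal (i1 * \<bar>f y\<bar>) + ennreal (x powr (\<delta> - \<sigma>)) * ennreal (i2 * \<bar>f y\<bar>) + ennreal (X * R powr (- \<delta>)) * ennreal (i3 * \<bar>f y\<bar>))"
          proof -
            have n: "0 \<le> i1 * \<bar>f y\<bar>" "0 \<le> i2 * \<bar>f y\<bar>" "0 \<le> i3 * \<bar>f y\<bar>" "0 \<le> X * R powr (- \<delta>)" using i by auto
            then have "0 \<le> x powr (- d) * (i1 * \<bar>f y\<bar>)" "0 \<le> x powr (\<delta> - \<sigma>) * (i2 * \<bar>f y\<bar>)" "0 \<le> X * R powr (- \<delta>) * (i3 * \<bar>f y\<bar>)"
              by (auto intro: mult_nonneg_nonneg)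
            then show ?thesis using n C(1) by (simp only: ennreal_mult' ennreal_mult ennreal_plus add_nonneg_nonneg less_imp_le powr_ge_zero)
          qed
          finally show ?thesis using True unfolding i1_def i2_def i3_def by simp
        qed simp
      qed
    qed
    also have "\<dots> = ennreal C * (ennreal (x powr (- d)) * (\<integral>\<^sup>+y. ennreal (indicator {y. y < 2 * x} y * \<bar>f y\<bar>) \<partial>mu_nu \<nu>)
          + ennreal (x powr (\<delta> - \<sigma>)) * (\<integral>\<^sup>+y. ennreal ((y powr (- (\<sigma> + \<delta> + 1)) * indicator {x..} y) * \<bar>f y\<bar>) \<partial>mu_nu \<nu>)
          + ennreal (X * R powr (- \<delta>)) * (\<integral>\<^sup>+y. ennreal ((y powr (- \<sigma>) * \<Phi> (R * y)) * \<bar>f y\<bar>) \<partial>mu_nu \<nu>))"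
      by (subst nn_integral_cmult, measurable, subst nn_integral_add, measurable, subst nn_integral_add, measurable)
         (simp add: nn_integral_cmult)
    also have "\<dots> \<le> ennreal C * (ennreal (x powr (- d)) * ennreal (((2 * x) powr d / d) powr r * G)
          + ennreal (x powr (\<delta> - \<sigma>)) * ennreal ((x powr (e + d) / (- (e + d))) powr r * G)
          + ennreal (X * R powr (- \<delta>)) * ennreal (((1 / d + 1 / (\<sigma> * q - d)) * R powr (\<sigma> * q - d)) powr r * G))"
      by (intro mult_left_mono add_mono H1 H2 H3) auto
    also have "\<dots> = ennreal C * (ennreal (A1 * X * G) + ennreal (A2 * X * G) + ennreal (A3 * X * G))"
    proof -
      have "X \<ge> 0" unfolding X_def by simp
      then have t: "ennreal a * ennreal (b * G) = ennreal (c * G)" if "a * b = c" "a \<ge> 0" "b \<ge> 0" for a b c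
        using that G by (simp add: ennreal_mult[symmetric] mult.assoc[symmetric])
      show ?thesis
        using t[OF E1] t[OF E2] t[OF E3] \<open>X \<ge> 0\<close> by simp
    qed
    also have "\<dots> = ennreal (C * (A1 + A2 + A3) * X * G)"
    proof -
      have "0 \<le> A1 * X * G" "0 \<le> A2 * X * G" "0 \<le> A3 * X * G" using A G unfolding X_def by auto
      then have "ennreal C * (ennreal (A1 * X * G) + ennreal (A2 * X * G) + ennreal (A3 * X * G)) = ennreal (C * (A1 * X * G + A2 * X * G + A3 * X * G))"
        using C(1) by (simp add: ennreal_mult ennreal_plus)
      also have "C * (A1 * X * G + A2 * X * G + A3 * X * G) = C * (A1 + A2 + A3) * X * G" by (simp add: algebra_simps)
      finally show ?thesis .
    qed
    finally show "(\<integral>\<^sup>+y. ennreal (\<bar>K \<delta> R x y\<bar> * \<bar>f y\<bar>) * indicator {y. nonlocal R x y} y \<partial>mu_nu \<nu>) \<le> ennreal (C * (A1 + A2 + A3) * x powr (- (d / p0 \<nu> \<delta>)) * G)"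
      unfolding pd X_def .
  qed
qed

text \<open>Covers the values of R below the threshold of the contour estimate. Below the first zero
  the kernel is an empty sum; between that and R1 all powers of R are bounded, whatever the sign of
  \<sigma>.\<close>

lemma K_bounded_small_R:
  assumes \<delta>: "\<delta> > 0"
  obtains C where "0 < C" "\<And>R x y. 0 < R \<Longrightarrow> R \<le> R1 \<Longrightarrow> 0 < x \<Longrightarrow> x < 1 \<Longrightarrow> 0 < y \<Longrightarrow> y < 1 \<Longrightarrow> \<bar>K \<delta> R x y\<bar> \<le> C"
proof -
  obtain \<eta> where \<eta>: "0 < \<eta>" "\<And>x. x \<in> Z \<Longrightarrow> \<eta> \<le> x" using Z_floor by metis
  obtain CD where CD: "0 < CD" "\<And>R x y. 0 < R \<Longrightarrow> 0 < x \<Longrightarrow> 0 < y \<Longrightarrow>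
     \<bar>K \<delta> R x y\<bar> \<le> CD * ((x powr (- \<sigma>) * \<Phi> (R * x)) * (y powr (- \<sigma>) * \<Phi> (R * y)) * R)"
    using K_diag_split[OF \<delta>] by blast
  define b where "b = max 1 R1"
  define B where "B = b powr \<bar>\<sigma>\<bar> * max (b powr \<sigma>) (\<eta> powr \<sigma>)"
  have b: "b \<ge> 1" unfolding b_def by simp
  have B: "B > 0" unfolding B_def using b by (auto simp: less_max_iff_disj)
  show ?thesis
  proof (rule that[of "CD * (B * B * b)"])
    show "0 < CD * (B * B * b)" using CD B b by simp
    fix R x y :: real assume h: "0 < R" "R \<le> R1" "0 < x" "x < 1" "0 < y" "y < 1"
    show "\<bar>K \<delta> R x y\<bar> \<le> CD * (B * B * b)"
    proof (cases "R < \<eta>")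
      case True
      then have "Z \<inter> {..<R} = {}" using \<eta>(2) by force
      then show ?thesis unfolding K_def using CD B b by simp
    next
      case False
      have Rs: "R powr \<sigma> \<le> max (b powr \<sigma>) (\<eta> powr \<sigma>)"
      proof (cases "\<sigma> \<ge> 0")
        case True
        then have "R powr \<sigma> \<le> b powr \<sigma>" using h unfolding b_def by (intro powr_mono2) auto
        then show ?thesis by simp
      next
        case f: False
        then have "R powr \<sigma> \<le> \<eta> powr \<sigma>" using False \<eta> by (intro powr_mono2') auto
        then show ?thesis by simp
      qed
      have v: "v powr (- \<sigma>) * \<Phi> (R * v) \<le> B" if "0 < v" "v < 1" for v
      proof -
        have "R * v \<le> b * 1" using that h b unfolding b_def by (intro mult_mono) auto
        then have "v powr (- \<sigma>) * \<Phi> (R * v) \<le> b powr \<bar>\<sigma>\<bar> * R powr \<sigma>" using that h b by (intro v\<Phi>_small) auto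
        also have "\<dots> \<le> B" unfolding B_def using Rs by (intro mult_left_mono) auto
        finally show ?thesis .
      qed
      have "\<bar>K \<delta> R x y\<bar> \<le> CD * ((x powr (- \<sigma>) * \<Phi> (R * x)) * (y powr (- \<sigma>) * \<Phi> (R * y)) * R)" using CD(2) h by blast
      also have "\<dots> \<le> CD * (B * B * b)"
        using CD(1) v[of x] v[of y] h B unfolding b_def by (intro mult_left_mono mult_mono) (auto intro!: mult_nonneg_nonneg \<Phi>_nonneg)
      finally show ?thesis .
    qed
  qed
qed

text \<open>Neither the constant nor the right side depends on R, so the bound passes to the
  supremum. L plays the role of the value of the maximal function at x.\<close>

lemma pointwise_bound:
  assumes \<delta>: "\<delta> > 0"
  obtains C where "0 < C" "\<And>R x f G L. 0 < R \<Longrightarrow> 0 < x \<Longrightarrow> x < 1 \<Longrightarrow> f \<in> borel_measurable borel \<Longrightarrow> 0 \<le> G \<Longrightarrow>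
    (\<integral>\<^sup>+y. ennreal (\<bar>f y\<bar> powr p0 \<nu> \<delta>) \<partial>mu_nu \<nu>) \<le> ennreal (G powr p0 \<nu> \<delta>) \<Longrightarrow> 0 \<le> L \<Longrightarrow>
    x \<notin> bad_set (mu_nu \<nu>) (\<lambda>y. ennreal (\<bar>f y\<bar> powr p0 \<nu> \<delta>)) (ennreal (L powr p0 \<nu> \<delta>)) \<Longrightarrow>
    (\<integral>\<^sup>+y. ennreal (\<bar>K \<delta> R x y\<bar> * \<bar>f y\<bar>) \<partial>mu_nu \<nu>) \<le> ennreal (C * (x powr (- (d / p0 \<nu> \<delta>)) * G + L))"
proof -
  obtain CL RL where CL: "0 < CL" "0 < RL" "\<And>R x f L. RL \<le> R \<Longrightarrow> 0 < x \<Longrightarrow> x < 1 \<Longrightarrow> 2 \<le> R * x \<Longrightarrow> 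
     f \<in> borel_measurable borel \<Longrightarrow> 0 \<le> L \<Longrightarrow>
     \<forall>a b. a < x \<longrightarrow> x < b \<longrightarrow> (\<integral>\<^sup>+y\<in>{a<..<b}. ennreal \<bar>f y\<bar> \<partial>mu_nu \<nu>) \<le> ennreal L * emeasure (mu_nu \<nu>) {a<..<b} \<Longrightarrow>
     (\<integral>\<^sup>+y. ennreal (\<bar>K \<delta> R x y\<bar> * \<bar>f y\<bar>) * indicator {x / 2<..<2 * x} y \<partial>mu_nu \<nu>) \<le> ennreal (CL * L)"
    by (rule local_part[OF \<delta>], rule that)
  obtain CN RN where CN: "0 < CN" "0 < RN" "\<And>R x f G. RN \<le> R \<Longrightarrow> 0 < x \<Longrightarrow> x < 1 \<Longrightarrow> f \<in> borel_measurable borel \<Longrightarrow> 0 \<le> G \<Longrightarrow>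
    (\<integral>\<^sup>+y. ennreal (\<bar>f y\<bar> powr p0 \<nu> \<delta>) \<partial>mu_nu \<nu>) \<le> ennreal (G powr p0 \<nu> \<delta>) \<Longrightarrow>
    (\<integral>\<^sup>+y. ennreal (\<bar>K \<delta> R x y\<bar> * \<bar>f y\<bar>) * indicator {y. nonlocal R x y} y \<partial>mu_nu \<nu>) \<le> ennreal (CN * x powr (- (d / p0 \<nu> \<delta>)) * G)"
    by (rule nonlocal_part[OF \<delta>], rule that)
  define R1 where "R1 = max RL RN"
  obtain CK where CK: "0 < CK" "\<And>R x y. 0 < R \<Longrightarrow> R \<le> R1 \<Longrightarrow> 0 < x \<Longrightarrow> x < 1 \<Longrightarrow> 0 < y \<Longrightarrow> y < 1 \<Longrightarrow> \<bar>K \<delta> R x y\<bar> \<le> CK"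
    by (rule K_bounded_small_R[OF \<delta>, of R1], rule that)
  obtain C1 where C1: "0 < C1" "\<And>f G. f \<in> borel_measurable borel \<Longrightarrow> 0 \<le> G \<Longrightarrow>
    (\<integral>\<^sup>+y. ennreal (\<bar>f y\<bar> powr p0 \<nu> \<delta>) \<partial>mu_nu \<nu>) \<le> ennreal (G powr p0 \<nu> \<delta>) \<Longrightarrow>
    (\<integral>\<^sup>+y. ennreal \<bar>f y\<bar> \<partial>mu_nu \<nu>) \<le> ennreal (C1 * G)"
    by (rule L1_bound[OF \<delta>], rule that)
  define C where "C = CL + CN + CK * C1"
  have C: "CL \<le> C" "CN \<le> C" "CK * C1 \<le> C" "0 < C" unfolding C_def using CL CN CK(1) C1(1) by (auto intro!: add_pos_pos)
  show ?thesis
  proof (rule that[OF C(4)])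
    fix R x :: real and f :: "real \<Rightarrow> real" and G L :: real assume R: "0 < R" and x: "0 < x" "x < 1" and f[measurable]: "f \<in> borel_measurable borel" and G: "0 \<le> (G::real)"
      and fG: "(\<integral>\<^sup>+y. ennreal (\<bar>f y\<bar> powr p0 \<nu> \<delta>) \<partial>mu_nu \<nu>) \<le> ennreal (G powr p0 \<nu> \<delta>)" and L: "0 \<le> (L::real)"
      and bad: "x \<notin> bad_set (mu_nu \<nu>) (\<lambda>y. ennreal (\<bar>f y\<bar> powr p0 \<nu> \<delta>)) (ennreal (L powr p0 \<nu> \<delta>))"
    define X where "X = x powr (- (d / p0 \<nu> \<delta>))"
    have p: "p0 \<nu> \<delta> \<ge> 1" by (rule p0_ge1[OF \<delta>])
    have X: "X \<ge> 1"
    proof -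
      have "1 powr (- (d / p0 \<nu> \<delta>)) \<le> x powr (- (d / p0 \<nu> \<delta>))" using x d_pos p by (intro powr_mono2') auto
      then show ?thesis unfolding X_def by simp
    qed
    have "(\<integral>\<^sup>+y. ennreal (\<bar>K \<delta> R x y\<bar> * \<bar>f y\<bar>) \<partial>mu_nu \<nu>) \<le> ennreal (C * (X * G + L))"
    proof (cases "R < R1")
      case True
      have "(\<integral>\<^sup>+y. ennreal (\<bar>K \<delta> R x y\<bar> * \<bar>f y\<bar>) \<partial>mu_nu \<nu>) \<le> (\<integral>\<^sup>+y. ennreal CK * ennreal \<bar>f y\<bar> \<partial>mu_nu \<nu>)"
      proof (rule nn_integral_mono_AE)
        show "AE y in mu_nu \<nu>. ennreal (\<bar>K \<delta> R x y\<bar> * \<bar>f y\<bar>) \<le> ennreal CK * ennreal \<bar>f y\<bar>"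
          using AE_mu
        proof eventually_elim
          case (elim y)
          have "\<bar>K \<delta> R x y\<bar> * \<bar>f y\<bar> \<le> CK * \<bar>f y\<bar>" using elim x R True by (intro mult_right_mono CK(2)) auto
          then show ?case using CK(1) by (simp add: ennreal_mult[symmetric] ennreal_leI)
        qed
      qed
      also have "\<dots> = ennreal CK * (\<integral>\<^sup>+y. ennreal \<bar>f y\<bar> \<partial>mu_nu \<nu>)" by (rule nn_integral_cmult) measurable
      also have "\<dots> \<le> ennreal CK * ennreal (C1 * G)" by (intro mult_left_mono C1(2) f G fG) auto
      also have "\<dots> = ennreal (CK * C1 * (1 * G))" using CK(1) C1(1) G by (simp add: ennreal_mult[symmetric] mult.assoc)
      also have "\<dots> \<le> ennreal (C * (X * G + L))"
      proof (rule ennreal_leI)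
        have "CK * C1 * (1 * G) \<le> C * (X * G)" using C X G CK(1) C1(1) by (intro mult_mono mult_right_mono) auto
        also have "\<dots> \<le> C * (X * G + L)" using C L by (intro mult_left_mono) auto
        finally show "CK * C1 * (1 * G) \<le> C * (X * G + L)" .
      qed
      finally show ?thesis .
    next
      case False
      then have RR: "RL \<le> R" "RN \<le> R" unfolding R1_def by auto
      have N: "(\<integral>\<^sup>+y. ennreal (\<bar>K \<delta> R x y\<bar> * \<bar>f y\<bar>) * indicator {y. nonlocal R x y} y \<partial>mu_nu \<nu>) \<le> ennreal (C * (X * G))"
      proof -
        have "(\<integral>\<^sup>+y. ennreal (\<bar>K \<delta> R x y\<bar> * \<bar>f y\<bar>) * indicator {y. nonlocal R x y} y \<partial>mu_nu \<nu>) \<le> ennreal (CN * X * G)"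
          unfolding X_def by (rule CN(3)[OF RR(2) x f G fG])
        also have "\<dots> \<le> ennreal (C * (X * G))" using C X G unfolding mult.assoc by (intro ennreal_leI mult_right_mono) auto
        finally show ?thesis .
      qed
      show ?thesis
      proof (cases "R * x < 2")
        case True
        then have "(\<integral>\<^sup>+y. ennreal (\<bar>K \<delta> R x y\<bar> * \<bar>f y\<bar>) \<partial>mu_nu \<nu>) = (\<integral>\<^sup>+y. ennreal (\<bar>K \<delta> R x y\<bar> * \<bar>f y\<bar>) * indicator {y. nonlocal R x y} y \<partial>mu_nu \<nu>)"
          by (intro nn_integral_cong) (simp add: nonlocal_def)
        also have "\<dots> \<le> ennreal (C * (X * G))" by (rule N)
        also have "\<dots> \<le> ennreal (C * (X * G + L))" using C L by (intro ennreal_leI mult_left_mono) auto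
        finally show ?thesis .
      next
        case R2: False
        have "(\<integral>\<^sup>+y. ennreal (\<bar>K \<delta> R x y\<bar> * \<bar>f y\<bar>) \<partial>mu_nu \<nu>) = 
          (\<integral>\<^sup>+y. ennreal (\<bar>K \<delta> R x y\<bar> * \<bar>f y\<bar>) * indicator {y. nonlocal R x y} y + ennreal (\<bar>K \<delta> R x y\<bar> * \<bar>f y\<bar>) * indicator {x / 2<..<2 * x} y \<partial>mu_nu \<nu>)"
          by (rule nn_integral_cong) (use R2 in \<open>auto simp: nonlocal_def indicator_def\<close>)
        also have "\<dots> = (\<integral>\<^sup>+y. ennreal (\<bar>K \<delta> R x y\<bar> * \<bar>f y\<bar>) * indicator {y. nonlocal R x y} y \<partial>mu_nu \<nu>) + (\<integral>\<^sup>+y. ennreal (\<bar>K \<delta> R x y\<bar> * \<bar>f y\<bar>) * indicator {x / 2<..<2 * x} y \<partial>mu_nu \<nu>)"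
          unfolding nonlocal_def by (rule nn_integral_add) measurable
        also have "\<dots> \<le> ennreal (C * (X * G)) + ennreal (CL * L)"
        proof (intro add_mono N)
          show "(\<integral>\<^sup>+y. ennreal (\<bar>K \<delta> R x y\<bar> * \<bar>f y\<bar>) * indicator {x / 2<..<2 * x} y \<partial>mu_nu \<nu>) \<le> ennreal (CL * L)"
            by (rule CL(3)[OF RR(1) x _ f L]) (use R2 interval_average[OF \<delta> f L bad] in auto)
        qed
        also have "\<dots> \<le> ennreal (C * (X * G)) + ennreal (C * L)" using C L by (intro add_left_mono ennreal_leI mult_right_mono) auto
        also have "\<dots> = ennreal (C * (X * G + L))" using C X G L by (subst ennreal_plus[symmetric]) (auto simp: distrib_left)
        finally show ?thesis .
      qed
    qed
    then show "(\<integral>\<^sup>+y. ennreal (\<bar>K \<delta> R x y\<bar> * \<bar>f y\<bar>) \<partial>mu_nu \<nu>) \<le> ennreal (C * (x powr (- (d / p0 \<nu> \<delta>)) * G + L))"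
      unfolding X_def .
  qed
qed

text \<open>The level set is covered by an interval at 0, where the power of x may be large, and the
  bad set of the maximal function; each has measure of order (G / t) powr p.\<close>

lemma maximal_distribution_bound:
  assumes \<delta>: "\<delta> > 0"
  obtains C where "0 < C" "\<And>f G t. f \<in> borel_measurable borel \<Longrightarrow> integrable (mu_nu \<nu>) f \<Longrightarrow> 0 \<le> G \<Longrightarrow>
    (\<integral>\<^sup>+y. ennreal (\<bar>f y\<bar> powr p0 \<nu> \<delta>) \<partial>mu_nu \<nu>) \<le> ennreal (G powr p0 \<nu> \<delta>) \<Longrightarrow> 0 < t \<Longrightarrow>
    emeasure (mu_nu \<nu>) {x \<in> {0<..<1}. bochner_riesz_max \<nu> \<delta> f x > ennreal t} \<le> ennreal ((C * G / t) powr p0 \<nu> \<delta>)"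
proof -
  define p where "p = p0 \<nu> \<delta>"
  have p: "p \<ge> 1" unfolding p_def by (rule p0_ge1[OF \<delta>])
  obtain C0 where C0: "0 < C0" "\<And>R x f G L. 0 < R \<Longrightarrow> 0 < x \<Longrightarrow> x < 1 \<Longrightarrow> f \<in> borel_measurable borel \<Longrightarrow> 0 \<le> G \<Longrightarrow>
    (\<integral>\<^sup>+y. ennreal (\<bar>f y\<bar> powr p0 \<nu> \<delta>) \<partial>mu_nu \<nu>) \<le> ennreal (G powr p0 \<nu> \<delta>) \<Longrightarrow> 0 \<le> L \<Longrightarrow>
    x \<notin> bad_set (mu_nu \<nu>) (\<lambda>y. ennreal (\<bar>f y\<bar> powr p0 \<nu> \<delta>)) (ennreal (L powr p0 \<nu> \<delta>)) \<Longrightarrow>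
    (\<integral>\<^sup>+y. ennreal (\<bar>K \<delta> R x y\<bar> * \<bar>f y\<bar>) \<partial>mu_nu \<nu>) \<le> ennreal (C0 * (x powr (- (d / p0 \<nu> \<delta>)) * G + L))"
    by (rule pointwise_bound[OF \<delta>], rule that)
  \<comment> \<open>1 / d comes from the mass of the interval at 0, and 2 from the weak-type bound
    of the maximal function.\<close>
  define D where "D = 1 / d + 2"
  have D: "D > 0" unfolding D_def using divide_pos_pos[OF zero_less_one d_pos] by linarith
  show ?thesis
  proof (rule that[of "D powr (1 / p) * (2 * C0)"])
    show "0 < D powr (1 / p) * (2 * C0)" using D C0 by simp
    fix f G t assume f[measurable]: "f \<in> borel_measurable borel" and fint: "integrable (mu_nu \<nu>) f" and G: "0 \<le> (G::real)"
      and fG: "(\<integral>\<^sup>+y. ennreal (\<bar>f y\<bar> powr p0 \<nu> \<delta>) \<partial>mu_nu \<nu>) \<le> ennreal (G powr p0 \<nu> \<delta>)" and t: "0 < (t::real)"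
    \<comment> \<open>Shares t evenly: off the exceptional sets both terms of the pointwise bound
      are at most L, and C0 (L + L) = t.\<close>
    define L where "L = t / (2 * C0)"
    have L: "L > 0" unfolding L_def using t C0 by simp
    \<comment> \<open>Solves x powr (- (d / p)) * G = L for x; then a powr d = (G / L) powr p. For G
      = 0 this gives a = 0.\<close>
    define a where "a = (G / L) powr (p / d)"
    define E where "E = bad_set (mu_nu \<nu>) (\<lambda>y. ennreal (\<bar>f y\<bar> powr p)) (ennreal (L powr p))"
    have GL: "0 \<le> G / L" using G L by simp
    have sub: "{x \<in> {0<..<1}. bochner_riesz_max \<nu> \<delta> f x > ennreal t} \<subseteq> {x. x < a} \<union> E"
    proof (rule subsetI, rule ccontr)
      fix x assume x: "x \<in> {x \<in> {0<..<1}. bochner_riesz_max \<nu> \<delta> f x > ennreal t}" "x \<notin> {x. x < a} \<union> E"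
      then have x01: "0 < x" "x < 1" and xa: "a \<le> x" and xE: "x \<notin> E" by auto
      have XG: "x powr (- (d / p)) * G \<le> L"
      proof (cases "G = 0")
        case False
        then have a0: "a > 0" unfolding a_def using G L by simp
        have "x powr (- (d / p)) \<le> a powr (- (d / p))" using xa a0 p d_pos by (intro powr_mono2') auto
        also have "\<dots> = (G / L) powr (- 1)" unfolding a_def powr_powr using p d_pos by simp
        also have "\<dots> = L / G" using False G L by (simp add: powr_minus)
        finally show ?thesis using False G by (simp add: pos_le_divide_eq)
      qed (use L in simp)
      have "bochner_riesz_max \<nu> \<delta> f x \<le> ennreal t" unfolding bochner_riesz_max_def
      proof (rule SUP_least)
        fix R :: real assume "R \<in> {0<..}"
        then have R: "R > 0" by simp
        have "ennreal \<bar>bochner_riesz \<nu> \<delta> R f x\<bar> \<le> (\<integral>\<^sup>+y. ennreal (\<bar>K \<delta> R x y\<bar> * \<bar>f y\<bar>) \<partial>mu_nu \<nu>)"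
          by (rule bochner_riesz_kernel_bound(2)[OF R x01(1) f fint])
        also have "\<dots> \<le> ennreal (C0 * (x powr (- (d / p0 \<nu> \<delta>)) * G + L))"
          by (rule C0(2)[OF R x01 f G fG less_imp_le[OF L]]) (use xE in \<open>simp add: E_def p_def\<close>)
        also have "\<dots> \<le> ennreal (C0 * (L + L))" using XG C0(1) unfolding p_def by (intro ennreal_leI mult_left_mono add_right_mono) auto
        also have "C0 * (L + L) = t" unfolding L_def using C0(1) by simp
        finally show "ennreal \<bar>bochner_riesz \<nu> \<delta> R f x\<bar> \<le> ennreal t" .
      qed
      then show False using x(1) by (simp add: not_less[symmetric])
    qed
    have sm: "{x. x < a} \<in> sets (mu_nu \<nu>)" "E \<in> sets (mu_nu \<nu>)" by (auto simp: E_def intro!: borel_open open_bad_set)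
    have "emeasure (mu_nu \<nu>) {x \<in> {0<..<1}. bochner_riesz_max \<nu> \<delta> f x > ennreal t} \<le> emeasure (mu_nu \<nu>) ({x. x < a} \<union> E)"
      using sub by (rule emeasure_mono) (intro sets.Un sm)
    also have "\<dots> \<le> emeasure (mu_nu \<nu>) {x. x < a} + emeasure (mu_nu \<nu>) E"
      by (rule emeasure_subadditive) (auto simp: E_def intro!: borel_open open_bad_set)
    also have "\<dots> \<le> ennreal ((G / L) powr p / d) + ennreal (2 * (G / L) powr p)"
    proof (rule add_mono)
      have "emeasure (mu_nu \<nu>) {x. x < a} = (\<integral>\<^sup>+x. indicator {x. x < a} x \<partial>mu_nu \<nu>)" by simp
      also have "\<dots> \<le> ennreal (a powr d / d)" by (rule mu_less) (simp add: a_def)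
      also have "a powr d = (G / L) powr p" unfolding a_def powr_powr using d_pos by simp
      finally show "emeasure (mu_nu \<nu>) {x. x < a} \<le> ennreal ((G / L) powr p / d)" .
      have "ennreal (L powr p) * emeasure (mu_nu \<nu>) E \<le> 2 * (\<integral>\<^sup>+x. ennreal (\<bar>f x\<bar> powr p) \<partial>mu_nu \<nu>)"
        unfolding E_def by (rule weak_type_maximal) (simp, measurable)
      also have "\<dots> \<le> 2 * ennreal (G powr p)" using fG unfolding p_def by (intro mult_left_mono) auto
      finally have w: "ennreal (L powr p) * emeasure (mu_nu \<nu>) E \<le> ennreal (2 * G powr p)" by (simp add: ennreal_mult')
      define m where "m = measure (mu_nu \<nu>) E"
      have m: "emeasure (mu_nu \<nu>) E = ennreal m" "m \<ge> 0"
        unfolding m_def using finite_measure.emeasure_eq_measure[OF finite_mu] by auto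
      have "L powr p * m \<le> 2 * G powr p" using w m by (simp add: ennreal_mult[symmetric])
      then have "m \<le> 2 * (G / L) powr p" using L G by (simp add: powr_divide field_simps)
      then show "emeasure (mu_nu \<nu>) E \<le> ennreal (2 * (G / L) powr p)" unfolding m by (rule ennreal_leI)
    qed
    also have "\<dots> = ennreal (D * (G / L) powr p)" using d_pos unfolding D_def
      by (subst ennreal_plus[symmetric]) (auto simp: algebra_simps)
    also have "D * (G / L) powr p = (D powr (1 / p) * (2 * C0) * G / t) powr p"
    proof -
      have "D powr (1 / p) * (2 * C0) * G / t = D powr (1 / p) * (G / L)" unfolding L_def using C0(1) by simp
      moreover have "(D powr (1 / p) * (G / L)) powr p = D * (G / L) powr p"
        unfolding powr_mult powr_powr using D p by simp
      ultimately show ?thesis by simp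
    qed
    finally show "emeasure (mu_nu \<nu>) {x \<in> {0<..<1}. bochner_riesz_max \<nu> \<delta> f x > ennreal t} \<le> ennreal ((D powr (1 / p) * (2 * C0) * G / t) powr p0 \<nu> \<delta>)"
      unfolding p_def .
  qed
qed

end

theorem theorem3:
  fixes \<nu> \<delta> :: real
  assumes "\<nu> > -1" and "\<delta> > 0"
  shows "\<exists>C. \<forall>f :: real \<Rightarrow> real.
           f \<in> borel_measurable (mu_nu \<nu>) \<and> integrable (mu_nu \<nu>) (\<lambda>x. \<bar>f x\<bar> powr p0 \<nu> \<delta>) \<longrightarrow>
           weak_Lq_norm \<nu> (p0 \<nu> \<delta>) (bochner_riesz_max \<nu> \<delta> f) \<le> ennreal (C * Lp_norm \<nu> (p0 \<nu> \<delta>) f)"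
proof -
  interpret bessel_order \<nu> by unfold_locales (rule assms(1))
  define p where "p = p0 \<nu> \<delta>"
  have p: "p \<ge> 1" unfolding p_def by (rule p0_ge1[OF assms(2)])
  obtain C where C: "0 < C" "\<And>f G t. f \<in> borel_measurable borel \<Longrightarrow> integrable (mu_nu \<nu>) f \<Longrightarrow> 0 \<le> G \<Longrightarrow>
    (\<integral>\<^sup>+y. ennreal (\<bar>f y\<bar> powr p0 \<nu> \<delta>) \<partial>mu_nu \<nu>) \<le> ennreal (G powr p0 \<nu> \<delta>) \<Longrightarrow> 0 < t \<Longrightarrow>
    emeasure (mu_nu \<nu>) {x \<in> {0<..<1}. bochner_riesz_max \<nu> \<delta> f x > ennreal t} \<le> ennreal ((C * G / t) powr p0 \<nu> \<delta>)"
    by (rule maximal_distribution_bound[OF assms(2)], rule that)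
  have "weak_Lq_norm \<nu> p (bochner_riesz_max \<nu> \<delta> f) \<le> ennreal (C * Lp_norm \<nu> p f)"
    if f: "f \<in> borel_measurable (mu_nu \<nu>)" and fi: "integrable (mu_nu \<nu>) (\<lambda>x. \<bar>f x\<bar> powr p)" for f :: "real \<Rightarrow> real"
  proof -
    have fb[measurable]: "f \<in> borel_measurable borel" using f by (simp cong: measurable_cong_sets)
    \<comment> \<open>The measure is finite and |f| \<le> 1 + |f| powr p as p \<ge> 1, so the
      coefficients of f are genuine integrals.\<close>
    have f1: "integrable (mu_nu \<nu>) f"
    proof (rule Bochner_Integration.integrable_bound)
      show "integrable (mu_nu \<nu>) (\<lambda>x. 1 + \<bar>f x\<bar> powr p)"
        by (intro Bochner_Integration.integrable_add finite_measure.integrable_const[OF finite_mu] fi)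
      show "AE x in mu_nu \<nu>. norm (f x) \<le> norm (1 + \<bar>f x\<bar> powr p)"
      proof (rule AE_I2)
        fix x
        show "norm (f x) \<le> norm (1 + \<bar>f x\<bar> powr p)"
        proof (cases "\<bar>f x\<bar> \<le> 1")
          case False
          then have "\<bar>f x\<bar> powr 1 \<le> \<bar>f x\<bar> powr p" using p by (intro powr_mono) auto
          then show ?thesis by simp
        qed (simp add: add_increasing2)
      qed
    qed (use f in auto)
    define G where "G = Lp_norm \<nu> p f"
    have G: "G \<ge> 0" unfolding G_def Lp_norm_def by simp
    have "G powr p = (\<integral>x. \<bar>f x\<bar> powr p \<partial>mu_nu \<nu>)" unfolding G_def Lp_norm_def using p by (simp add: powr_powr integral_nonneg_AE)
    then have fG: "(\<integral>\<^sup>+y. ennreal (\<bar>f y\<bar> powr p0 \<nu> \<delta>) \<partial>mu_nu \<nu>) \<le> ennreal (G powr p0 \<nu> \<delta>)"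
      using nn_integral_eq_integral[OF fi] unfolding p_def by simp
    show ?thesis unfolding weak_Lq_norm_def
    proof (rule SUP_least)
      fix t :: real assume "t \<in> {0<..}"
      then have t: "t > 0" by simp
      define m where "m = enn2real (emeasure (mu_nu \<nu>) {x \<in> {0<..<1}. bochner_riesz_max \<nu> \<delta> f x > ennreal t})"
      have "m \<le> (C * G / t) powr p"
        unfolding m_def p_def by (rule enn2real_leI[OF _ C(2)[OF fb f1 G fG t]]) simp
      then have "m powr (1 / p) \<le> ((C * G / t) powr p) powr (1 / p)" using p unfolding m_def by (intro powr_mono2) auto
      also have "\<dots> = C * G / t" using p C(1) G t by (simp add: powr_powr)
      finally have "t * m powr (1 / p) \<le> C * G" using t by (simp add: field_simps)
      then show "ennreal (t * enn2real (emeasure (mu_nu \<nu>) {x \<in> {0<..<1}. bochner_riesz_max \<nu> \<delta> f x > ennreal t}) powr (1 / p)) \<le> ennreal (C * Lp_norm \<nu> p f)"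
        unfolding m_def[symmetric] G_def[symmetric] by (rule ennreal_leI)
    qed
  qed
  then show ?thesis unfolding p_def by blast
qed

end
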